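(* Let $\beta\in\mathbb C^d$ and let $M$ be a module in $\mathcal T\text{-irred}(\bar X,\beta)$. If $B$ has columns that $\mathbb Z$-span $\ker_{\mathbb Z}(A)$, then the characteristic variety and the singular locus of $\Pi^{\tilde A}_B(M)$, intersected with $Z$ (for the characteristic variety: restricted to $T^*Z$), are geometric quotients (by the action of $T$) of the intersections of the characteristic variety and the singular locus of $M$ with $X$ (for the characteristic variety: its restriction to $T^*X$), respectively.
   Context: Setting. Fix integers $n>m>0$ and $d=n-m$. $A=(a_{ij})\in\mathbb Z^{d\times n}$ has rank $d$, its columns $a_1,\dots,a_n$ span $\mathbb Z^d$, and $A$ is pointed (there is $h\in\mathbb R^d$ with $h\cdot a_i>0$ for all $i$). $\bar X=\mathbb C^n$, $X=(\mathbb C^* )^n$, $\bar Z=\mathbb C^m$, $Z=(\mathbb C^* )^m$, inclusions $i\colon X\hookrightarrow\bar X$, $j\colon Z\hookrightarrow\bar Z$. $D_{\bar X},D_{\bar Z}$ are the Weyl algebras, $D_X=\mathbb C[x^{\pm}]\otimes_{\mathbb C[x]}D_{\bar X}$, $D_Z=\mathbb C[z^{\pm}]\otimes_{\mathbb C[z]}D_{\bar Z}$. Put $\theta_i=x_i\partial_{x_i}$, $\eta_i=z_i\partial_{z_i}$, $E_i=\sum_{j=1}^n a_{ij}\theta_j$, $\mathbb C[E]=\mathbb C[E_1,\dots,E_d]$. The $A$-grading has $\deg x_i=a_i$, $\deg\partial_{x_i}=-a_i$. $T=(\mathbb C^* )^d$ acts on $X$ by $t\diamond x=(t^{a_1}x_1,\dots,t^{a_n}x_n)$,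 and on $T^*X$ with coordinates $(x,\xi)$, $\xi_i$ the symbol of $\partial_{x_i}$, by additionally $t\diamond\xi_i=t^{-a_i}\xi_i$. The characteristic variety is the support of the associated graded module for the order filtration; the singular locus is the projection to the base of the characteristic variety minus the zero section. $\mathcal T\text{-irred}(\bar X,\beta)$ consists of the finitely generated $A$-graded $D_{\bar X}$-modules $M$ such that for each nonzero homogeneous $\gamma\in M$, $\operatorname{ann}_{\mathbb C[E]}(\gamma)=\langle E_i-\beta_i-\deg(\gamma)_i\mid 1\le i\le d\rangle$. Functors. $B$ is a Gale dual of $A$: an $n\times m$ integer matrix whose columns span $\ker_{\mathbb Q}(A)$. $\tilde A\in\operatorname{GL}(n,\mathbb Z)$ has top $d$ rows equal to $A$; $A^\perp$ is its bottom $m$ rows; $C$ is the matrix of the last $m$ columns of $\tilde A^{-1}$; $K=A^\perp B$, so $B=CK$. For an $A$-graded $D_X$-module $M$, $\Delta^{\tilde A}_B(M)$ is the degree-zero part $M_0$ as a $D_Z$-module, where $z^v$ acts as $x^{Bv}$ and the column $(\eta_1,\dots,\eta_m)^t$ acts as $K^{-1}A^\perp(\theta_1,\dots,\theta_n)^t$. $\Pi^{\tilde A}_B=j_+\circ\Delta^{\tilde A}_B\circ i^*$, with $i^*M=D_X\otimes_{D_{\bar X}}M$ and $j_+$ the non-derived direct image. *)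

theory Defs
  imports "HOL-Analysis.Analysis" "HOL-Algebra.Algebra"
begin

section \<open>Laurent polynomials and differential operators\<close>

text \<open>
  The finite types \<open>'n\<close>, \<open>'m\<close>, \<open>'d\<close> index the coordinates of \<open>\<complex>\<^sup>n\<close>, \<open>\<complex>\<^sup>m\<close> and of the torus
  \<open>(\<complex>\<^sup>*)\<^sup>d\<close>. A Laurent polynomial is the finitely supported function
  sending an exponent vector to its coefficient.
\<close>

type_synonym 'n laurent = "(int ^ 'n) \<Rightarrow>\<^sub>0 complex"
type_synonym 'n dop = "'n laurent \<Rightarrow> 'n laurent"

definition lmon :: "int ^ 'n \<Rightarrow> 'n laurent" where
  "lmon u = Poly_Mapping.single u 1"

definition lconst :: "complex \<Rightarrow> ('n :: finite) laurent" where
  "lconst c = Poly_Mapping.single 0 c"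

definition polynomials :: "('n :: finite) laurent set" where
  "polynomials = {f. \<forall>u \<in> Poly_Mapping.keys f. \<forall>i. 0 \<le> u $ i}"

text \<open>Evaluation at a point; for genuine polynomials this is also meaningful where coordinates
  vanish, since \<open>0 powi 0 = 1\<close>.\<close>

definition leval :: "('n :: finite) laurent \<Rightarrow> complex ^ 'n \<Rightarrow> complex" where
  "leval f x = (\<Sum>u \<in> Poly_Mapping.keys f. Poly_Mapping.lookup f u * (\<Prod>i\<in>UNIV. (x $ i) powi (u $ i)))"

definition ivec :: "nat ^ 'n \<Rightarrow> int ^ 'n" where
  "ivec v = (\<chi> i. int (v $ i))"

definition vdeg :: "nat ^ ('n :: finite) \<Rightarrow> nat" where
  "vdeg v = (\<Sum>i\<in>UNIV. v $ i)"

text \<open>The iterated partial derivative \<open>\<partial>\<^sup>v\<close>, given on monomials by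
  \<open>\<partial>\<^sup>v x\<^sup>u = (\<Prod>i. u\<^sub>i (u\<^sub>i - 1) \<cdots> (u\<^sub>i - v\<^sub>i + 1)) x\<^bsup>u - v\<^esup>\<close>.\<close>

definition pdiff :: "nat ^ 'n \<Rightarrow> ('n :: finite) dop" where
  "pdiff v f = (\<Sum>u \<in> Poly_Mapping.keys f.
     Poly_Mapping.single (u - ivec v)
       (Poly_Mapping.lookup f u * (\<Prod>i\<in>UNIV. \<Prod>k<v $ i. of_int (u $ i) - of_nat k)))"

definition lmult :: "('n :: finite) laurent \<Rightarrow> 'n dop" where
  "lmult g = (\<lambda>f. g * f)"

definition theta :: "'n \<Rightarrow> ('n :: finite) dop" where
  "theta i = lmult (lmon (axis i 1)) \<circ> pdiff (axis i 1)"

text \<open>A family \<open>c\<close> of Laurent polynomials encodes the operator \<open>\<Sum>v. c\<^sub>v \<partial>\<^sup>v\<close>. In characteristic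
  zero the operators act faithfully on Laurent polynomials, so the rings of differential operators
  are realised as rings of endomorphisms, multiplication being composition.\<close>

definition dop :: "((nat ^ 'n) \<Rightarrow>\<^sub>0 'n laurent) \<Rightarrow> ('n :: finite) dop" where
  "dop c f = (\<Sum>v \<in> Poly_Mapping.keys c. Poly_Mapping.lookup c v * pdiff v f)"

definition dop_ring :: "('n :: finite) dop set \<Rightarrow> 'n dop ring" where
  "dop_ring S = \<lparr>carrier = S, monoid.mult = (\<circ>), monoid.one = id,
     ring.zero = (\<lambda>_. 0), ring.add = (\<lambda>P Q f. P f + Q f)\<rparr>"

definition poly_coeffs :: "((nat ^ 'n) \<Rightarrow>\<^sub>0 ('n :: finite) laurent) set" where
  "poly_coeffs = {c. \<forall>v. Poly_Mapping.lookup c v \<in> polynomials}"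

text \<open>The Weyl algebra, and the ring \<open>\<complex>[x\<^sup>\<plusminus>] \<otimes>\<^bsub>\<complex>[x]\<^esub> D\<close> of differential operators on the torus.\<close>

definition weyl :: "('n :: finite) dop ring" where
  "weyl = dop_ring (dop ` poly_coeffs)"

definition torus_dops :: "('n :: finite) dop ring" where
  "torus_dops = dop_ring (range dop)"


section \<open>Modules over noncommutative rings\<close>

text \<open>The library's locale \<open>module\<close> requires a commutative ring of scalars.\<close>

locale left_module = R?: ring R + M?: abelian_group M
  for R :: "('r, 'x) ring_scheme" (structure) and M :: "('r, 'v, 'y) module_scheme" (structure) +
  assumes smult_closed: "\<lbrakk>a \<in> carrier R; x \<in> carrier M\<rbrakk> \<Longrightarrow> a \<odot>\<^bsub>M\<^esub> x \<in> carrier M"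
    and smult_l_distr: "\<lbrakk>a \<in> carrier R; b \<in> carrier R; x \<in> carrier M\<rbrakk> \<Longrightarrow>
      (a \<oplus>\<^bsub>R\<^esub> b) \<odot>\<^bsub>M\<^esub> x = a \<odot>\<^bsub>M\<^esub> x \<oplus>\<^bsub>M\<^esub> b \<odot>\<^bsub>M\<^esub> x"
    and smult_r_distr: "\<lbrakk>a \<in> carrier R; x \<in> carrier M; y \<in> carrier M\<rbrakk> \<Longrightarrow>
      a \<odot>\<^bsub>M\<^esub> (x \<oplus>\<^bsub>M\<^esub> y) = a \<odot>\<^bsub>M\<^esub> x \<oplus>\<^bsub>M\<^esub> a \<odot>\<^bsub>M\<^esub> y"
    and smult_assoc: "\<lbrakk>a \<in> carrier R; b \<in> carrier R; x \<in> carrier M\<rbrakk> \<Longrightarrow>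
      (a \<otimes>\<^bsub>R\<^esub> b) \<odot>\<^bsub>M\<^esub> x = a \<odot>\<^bsub>M\<^esub> (b \<odot>\<^bsub>M\<^esub> x)"
    and smult_one: "x \<in> carrier M \<Longrightarrow> \<one>\<^bsub>R\<^esub> \<odot>\<^bsub>M\<^esub> x = x"

definition finitely_generated :: "('r, 'x) ring_scheme \<Rightarrow> ('r, 'v, 'y) module_scheme \<Rightarrow> bool" where
  "finitely_generated R M \<longleftrightarrow> (\<exists>S. finite S \<and> S \<subseteq> carrier M \<and>
     generate (add_monoid M) {P \<odot>\<^bsub>M\<^esub> s | P s. P \<in> carrier R \<and> s \<in> S} = carrier M)"

text \<open>Extension of scalars \<open>D \<otimes>\<^sub>R M\<close> for a subring \<open>R\<close> of \<open>D\<close>: the free abelian group on pairs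
  modulo the subgroup generated by the relations of the tensor product.\<close>

definition tensor_relations ::
  "('r, 'x) ring_scheme \<Rightarrow> ('r, 'y) ring_scheme \<Rightarrow> ('r, 'v, 'z) module_scheme
     \<Rightarrow> ('r \<times> 'v \<Rightarrow>\<^sub>0 int) set" where
  "tensor_relations D R M =
     {frag_of (P \<oplus>\<^bsub>D\<^esub> Q, u) - frag_of (P, u) - frag_of (Q, u) | P Q u.
        P \<in> carrier D \<and> Q \<in> carrier D \<and> u \<in> carrier M} \<union>
     {frag_of (P, u \<oplus>\<^bsub>M\<^esub> w) - frag_of (P, u) - frag_of (P, w) | P u w.
        P \<in> carrier D \<and> u \<in> carrier M \<and> w \<in> carrier M} \<union>
     {frag_of (P \<otimes>\<^bsub>D\<^esub> Q, u) - frag_of (P, Q \<odot>\<^bsub>M\<^esub> u) | P Q u.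
        P \<in> carrier D \<and> Q \<in> carrier R \<and> u \<in> carrier M}"

definition tensor_free ::
  "('r, 'x) ring_scheme \<Rightarrow> ('r, 'v, 'z) module_scheme \<Rightarrow> ('r \<times> 'v \<Rightarrow>\<^sub>0 int) monoid" where
  "tensor_free D M = free_Abelian_group (carrier D \<times> carrier M)"

definition tensor_null ::
  "('r, 'x) ring_scheme \<Rightarrow> ('r, 'y) ring_scheme \<Rightarrow> ('r, 'v, 'z) module_scheme
     \<Rightarrow> ('r \<times> 'v \<Rightarrow>\<^sub>0 int) set" where
  "tensor_null D R M = generate (tensor_free D M) (tensor_relations D R M)"

definition tensor_class ::
  "('r, 'x) ring_scheme \<Rightarrow> ('r, 'y) ring_scheme \<Rightarrow> ('r, 'v, 'z) module_scheme
     \<Rightarrow> ('r \<times> 'v \<Rightarrow>\<^sub>0 int) \<Rightarrow> ('r \<times> 'v \<Rightarrow>\<^sub>0 int) set" where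
  "tensor_class D R M c = tensor_null D R M #>\<^bsub>tensor_free D M\<^esub> c"

text \<open>The fields \<open>mult\<close> and \<open>one\<close> of a module record carry no meaning. The scalar action is
  \<open>P \<odot> (Q \<otimes> u) = P Q \<otimes> u\<close>.\<close>

definition extend_scalars ::
  "('r, 'x) ring_scheme \<Rightarrow> ('r, 'y) ring_scheme \<Rightarrow> ('r, 'v, 'z) module_scheme
     \<Rightarrow> ('r, ('r \<times> 'v \<Rightarrow>\<^sub>0 int) set) module" where
  "extend_scalars D R M = (let T = tensor_free D M Mod tensor_null D R M in
     \<lparr>carrier = carrier T, monoid.mult = undefined, monoid.one = undefined,
      ring.zero = monoid.one T, ring.add = monoid.mult T,
      module.smult = (\<lambda>P Y. \<Union>c\<in>Y. tensor_class D R M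
        (frag_extend (\<lambda>(Q, u). frag_of (P \<otimes>\<^bsub>D\<^esub> Q, u)) c))\<rparr>)"


section \<open>Gradings and torus-irreducible modules\<close>

text \<open>Operators homogeneous of degree \<open>\<alpha>\<close>, where \<open>deg x\<^sub>i = a\<^sub>i\<close> and \<open>deg \<partial>\<^sub>i = - a\<^sub>i\<close>.\<close>

definition dop_degree :: "int ^ 'n ^ 'd \<Rightarrow> int ^ 'd \<Rightarrow> ('n :: finite) dop set" where
  "dop_degree A \<alpha> = dop ` {c. \<forall>v \<in> Poly_Mapping.keys c.
     \<forall>u \<in> Poly_Mapping.keys (Poly_Mapping.lookup c v). A *v (u - ivec v) = \<alpha>}"

text \<open>\<open>G \<alpha>\<close> is the part of degree \<open>\<alpha>\<close>. As constants have degree \<open>0\<close>, the graded parts are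
  complex subspaces.\<close>

definition graded_module ::
  "int ^ 'n ^ 'd \<Rightarrow> ('n :: finite) dop ring \<Rightarrow> ('n dop, 'v) module \<Rightarrow> (int ^ 'd \<Rightarrow> 'v set) \<Rightarrow> bool" where
  "graded_module A R M G \<longleftrightarrow> left_module R M \<and>
     (\<forall>\<alpha>. subgroup (G \<alpha>) (add_monoid M)) \<and>
     (\<forall>u \<in> carrier M. \<exists>!g. (\<forall>\<alpha>. g \<alpha> \<in> G \<alpha>) \<and> finite {\<alpha>. g \<alpha> \<noteq> \<zero>\<^bsub>M\<^esub>} \<and>
        u = finsum M g {\<alpha>. g \<alpha> \<noteq> \<zero>\<^bsub>M\<^esub>}) \<and>
     (\<forall>\<alpha> \<gamma>. \<forall>P \<in> carrier R \<inter> dop_degree A \<alpha>. \<forall>u \<in> G \<gamma>. P \<odot>\<^bsub>M\<^esub> u \<in> G (\<alpha> + \<gamma>))"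

definition euler :: "int ^ 'n ^ 'd \<Rightarrow> 'd \<Rightarrow> ('n :: finite) dop" where
  "euler A i = (\<lambda>f. \<Sum>j\<in>UNIV. lconst (of_int (A $ i $ j)) * theta j f)"

definition euler_ring :: "int ^ 'n ^ 'd \<Rightarrow> ('n :: finite) dop ring" where
  "euler_ring A = dop_ring (generate_ring weyl (range (\<lambda>c. lmult (lconst c)) \<union> range (euler A)))"

definition T_irred ::
  "int ^ 'n ^ 'd \<Rightarrow> complex ^ 'd \<Rightarrow> (('n :: finite dop, 'v) module \<times> (int ^ 'd \<Rightarrow> 'v set)) set" where
  "T_irred A \<beta> = {(M, G). graded_module A weyl M G \<and> finitely_generated weyl M \<and>
     (\<forall>\<alpha>. \<forall>\<gamma> \<in> G \<alpha> - {\<zero>\<^bsub>M\<^esub>}.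
        {P \<in> carrier (euler_ring A). P \<odot>\<^bsub>M\<^esub> \<gamma> = \<zero>\<^bsub>M\<^esub>} =
        Idl\<^bsub>euler_ring A\<^esub>
          (range (\<lambda>i f. euler A i f - lconst (\<beta> $ i) * f - lconst (of_int (\<alpha> $ i)) * f)))}"


section \<open>The functors\<close>

text \<open>The inverse image to the torus, and its induced grading.\<close>

definition torus_restriction ::
  "('n :: finite dop, 'v) module \<Rightarrow> ('n dop, ('n dop \<times> 'v \<Rightarrow>\<^sub>0 int) set) module" where
  "torus_restriction M = extend_scalars torus_dops weyl M"

definition torus_grading ::
  "int ^ 'n ^ 'd \<Rightarrow> ('n :: finite dop, 'v) module \<Rightarrow> (int ^ 'd \<Rightarrow> 'v set)
     \<Rightarrow> int ^ 'd \<Rightarrow> ('n dop \<times> 'v \<Rightarrow>\<^sub>0 int) set set" where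
  "torus_grading A M G \<alpha> = generate (add_monoid (torus_restriction M))
     {tensor_class torus_dops weyl M (frag_of (P, u)) | P u \<gamma>. P \<in> dop_degree A \<gamma> \<and> u \<in> G (\<alpha> - \<gamma>)}"

definition lower_rows :: "int ^ 'n ^ (('d :: finite) + 'm) \<Rightarrow> int ^ 'n ^ ('m :: finite)" where
  "lower_rows Atil = (\<chi> k. Atil $ Inr k)"

text \<open>The matrix \<open>K\<^sup>-\<^sup>1 A\<^sup>\<bottom>\<close> with \<open>K = A\<^sup>\<bottom> B\<close>.\<close>

definition eta_matrix ::
  "int ^ 'n ^ (('d :: finite) + 'm) \<Rightarrow> int ^ 'm ^ 'n \<Rightarrow> complex ^ ('n :: finite) ^ ('m :: finite)" where
  "eta_matrix Atil B =
     matrix_inv (map_matrix of_int (lower_rows Atil ** B)) ** map_matrix of_int (lower_rows Atil)"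

text \<open>The \<open>\<complex>\<close>-algebra homomorphism through which operators in \<open>z\<close> act on the degree zero part. It is
  unique because \<open>\<complex>\<close>, the \<open>z\<^sup>v\<close> and the \<open>\<eta>\<^sub>j\<close> generate; for a Gale dual \<open>B\<close> it exists because
  \<open>K\<^sup>-\<^sup>1 A\<^sup>\<bottom> B = 1\<close>, so that the commutation relations \<open>[\<eta>\<^sub>j, z\<^sup>v] = v\<^sub>j z\<^sup>v\<close> are respected.\<close>

definition delta_hom ::
  "int ^ 'n ^ (('d :: finite) + 'm) \<Rightarrow> int ^ 'm ^ 'n \<Rightarrow> ('m :: finite) dop \<Rightarrow> ('n :: finite) dop" where
  "delta_hom Atil B = (THE \<phi>. \<phi> \<in> ring_hom torus_dops torus_dops \<and>
     \<phi> \<in> extensional (carrier torus_dops) \<and>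
     (\<forall>c. \<phi> (lmult (lconst c)) = lmult (lconst c)) \<and>
     (\<forall>v. \<phi> (lmult (lmon v)) = lmult (lmon (B *v v))) \<and>
     (\<forall>j. \<phi> (theta j) = (\<lambda>f. \<Sum>i\<in>UNIV. lconst (eta_matrix Atil B $ j $ i) * theta i f)))"

definition Delta ::
  "int ^ 'n ^ (('d :: finite) + 'm) \<Rightarrow> int ^ 'm ^ 'n \<Rightarrow> ('n :: finite dop, 'v) module \<Rightarrow> (int ^ 'd \<Rightarrow> 'v set)
     \<Rightarrow> ('m :: finite dop, 'v) module" where
  "Delta Atil B N G = \<lparr>carrier = G 0, monoid.mult = undefined, monoid.one = undefined,
     ring.zero = \<zero>\<^bsub>N\<^esub>, ring.add = (\<oplus>\<^bsub>N\<^esub>), module.smult = (\<lambda>P u. delta_hom Atil B P \<odot>\<^bsub>N\<^esub> u)\<rparr>"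

text \<open>For the affine open embedding of the torus the transfer bimodule is the ring of operators on
  the torus itself, so the direct image is the same module with scalars restricted to the Weyl
  algebra.\<close>

definition direct_image :: "('m :: finite dop, 'v) module \<Rightarrow> ('m dop, 'v) module" where
  "direct_image N = N\<lparr>module.smult := restrict (module.smult N) (carrier weyl)\<rparr>"

definition Pi_functor ::
  "int ^ 'n ^ 'd \<Rightarrow> int ^ 'n ^ (('d :: finite) + 'm) \<Rightarrow> int ^ 'm ^ 'n \<Rightarrow>
   ('n :: finite dop, 'v) module \<Rightarrow> (int ^ 'd \<Rightarrow> 'v set)
     \<Rightarrow> ('m :: finite dop, ('n dop \<times> 'v \<Rightarrow>\<^sub>0 int) set) module" where
  "Pi_functor A Atil B M G =
     direct_image (Delta Atil B (torus_restriction M) (torus_grading A M G))"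


section \<open>Characteristic variety and singular locus\<close>

text \<open>Points \<open>(x, \<xi>)\<close> of the cotangent bundle of \<open>\<complex>\<^sup>n\<close> have index type \<open>'n + 'n\<close>: the \<open>Inl\<close>
  coordinates are \<open>x\<close>, the \<open>Inr\<close> coordinates are \<open>\<xi>\<close>.\<close>

definition cot_base :: "complex ^ ('n + 'n) \<Rightarrow> complex ^ ('n :: finite)" where
  "cot_base p = (\<chi> i. p $ Inl i)"

definition cot_fibre :: "complex ^ ('n + 'n) \<Rightarrow> complex ^ ('n :: finite)" where
  "cot_fibre p = (\<chi> i. p $ Inr i)"

text \<open>Coefficient families of the operators in the Weyl algebra of order at most \<open>k\<close>; the index is an
  integer so that the step below order \<open>0\<close> is the zero space.\<close>

definition order_filt :: "int \<Rightarrow> ((nat ^ 'n) \<Rightarrow>\<^sub>0 ('n :: finite) laurent) set" where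
  "order_filt k = {c \<in> poly_coeffs. \<forall>v \<in> Poly_Mapping.keys c. int (vdeg v) \<le> k}"

definition symb ::
  "int \<Rightarrow> ((nat ^ 'n) \<Rightarrow>\<^sub>0 ('n :: finite) laurent) \<Rightarrow> complex ^ ('n + 'n) \<Rightarrow> complex" where
  "symb k c p = (\<Sum>v \<in> {v \<in> Poly_Mapping.keys c. int (vdeg v) = k}.
     leval (Poly_Mapping.lookup c v) (cot_base p) * (\<Prod>i\<in>UNIV. (cot_fibre p $ i) ^ (v $ i)))"

definition gen_filt :: "('n :: finite dop, 'v) module \<Rightarrow> 'v set \<Rightarrow> int \<Rightarrow> 'v set" where
  "gen_filt M S k =
     generate (add_monoid M) {dop c \<odot>\<^bsub>M\<^esub> s | c s. c \<in> order_filt k \<and> s \<in> S}"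

text \<open>The support of \<open>gr (D S) = \<Oplus>l. F\<^sub>l / F\<^bsub>l-1\<^esub>\<close> for the good filtration \<open>F\<^sub>l = F\<^sub>l D \<cdot> S\<close> of the submodule
  generated by a finite set \<open>S\<close>, i.e. the zero set of its annihilator in \<open>gr D = \<complex>[x, \<xi>]\<close>. The
  annihilator is homogeneous in \<open>\<xi>\<close>; the symbol of order \<open>k\<close> of an operator \<open>P\<close> lies in it iff \<open>P\<close> maps
  every \<open>F\<^sub>l\<close> into \<open>F\<^bsub>l+k-1\<^esub>\<close>.\<close>

definition gr_support :: "('n :: finite dop, 'v) module \<Rightarrow> 'v set \<Rightarrow> (complex ^ ('n + 'n)) set" where
  "gr_support M S = {p. \<forall>k. \<forall>c \<in> order_filt k.
     (\<forall>l. \<forall>u \<in> gen_filt M S l. dop c \<odot>\<^bsub>M\<^esub> u \<in> gen_filt M S (l + k - 1)) \<longrightarrow> symb k c p = 0}"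

text \<open>If \<open>M\<close> is finitely generated, the union is attained at any finite generating set (the support
  does not depend on the generators, and grows with the submodule). Taking the union over all finitely
  generated submodules extends the notion to arbitrary modules; this is needed since the direct image
  from the torus to affine space need not be finitely generated.\<close>

definition char_variety :: "('n :: finite dop, 'v) module \<Rightarrow> (complex ^ ('n + 'n)) set" where
  "char_variety M = (\<Union>S \<in> {S. finite S \<and> S \<subseteq> carrier M}. gr_support M S)"

definition singular_locus :: "('n :: finite dop, 'v) module \<Rightarrow> (complex ^ 'n) set" where
  "singular_locus M = cot_base ` (char_variety M - {p. cot_fibre p = 0})"


section \<open>Varieties and geometric quotients\<close>

definition polyfuns :: "(complex ^ ('k :: finite) \<Rightarrow> complex) set" where
  "polyfuns = leval ` polynomials"

definition zariski :: "(complex ^ ('k :: finite)) topology" where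
  "zariski = topology_generated_by ((\<lambda>f. {p. f p \<noteq> 0}) ` polyfuns)"

definition quasi_affine :: "(complex ^ ('k :: finite)) set \<Rightarrow> bool" where
  "quasi_affine V \<longleftrightarrow> (\<exists>C U. closedin zariski C \<and> openin zariski U \<and> V = C \<inter> U)"

definition regular_fun ::
  "(complex ^ ('k :: finite)) set \<Rightarrow> (complex ^ 'k) set \<Rightarrow> (complex ^ 'k \<Rightarrow> complex) \<Rightarrow> bool" where
  "regular_fun V U f \<longleftrightarrow> (\<forall>p\<in>U. \<exists>W. openin (subtopology zariski V) W \<and> p \<in> W \<and> W \<subseteq> U \<and>
     (\<exists>g\<in>polyfuns. \<exists>h\<in>polyfuns. \<forall>q\<in>W. h q \<noteq> 0 \<and> f q = g q / h q))"

definition variety_morphism ::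
  "(complex ^ ('k :: finite)) set \<Rightarrow> (complex ^ ('l :: finite)) set \<Rightarrow> (complex ^ 'k \<Rightarrow> complex ^ 'l) \<Rightarrow> bool" where
  "variety_morphism V W \<phi> \<longleftrightarrow>
     continuous_map (subtopology zariski V) (subtopology zariski W) \<phi> \<and>
     (\<forall>U f. openin (subtopology zariski W) U \<and> regular_fun W U f \<longrightarrow>
        regular_fun V {p\<in>V. \<phi> p \<in> U} (f \<circ> \<phi>))"

text \<open>Geometric quotient in the sense of Mumford: \<open>\<phi>\<close> is surjective and submersive (\<open>quotient_map\<close>), its
  fibres are exactly the orbits, and the regular functions on the base are the invariant regular
  functions upstairs.\<close>

definition geometric_quotient_map ::
  "'t set \<Rightarrow> ('t \<Rightarrow> complex ^ 'k \<Rightarrow> complex ^ 'k) \<Rightarrow> (complex ^ ('k :: finite)) set \<Rightarrow>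
   (complex ^ ('l :: finite)) set \<Rightarrow> (complex ^ 'k \<Rightarrow> complex ^ 'l) \<Rightarrow> bool" where
  "geometric_quotient_map T act V W \<phi> \<longleftrightarrow>
     quasi_affine V \<and> quasi_affine W \<and> (\<forall>t\<in>T. \<forall>p\<in>V. act t p \<in> V) \<and>
     variety_morphism V W \<phi> \<and>
     quotient_map (subtopology zariski V) (subtopology zariski W) \<phi> \<and>
     (\<forall>p\<in>V. \<forall>q\<in>V. \<phi> p = \<phi> q \<longleftrightarrow> (\<exists>t\<in>T. q = act t p)) \<and>
     (\<forall>U f. openin (subtopology zariski W) U \<and> regular_fun V {p\<in>V. \<phi> p \<in> U} f \<and>
        (\<forall>t\<in>T. \<forall>p\<in>V. \<phi> p \<in> U \<longrightarrow> f (act t p) = f p) \<longrightarrow>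
        (\<exists>g. regular_fun W U g \<and> (\<forall>p\<in>V. \<phi> p \<in> U \<longrightarrow> f p = g (\<phi> p))))"

definition is_geometric_quotient ::
  "'t set \<Rightarrow> ('t \<Rightarrow> complex ^ 'k \<Rightarrow> complex ^ 'k) \<Rightarrow> (complex ^ ('k :: finite)) set \<Rightarrow>
   (complex ^ ('l :: finite)) set \<Rightarrow> bool" where
  "is_geometric_quotient T act V W \<longleftrightarrow> (\<exists>\<phi>. geometric_quotient_map T act V W \<phi>)"

definition torus :: "(complex ^ ('k :: finite)) set" where
  "torus = {x. \<forall>i. x $ i \<noteq> 0}"

definition cot_torus :: "(complex ^ (('k :: finite) + 'k)) set" where
  "cot_torus = {p. cot_base p \<in> torus}"

definition tpow :: "complex ^ ('d :: finite) \<Rightarrow> int ^ 'd \<Rightarrow> complex" where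
  "tpow t a = (\<Prod>j\<in>UNIV. (t $ j) powi (a $ j))"

definition torus_act ::
  "int ^ 'n ^ 'd \<Rightarrow> complex ^ ('d :: finite) \<Rightarrow> complex ^ 'n \<Rightarrow> complex ^ ('n :: finite)" where
  "torus_act A t x = (\<chi> i. tpow t (column i A) * x $ i)"

definition cot_torus_act ::
  "int ^ 'n ^ 'd \<Rightarrow> complex ^ ('d :: finite) \<Rightarrow> complex ^ ('n + 'n) \<Rightarrow> complex ^ ('n + ('n :: finite))" where
  "cot_torus_act A t p = (\<chi> k. case k of
     Inl i \<Rightarrow> tpow t (column i A) * p $ k
   | Inr i \<Rightarrow> tpow t (- column i A) * p $ k)"


section \<open>The integer matrices\<close>

definition columns_span :: "int ^ 'n ^ 'd \<Rightarrow> bool" where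
  "columns_span A \<longleftrightarrow> range ((*v) A) = (UNIV :: (int ^ 'd) set)"

definition pointed :: "int ^ 'n ^ ('d :: finite) \<Rightarrow> bool" where
  "pointed A \<longleftrightarrow> (\<exists>h :: real ^ 'd. \<forall>i. h \<bullet> column i (map_matrix real_of_int A) > 0)"

definition gale_dual :: "int ^ 'n ^ 'd \<Rightarrow> int ^ 'm ^ 'n \<Rightarrow> bool" where
  "gale_dual A B \<longleftrightarrow>
     range ((*v) (map_matrix rat_of_int B)) = {w :: rat ^ 'n. map_matrix rat_of_int A *v w = 0}"

definition spans_integer_kernel :: "int ^ 'n ^ 'd \<Rightarrow> int ^ 'm ^ 'n \<Rightarrow> bool" where
  "spans_integer_kernel A B \<longleftrightarrow> range ((*v) B) = {w :: int ^ 'n. A *v w = 0}"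

end

theory Submission
  imports Defs "HOL-Library.Function_Algebras" "HOL-Computational_Algebra.Fundamental_Theorem_Algebra"
begin

text \<open>
  Logarithmic coordinates \<open>(x, y)\<close> with \<open>y\<^sub>i = x\<^sub>i \<xi>\<^sub>i\<close> trivialise the cotangent bundle of the torus \<open>X\<close>. A
  unimodular change of coordinates splits \<open>X\<close> as the product of \<open>T\<close> and \<open>Z\<close>; in it, on elements of degree
  \<open>\<alpha>\<close> the Euler operators act as the scalars \<open>\<beta>\<^sub>i + \<alpha>\<^sub>i\<close>, so an operator of degree \<open>0\<close> acts as the
  pull-back of an operator on \<open>Z\<close>, and principal symbols correspond under \<open>(x, y) \<mapsto> (x\<^sup>B, L y)\<close> on
  \<open>A y = 0\<close>, where \<open>L = K\<^sup>-\<^sup>1 A\<^sup>\<bottom>\<close>. As multiplication by monomials moves homogeneous generators into degree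
  \<open>0\<close>, the characteristic variety of \<open>M\<close> over \<open>X\<close> is the preimage of that of \<open>\<Pi>(M)\<close> over \<open>Z\<close> under this map.
  The map has a monomial section and its fibres are the orbits, which makes it a geometric quotient onto
  every closed subset. The singular loci follow, since the projection of a closed set that is conical in
  the fibres is closed.

  That good filtrations over \<open>X\<close> may be compared at all rests on noetherianity of the Rees module.
\<close>

text \<open>Seen as endomorphisms of Laurent polynomials, operators are sums of
  \<open>x^u p(\<theta>)\<close>, which shift exponents by \<open>u\<close> with weight
  \<open>p\<close>. Order, degree, symbol and membership in the Weyl algebra become statements about
  such pairs. The main obstacle is finiteness: \<open>\<Pi>(M)\<close> need not be finitely
  generated over the Weyl algebra, so its characteristic variety is a union over all finite sets
  \<open>S\<close>, and one \<open>S\<close> has to dominate the rest over the torus. An inclusion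
  of generated submodules yields no inclusion of annihilators of graded modules, only one up to
  radical; noetherianity supplies the exponent. Integrality is the second point. As \<open>B\<close>
  spans the integer kernel, \<open>K\<close> is unimodular and \<open>L\<close> has integer entries.
  Thus \<open>z \<mapsto> z^L\<close> is a map of tori, available as a section; were
  \<open>K\<close> not unimodular, the fibres of \<open>x \<mapsto> x^B\<close> would consist of
  several orbits. Closedness of the singular locus is not formal, the fibres of the cotangent bundle
  being affine. Homogeneity in the covector replaces properness, via a Nullstellensatz that uses the
  uncountability of \<open>\<complex>\<close>.\<close>

declare One_nat_def [simp del]

section \<open>Multi-indices and their total degree\<close>

lemma vec_nat_induct [case_names zero step]:
  fixes v :: "nat ^ ('n::finite)"
  assumes "P 0" "\<And>v i. P v \<Longrightarrow> P (v + axis i 1)"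
  shows "P v"
proof (induction "vdeg v" arbitrary: v)
  case 0
  then have "v = 0" by (simp add: vdeg_def vec_eq_iff)
  then show ?case using assms(1) by simp
next
  case (Suc n)
  then have "vdeg v \<noteq> 0" by simp
  then obtain i where i: "v $ i \<noteq> 0" by (auto simp: vdeg_def)
  define u where "u = (\<chi> j. if j = i then v $ i - 1 else v $ j)"
  have v: "v = u + axis i 1" using i by (auto simp: u_def vec_eq_iff axis_def)
  have "vdeg v = vdeg u + 1"
    by (simp add: v vdeg_def sum.distrib axis_def)
  then have "P u" using Suc by simp
  then show ?case using assms(2) v by simp
qed

lemma vdeg_add: "vdeg (u + v) = vdeg u + vdeg v"
  by (simp add: vdeg_def sum.distrib)

lemma vdeg_0 [simp]: "vdeg 0 = 0"
  by (simp add: vdeg_def)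

lemma vdeg_axis [simp]: "vdeg (axis i k) = k"
  by (simp add: vdeg_def axis_def)

lemma vdeg_eq_0 [simp]: "vdeg v = 0 \<longleftrightarrow> v = 0"
  by (simp add: vdeg_def vec_eq_iff)

lemma ivec_add: "ivec (u + v) = ivec u + ivec v"
  by (simp add: ivec_def vec_eq_iff)

lemma ivec_axis: "ivec (axis i 1) = axis i 1"
  by (simp add: ivec_def vec_eq_iff axis_def)

lemma poly_mapping_as_sum: "f = (\<Sum>w\<in>Poly_Mapping.keys f. Poly_Mapping.single w (Poly_Mapping.lookup f w))"
  by (rule poly_mapping_eqI)
    (auto simp: lookup_sum lookup_single when_def in_keys_iff sum.delta)

section \<open>The operators \<open>x^u p(\<theta>)\<close> as weighted shifts of exponents\<close>

section \<open>Weighted shift operators\<close>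

text \<open>This is \<open>x^u p(\<theta>)\<close>: the monomial \<open>x^w\<close> is an
  eigenvector of every \<open>\<theta>\<^sub>i\<close> with eigenvalue \<open>w\<^sub>i\<close>, so
  \<open>p(\<theta>)\<close> multiplies it by \<open>p w\<close>. Letting \<open>p\<close> be an
  arbitrary function reduces products to the pointwise rule \<open>shift_op_comp\<close>;
  polynomiality is imposed separately by \<open>leading_form\<close>.\<close>

definition shift_op :: "int ^ 'n \<Rightarrow> (int ^ 'n \<Rightarrow> complex) \<Rightarrow> ('n::finite) dop" where
  "shift_op u p f = (\<Sum>w\<in>Poly_Mapping.keys f. Poly_Mapping.single (w + u) (Poly_Mapping.lookup f w * p w))"

lemma lookup_shift_op:
  "Poly_Mapping.lookup (shift_op u p f) w = Poly_Mapping.lookup f (w - u) * p (w - u)"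
proof -
  have *: "v + u = w \<longleftrightarrow> v = w - u" for v by (auto simp: algebra_simps)
  show ?thesis
    by (auto simp: shift_op_def lookup_sum lookup_single when_def * in_keys_iff sum.delta)
qed

lemma shift_op_add_right: "shift_op u p (f + g) = shift_op u p f + shift_op u p g"
  by (rule poly_mapping_eqI) (simp add: lookup_shift_op lookup_add algebra_simps)

lemma shift_op_add: "shift_op u (p + q) = shift_op u p + shift_op u q"
  by (intro ext poly_mapping_eqI) (simp add: lookup_shift_op lookup_add algebra_simps)

lemma shift_op_zero [simp]: "shift_op u 0 = 0"
  by (intro ext poly_mapping_eqI) (simp add: lookup_shift_op)

lemma shift_op_comp:
  "shift_op u p \<circ> shift_op v q = shift_op (u + v) (\<lambda>w. p (w + v) * q w)"
  by (intro ext poly_mapping_eqI) (simp add: lookup_shift_op algebra_simps)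

lemma shift_op_single:
  "shift_op u p (Poly_Mapping.single w c) = Poly_Mapping.single (w + u) (c * p w)"
  by (rule poly_mapping_eqI) (auto simp: lookup_shift_op lookup_single when_def algebra_simps)

lemma shift_op_one: "shift_op 0 (\<lambda>_. 1) = id"
  by (intro ext poly_mapping_eqI) (simp add: lookup_shift_op)

lemma single_times_lookup:
  fixes f :: "('n::finite) laurent"
  shows "Poly_Mapping.single u c * f = shift_op u (\<lambda>_. c) f"
  by (subst poly_mapping_as_sum[of f])
    (simp add: shift_op_def sum_distrib_left mult_single add.commute mult.commute)

lemma lmult_single: "lmult (Poly_Mapping.single u c) = shift_op u (\<lambda>_. c)"
  by (simp add: lmult_def single_times_lookup fun_eq_iff)

lemma lmult_lmon: "lmult (lmon u) = shift_op u (\<lambda>_. 1)"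
  by (simp add: lmon_def lmult_single)

lemma lmult_lconst: "lmult (lconst c) = shift_op 0 (\<lambda>_. c)"
  by (simp add: lconst_def lmult_single)

lemma lconst_times: "lconst c * f = shift_op 0 (\<lambda>_. c) f"
  by (simp add: lconst_def single_times_lookup)

text \<open>The eigenvalue of \<open>x^v \<partial>^v\<close> on \<open>x^w\<close>, a product of
  falling factorials; hence \<open>\<partial>^v\<close> is the shift by \<open>-v\<close> with this
  weight.\<close>

definition falling :: "nat ^ 'n \<Rightarrow> int ^ 'n \<Rightarrow> complex" where
  "falling v w = (\<Prod>i\<in>UNIV. \<Prod>k<v $ i. of_int (w $ i) - of_nat k)"

lemma pdiff_eq: "pdiff v = shift_op (- ivec v) (falling v)"
  by (simp add: pdiff_def shift_op_def falling_def fun_eq_iff)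

lemma falling_0 [simp]: "falling 0 w = 1"
  by (simp add: falling_def)

text \<open>Adding a unit vector changes one factor only. The factor function is left general
  because falling factorials, prime powers and powers of weights are all treated this way.\<close>

lemma prod_axis_Suc:
  fixes v :: "nat ^ ('n::finite)"
  shows "(\<Prod>j\<in>UNIV. g j ((v + axis i 1) $ j)) =
    g i (v $ i + 1) * (\<Prod>j\<in>UNIV - {i}. g j (v $ j))"
proof -
  have "(\<Prod>j\<in>UNIV. g j ((v + axis i 1) $ j)) =
      g i ((v + axis i 1) $ i) * (\<Prod>j\<in>UNIV - {i}. g j ((v + axis i 1) $ j))"
    by (rule prod.remove) auto
  also have "(\<Prod>j\<in>UNIV - {i}. g j ((v + axis i 1) $ j)) = (\<Prod>j\<in>UNIV - {i}. g j (v $ j))"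
    by (rule prod.cong) (auto simp: axis_def)
  finally show ?thesis by (simp add: axis_def)
qed

lemma falling_Suc:
  "falling (v + axis i 1) w = (of_int (w $ i) - of_nat (v $ i)) * falling (v :: nat ^ ('n::finite)) w"
proof -
  have "falling v w = (\<Prod>k<v $ i. of_int (w $ i) - of_nat k) *
      (\<Prod>j\<in>UNIV-{i}. \<Prod>k<v $ j. of_int (w $ j) - of_nat k)"
    unfolding falling_def by (rule prod.remove) auto
  moreover have "falling (v + axis i 1) w = (\<Prod>k<v $ i + 1. of_int (w $ i) - of_nat k) *
      (\<Prod>j\<in>UNIV-{i}. \<Prod>k<v $ j. of_int (w $ j) - of_nat k)"
    unfolding falling_def
    by (rule prod_axis_Suc[where g = "\<lambda>j m. \<Prod>k<m. of_int (w $ j) - of_nat k"])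
  moreover have "(\<Prod>k<v $ i + 1. of_int (w $ i) - of_nat k :: complex) =
      (\<Prod>k<v $ i. of_int (w $ i) - of_nat k) * (of_int (w $ i) - of_nat (v $ i))"
    by (simp flip: Suc_eq_plus1)
  ultimately show ?thesis by (simp only: mult_ac)
qed

lemma falling_axis: "falling (axis i 1) w = of_int (w $ i)"
  using falling_Suc[of 0 i w] by simp

lemma theta_eq: "theta i = shift_op 0 (\<lambda>w. of_int (w $ i))"
  by (simp add: theta_def lmult_lmon pdiff_eq shift_op_comp ivec_axis falling_axis)

lemma theta_comp: "theta i \<circ> shift_op u p = shift_op u (\<lambda>w. of_int ((w + u) $ i) * p w)"
  by (simp add: theta_eq shift_op_comp)

definition ymon :: "nat ^ 'n \<Rightarrow> complex ^ 'n \<Rightarrow> complex" where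
  "ymon v y = (\<Prod>i\<in>UNIV. (y $ i) ^ (v $ i))"

lemma ymon_0 [simp]: "ymon 0 y = 1"
  by (simp add: ymon_def)

lemma ymon_add: "ymon (u + v) y = ymon u y * ymon v y"
  by (simp add: ymon_def power_add prod.distrib)

lemma ymon_axis [simp]: "ymon (axis i (1::nat)) y = y $ i"
proof -
  have "ymon (axis i (1::nat)) y = (\<Prod>j\<in>UNIV. if j = i then y $ i else 1)"
    unfolding ymon_def by (rule prod.cong) (auto simp: axis_def)
  then show ?thesis by simp
qed

lemma ymon_Suc: "ymon (v + axis i 1) y = y $ i * ymon (v :: nat ^ ('n::finite)) y"
  by (simp add: ymon_add mult.commute)

section \<open>Degree and top homogeneous part of a polynomial in the exponents\<close>

section \<open>Polynomial weights and their leading forms\<close>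

text \<open>The third argument is the homogeneous part of degree \<open>k\<close> of the polynomial
  \<open>p\<close>, whose degree is at most \<open>k\<close>. A relation avoids choosing
  coefficients for a function on \<open>\<int>^n\<close>: the rules build polynomials from constants
  and coordinates, and \<open>lift\<close> records that a larger degree bound kills the leading
  part.\<close>

inductive leading_form ::
  "int \<Rightarrow> (int ^ 'n \<Rightarrow> complex) \<Rightarrow> (complex ^ 'n \<Rightarrow> complex) \<Rightarrow> bool" where
  zero: "leading_form k 0 0"
| const: "leading_form 0 (\<lambda>_. c) (\<lambda>_. c)"
| coord: "leading_form k p h \<Longrightarrow> leading_form (k + 1) (\<lambda>w. of_int (w $ i) * p w) (\<lambda>y. y $ i * h y)"
| add: "leading_form k p h \<Longrightarrow> leading_form k q g \<Longrightarrow> leading_form k (p + q) (h + g)"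
| lift: "leading_form k p h \<Longrightarrow> leading_form (k + 1) p 0"

lemma leading_form_lift_nat: "leading_form k p h \<Longrightarrow> leading_form (k + 1 + int n) p 0"
proof (induction n)
  case 0
  then show ?case using leading_form.lift[of k p h] by (simp only: of_nat_0 add_0_right)
next
  case (Suc n)
  then have "leading_form (k + 1 + int n + 1) p 0" by (intro leading_form.lift) simp
  moreover have "k + 1 + int n + 1 = k + 1 + int (Suc n)" by simp
  ultimately show ?case by (simp only:)
qed

lemma leading_form_mono: "leading_form k p h \<Longrightarrow> k < l \<Longrightarrow> leading_form l p 0"
  using leading_form_lift_nat[of k p h "nat (l - k - 1)"] by simp

lemma leading_form_scale: "leading_form k p h \<Longrightarrow> leading_form k (\<lambda>w. c * p w) (\<lambda>y. c * h y)"
proof (induction rule: leading_form.induct)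
  case (zero k)
  then show ?case using leading_form.zero by (simp add: zero_fun_def)
next
  case (const d)
  then show ?case by (rule leading_form.const)
next
  case (coord k p h i)
  then show ?case using leading_form.coord[OF coord.IH, of i] by (simp add: mult.left_commute)
next
  case (add k p h q g)
  then show ?case using leading_form.add[OF add.IH] by (simp add: plus_fun_def distrib_left)
next
  case (lift k p h)
  then show ?case using leading_form.lift[OF lift.IH] by (simp add: zero_fun_def)
qed

lemma leading_form_uminus: "leading_form k p h \<Longrightarrow> leading_form k (- p) (- h)"
  using leading_form_scale[of k p h "-1"] by (simp add: fun_Compl_def)

lemma leading_form_diff:
  "leading_form k p h \<Longrightarrow> leading_form k q g \<Longrightarrow> leading_form k (p - q) (h - g)"
  using leading_form.add[OF _ leading_form_uminus, of k p h q g] by simp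

lemma leading_form_mult:
  "leading_form k p h \<Longrightarrow> leading_form l q g \<Longrightarrow>
    leading_form (k + l) (\<lambda>w. p w * q w) (\<lambda>y. h y * g y)"
proof (induction rule: leading_form.induct)
  case (zero k)
  then show ?case using leading_form.zero by (simp add: zero_fun_def)
next
  case (const d)
  then show ?case by (simp add: leading_form_scale)
next
  case (coord k p h i)
  then show ?case
    using leading_form.coord[OF coord.IH[OF coord.prems], of i] by (simp add: mult.assoc algebra_simps)
next
  case (add k p h q g)
  then show ?case
    using leading_form.add[OF add.IH(1)[OF add.prems] add.IH(2)[OF add.prems]]
    by (simp add: plus_fun_def distrib_right)
next
  case (lift k p h)
  then show ?case using leading_form.lift[OF lift.IH[OF lift.prems]]
    by (simp add: zero_fun_def algebra_simps)
qed

text \<open>Discrete Leibniz rule: the difference of \<open>w\<^sub>i p(w)\<close> is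
  \<open>w\<^sub>i\<close> times the difference of \<open>p\<close>, plus
  \<open>a\<^sub>i p(w + a)\<close>. This loss of one degree is what makes commutators drop the
  order.\<close>

lemma leading_form_difference:
  "leading_form k p h \<Longrightarrow> \<exists>g. leading_form (k - 1) (\<lambda>w. p (w + a) - p w) g"
proof (induction rule: leading_form.induct)
  case (zero k)
  then show ?case using leading_form.zero by (auto simp: zero_fun_def)
next
  case (const d)
  then show ?case using leading_form.zero[of "-1"] by (auto simp: zero_fun_def)
next
  case (coord k p h i)
  obtain g where g: "leading_form (k - 1) (\<lambda>w. p (w + a) - p w) g" using coord.IH by blast
  have "leading_form (k - 1 + 1) (\<lambda>w. of_int (w $ i) * (p (w + a) - p w)) (\<lambda>y. y $ i * g y)"
    using g by (rule leading_form.coord)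
  \<comment> \<open>\<open>p (w + a)\<close> is recovered as difference plus \<open>p\<close>; the
    difference has order \<open>k - 1\<close>, so only \<open>p\<close> contributes to the leading
    part.\<close>
  moreover have "leading_form (k - 1 + 1) (\<lambda>w. p (w + a) - p w) 0"
    using g by (rule leading_form.lift)
  then have "leading_form k ((\<lambda>w. p (w + a) - p w) + p) (0 + h)"
    using coord.hyps by (intro leading_form.add) (simp_all only: diff_add_cancel)
  then have "leading_form k (\<lambda>w. of_int (a $ i) * p (w + a)) (\<lambda>y. of_int (a $ i) * h y)"
    using leading_form_scale[of k _ _ "of_int (a $ i)"] by (simp add: plus_fun_def)
  ultimately have "leading_form k ((\<lambda>w. of_int (w $ i) * (p (w + a) - p w)) +
      (\<lambda>w. of_int (a $ i) * p (w + a))) ((\<lambda>y. y $ i * g y) + (\<lambda>y. of_int (a $ i) * h y))"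
    using leading_form.add by auto
  moreover have "((\<lambda>w. of_int (w $ i) * (p (w + a) - p w)) + (\<lambda>w. of_int (a $ i) * p (w + a))) =
      (\<lambda>w. of_int ((w + a) $ i) * p (w + a) - of_int (w $ i) * p w)"
    by (simp add: fun_eq_iff algebra_simps)
  ultimately show ?case by auto
next
  case (add k p h q g)
  then obtain h' g' where "leading_form (k - 1) (\<lambda>w. p (w + a) - p w) h'"
    "leading_form (k - 1) (\<lambda>w. q (w + a) - q w) g'" by blast
  then have "leading_form (k - 1) ((\<lambda>w. p (w + a) - p w) + (\<lambda>w. q (w + a) - q w)) (h' + g')"
    by (rule leading_form.add)
  then show ?case by (auto simp: plus_fun_def algebra_simps)
next
  case (lift k p h)
  then show ?case using leading_form.lift by force
qed

lemma leading_form_translate: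
  assumes "leading_form k p h" shows "leading_form k (\<lambda>w. p (w + a)) h"
proof -
  obtain g where g: "leading_form (k - 1) (\<lambda>w. p (w + a) - p w) g"
    using leading_form_difference assms by blast
  have "leading_form k ((\<lambda>w. p (w + a) - p w) + p) (0 + h)"
    using leading_form.lift[OF g] assms by (intro leading_form.add) (simp_all only: diff_add_cancel)
  then show ?thesis by (simp add: plus_fun_def)
qed

text \<open>The weight in question is that of the commutator of \<open>x^u p(\<theta>)\<close> and
  \<open>x^v q(\<theta>)\<close>. The products \<open>p q\<close> cancel, leaving two terms that
  each contain a difference.\<close>

lemma leading_form_ring_comm:
  fixes u v :: "int ^ 'n"
  assumes "leading_form k p h" "leading_form l q g"
  shows "\<exists>r. leading_form (k + l - 1) (\<lambda>w. p (w + v) * q w - q (w + u) * p w) r"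
proof -
  obtain h' where h': "leading_form (k - 1) (\<lambda>w. p (w + v) - p w) h'"
    using leading_form_difference assms by blast
  obtain g' where g': "leading_form (l - 1) (\<lambda>w. q (w + u) - q w) g'"
    using leading_form_difference assms by blast
  have "leading_form (k + l - 1) ((\<lambda>w. (p (w + v) - p w) * q w) - (\<lambda>w. (q (w + u) - q w) * p w))
     ((\<lambda>y. h' y * g y) - (\<lambda>y. g' y * h y))"
    using leading_form_mult[OF h' assms(2)] leading_form_mult[OF g' assms(1)]
    by (intro leading_form_diff) (simp_all add: algebra_simps)
  moreover have "(\<lambda>w. (p (w + v) - p w) * q w) - (\<lambda>w. (q (w + u) - q w) * p w) =
    (\<lambda>w. p (w + v) * q w - q (w + u) * p w)"
    by (auto simp: fun_eq_iff algebra_simps)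
  ultimately show ?thesis by auto
qed

text \<open>A linear substitution preserves homogeneity, so the leading part undergoes the same
  substitution, now over \<open>\<complex>\<close>.\<close>

lemma leading_form_linear:
  fixes L :: "int ^ 'n ^ ('m::finite)"
  assumes "leading_form k q g"
  shows "leading_form k (\<lambda>w. q (L *v w)) (\<lambda>y. g (map_matrix of_int L *v (y :: complex ^ ('n::finite))))"
  using assms
proof (induction rule: leading_form.induct)
  case (zero k)
  then show ?case using leading_form.zero by (simp add: zero_fun_def)
next
  case (const c)
  show ?case by (rule leading_form.const)
next
  case (coord k q g i)
  let ?q = "\<lambda>w. q (L *v w)" and ?g = "\<lambda>y::complex^'n. g (map_matrix of_int L *v y)"
  have "leading_form (k + 1) (\<lambda>w. (\<Sum>j\<in>J. of_int (L $ i $ j) * of_int (w $ j)) * ?q w)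
      (\<lambda>y. (\<Sum>j\<in>J. of_int (L $ i $ j) * y $ j) * ?g y)" if "finite J" for J
    using that
  proof (induction J)
    case empty
    then show ?case using leading_form.zero by (simp add: zero_fun_def)
  next
    case (insert j J)
    have "leading_form (k + 1) (\<lambda>w. of_int (L $ i $ j) * (of_int (w $ j) * ?q w))
      (\<lambda>y. of_int (L $ i $ j) * (y $ j * ?g y))"
      using coord.IH by (intro leading_form_scale leading_form.coord)
    from leading_form.add[OF this insert.IH]
    show ?case using insert.hyps by (simp add: plus_fun_def algebra_simps)
  qed
  from this[of UNIV] show ?case
    by (simp add: matrix_vector_mult_def map_matrix_def)
next
  case (add k p h q g)
  then show ?case using leading_form.add[OF add.IH] by (simp add: plus_fun_def)
next
  case (lift k p h)
  then show ?case using leading_form.lift[OF lift.IH] by (simp add: zero_fun_def)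
qed

text \<open>Each new factor is \<open>w\<^sub>i - v\<^sub>i\<close>, whose constant term is of lower
  order; so \<open>x^v \<partial>^v\<close> has symbol \<open>y^v\<close>.\<close>

lemma leading_form_falling: "leading_form (int (vdeg v)) (falling v) (ymon v)"
proof (induction v rule: vec_nat_induct)
  case zero
  then show ?case using leading_form.const[of 1] by (simp add: falling_def[abs_def] ymon_def[abs_def])
next
  case (step v i)
  have "leading_form (int (vdeg v) + 1)
     ((\<lambda>w. of_int (w $ i) * falling v w) + (\<lambda>w. - of_nat (v $ i) * falling v w))
     ((\<lambda>y. y $ i * ymon v y) + 0)"
    using step leading_form.lift[OF leading_form_scale[OF step, of "- of_nat (v $ i)"]]
    by (intro leading_form.add leading_form.coord)
  moreover have "(\<lambda>w. of_int (w $ i) * falling v w) + (\<lambda>w. - of_nat (v $ i) * falling v w)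
     = falling (v + axis i 1)"
    by (auto simp: fun_eq_iff falling_Suc algebra_simps)
  moreover have "(\<lambda>y. y $ i * ymon v y) + 0 = ymon (v + axis i 1)"
    by (auto simp: fun_eq_iff ymon_Suc)
  ultimately show ?case by (simp add: vdeg_add)
qed

section \<open>Principal symbols of operators on the torus and their calculus\<close>

section \<open>Symbols in logarithmic coordinates\<close>

lemma tpow_0 [simp]: "tpow x 0 = 1"
  by (simp add: tpow_def)

lemma tpow_add: "x \<in> torus \<Longrightarrow> tpow x (u + v) = tpow x u * tpow x v"
  by (simp add: tpow_def torus_def power_int_add prod.distrib)

lemma tpow_minus: "tpow x (- u) = inverse (tpow x u)"
  using prod_inversef[of "\<lambda>j. x $ j powi u $ j" UNIV] by (simp add: tpow_def power_int_minus comp_def)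

lemma tpow_nonzero: "x \<in> torus \<Longrightarrow> tpow x u \<noteq> 0"
  by (simp add: tpow_def torus_def)

lemma tpow_ivec: "tpow x (ivec v) = ymon v x"
  by (simp add: tpow_def ymon_def ivec_def)

text \<open>Symbols are taken in the coordinates \<open>(x, y)\<close> with \<open>y\<^sub>i = x\<^sub>i \<xi>\<^sub>i\<close>, the symbol of \<open>\<theta>\<^sub>i\<close>; the set \<open>U\<close>
  bounds the exponents of the Laurent monomials, which records the degree in a grading.\<close>

inductive has_symbol :: "(int ^ 'n) set \<Rightarrow> int \<Rightarrow> ('n::finite) dop \<Rightarrow>
    (complex ^ 'n \<Rightarrow> complex ^ 'n \<Rightarrow> complex) \<Rightarrow> bool"
  for U k where
  zero: "has_symbol U k 0 (\<lambda>_ _. 0)"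
| shift: "u \<in> U \<Longrightarrow> leading_form k p h \<Longrightarrow> has_symbol U k (shift_op u p) (\<lambda>x y. tpow x u * h y)"
| add: "has_symbol U k P f \<Longrightarrow> has_symbol U k Q g \<Longrightarrow> has_symbol U k (P + Q) (\<lambda>x y. f x y + g x y)"
| cong: "has_symbol U k P f \<Longrightarrow> (\<And>x y. x \<in> torus \<Longrightarrow> f x y = g x y) \<Longrightarrow> has_symbol U k P g"

lemma has_symbol_subset: "has_symbol U k P f \<Longrightarrow> U \<subseteq> V \<Longrightarrow> has_symbol V k P f"
proof (induction rule: has_symbol.induct)
  case (shift u p h)
  then show ?case by (intro has_symbol.shift) auto
next
  case (cong P f g)
  show ?case using cong.IH[OF cong.prems] cong.hyps(2) by (rule has_symbol.cong)
qed (use has_symbol.zero has_symbol.add in blast)+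

lemma has_symbol_mono: "has_symbol U k P f \<Longrightarrow> k < l \<Longrightarrow> has_symbol U l P (\<lambda>_ _. 0)"
proof (induction rule: has_symbol.induct)
  case zero
  show ?case by (rule has_symbol.zero)
next
  case (shift u p h)
  then show ?case using has_symbol.shift[OF shift.hyps(1) leading_form_mono[of k p h l]] by simp
next
  case (add P f Q g)
  then have "has_symbol U l (P + Q) (\<lambda>_ _. 0 + 0)" by (intro has_symbol.add) auto
  then show ?case by (rule has_symbol.cong) simp
next
  case (cong P f g)
  then show ?case by simp
qed

lemma has_symbol_le: "has_symbol U k P f \<Longrightarrow> k \<le> l \<Longrightarrow> \<exists>g. has_symbol U l P g"
  using has_symbol_mono[of U k P f l] by (cases "k = l") auto

lemma has_symbol_additive: "has_symbol U k P f \<Longrightarrow> P (a + b) = P a + P b"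
  by (induction rule: has_symbol.induct) (auto simp: shift_op_add_right algebra_simps)

lemma uminus_shift_op: "- shift_op u p = shift_op u (- p)"
  by (intro ext poly_mapping_eqI) (simp add: lookup_shift_op)

lemma has_symbol_uminus: "has_symbol U k P f \<Longrightarrow> has_symbol U k (- P) (\<lambda>x y. - f x y)"
proof (induction rule: has_symbol.induct)
  case zero
  then show ?case using has_symbol.zero[of U k] by (simp add: zero_fun_def)
next
  case (shift u p h)
  show ?case using has_symbol.shift[OF shift.hyps(1) leading_form_uminus[OF shift.hyps(2)]]
    by (simp add: uminus_shift_op)
next
  case (add P f Q g)
  have "has_symbol U k (- P + - Q) (\<lambda>x y. - f x y + - g x y)" by (intro has_symbol.add add.IH)
  then have "has_symbol U k (- (P + Q)) (\<lambda>x y. - (f x y + g x y))" by simp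
  then show ?case .
next
  case (cong P f g)
  show ?case using cong.IH by (rule has_symbol.cong) (use cong.hyps in simp)
qed

lemma has_symbol_diff:
  "has_symbol U k P f \<Longrightarrow> has_symbol U k Q g \<Longrightarrow> has_symbol U k (P - Q) (\<lambda>x y. f x y - g x y)"
  using has_symbol.add[OF _ has_symbol_uminus, of U k P f Q g] by simp

lemma sum_apply: "(\<Sum>i\<in>I. F i) x = (\<Sum>i\<in>I. F i x)"
  by (induction I rule: infinite_finite_induct) auto

lemma has_symbol_sum:
  assumes "finite I" "\<And>i. i \<in> I \<Longrightarrow> has_symbol U k (P i) (f i)"
  shows "has_symbol U k (\<Sum>i\<in>I. P i) (\<lambda>x y. \<Sum>i\<in>I. f i x y)"
  using assms
proof (induction I)
  case empty
  show ?case using has_symbol.zero[of U k] by (simp add: zero_fun_def)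
next
  case (insert i I)
  have "has_symbol U k (P i + (\<Sum>i\<in>I. P i)) (\<lambda>x y. f i x y + (\<Sum>i\<in>I. f i x y))"
    using insert by (intro has_symbol.add) auto
  then have "has_symbol U k (\<Sum>i\<in>insert i I. P i) (\<lambda>x y. \<Sum>i\<in>insert i I. f i x y)"
    using insert.hyps by simp
  then show ?case .
qed

lemma comp_plus_left: "(P + Q) \<circ> R = (P \<circ> R) + (Q \<circ> R)" for R :: "'a \<Rightarrow> 'a :: plus"
  by (auto simp: fun_eq_iff)

lemma shift_comp_plus: "shift_op u p \<circ> (P + Q) = (shift_op u p \<circ> P) + (shift_op u p \<circ> Q)"
  by (auto simp: fun_eq_iff shift_op_add_right)

lemma shift_op_0_right [simp]: "shift_op u p 0 = 0"
  by (rule poly_mapping_eqI) (simp add: lookup_shift_op)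

text \<open>Composition evaluates \<open>p\<close> at a translate, which leaves its leading form
  unchanged, so symbols multiply. The factor \<open>tpow x (u + v)\<close> splits on the torus, and
  the rule \<open>cong\<close> allows symbols to be compared there only.\<close>

lemma has_symbol_shift_comp:
  assumes "leading_form k p h" "has_symbol V l Q g" "\<And>v. v \<in> V \<Longrightarrow> u + v \<in> W"
  shows "has_symbol W (k + l) (shift_op u p \<circ> Q) (\<lambda>x y. tpow x u * h y * g x y)"
  using assms(2)
proof (induction rule: has_symbol.induct)
  case zero
  have "has_symbol W (k + l) (shift_op u p \<circ> 0) (\<lambda>_ _. 0)"
    using has_symbol.zero[of W "k + l"] by (simp add: comp_def zero_fun_def)
  then show ?case by (rule has_symbol.cong) simp
next
  case (shift v q g)
  have "leading_form (k + l) (\<lambda>w. p (w + v) * q w) (\<lambda>y. h y * g y)"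
    by (intro leading_form_mult leading_form_translate assms shift)
  from has_symbol.shift[OF assms(3)[OF shift.hyps(1)] this]
  show ?case unfolding shift_op_comp by (rule has_symbol.cong) (simp add: tpow_add)
next
  case (add P f Q g)
  show ?case unfolding shift_comp_plus
    by (rule has_symbol.cong[OF has_symbol.add[OF add.IH]]) (simp add: algebra_simps)
next
  case (cong P f g)
  show ?case using cong.IH by (rule has_symbol.cong) (use cong.hyps in simp)
qed

lemma has_symbol_comp:
  assumes "has_symbol U k P f" "has_symbol V l Q g" "\<And>u v. u \<in> U \<Longrightarrow> v \<in> V \<Longrightarrow> u + v \<in> W"
  shows "has_symbol W (k + l) (P \<circ> Q) (\<lambda>x y. f x y * g x y)"
  using assms(1)
proof (induction rule: has_symbol.induct)
  case zero
  have "has_symbol W (k + l) (0 \<circ> Q) (\<lambda>_ _. 0)"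
    using has_symbol.zero[of W "k + l"] by (simp add: comp_def zero_fun_def)
  then show ?case by (rule has_symbol.cong) simp
next
  case (shift u p h)
  then show ?case using has_symbol_shift_comp[OF _ assms(2)] assms(3) by blast
next
  case (add P f Q g)
  show ?case unfolding comp_plus_left
    by (rule has_symbol.cong[OF has_symbol.add[OF add.IH]]) (simp add: algebra_simps)
next
  case (cong P f g)
  show ?case using cong.IH by (rule has_symbol.cong) (use cong.hyps in simp)
qed

text \<open>By additivity in both arguments two weighted shifts are enough; their commutator is
  again one weighted shift, by \<open>u + v\<close>, whose weight has lost one degree.\<close>

lemma has_symbol_comm:
  assumes "has_symbol UNIV k P f" "has_symbol UNIV l Q g"
  shows "\<exists>r. has_symbol UNIV (k + l - 1) ((P \<circ> Q) - (Q \<circ> P)) r"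
proof -
  have *: "\<exists>r. has_symbol UNIV (k + l - 1) ((shift_op u p \<circ> Q) - (Q \<circ> shift_op u p)) r"
    if "leading_form k p h" for u p h
    using assms(2)
  proof (induction rule: has_symbol.induct)
    case zero
    have "(shift_op u p \<circ> 0) - (0 \<circ> shift_op u p) = 0" by (auto simp: fun_eq_iff)
    then show ?case using has_symbol.zero by metis
  next
    case (shift v q g)
    have eq: "(shift_op u p \<circ> shift_op v q) - (shift_op v q \<circ> shift_op u p) =
      shift_op (u + v) (\<lambda>w. p (w + v) * q w - q (w + u) * p w)"
      by (intro ext poly_mapping_eqI)
        (simp add: shift_op_comp lookup_shift_op lookup_minus algebra_simps)
    obtain r where "leading_form (k + l - 1) (\<lambda>w. p (w + v) * q w - q (w + u) * p w) r"
      using leading_form_ring_comm[OF \<open>leading_form k p h\<close> shift.hyps(2)] by blast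
    then show ?case unfolding eq using has_symbol.shift by blast
  next
    case (add P f Q g)
    have "(shift_op u p \<circ> (P + Q)) - ((P + Q) \<circ> shift_op u p) =
      ((shift_op u p \<circ> P) - (P \<circ> shift_op u p)) + ((shift_op u p \<circ> Q) - (Q \<circ> shift_op u p))"
      by (simp add: fun_eq_iff shift_op_add_right)
    moreover obtain r r' where "has_symbol UNIV (k + l - 1) ((shift_op u p \<circ> P) - (P \<circ> shift_op u p)) r"
      "has_symbol UNIV (k + l - 1) ((shift_op u p \<circ> Q) - (Q \<circ> shift_op u p)) r'"
      using add.IH by blast
    ultimately have "has_symbol UNIV (k + l - 1) ((shift_op u p \<circ> (P + Q)) - ((P + Q) \<circ> shift_op u p))
        (\<lambda>x y. r x y + r' x y)"
      using has_symbol.add by (simp only:)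
    then show ?case by blast
  qed auto
  show ?thesis
    using assms(1)
  proof (induction rule: has_symbol.induct)
    case zero
    have "(0 \<circ> Q) - (Q \<circ> 0) = 0" using has_symbol_additive[OF assms(2), of 0 0] by (auto simp: fun_eq_iff)
    then show ?case using has_symbol.zero by metis
  next
    case (shift u p h)
    then show ?case using * by blast
  next
    case (add P f R g)
    have "((P + R) \<circ> Q) - (Q \<circ> (P + R)) = ((P \<circ> Q) - (Q \<circ> P)) + ((R \<circ> Q) - (Q \<circ> R))"
      by (simp add: fun_eq_iff has_symbol_additive[OF assms(2)])
    moreover obtain r r' where "has_symbol UNIV (k + l - 1) ((P \<circ> Q) - (Q \<circ> P)) r"
      "has_symbol UNIV (k + l - 1) ((R \<circ> Q) - (Q \<circ> R)) r'"
      using add.IH by blast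
    ultimately have "has_symbol UNIV (k + l - 1) (((P + R) \<circ> Q) - (Q \<circ> (P + R))) (\<lambda>x y. r x y + r' x y)"
      using has_symbol.add by (simp only:)
    then show ?case by blast
  qed auto
qed

lemma has_symbol_shift_one: "u \<in> U \<Longrightarrow> has_symbol U 0 (shift_op u (\<lambda>_. c)) (\<lambda>x y. c * tpow x u)"
  using has_symbol.shift[OF _ leading_form.const[of c]] by (simp add: mult.commute)

lemma has_symbol_id: "0 \<in> U \<Longrightarrow> has_symbol U 0 id (\<lambda>x y. 1)"
  using has_symbol_shift_one[of 0 U 1] by (simp add: shift_op_one)

section \<open>Coefficients of \<open>\<partial>^v\<close> against weights in
  \<open>\<theta>\<close>\<close>

subsection \<open>Comparison with coefficient families\<close>

text \<open>The same data expanded in falling factorials instead of powers, that is, in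
  \<open>\<partial>^v\<close> instead of \<open>\<theta>^v\<close>: in this basis a coefficient
  family can be read off.\<close>

inductive falling_form :: "int \<Rightarrow> (int ^ 'n \<Rightarrow> complex) \<Rightarrow> (complex ^ ('n::finite) \<Rightarrow> complex) \<Rightarrow> bool"
  for k where
  zero: "falling_form k (\<lambda>_. 0) (\<lambda>_. 0)"
| step: "falling_form k p h \<Longrightarrow> int (vdeg v) \<le> k \<Longrightarrow>
    falling_form k (\<lambda>w. p w + c * falling v w)
      (\<lambda>y. h y + (if int (vdeg v) = k then c * ymon v y else 0))"

lemma falling_form_add:
  "falling_form k q g \<Longrightarrow> falling_form k p h \<Longrightarrow> falling_form k (\<lambda>w. p w + q w) (\<lambda>y. h y + g y)"
proof (induction rule: falling_form.induct)
  case zero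
  then show ?case by simp
next
  case (step q g v c)
  show ?case using falling_form.step[OF step.IH[OF step.prems] step.hyps(2), of c]
    by (simp add: add.assoc)
qed

lemma falling_form_lift: "falling_form k p h \<Longrightarrow> falling_form (k + 1) p (\<lambda>_. 0)"
proof (induction rule: falling_form.induct)
  case zero
  show ?case by (rule falling_form.zero)
next
  case (step p h v c)
  then have "int (vdeg v) \<le> k + 1" "int (vdeg v) \<noteq> k + 1" by auto
  then show ?case using falling_form.step[OF step.IH, of v c] by simp
qed

lemma subst_arguments: "P a b \<Longrightarrow> a = a' \<Longrightarrow> b = b' \<Longrightarrow> P a' b'"
  by simp

text \<open>Change of basis: \<open>w\<^sub>i\<close> times the falling factorial of
  \<open>v\<close> is that of \<open>v + e\<^sub>i\<close> plus \<open>v\<^sub>i\<close> times that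
  of \<open>v\<close>, and the second term is below the top order.\<close>

lemma falling_form_coord:
  "falling_form k p h \<Longrightarrow> falling_form (k + 1) (\<lambda>w. of_int (w $ i) * p w) (\<lambda>y. y $ i * h y)"
proof (induction rule: falling_form.induct)
  case zero
  then show ?case using falling_form.zero by simp
next
  case (step p h v c)
  have 1: "int (vdeg (v + axis i 1)) \<le> k + 1" "int (vdeg v) \<le> k + 1" "int (vdeg v) \<noteq> k + 1"
    using step.hyps by (auto simp: vdeg_add)
  have 2: "(int (vdeg (v + axis i 1)) = k + 1) = (int (vdeg v) = k)" by (auto simp: vdeg_add)
  show ?case
    using falling_form.step[OF falling_form.step[OF step.IH 1(1), of c] 1(2), of "c * of_nat (v $ i)"] 1(3)
    unfolding 2 by (elim subst_arguments[of "falling_form (k + 1)"]) (auto simp: fun_eq_iff falling_Suc ymon_Suc algebra_simps)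
qed

lemma leading_form_falling_form: "leading_form k p h \<Longrightarrow> falling_form k p h"
proof (induction rule: leading_form.induct)
  case (zero k)
  then show ?case using falling_form.zero by (simp add: zero_fun_def)
next
  case (const c)
  then show ?case using falling_form.step[OF falling_form.zero, of 0 0 c] by simp
next
  case (coord k p h i)
  then show ?case by (intro falling_form_coord)
next
  case (add k p h q g)
  then show ?case using falling_form_add by (simp add: plus_fun_def)
next
  case (lift k p h)
  then show ?case using falling_form_lift by (simp add: zero_fun_def)
qed

lemma leval_superset:
  assumes "finite U" "Poly_Mapping.keys f \<subseteq> U"
  shows "leval f x = (\<Sum>u\<in>U. Poly_Mapping.lookup f u * tpow x u)"
  unfolding leval_def tpow_def
  by (rule sum.mono_neutral_left) (use assms in \<open>auto simp: in_keys_iff\<close>)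

lemma leval_add: "leval (f + g) x = leval f x + leval g x"
proof -
  let ?U = "Poly_Mapping.keys f \<union> Poly_Mapping.keys g"
  show ?thesis
    using keys_add[of f g] by (subst (1 2 3) leval_superset[of ?U])
      (auto simp: lookup_add algebra_simps sum.distrib)
qed

lemma leval_0 [simp]: "leval 0 x = 0"
  by (simp add: leval_def)

lemma leval_single: "leval (Poly_Mapping.single u c) x = c * tpow x u"
  by (simp add: leval_superset[of "{u}"])

lemma dop_superset:
  assumes "finite V" "Poly_Mapping.keys c \<subseteq> V"
  shows "dop c f = (\<Sum>v\<in>V. Poly_Mapping.lookup c v * pdiff v f)"
  unfolding dop_def
  by (rule sum.mono_neutral_left) (use assms in \<open>auto simp: in_keys_iff\<close>)

lemma symb_superset:
  assumes "finite V" "Poly_Mapping.keys c \<subseteq> V"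
  shows "symb k c p = (\<Sum>v\<in>V. if int (vdeg v) = k then
    leval (Poly_Mapping.lookup c v) (cot_base p) * ymon v (cot_fibre p) else 0)"
proof -
  have "symb k c p = (\<Sum>v\<in>Poly_Mapping.keys c. if int (vdeg v) = k then
    leval (Poly_Mapping.lookup c v) (cot_base p) * ymon v (cot_fibre p) else 0)"
    unfolding symb_def ymon_def by (subst sum.inter_filter) auto
  also have "\<dots> = (\<Sum>v\<in>V. if int (vdeg v) = k then
    leval (Poly_Mapping.lookup c v) (cot_base p) * ymon v (cot_fibre p) else 0)"
    by (rule sum.mono_neutral_left) (use assms in \<open>auto simp: in_keys_iff\<close>)
  finally show ?thesis .
qed

lemma dop_add: "dop (c + d) = dop c + dop d"
proof
  fix f
  let ?V = "Poly_Mapping.keys c \<union> Poly_Mapping.keys d"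
  show "dop (c + d) f = (dop c + dop d) f"
    using keys_add[of c d] unfolding plus_fun_def
    by (subst (1 2 3) dop_superset[of ?V]) (auto simp: lookup_add algebra_simps sum.distrib)
qed

lemma symb_add: "symb k (c + d) p = symb k c p + symb k d p"
proof -
  let ?V = "Poly_Mapping.keys c \<union> Poly_Mapping.keys d"
  show ?thesis
    using keys_add[of c d]
    by (subst (1 2 3) symb_superset[of ?V])
      (auto simp: lookup_add leval_add algebra_simps sum.distrib[symmetric] intro!: sum.cong)
qed

definition log_fibre :: "complex ^ ('n + 'n) \<Rightarrow> complex ^ ('n::finite)" where
  "log_fibre p = (\<chi> i. cot_base p $ i * cot_fibre p $ i)"

lemma ymon_mult: "ymon v (\<chi> i. x $ i * y $ i) = ymon v x * ymon v y"
  by (simp add: ymon_def power_mult_distrib prod.distrib)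

text \<open>Since \<open>y^v = x^v \<xi>^v\<close>, shifting the exponent by \<open>-v\<close>
  compensates exactly for the change from \<open>\<xi>\<close> to \<open>y\<close>. This reconciles
  the two notions of symbol.\<close>

lemma tpow_ymon_log:
  assumes "p \<in> cot_torus"
  shows "tpow (cot_base p) (u - ivec v) * ymon v (log_fibre p) = tpow (cot_base p) u * ymon v (cot_fibre p)"
proof -
  have "cot_base p \<in> torus" using assms by (simp add: cot_torus_def)
  then have "tpow (cot_base p) (u - ivec v) * tpow (cot_base p) (ivec v) = tpow (cot_base p) u"
    by (simp flip: tpow_add)
  then show ?thesis
    by (simp add: log_fibre_def ymon_mult tpow_ivec mult.assoc flip: mult.assoc)
qed

text \<open>Termwise, \<open>x^u \<partial>^v\<close> is the shift by \<open>u - v\<close> with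
  weight \<open>falling v\<close>; the exponents collected in \<open>U\<close> are therefore the
  differences \<open>u - v\<close>, on which the \<open>A\<close>-degree depends.\<close>

lemma dop_has_symbol:
  assumes deg: "\<And>v. v \<in> Poly_Mapping.keys c \<Longrightarrow> int (vdeg v) \<le> k"
    and U: "\<And>v u. v \<in> Poly_Mapping.keys c \<Longrightarrow> u \<in> Poly_Mapping.keys (Poly_Mapping.lookup c v) \<Longrightarrow> u - ivec v \<in> U"
  obtains f where "has_symbol U k (dop c) f"
    "\<And>p. p \<in> cot_torus \<Longrightarrow> f (cot_base p) (log_fibre p) = symb k c p"
proof -
  let ?l = "Poly_Mapping.lookup" and ?K = "Poly_Mapping.keys"
  define f where "f = (\<lambda>x y. \<Sum>v\<in>?K c. \<Sum>u\<in>?K (?l c v).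
      tpow x (u - ivec v) * (?l (?l c v) u * (if int (vdeg v) = k then ymon v y else 0)))"
  have "dop c = (\<Sum>v\<in>?K c. \<Sum>u\<in>?K (?l c v). shift_op (u - ivec v) (\<lambda>w. ?l (?l c v) u * falling v w))"
  proof (intro ext poly_mapping_eqI)
    fix a w
    have "?l c v * pdiff v a = (\<Sum>u\<in>?K (?l c v). shift_op (u - ivec v) (\<lambda>w. ?l (?l c v) u * falling v w) a)" for v
    proof -
      have "?l c v * pdiff v a = (\<Sum>u\<in>?K (?l c v). Poly_Mapping.single u (?l (?l c v) u)) * pdiff v a"
        by (simp flip: poly_mapping_as_sum)
      also have "\<dots> = (\<Sum>u\<in>?K (?l c v). (shift_op u (\<lambda>_. ?l (?l c v) u) \<circ> pdiff v) a)"
        by (simp add: sum_distrib_right single_times_lookup)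
      finally show ?thesis by (simp add: pdiff_eq shift_op_comp)
    qed
    then show "?l (dop c a) w = ?l ((\<Sum>v\<in>?K c. \<Sum>u\<in>?K (?l c v). shift_op (u - ivec v) (\<lambda>w. ?l (?l c v) u * falling v w)) a) w"
      by (simp add: dop_def sum_apply)
  qed
  moreover have "has_symbol U k (\<Sum>v\<in>?K c. \<Sum>u\<in>?K (?l c v). shift_op (u - ivec v) (\<lambda>w. ?l (?l c v) u * falling v w)) f"
    unfolding f_def
  proof (intro has_symbol_sum has_symbol.shift U)
    fix v u assume v: "v \<in> ?K c"
    have "leading_form k (falling v) (\<lambda>y. if int (vdeg v) = k then ymon v y else 0)"
      using deg[OF v] leading_form_falling[of v] leading_form_mono[OF leading_form_falling, of v k]
      by (cases "int (vdeg v) = k") (auto simp: zero_fun_def eta_contract_eq)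
    then show "leading_form k (\<lambda>w. ?l (?l c v) u * falling v w)
        (\<lambda>y. ?l (?l c v) u * (if int (vdeg v) = k then ymon v y else 0))"
      by (rule leading_form_scale)
  qed auto
  moreover have "f (cot_base p) (log_fibre p) = symb k c p" if "p \<in> cot_torus" for p
  proof -
    have "f (cot_base p) (log_fibre p) = (\<Sum>v\<in>?K c. \<Sum>u\<in>?K (?l c v). ?l (?l c v) u * (if int (vdeg v) = k then
        tpow (cot_base p) u * ymon v (cot_fibre p) else 0))"
      unfolding f_def using that
      by (intro sum.cong refl) (auto simp: tpow_ymon_log[symmetric])
    also have "\<dots> = symb k c p"
      by (subst symb_superset[OF _ subset_refl])
        (auto simp: leval_superset[OF _ subset_refl] sum_distrib_right mult.assoc intro!: sum.cong)
    finally show ?thesis .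
  qed
  ultimately show ?thesis using that by metis
qed

text \<open>The converse reading: \<open>x^u\<close> times the falling factorial of \<open>v\<close>
  in \<open>\<theta>\<close> is \<open>x^(u+v) \<partial>^v\<close>. All bounds are conditions on
  keys, and the keys of a sum lie among those of the summands, so cancellation does no harm.\<close>

lemma has_symbol_imp_dop:
  assumes "has_symbol U k P f"
  shows "\<exists>c. dop c = P \<and> (\<forall>v\<in>Poly_Mapping.keys c. int (vdeg v) \<le> k) \<and>
    (\<forall>v\<in>Poly_Mapping.keys c. \<forall>u\<in>Poly_Mapping.keys (Poly_Mapping.lookup c v). u - ivec v \<in> U) \<and>
    (\<forall>p\<in>cot_torus. symb k c p = f (cot_base p) (log_fibre p))"
proof -
  define good where "good P f c \<longleftrightarrow> dop c = P \<and> (\<forall>v\<in>Poly_Mapping.keys c. int (vdeg v) \<le> k) \<and>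
    (\<forall>v\<in>Poly_Mapping.keys c. \<forall>u\<in>Poly_Mapping.keys (Poly_Mapping.lookup c v). u - ivec v \<in> U) \<and>
    (\<forall>p\<in>cot_torus. symb k c p = f (cot_base p) (log_fibre p))" for P f c
  have good_add: "good (P + Q) (\<lambda>x y. f x y + g x y) (c + d)" if "good P f c" "good Q g d" for P Q f g c d
    unfolding good_def
  proof (intro conjI)
    show "dop (c + d) = P + Q" using that by (simp add: good_def dop_add)
    show "\<forall>v\<in>Poly_Mapping.keys (c + d). int (vdeg v) \<le> k" using that keys_add[of c d] unfolding good_def by blast
    show "\<forall>v\<in>Poly_Mapping.keys (c + d). \<forall>u\<in>Poly_Mapping.keys (Poly_Mapping.lookup (c + d) v). u - ivec v \<in> U"
    proof (intro ballI)
      fix v u assume "u \<in> Poly_Mapping.keys (Poly_Mapping.lookup (c + d) v)"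
      then have "u \<in> Poly_Mapping.keys (Poly_Mapping.lookup c v) \<or> u \<in> Poly_Mapping.keys (Poly_Mapping.lookup d v)"
        using keys_add by (fastforce simp: lookup_add)
      moreover have "v \<in> Poly_Mapping.keys e" if "u \<in> Poly_Mapping.keys (Poly_Mapping.lookup e v)"
        for e :: "(nat ^ 'a) \<Rightarrow>\<^sub>0 'a laurent"
        using that by (auto simp: in_keys_iff)
      ultimately show "u - ivec v \<in> U" using \<open>good P f c\<close> \<open>good Q g d\<close> unfolding good_def by blast
    qed
    show "\<forall>p\<in>cot_torus. symb k (c + d) p = f (cot_base p) (log_fibre p) + g (cot_base p) (log_fibre p)"
      using that by (simp add: good_def symb_add)
  qed
  have good_zero: "good 0 (\<lambda>_ _. 0) 0"
    by (auto simp: good_def dop_def fun_eq_iff symb_def)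
  have "\<exists>c. good P f c"
    using assms
  proof (induction rule: has_symbol.induct)
    case zero
    then show ?case using good_zero by blast
  next
    case (shift u p h)
    have "falling_form k p h" using shift(2) by (rule leading_form_falling_form)
    then show ?case
    proof (induction rule: falling_form.induct)
      case zero
      have "shift_op u (\<lambda>_. 0) = 0" using shift_op_zero[of u] by (simp add: zero_fun_def)
      then show ?case using good_zero by (intro exI[of _ 0]) (simp add: good_def zero_fun_def)
    next
      case (step p h v a)
      let ?d = "Poly_Mapping.single v (Poly_Mapping.single (u + ivec v) a)"
      obtain c where c: "good (shift_op u p) (\<lambda>x y. tpow x u * h y) c" using step.IH by blast
      have "dop ?d = shift_op u (\<lambda>w. a * falling v w)"
      proof
        fix b
        have "dop ?d b = (shift_op (u + ivec v) (\<lambda>_. a) \<circ> pdiff v) b"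
          by (subst dop_superset[of "{v}"]) (auto simp: single_times_lookup)
        then show "dop ?d b = shift_op u (\<lambda>w. a * falling v w) b"
          by (simp add: pdiff_eq shift_op_comp)
      qed
      moreover have "symb k ?d p = tpow (cot_base p) u * (if int (vdeg v) = k then a * ymon v (log_fibre p) else 0)"
        if "p \<in> cot_torus" for p
        using tpow_ymon_log[OF that, of "u + ivec v" v]
        by (subst symb_superset[of "{v}"]) (auto simp: leval_single)
      ultimately have "good (shift_op u (\<lambda>w. a * falling v w))
          (\<lambda>x y. tpow x u * (if int (vdeg v) = k then a * ymon v y else 0)) ?d"
        using step.hyps(2) shift.hyps(1) unfolding good_def by (auto split: if_splits)
      from good_add[OF c this]
      have "good (shift_op u p + shift_op u (\<lambda>w. a * falling v w))
         (\<lambda>x y. tpow x u * (h y + (if int (vdeg v) = k then a * ymon v y else 0))) (c + ?d)"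
        unfolding distrib_left .
      moreover have "shift_op u p + shift_op u (\<lambda>w. a * falling v w) = shift_op u (\<lambda>w. p w + a * falling v w)"
        using shift_op_add[of u p "\<lambda>w. a * falling v w"] by (simp add: plus_fun_def)
      ultimately have "good (shift_op u (\<lambda>w. p w + a * falling v w))
         (\<lambda>x y. tpow x u * (h y + (if int (vdeg v) = k then a * ymon v y else 0))) (c + ?d)"
        by (simp only:)
      then show ?case by (rule exI)
    qed
  next
    case (add P f Q g)
    then show ?case using good_add by blast
  next
    case (cong P f g)
    then show ?case by (auto simp: good_def cot_torus_def)
  qed
  then show ?thesis by (simp only: good_def)
qed

lemma dop_has_some_symbol:
  assumes "\<forall>v\<in>Poly_Mapping.keys c. \<forall>u\<in>Poly_Mapping.keys (Poly_Mapping.lookup c v). u - ivec v \<in> U"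
  shows "\<exists>k f. has_symbol U k (dop c) f"
proof -
  define k where "k = Max (insert 0 ((\<lambda>v. int (vdeg v)) ` Poly_Mapping.keys c))"
  have "int (vdeg v) \<le> k" if "v \<in> Poly_Mapping.keys c" for v
    unfolding k_def using that by (intro Max_ge) auto
  then obtain f where "has_symbol U k (dop c) f"
    by (rule dop_has_symbol[of c k U]) (use assms in auto)
  then show ?thesis by blast
qed

lemma carrier_torus_dops: "carrier torus_dops = {P :: ('n::finite) dop. \<exists>k f. has_symbol UNIV k P f}"
proof -
  have "\<exists>k f. has_symbol UNIV k (dop c) f" for c :: "(nat ^ 'n) \<Rightarrow>\<^sub>0 ('n::finite) laurent"
    by (rule dop_has_some_symbol) simp
  moreover have "P \<in> range dop" if "has_symbol UNIV k P f" for k P and f :: "complex ^ 'n \<Rightarrow> complex ^ ('n::finite) \<Rightarrow> complex"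
    using has_symbol_imp_dop[OF that] by blast
  ultimately have "range dop = {P :: ('n::finite) dop. \<exists>k f. has_symbol UNIV k P f}" by blast
  then show ?thesis by (simp add: torus_dops_def dop_ring_def)
qed

lemma dop_degree_iff: "P \<in> dop_degree A \<alpha> \<longleftrightarrow> (\<exists>k f. has_symbol {u. A *v u = \<alpha>} k P f)"
proof
  assume "P \<in> dop_degree A \<alpha>"
  then obtain c where "P = dop c" "\<forall>v\<in>Poly_Mapping.keys c.
     \<forall>u\<in>Poly_Mapping.keys (Poly_Mapping.lookup c v). u - ivec v \<in> {u. A *v u = \<alpha>}"
    by (auto simp: dop_degree_def)
  then show "\<exists>k f. has_symbol {u. A *v u = \<alpha>} k P f"
    using dop_has_some_symbol by metis
next
  assume "\<exists>k f. has_symbol {u. A *v u = \<alpha>} k P f"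
  then obtain k f where "has_symbol {u. A *v u = \<alpha>} k P f" by blast
  from has_symbol_imp_dop[OF this] obtain c where "dop c = P"
    "\<forall>v\<in>Poly_Mapping.keys c. \<forall>u\<in>Poly_Mapping.keys (Poly_Mapping.lookup c v). A *v (u - ivec v) = \<alpha>"
    by (simp only: mem_Collect_eq) blast
  then show "P \<in> dop_degree A \<alpha>"
    unfolding dop_degree_def by (intro image_eqI[of _ _ c]) (auto simp only: mem_Collect_eq)
qed

section \<open>Recognising the Weyl algebra without coefficient families\<close>

subsection \<open>The Weyl algebra as the stabiliser of the polynomials\<close>

lemma polynomials_add: "f \<in> polynomials \<Longrightarrow> g \<in> polynomials \<Longrightarrow> f + g \<in> polynomials"
  using keys_add[of f g] by (auto simp: polynomials_def)

lemma polynomials_uminus: "f \<in> polynomials \<Longrightarrow> - f \<in> polynomials"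
  by (auto simp: polynomials_def in_keys_iff)

lemma polynomials_diff: "f \<in> polynomials \<Longrightarrow> g \<in> polynomials \<Longrightarrow> f - g \<in> polynomials"
  using polynomials_add[OF _ polynomials_uminus] by force

lemma polynomials_0 [simp]: "0 \<in> polynomials"
  by (simp add: polynomials_def)

lemma polynomials_sum: "(\<And>i. i \<in> I \<Longrightarrow> f i \<in> polynomials) \<Longrightarrow> (\<Sum>i\<in>I. f i) \<in> polynomials"
  by (induction I rule: infinite_finite_induct) (auto intro: polynomials_add)

lemma polynomials_single: "(c \<noteq> 0 \<Longrightarrow> (\<forall>i. 0 \<le> u $ i)) \<Longrightarrow> Poly_Mapping.single u c \<in> polynomials"
  by (auto simp: polynomials_def)

lemma polynomials_mult: "f \<in> polynomials \<Longrightarrow> g \<in> polynomials \<Longrightarrow> f * g \<in> polynomials"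
  using keys_mult[of f g] by (fastforce simp: polynomials_def)

definition preserves_polynomials :: "('n::finite) dop \<Rightarrow> bool" where
  "preserves_polynomials P \<longleftrightarrow> P ` polynomials \<subseteq> polynomials"

lemma falling_eq_0: "(\<exists>i. 0 \<le> w $ i \<and> w $ i < int (v $ i)) \<Longrightarrow> falling v w = 0"
proof -
  assume "\<exists>i. 0 \<le> w $ i \<and> w $ i < int (v $ i)"
  then obtain i where i: "0 \<le> w $ i" "w $ i < int (v $ i)" by blast
  have "(\<Prod>k<v $ i. of_int (w $ i) - of_nat k :: complex) = 0"
    using i by (intro prod_zero bexI[of _ "nat (w $ i)"]) auto
  then show ?thesis unfolding falling_def by (intro prod_zero bexI[of _ i]) auto
qed

lemma falling_self: "falling v (ivec v) \<noteq> 0"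
  by (auto simp: falling_def ivec_def)

text \<open>On the exponents of a polynomial, the falling factorial vanishes exactly when
  differentiation would create a negative exponent.\<close>

lemma preserves_polynomials_dop:
  assumes "c \<in> poly_coeffs" shows "preserves_polynomials (dop c)"
  unfolding preserves_polynomials_def
proof safe
  fix f :: "'a laurent" assume f: "f \<in> polynomials"
  have "pdiff v f \<in> polynomials" for v
    unfolding pdiff_eq shift_op_def
  proof (intro polynomials_sum polynomials_single allI)
    fix u i assume u: "u \<in> Poly_Mapping.keys f" "Poly_Mapping.lookup f u * falling v u \<noteq> 0"
    then have "0 \<le> u $ i" using f by (auto simp: polynomials_def)
    moreover have "\<not> (0 \<le> u $ i \<and> u $ i < int (v $ i))" using u falling_eq_0[of u v] by auto
    ultimately show "0 \<le> (u + - ivec v) $ i" by (simp add: ivec_def)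
  qed
  then show "dop c f \<in> polynomials"
    using assms unfolding dop_def by (auto simp: poly_coeffs_def intro!: polynomials_sum polynomials_mult)
qed

lemma dop_single: "dop c (Poly_Mapping.single w 1) =
  (\<Sum>v\<in>Poly_Mapping.keys c. Poly_Mapping.lookup c v * Poly_Mapping.single (w - ivec v) (falling v w))"
  by (simp add: dop_def pdiff_eq shift_op_single)

text \<open>The operator is tested on \<open>x^v\<close>, by induction on the size of
  \<open>v\<close>. Terms \<open>v'\<close> with some component above that of \<open>v\<close>
  annihilate \<open>x^v\<close>, smaller \<open>v'\<close> have polynomial coefficients by
  induction, and what is left is \<open>v!\<close> times the coefficient of
  \<open>\<partial>^v\<close>.\<close>

lemma poly_coeffs_if_preserves:
  assumes "preserves_polynomials (dop c)" shows "c \<in> poly_coeffs"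
proof -
  have "Poly_Mapping.lookup c v \<in> polynomials" for v
  proof (induction "vdeg v" arbitrary: v rule: less_induct)
    case less
    show ?case
    proof (cases "v \<in> Poly_Mapping.keys c")
      case True
      let ?t = "\<lambda>v'. Poly_Mapping.lookup c v' * Poly_Mapping.single (ivec v - ivec v') (falling v' (ivec v))"
      have other: "?t v' \<in> polynomials" if "v' \<noteq> v" for v'
      proof (cases "\<exists>i. v $ i < v' $ i")
        case True
        then have "falling v' (ivec v) = 0" by (intro falling_eq_0) (auto simp: ivec_def)
        then show ?thesis by simp
      next
        case False
        then have le: "v' $ i \<le> v $ i" for i by (simp add: not_less)
        obtain i where "v' $ i \<noteq> v $ i" using \<open>v' \<noteq> v\<close> by (auto simp: vec_eq_iff)
        then have "vdeg v' < vdeg v" unfolding vdeg_def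
          using le by (intro sum_strict_mono_ex1 bexI[of _ i]) (auto simp: le_less)
        then show ?thesis
          using less le by (intro polynomials_mult polynomials_single) (auto simp: ivec_def)
      qed
      have "Poly_Mapping.single (ivec v) 1 \<in> polynomials"
        by (rule polynomials_single) (simp add: ivec_def)
      then have "dop c (Poly_Mapping.single (ivec v) 1) \<in> polynomials"
        using assms by (auto simp: preserves_polynomials_def)
      moreover have "dop c (Poly_Mapping.single (ivec v) 1) = ?t v + (\<Sum>v'\<in>Poly_Mapping.keys c - {v}. ?t v')"
        unfolding dop_single by (rule sum.remove) (use True in auto)
      moreover have "(\<Sum>v'\<in>Poly_Mapping.keys c - {v}. ?t v') \<in> polynomials"
        using other by (intro polynomials_sum) auto
      ultimately have "?t v \<in> polynomials"
        using polynomials_diff by fastforce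
      then have "?t v * Poly_Mapping.single 0 (inverse (falling v (ivec v))) \<in> polynomials"
        by (rule polynomials_mult) (auto intro: polynomials_single)
      moreover have "?t v * Poly_Mapping.single 0 (inverse (falling v (ivec v))) = Poly_Mapping.lookup c v"
        unfolding mult.assoc mult_single using falling_self[of v] by simp
      ultimately show ?thesis by simp
    next
      case False
      then show ?thesis by (simp add: in_keys_iff)
    qed
  qed
  then show ?thesis by (simp add: poly_coeffs_def)
qed

lemma order_filtE:
  assumes "c \<in> order_filt k"
  obtains f where "has_symbol UNIV k (dop c) f" "preserves_polynomials (dop c)"
    "\<And>p. p \<in> cot_torus \<Longrightarrow> f (cot_base p) (log_fibre p) = symb k c p"
proof -
  have c: "c \<in> poly_coeffs" "\<And>v. v \<in> Poly_Mapping.keys c \<Longrightarrow> int (vdeg v) \<le> k"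
    using assms by (auto simp: order_filt_def)
  obtain f where "has_symbol UNIV k (dop c) f"
    "\<And>p. p \<in> cot_torus \<Longrightarrow> f (cot_base p) (log_fibre p) = symb k c p"
    using c(2) by (rule dop_has_symbol[of c k UNIV]) auto
  then show ?thesis using that preserves_polynomials_dop[OF c(1)] by blast
qed

lemma has_symbol_order_filt:
  assumes "has_symbol UNIV k P f" "preserves_polynomials P"
  obtains c where "c \<in> order_filt k" "dop c = P"
    "\<And>p. p \<in> cot_torus \<Longrightarrow> symb k c p = f (cot_base p) (log_fibre p)"
proof -
  obtain c where c: "dop c = P" "\<forall>v\<in>Poly_Mapping.keys c. int (vdeg v) \<le> k"
    "\<forall>p\<in>cot_torus. symb k c p = f (cot_base p) (log_fibre p)"
    using has_symbol_imp_dop[OF assms(1)] by blast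
  then have "c \<in> order_filt k"
    using poly_coeffs_if_preserves[of c] assms(2) by (simp add: order_filt_def)
  then show ?thesis using that c by blast
qed

lemma dop_order_filt:
  "dop ` order_filt k = {P. (\<exists>f. has_symbol UNIV k P f) \<and> preserves_polynomials P}"
proof (intro equalityI subsetI)
  fix P :: "'a dop" assume "P \<in> dop ` order_filt k"
  then show "P \<in> {P. (\<exists>f. has_symbol UNIV k P f) \<and> preserves_polynomials P}"
    by (auto elim: order_filtE)
next
  fix P :: "'a dop" assume "P \<in> {P. (\<exists>f. has_symbol UNIV k P f) \<and> preserves_polynomials P}"
  then show "P \<in> dop ` order_filt k" using has_symbol_order_filt by blast
qed

lemma carrier_weyl:
  "carrier weyl = {P :: ('n::finite) dop. P \<in> carrier torus_dops \<and> preserves_polynomials P}"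
proof -
  have "dop ` poly_coeffs = {P :: 'n dop. P \<in> range dop \<and> preserves_polynomials P}"
    using preserves_polynomials_dop poly_coeffs_if_preserves by blast
  then show ?thesis by (simp add: weyl_def torus_dops_def dop_ring_def)
qed

lemma has_symbol_carrier: "has_symbol U k P f \<Longrightarrow> P \<in> carrier torus_dops"
  using has_symbol_subset[of U k P f UNIV] by (auto simp: carrier_torus_dops)

lemma torus_dops_simps [simp]:
  "P \<otimes>\<^bsub>torus_dops\<^esub> Q = P \<circ> Q" "\<one>\<^bsub>torus_dops\<^esub> = id" "\<zero>\<^bsub>torus_dops\<^esub> = 0"
  "P \<oplus>\<^bsub>torus_dops\<^esub> Q = P + Q"
  by (auto simp: torus_dops_def dop_ring_def zero_fun_def plus_fun_def)

lemma weyl_simps [simp]: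
  "P \<otimes>\<^bsub>weyl\<^esub> Q = P \<circ> Q" "\<one>\<^bsub>weyl\<^esub> = id" "\<zero>\<^bsub>weyl\<^esub> = 0" "P \<oplus>\<^bsub>weyl\<^esub> Q = P + Q"
  by (auto simp: weyl_def dop_ring_def zero_fun_def plus_fun_def)

lemma torus_dops_additive: "P \<in> carrier torus_dops \<Longrightarrow> P (a + b) = P a + P b"
  using has_symbol_additive by (auto simp: carrier_torus_dops)

lemma torus_dops_common_order:
  assumes "P \<in> carrier torus_dops" "Q \<in> carrier torus_dops"
  obtains k f g where "has_symbol UNIV k P f" "has_symbol UNIV k Q g"
proof -
  obtain k f l g where kl: "has_symbol UNIV k P f" "has_symbol UNIV l Q g"
    using assms by (auto simp: carrier_torus_dops)
  show ?thesis
    using that has_symbol_le[OF kl(1), of "max k l"] has_symbol_le[OF kl(2), of "max k l"] by auto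
qed

lemma torus_dops_closed:
  "0 \<in> carrier torus_dops" "id \<in> carrier torus_dops"
  "P \<in> carrier torus_dops \<Longrightarrow> Q \<in> carrier torus_dops \<Longrightarrow> P + Q \<in> carrier torus_dops"
  "P \<in> carrier torus_dops \<Longrightarrow> Q \<in> carrier torus_dops \<Longrightarrow> P - Q \<in> carrier torus_dops"
  "P \<in> carrier torus_dops \<Longrightarrow> - P \<in> carrier torus_dops"
  "P \<in> carrier torus_dops \<Longrightarrow> Q \<in> carrier torus_dops \<Longrightarrow> P \<circ> Q \<in> carrier torus_dops"
proof -
  show "0 \<in> carrier torus_dops" by (rule has_symbol_carrier[OF has_symbol.zero])
  show "id \<in> carrier torus_dops" by (rule has_symbol_carrier[OF has_symbol_id[of UNIV]]) simp
  show "- P \<in> carrier torus_dops" if "P \<in> carrier torus_dops"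
    using that has_symbol_uminus has_symbol_carrier unfolding carrier_torus_dops by blast
  show "P + Q \<in> carrier torus_dops" if "P \<in> carrier torus_dops" "Q \<in> carrier torus_dops"
    by (rule torus_dops_common_order[OF that]) (auto intro: has_symbol_carrier has_symbol.add)
  show "P - Q \<in> carrier torus_dops" if "P \<in> carrier torus_dops" "Q \<in> carrier torus_dops"
    by (rule torus_dops_common_order[OF that]) (auto intro: has_symbol_carrier has_symbol_diff)
  show "P \<circ> Q \<in> carrier torus_dops" if PQ: "P \<in> carrier torus_dops" "Q \<in> carrier torus_dops"
  proof -
    obtain k f g where "has_symbol UNIV k P f" "has_symbol UNIV k Q g" by (rule torus_dops_common_order[OF PQ])
    then have "has_symbol UNIV (k + k) (P \<circ> Q) (\<lambda>x y. f x y * g x y)"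
      by (rule has_symbol_comp) simp
    then show ?thesis by (rule has_symbol_carrier)
  qed
qed

lemma preserves_polynomials_closed:
  "preserves_polynomials 0" "preserves_polynomials id"
  "preserves_polynomials P \<Longrightarrow> preserves_polynomials Q \<Longrightarrow> preserves_polynomials (P + Q)"
  "preserves_polynomials P \<Longrightarrow> preserves_polynomials Q \<Longrightarrow> preserves_polynomials (P - Q)"
  "preserves_polynomials P \<Longrightarrow> preserves_polynomials (- P)"
  "preserves_polynomials P \<Longrightarrow> preserves_polynomials Q \<Longrightarrow> preserves_polynomials (P \<circ> Q)"
  unfolding preserves_polynomials_def
  by (auto intro!: polynomials_add polynomials_diff polynomials_uminus)

lemma weyl_closed:
  "0 \<in> carrier weyl" "id \<in> carrier weyl"
  "P \<in> carrier weyl \<Longrightarrow> Q \<in> carrier weyl \<Longrightarrow> P + Q \<in> carrier weyl"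
  "P \<in> carrier weyl \<Longrightarrow> Q \<in> carrier weyl \<Longrightarrow> P - Q \<in> carrier weyl"
  "P \<in> carrier weyl \<Longrightarrow> - P \<in> carrier weyl"
  "P \<in> carrier weyl \<Longrightarrow> Q \<in> carrier weyl \<Longrightarrow> P \<circ> Q \<in> carrier weyl"
  by (auto simp only: carrier_weyl mem_Collect_eq intro!: torus_dops_closed preserves_polynomials_closed)

lemma weyl_subset: "P \<in> carrier weyl \<Longrightarrow> P \<in> carrier torus_dops"
  by (simp add: carrier_weyl)

lemma ring_of_additive_maps:
  fixes R :: "('n::finite) dop ring"
  assumes ops: "\<And>P Q. P \<otimes>\<^bsub>R\<^esub> Q = P \<circ> Q" "\<one>\<^bsub>R\<^esub> = id" "\<zero>\<^bsub>R\<^esub> = 0" "\<And>P Q. P \<oplus>\<^bsub>R\<^esub> Q = P + Q"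
    and closed: "0 \<in> carrier R" "id \<in> carrier R"
      "\<And>P Q. P \<in> carrier R \<Longrightarrow> Q \<in> carrier R \<Longrightarrow> P + Q \<in> carrier R"
      "\<And>P Q. P \<in> carrier R \<Longrightarrow> Q \<in> carrier R \<Longrightarrow> P \<circ> Q \<in> carrier R"
      "\<And>P. P \<in> carrier R \<Longrightarrow> - P \<in> carrier R"
    and additive: "\<And>P a b. P \<in> carrier R \<Longrightarrow> P (a + b) = P a + P b"
  shows "ring R"
proof (intro ringI abelian_groupI monoidI)
  fix P Q S assume *: "P \<in> carrier R" "Q \<in> carrier R" "S \<in> carrier R"
  show "(P \<oplus>\<^bsub>R\<^esub> Q) \<otimes>\<^bsub>R\<^esub> S = P \<otimes>\<^bsub>R\<^esub> S \<oplus>\<^bsub>R\<^esub> Q \<otimes>\<^bsub>R\<^esub> S"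
    by (auto simp: ops fun_eq_iff)
  show "S \<otimes>\<^bsub>R\<^esub> (P \<oplus>\<^bsub>R\<^esub> Q) = S \<otimes>\<^bsub>R\<^esub> P \<oplus>\<^bsub>R\<^esub> S \<otimes>\<^bsub>R\<^esub> Q"
    using * by (auto simp: ops fun_eq_iff additive)
next
  fix P assume P: "P \<in> carrier R"
  show "\<exists>Q\<in>carrier R. Q \<oplus>\<^bsub>R\<^esub> P = \<zero>\<^bsub>R\<^esub>"
    using P by (intro bexI[of _ "- P"]) (auto simp: ops closed)
next
  fix P Q assume *: "P \<in> carrier R" "Q \<in> carrier R"
  show "P \<oplus>\<^bsub>R\<^esub> Q = Q \<oplus>\<^bsub>R\<^esub> P" by (simp add: ops add.commute)
  show "P \<oplus>\<^bsub>R\<^esub> Q \<in> carrier R" "P \<otimes>\<^bsub>R\<^esub> Q \<in> carrier R" using * by (simp_all add: ops closed)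
next
  fix P Q S
  show "P \<oplus>\<^bsub>R\<^esub> Q \<oplus>\<^bsub>R\<^esub> S = P \<oplus>\<^bsub>R\<^esub> (Q \<oplus>\<^bsub>R\<^esub> S)" by (simp add: ops add.assoc)
  show "P \<otimes>\<^bsub>R\<^esub> Q \<otimes>\<^bsub>R\<^esub> S = P \<otimes>\<^bsub>R\<^esub> (Q \<otimes>\<^bsub>R\<^esub> S)" by (simp add: ops comp_assoc)
next
  show "\<zero>\<^bsub>R\<^esub> \<in> carrier R" "\<one>\<^bsub>R\<^esub> \<in> carrier R" by (simp_all only: ops closed)
next
  fix P
  show "\<zero>\<^bsub>R\<^esub> \<oplus>\<^bsub>R\<^esub> P = P" by (simp only: ops add_0_left)
  show "\<one>\<^bsub>R\<^esub> \<otimes>\<^bsub>R\<^esub> P = P" "P \<otimes>\<^bsub>R\<^esub> \<one>\<^bsub>R\<^esub> = P" by (simp_all only: ops comp_id id_comp)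
qed

lemma ring_torus_dops: "ring torus_dops"
  by (rule ring_of_additive_maps) (auto intro: torus_dops_closed torus_dops_additive)

lemma ring_weyl: "ring weyl"
  by (rule ring_of_additive_maps) (auto intro: weyl_closed torus_dops_additive weyl_subset)

section \<open>The multiplicative system of powers of \<open>x_1 ... x_n\<close>\<close>

subsection \<open>Clearing denominators\<close>

text \<open>Multiplication by the \<open>k\<close>-th power of \<open>x_1 ... x_n\<close>. Inverting
  this single element turns the Weyl algebra into the operators on the torus, so localization
  arguments become statements about large \<open>k\<close>.\<close>

definition xpow :: "nat \<Rightarrow> ('n::finite) dop" where
  "xpow k = shift_op (vec (int k)) (\<lambda>_. 1)"

definition xinv :: "nat \<Rightarrow> ('n::finite) dop" where
  "xinv k = shift_op (- vec (int k)) (\<lambda>_. 1)"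

lemma xpow_add: "xpow (j + k) = xpow j \<circ> xpow k"
  by (simp add: xpow_def shift_op_comp vec_add)

lemma xinv_xpow: "xinv k \<circ> xpow k = id"
  by (simp add: xinv_def xpow_def shift_op_comp shift_op_one)

lemma xpow_symbol: "has_symbol UNIV 0 (xpow k) (\<lambda>x y. tpow x (vec (int k)))"
  using has_symbol_shift_one[of "vec (int k)" UNIV 1] by (simp add: xpow_def)

lemma xinv_symbol: "has_symbol UNIV 0 (xinv k) (\<lambda>x y. tpow x (- vec (int k)))"
  using has_symbol_shift_one[of "- vec (int k)" UNIV 1] by (simp add: xinv_def)

lemma xpow_torus: "xpow k \<in> carrier torus_dops" and xinv_torus: "xinv k \<in> carrier torus_dops"
  using xpow_symbol xinv_symbol has_symbol_carrier by blast+

lemma preserves_xpow: "preserves_polynomials (xpow k)"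
  unfolding preserves_polynomials_def xpow_def
proof safe
  fix g :: "'a laurent" assume "g \<in> polynomials"
  then show "shift_op (vec (int k)) (\<lambda>_. 1) g \<in> polynomials"
    unfolding shift_op_def by (intro polynomials_sum polynomials_single) (auto simp: polynomials_def)
qed

lemma xpow_weyl: "xpow k \<in> carrier weyl"
  by (simp add: carrier_weyl xpow_torus preserves_xpow)

text \<open>A shift by \<open>u\<close> is compensated once \<open>k\<close> is at least every
  \<open>|u_i|\<close>. The claim is made for all large \<open>k\<close> so that finitely many
  operators can be treated with the same power.\<close>

lemma clear_denominators:
  assumes "P \<in> carrier torus_dops"
  shows "eventually (\<lambda>k. preserves_polynomials (xpow k \<circ> P)) sequentially"
proof -
  obtain k f where "has_symbol UNIV k P f" using assms by (auto simp: carrier_torus_dops)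
  then have "\<exists>N. \<forall>k\<ge>N. preserves_polynomials (xpow k \<circ> P)"
  proof (induction rule: has_symbol.induct)
    case zero
    have "preserves_polynomials (xpow k \<circ> 0)" for k
      by (auto simp: preserves_polynomials_def xpow_def)
    then show ?case by blast
  next
    case (shift u p h)
    define N where "N = nat (Max (range (\<lambda>i. \<bar>u $ i\<bar>)))"
    have N: "\<bar>u $ i\<bar> \<le> int N" for i
    proof -
      have "\<bar>u $ i\<bar> \<le> Max (range (\<lambda>i. \<bar>u $ i\<bar>))" by (rule Max_ge) auto
      then show ?thesis unfolding N_def by linarith
    qed
    have "preserves_polynomials (xpow k \<circ> shift_op u p)" if "k \<ge> N" for k
      unfolding xpow_def shift_op_comp preserves_polynomials_def
    proof safe
      fix g :: "'a laurent" assume "g \<in> polynomials"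
      then have "0 \<le> w $ i + (int k + u $ i)" if "w \<in> Poly_Mapping.keys g" for w i
        using N[of i] \<open>k \<ge> N\<close> that by (force simp: polynomials_def)
      then show "shift_op (vec (int k) + u) (\<lambda>w. 1 * p w) g \<in> polynomials"
        unfolding shift_op_def by (intro polynomials_sum polynomials_single) auto
    qed
    then show ?case by blast
  next
    case (add P f Q g)
    then obtain M N where "\<forall>k\<ge>M. preserves_polynomials (xpow k \<circ> P)"
      "\<forall>k\<ge>N. preserves_polynomials (xpow k \<circ> Q)" by blast
    moreover have "xpow k \<circ> (P + Q) = (xpow k \<circ> P) + (xpow k \<circ> Q)" for k
      unfolding xpow_def by (rule shift_comp_plus)
    ultimately have "preserves_polynomials (xpow k \<circ> (P + Q))" if "k \<ge> max M N" for k
      using that by (auto intro: preserves_polynomials_closed(3))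
    then show ?case by blast
  qed auto
  then show ?thesis by (simp add: eventually_sequentially)
qed

section \<open>Modules over either ring of operators and the filtrations generated by a set\<close>

section \<open>Filtered modules over rings of differential operators\<close>

definition span_of :: "('r, 'v, 'x) module_scheme \<Rightarrow> 'r set \<Rightarrow> 'v set \<Rightarrow> 'v set" where
  "span_of M Os S = generate (add_monoid M) {P \<odot>\<^bsub>M\<^esub> s | P s. P \<in> Os \<and> s \<in> S}"

text \<open>Common ground of the Weyl algebra and the operators on the torus: both have composition
  as product and the pointwise sum as addition, so one development of spans serves both.\<close>

locale dop_module = left_module R M
  for R :: "('n::finite) dop ring" (structure) and M :: "('n dop, 'v) module" (structure) +
  assumes R_mult: "P \<otimes>\<^bsub>R\<^esub> Q = P \<circ> Q" and R_one: "\<one>\<^bsub>R\<^esub> = id" and R_zero: "\<zero>\<^bsub>R\<^esub> = 0"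
    and R_add: "P \<oplus>\<^bsub>R\<^esub> Q = P + Q" and R_uminus: "P \<in> carrier R \<Longrightarrow> - P \<in> carrier R"
begin

lemma R_closed:
  "P \<in> carrier R \<Longrightarrow> Q \<in> carrier R \<Longrightarrow> P + Q \<in> carrier R"
  "P \<in> carrier R \<Longrightarrow> Q \<in> carrier R \<Longrightarrow> P \<circ> Q \<in> carrier R"
  "0 \<in> carrier R" "id \<in> carrier R"
  using R.add.m_closed R.m_closed R.zero_closed R.one_closed by (simp_all only: R_mult R_one R_zero R_add)

lemma R_diff: "P \<in> carrier R \<Longrightarrow> Q \<in> carrier R \<Longrightarrow> P - Q \<in> carrier R"
  using R_closed(1)[OF _ R_uminus] by simp

lemma act_add: "P \<in> carrier R \<Longrightarrow> Q \<in> carrier R \<Longrightarrow> x \<in> carrier M \<Longrightarrow>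
    (P + Q) \<odot>\<^bsub>M\<^esub> x = P \<odot>\<^bsub>M\<^esub> x \<oplus>\<^bsub>M\<^esub> Q \<odot>\<^bsub>M\<^esub> x"
  using smult_l_distr by (simp only: R_add)

lemma act_comp: "P \<in> carrier R \<Longrightarrow> Q \<in> carrier R \<Longrightarrow> x \<in> carrier M \<Longrightarrow>
    (P \<circ> Q) \<odot>\<^bsub>M\<^esub> x = P \<odot>\<^bsub>M\<^esub> (Q \<odot>\<^bsub>M\<^esub> x)"
  using smult_assoc by (simp only: R_mult)

lemma act_id: "x \<in> carrier M \<Longrightarrow> id \<odot>\<^bsub>M\<^esub> x = x"
  using smult_one by (simp only: R_one)

lemma act_zero: assumes "x \<in> carrier M" shows "0 \<odot>\<^bsub>M\<^esub> x = \<zero>\<^bsub>M\<^esub>"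
proof -
  have "(0 + 0) \<odot>\<^bsub>M\<^esub> x = 0 \<odot>\<^bsub>M\<^esub> x \<oplus>\<^bsub>M\<^esub> 0 \<odot>\<^bsub>M\<^esub> x"
    using R_closed(3) assms by (intro act_add)
  then show ?thesis using smult_closed[OF R_closed(3) assms] by simp
qed

lemma act_zero_right: assumes "P \<in> carrier R" shows "P \<odot>\<^bsub>M\<^esub> \<zero>\<^bsub>M\<^esub> = \<zero>\<^bsub>M\<^esub>"
proof -
  have "P \<odot>\<^bsub>M\<^esub> (\<zero>\<^bsub>M\<^esub> \<oplus>\<^bsub>M\<^esub> \<zero>\<^bsub>M\<^esub>) = P \<odot>\<^bsub>M\<^esub> \<zero>\<^bsub>M\<^esub> \<oplus>\<^bsub>M\<^esub> P \<odot>\<^bsub>M\<^esub> \<zero>\<^bsub>M\<^esub>"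
    using assms by (intro smult_r_distr) auto
  then show ?thesis using smult_closed[OF assms M.zero_closed] by simp
qed

lemma act_uminus:
  assumes "P \<in> carrier R" "x \<in> carrier M" shows "(- P) \<odot>\<^bsub>M\<^esub> x = \<ominus>\<^bsub>M\<^esub> (P \<odot>\<^bsub>M\<^esub> x)"
proof -
  have "(- P + P) \<odot>\<^bsub>M\<^esub> x = (- P) \<odot>\<^bsub>M\<^esub> x \<oplus>\<^bsub>M\<^esub> P \<odot>\<^bsub>M\<^esub> x"
    using assms R_uminus by (intro act_add)
  then have "(- P) \<odot>\<^bsub>M\<^esub> x \<oplus>\<^bsub>M\<^esub> P \<odot>\<^bsub>M\<^esub> x = \<zero>\<^bsub>M\<^esub>" using act_zero[OF assms(2)] by simp
  then show ?thesis using assms R_uminus smult_closed by (metis M.minus_equality)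
qed

lemma act_minus_right:
  assumes "P \<in> carrier R" "x \<in> carrier M" shows "P \<odot>\<^bsub>M\<^esub> (\<ominus>\<^bsub>M\<^esub> x) = \<ominus>\<^bsub>M\<^esub> (P \<odot>\<^bsub>M\<^esub> x)"
proof -
  have "P \<odot>\<^bsub>M\<^esub> (\<ominus>\<^bsub>M\<^esub> x \<oplus>\<^bsub>M\<^esub> x) = P \<odot>\<^bsub>M\<^esub> (\<ominus>\<^bsub>M\<^esub> x) \<oplus>\<^bsub>M\<^esub> P \<odot>\<^bsub>M\<^esub> x"
    using assms by (intro smult_r_distr) auto
  then have "P \<odot>\<^bsub>M\<^esub> (\<ominus>\<^bsub>M\<^esub> x) \<oplus>\<^bsub>M\<^esub> P \<odot>\<^bsub>M\<^esub> x = \<zero>\<^bsub>M\<^esub>"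
    using assms act_zero_right by (simp add: M.l_neg)
  then show ?thesis using assms smult_closed by (metis M.a_inv_closed M.minus_equality)
qed

lemma act_diff: "P \<in> carrier R \<Longrightarrow> Q \<in> carrier R \<Longrightarrow> x \<in> carrier M \<Longrightarrow>
    (P - Q) \<odot>\<^bsub>M\<^esub> x = P \<odot>\<^bsub>M\<^esub> x \<ominus>\<^bsub>M\<^esub> Q \<odot>\<^bsub>M\<^esub> x"
  using act_add[of P "- Q" x] R_uminus[of Q] by (simp add: act_uminus M.minus_eq)

lemma minus_eq_zeroD:
  assumes "a \<ominus>\<^bsub>M\<^esub> b = \<zero>\<^bsub>M\<^esub>" "a \<in> carrier M" "b \<in> carrier M" shows "a = b"
proof -
  have "a = (a \<ominus>\<^bsub>M\<^esub> b) \<oplus>\<^bsub>M\<^esub> b" using assms(2,3) by (simp add: M.minus_eq M.a_assoc M.l_neg)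
  then show ?thesis using assms by simp
qed

lemma span_gen_subset: "Os \<subseteq> carrier R \<Longrightarrow> S \<subseteq> carrier M \<Longrightarrow> {P \<odot>\<^bsub>M\<^esub> s | P s. P \<in> Os \<and> s \<in> S} \<subseteq> carrier M"
  using smult_closed by blast

lemma span_subgroup: "Os \<subseteq> carrier R \<Longrightarrow> S \<subseteq> carrier M \<Longrightarrow> subgroup (span_of M Os S) (add_monoid M)"
  unfolding span_of_def by (rule M.add.generate_is_subgroup) (use span_gen_subset in auto)

lemma span_closed: "Os \<subseteq> carrier R \<Longrightarrow> S \<subseteq> carrier M \<Longrightarrow> x \<in> span_of M Os S \<Longrightarrow> x \<in> carrier M"
  using subgroup.subset[OF span_subgroup, of Os S] by auto

lemma span_zero: "\<zero>\<^bsub>M\<^esub> \<in> span_of M Os S"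
  unfolding span_of_def using generate.one[of "add_monoid M"] by simp

lemma span_incl: "P \<in> Os \<Longrightarrow> s \<in> S \<Longrightarrow> P \<odot>\<^bsub>M\<^esub> s \<in> span_of M Os S"
  unfolding span_of_def by (rule generate.incl) auto

lemma span_add: "x \<in> span_of M Os S \<Longrightarrow> y \<in> span_of M Os S \<Longrightarrow> x \<oplus>\<^bsub>M\<^esub> y \<in> span_of M Os S"
  unfolding span_of_def using generate.eng[of x "add_monoid M" _ y] by simp

lemma span_uminus: "Os \<subseteq> carrier R \<Longrightarrow> S \<subseteq> carrier M \<Longrightarrow> x \<in> span_of M Os S \<Longrightarrow> \<ominus>\<^bsub>M\<^esub> x \<in> span_of M Os S"
  using subgroup.m_inv_closed[OF span_subgroup, of Os S x] by (simp add: a_inv_def)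

lemma span_minus: "Os \<subseteq> carrier R \<Longrightarrow> S \<subseteq> carrier M \<Longrightarrow> x \<in> span_of M Os S \<Longrightarrow> y \<in> span_of M Os S
    \<Longrightarrow> x \<ominus>\<^bsub>M\<^esub> y \<in> span_of M Os S"
  using span_add span_uminus by (simp add: M.minus_eq)

text \<open>No case for inverses is left, because the inverse of a generator \<open>P s\<close> is
  the generator \<open>(- P) s\<close>.\<close>

lemma span_induct [consumes 1, case_names Os S uminus zero gen add]:
  assumes "x \<in> span_of M Os S" and sub: "Os \<subseteq> carrier R" "S \<subseteq> carrier M"
    and uminus: "\<And>P. P \<in> Os \<Longrightarrow> - P \<in> Os"
    and zero: "Q \<zero>\<^bsub>M\<^esub>"
    and gen: "\<And>P s. P \<in> Os \<Longrightarrow> s \<in> S \<Longrightarrow> Q (P \<odot>\<^bsub>M\<^esub> s)"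
    and add: "\<And>x y. x \<in> span_of M Os S \<Longrightarrow> y \<in> span_of M Os S \<Longrightarrow> Q x \<Longrightarrow> Q y \<Longrightarrow> Q (x \<oplus>\<^bsub>M\<^esub> y)"
  shows "Q x"
  using assms(1) unfolding span_of_def
proof (induction rule: generate.induct)
  case one
  then show ?case using zero by simp
next
  case (incl h)
  then show ?case using gen by blast
next
  case (inv h)
  then obtain P s where h: "h = P \<odot>\<^bsub>M\<^esub> s" "P \<in> Os" "s \<in> S" by blast
  then have "P \<in> carrier R" "s \<in> carrier M" using sub by blast+
  then have "inv\<^bsub>add_monoid M\<^esub> h = (- P) \<odot>\<^bsub>M\<^esub> s"
    using act_uminus[of P s] h by (simp add: a_inv_def)
  then show ?case using gen[OF uminus] h by simp
next
  case (eng x y)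
  then show ?case using add unfolding span_of_def by simp
qed

lemma span_mono:
  assumes "x \<in> span_of M Os S" "Os \<subseteq> carrier R" "S \<subseteq> carrier M" "\<And>P. P \<in> Os \<Longrightarrow> - P \<in> Os" "Os \<subseteq> Os'"
  shows "x \<in> span_of M Os' S"
  using assms(1)
proof (induction rule: span_induct)
  case zero
  show ?case by (rule span_zero)
next
  case (gen P s)
  then show ?case using assms(5) by (intro span_incl) auto
next
  case (add x y)
  show ?case using add.IH by (intro span_add)
qed (use assms(2-4) in auto)

end

text \<open>\<open>F_comm\<close> expresses that the associated graded ring is commutative, which is
  what makes its support a set of points in the cotangent bundle.\<close>

locale filtered_dop_module = dop_module R M
  for R :: "('n::finite) dop ring" (structure) and M :: "('n dop, 'v) module" (structure) +
  fixes F :: "int \<Rightarrow> 'n dop set"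
  assumes F_sub: "F k \<subseteq> carrier R" and F_zero: "0 \<in> F k" and F_id: "id \<in> F 0"
    and F_add: "P \<in> F k \<Longrightarrow> Q \<in> F k \<Longrightarrow> P + Q \<in> F k" and F_uminus: "P \<in> F k \<Longrightarrow> - P \<in> F k"
    and F_comp: "P \<in> F k \<Longrightarrow> Q \<in> F l \<Longrightarrow> P \<circ> Q \<in> F (k + l)"
    and F_comm: "P \<in> F k \<Longrightarrow> Q \<in> F l \<Longrightarrow> (P \<circ> Q) - (Q \<circ> P) \<in> F (k + l - 1)"
    and F_mono: "P \<in> F k \<Longrightarrow> k \<le> l \<Longrightarrow> P \<in> F l"
begin

abbreviation "filt S k \<equiv> span_of M (F k) S"

lemma F_closed: "P \<in> F k \<Longrightarrow> P \<in> carrier R"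
  using F_sub by blast

lemma filt_mono: "S \<subseteq> carrier M \<Longrightarrow> x \<in> filt S k \<Longrightarrow> k \<le> l \<Longrightarrow> x \<in> filt S l"
  by (rule span_mono) (auto intro: F_closed F_uminus F_mono)

lemma filt_closed: "S \<subseteq> carrier M \<Longrightarrow> x \<in> filt S k \<Longrightarrow> x \<in> carrier M"
  using span_closed F_sub by blast

lemma filt_gen: "S \<subseteq> carrier M \<Longrightarrow> s \<in> S \<Longrightarrow> s \<in> filt S 0"
  using span_incl[OF F_id, of s S] act_id by auto

lemma filt_act:
  assumes S: "S \<subseteq> carrier M" and P: "P \<in> F k"
  assumes "u \<in> filt S l"
  shows "P \<odot>\<^bsub>M\<^esub> u \<in> filt S (k + l)"
  using assms(3)
proof (induction rule: span_induct)
  case zero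
  then show ?case using span_zero act_zero_right F_closed[OF P] by simp
next
  case (gen Q s)
  have "P \<odot>\<^bsub>M\<^esub> (Q \<odot>\<^bsub>M\<^esub> s) = (P \<circ> Q) \<odot>\<^bsub>M\<^esub> s"
    using gen S P F_closed by (intro act_comp[symmetric]) auto
  then show ?case using gen F_comp[OF P] by (auto intro: span_incl)
next
  case (add x y)
  then show ?case
    using F_closed[OF P] filt_closed[OF S] by (auto simp: smult_r_distr intro!: span_add)
qed (use S F_sub F_uminus in auto)

text \<open>As commutators drop the order by one, annihilating the generators of \<open>gr\<close> is enough.\<close>

lemma filt_lower:
  assumes S: "S \<subseteq> carrier M" and P: "P \<in> F k" "\<And>s. s \<in> S \<Longrightarrow> P \<odot>\<^bsub>M\<^esub> s \<in> filt S (k - 1)"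
  assumes "u \<in> filt S l"
  shows "P \<odot>\<^bsub>M\<^esub> u \<in> filt S (l + k - 1)"
  using assms(4)
proof (induction rule: span_induct)
  case zero
  then show ?case using span_zero act_zero_right F_closed[OF P(1)] by simp
next
  case (gen Q s)
  have s: "s \<in> carrier M" using gen S by blast
  have c: "P \<in> carrier R" "Q \<in> carrier R" "(P \<circ> Q) - (Q \<circ> P) \<in> carrier R"
    using F_closed P gen by (auto intro!: R_diff R_closed)
  have "P \<odot>\<^bsub>M\<^esub> (Q \<odot>\<^bsub>M\<^esub> s) = (((P \<circ> Q) - (Q \<circ> P)) + (Q \<circ> P)) \<odot>\<^bsub>M\<^esub> s"
    using c s by (simp add: act_comp)
  also have "\<dots> = ((P \<circ> Q) - (Q \<circ> P)) \<odot>\<^bsub>M\<^esub> s \<oplus>\<^bsub>M\<^esub> Q \<odot>\<^bsub>M\<^esub> (P \<odot>\<^bsub>M\<^esub> s)"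
    using c s R_closed by (subst act_add) (auto simp: act_comp)
  also have "\<dots> \<in> filt S (l + k - 1)"
  proof (rule span_add)
    show "((P \<circ> Q) - (Q \<circ> P)) \<odot>\<^bsub>M\<^esub> s \<in> filt S (l + k - 1)"
      using F_comm[OF P(1) gen(1)] gen(2) by (intro span_incl) (auto simp: add.commute)
    show "Q \<odot>\<^bsub>M\<^esub> (P \<odot>\<^bsub>M\<^esub> s) \<in> filt S (l + k - 1)"
      using filt_act[OF S gen(1) P(2)[OF gen(2)]] by (simp add: algebra_simps)
  qed
  finally show ?case .
next
  case (add x y)
  then show ?case
    using F_closed[OF P(1)] filt_closed[OF S] by (auto simp: smult_r_distr intro!: span_add)
qed (use S F_sub F_uminus in auto)

end

definition torus_filt :: "int \<Rightarrow> ('n::finite) dop set" where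
  "torus_filt k = {P. \<exists>f. has_symbol UNIV k P f}"

definition weyl_filt :: "int \<Rightarrow> ('n::finite) dop set" where
  "weyl_filt k = dop ` order_filt k"

lemma weyl_filt_eq: "weyl_filt k = {P. P \<in> torus_filt k \<and> preserves_polynomials P}"
  by (simp add: weyl_filt_def torus_filt_def dop_order_filt)

lemma torus_filt_closed:
  "torus_filt k \<subseteq> carrier torus_dops" "0 \<in> torus_filt k" "id \<in> torus_filt 0"
  "P \<in> torus_filt k \<Longrightarrow> Q \<in> torus_filt k \<Longrightarrow> P + Q \<in> torus_filt k"
  "P \<in> torus_filt k \<Longrightarrow> - P \<in> torus_filt k"
  "P \<in> torus_filt k \<Longrightarrow> Q \<in> torus_filt l \<Longrightarrow> P \<circ> Q \<in> torus_filt (k + l)"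
  "P \<in> torus_filt k \<Longrightarrow> Q \<in> torus_filt l \<Longrightarrow> (P \<circ> Q) - (Q \<circ> P) \<in> torus_filt (k + l - 1)"
  "P \<in> torus_filt k \<Longrightarrow> k \<le> l \<Longrightarrow> P \<in> torus_filt l"
proof -
  show "torus_filt k \<subseteq> carrier torus_dops"
    using has_symbol_carrier by (auto simp: torus_filt_def)
  show "0 \<in> torus_filt k" unfolding torus_filt_def using has_symbol.zero by blast
  show "id \<in> torus_filt 0" unfolding torus_filt_def using has_symbol_id[of UNIV] by blast
  show "P \<in> torus_filt k \<Longrightarrow> Q \<in> torus_filt k \<Longrightarrow> P + Q \<in> torus_filt k"
    unfolding torus_filt_def using has_symbol.add by blast
  show "P \<in> torus_filt k \<Longrightarrow> - P \<in> torus_filt k"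
    unfolding torus_filt_def using has_symbol_uminus by blast
  show "P \<circ> Q \<in> torus_filt (k + l)" if PQ: "P \<in> torus_filt k" "Q \<in> torus_filt l"
  proof -
    obtain f g where "has_symbol UNIV k P f" "has_symbol UNIV l Q g" using PQ by (auto simp: torus_filt_def)
    then have "has_symbol UNIV (k + l) (P \<circ> Q) (\<lambda>x y. f x y * g x y)" by (rule has_symbol_comp) simp
    then show ?thesis by (auto simp: torus_filt_def)
  qed
  show "P \<in> torus_filt k \<Longrightarrow> Q \<in> torus_filt l \<Longrightarrow> (P \<circ> Q) - (Q \<circ> P) \<in> torus_filt (k + l - 1)"
    unfolding torus_filt_def using has_symbol_comm by blast
  show "P \<in> torus_filt k \<Longrightarrow> k \<le> l \<Longrightarrow> P \<in> torus_filt l"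
    unfolding torus_filt_def using has_symbol_le by blast
qed

lemma filtered_dop_moduleI_torus:
  "left_module torus_dops N \<Longrightarrow> filtered_dop_module torus_dops N torus_filt"
  by (intro filtered_dop_module.intro dop_module.intro dop_module_axioms.intro filtered_dop_module_axioms.intro)
    (auto intro: torus_dops_closed torus_filt_closed torus_filt_closed(1)[THEN subsetD])

lemma filtered_dop_moduleI_weyl:
  "left_module weyl M \<Longrightarrow> filtered_dop_module weyl M weyl_filt"
  by (intro filtered_dop_module.intro dop_module.intro dop_module_axioms.intro filtered_dop_module_axioms.intro)
    (auto simp: weyl_filt_eq carrier_weyl intro: torus_dops_closed torus_filt_closed
      preserves_polynomials_closed torus_filt_closed(1)[THEN subsetD])

lemma gen_filt_eq: "gen_filt M S k = span_of M (weyl_filt k) S"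
  unfolding gen_filt_def span_of_def weyl_filt_def
  by (rule arg_cong[where f = "generate (add_monoid M)"]) blast

text \<open>The zero set of the annihilator of \<open>gr\<close> over the cotangent bundle of the torus, in the
  coordinates \<open>(x, y)\<close>.\<close>

definition log_support :: "(('n::finite) dop, 'v) module \<Rightarrow> 'v set \<Rightarrow> ((complex ^ 'n) \<times> (complex ^ 'n)) set" where
  "log_support N S = {(x, y). x \<in> torus \<and> (\<forall>k P f. has_symbol UNIV k P f \<longrightarrow>
     (\<forall>s\<in>S. P \<odot>\<^bsub>N\<^esub> s \<in> span_of N (torus_filt (k - 1)) S) \<longrightarrow> f x y = 0)}"

text \<open>\<open>N\<close> is \<open>M\<close> with \<open>x_1 ... x_n\<close> inverted, stated
  elementwise: the kernel of \<open>\<iota>\<close> is torsion and every element of \<open>N\<close>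
  is a fraction. The map \<open>u \<mapsto> 1 \<otimes> u\<close> and the identity on a direct image
  are the two cases to come.\<close>

locale dop_localization =
  W: filtered_dop_module weyl M weyl_filt + X: filtered_dop_module torus_dops N torus_filt
  for M :: "(('n::finite) dop, 'v) module" and N :: "('n dop, 'w) module" +
  fixes \<iota> :: "'v \<Rightarrow> 'w"
  assumes \<iota>_closed: "m \<in> carrier M \<Longrightarrow> \<iota> m \<in> carrier N"
    and \<iota>_add: "m \<in> carrier M \<Longrightarrow> m' \<in> carrier M \<Longrightarrow> \<iota> (m \<oplus>\<^bsub>M\<^esub> m') = \<iota> m \<oplus>\<^bsub>N\<^esub> \<iota> m'"
    and \<iota>_act: "P \<in> carrier weyl \<Longrightarrow> m \<in> carrier M \<Longrightarrow> \<iota> (P \<odot>\<^bsub>M\<^esub> m) = P \<odot>\<^bsub>N\<^esub> \<iota> m"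
    and \<iota>_kernel: "m \<in> carrier M \<Longrightarrow> \<iota> m = \<zero>\<^bsub>N\<^esub> \<Longrightarrow>
      eventually (\<lambda>k. xpow k \<odot>\<^bsub>M\<^esub> m = \<zero>\<^bsub>M\<^esub>) sequentially"
    and \<iota>_surj: "n \<in> carrier N \<Longrightarrow> eventually (\<lambda>k. xpow k \<odot>\<^bsub>N\<^esub> n \<in> \<iota> ` carrier M) sequentially"
begin

lemma \<iota>_zero: "\<iota> \<zero>\<^bsub>M\<^esub> = \<zero>\<^bsub>N\<^esub>"
  using \<iota>_act[OF weyl_closed(1) W.M.zero_closed] \<iota>_closed[OF W.M.zero_closed]
  by (simp add: W.act_zero X.act_zero)

lemma \<iota>_uminus: assumes "m \<in> carrier M" shows "\<iota> (\<ominus>\<^bsub>M\<^esub> m) = \<ominus>\<^bsub>N\<^esub> \<iota> m"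
  using \<iota>_act[OF weyl_closed(5)[OF weyl_closed(2)] assms] \<iota>_closed[OF assms] assms
  by (simp add: W.act_uminus W.R_closed W.act_id X.act_uminus X.R_closed X.act_id)

lemma \<iota>_filt:
  assumes S: "S \<subseteq> carrier M" and "u \<in> W.filt S l"
  shows "\<iota> u \<in> X.filt (\<iota> ` S) l"
  using assms(2)
proof (induction rule: W.span_induct)
  case zero
  then show ?case by (simp add: \<iota>_zero X.span_zero)
next
  case (gen P s)
  then show ?case
    using \<iota>_act[OF W.F_closed] S X.span_incl[of P "torus_filt l" "\<iota> s" "\<iota> ` S"]
    by (auto simp: weyl_filt_eq subset_eq)
next
  case (add x y)
  then show ?case using W.filt_closed[OF S] by (auto simp: \<iota>_add intro: X.span_add)
qed (use S W.F_sub W.F_uminus in auto)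

text \<open>Clearing denominators costs no order: \<open>xpow j\<close> has order 0, so an operator
  of order \<open>l\<close> becomes a Weyl operator of order \<open>l\<close>.\<close>

lemma filt_lift:
  assumes S: "S \<subseteq> carrier M" and "u \<in> X.filt (\<iota> ` S) l"
  shows "eventually (\<lambda>j. \<exists>m\<in>W.filt S l. xpow j \<odot>\<^bsub>N\<^esub> u = \<iota> m) sequentially"
  using assms(2)
proof (induction rule: X.span_induct)
  case zero
  then show ?case using W.span_zero X.act_zero_right[OF xpow_torus] \<iota>_zero
    by (intro always_eventually) (metis)
next
  case (gen P t)
  then obtain s where s: "s \<in> S" "t = \<iota> s" by blast
  have P: "P \<in> carrier torus_dops" using X.F_closed gen by blast
  show ?case
    using clear_denominators[OF P]
  proof (eventually_elim)
    case (elim j)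
    have "xpow j \<circ> P \<in> torus_filt (0 + l)"
      using gen(1) xpow_symbol by (intro torus_filt_closed(6)) (auto simp: torus_filt_def)
    then have Q: "xpow j \<circ> P \<in> weyl_filt l" using elim by (simp add: weyl_filt_eq)
    have "\<iota> ((xpow j \<circ> P) \<odot>\<^bsub>M\<^esub> s) = (xpow j \<circ> P) \<odot>\<^bsub>N\<^esub> \<iota> s"
      using \<iota>_act[OF W.F_closed[OF Q]] s S by auto
    also have "\<dots> = xpow j \<odot>\<^bsub>N\<^esub> (P \<odot>\<^bsub>N\<^esub> \<iota> s)"
      using s S \<iota>_closed P xpow_torus by (intro X.act_comp) auto
    finally show ?case using W.span_incl[OF Q s(1)] s by metis
  qed
next
  case (add x y)
  have xy: "x \<in> carrier N" "y \<in> carrier N"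
    using add X.filt_closed[of "\<iota> ` S"] S \<iota>_closed by blast+
  from add.IH show ?case
  proof (eventually_elim)
    case (elim j)
    then obtain m m' where m: "m \<in> W.filt S l" "m' \<in> W.filt S l"
      "xpow j \<odot>\<^bsub>N\<^esub> x = \<iota> m" "xpow j \<odot>\<^bsub>N\<^esub> y = \<iota> m'" by blast
    then have "xpow j \<odot>\<^bsub>N\<^esub> (x \<oplus>\<^bsub>N\<^esub> y) = \<iota> (m \<oplus>\<^bsub>M\<^esub> m')"
      using xy W.filt_closed[OF S] by (simp add: X.smult_r_distr xpow_torus \<iota>_add)
    then show ?case using m W.span_add by blast
  qed
qed (use S X.F_sub X.F_uminus \<iota>_closed in auto)

lemma xpow_filt: "xpow j \<in> weyl_filt 0"
  using xpow_symbol preserves_xpow by (auto simp: weyl_filt_eq torus_filt_def)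

text \<open>Over the torus the symbol of \<open>xpow n\<close> does not vanish, so \<open>P\<close>
  and its cleared multiple \<open>xpow n \<circ> P\<close> impose the same equation. In this way
  operators on the torus that lower the filtration are traded for operators in the Weyl
  algebra.\<close>

lemma gr_support_iff:
  assumes S: "finite S" "S \<subseteq> carrier M" and p: "p \<in> cot_torus"
  shows "p \<in> gr_support M S \<longleftrightarrow> (cot_base p, log_fibre p) \<in> log_support N (\<iota> ` S)"
proof
  assume p': "p \<in> gr_support M S"
  have x: "cot_base p \<in> torus" using p by (simp add: cot_torus_def)
  show "(cot_base p, log_fibre p) \<in> log_support N (\<iota> ` S)"
    unfolding log_support_def
  proof (intro CollectI case_prodI conjI allI impI x)
    fix k P f assume P: "has_symbol UNIV k P f" "\<forall>t\<in>\<iota> ` S. P \<odot>\<^bsub>N\<^esub> t \<in> X.filt (\<iota> ` S) (k - 1)"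
    have PR: "P \<in> carrier torus_dops" using P(1) by (rule has_symbol_carrier)
    \<comment> \<open>In \<open>N\<close> the element \<open>P s\<close> lies one step lower. In
      \<open>M\<close> this holds for \<open>xpow n \<circ> P\<close> once torsion is removed too;
      having it for all large \<open>n\<close> lets one \<open>n\<close> serve all of
      \<open>S\<close>.\<close>
    have "eventually (\<lambda>n. (xpow n \<circ> P) \<odot>\<^bsub>M\<^esub> s \<in> W.filt S (k - 1)) sequentially" if s: "s \<in> S" for s
    proof -
      have "eventually (\<lambda>j. (\<exists>m\<in>W.filt S (k - 1). xpow j \<odot>\<^bsub>N\<^esub> (P \<odot>\<^bsub>N\<^esub> \<iota> s) = \<iota> m) \<and>
          preserves_polynomials (xpow j \<circ> P)) sequentially"
        using filt_lift[OF S(2)] P(2) s clear_denominators[OF PR] by (intro eventually_conj) auto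
      then obtain j m where j: "m \<in> W.filt S (k - 1)" "xpow j \<odot>\<^bsub>N\<^esub> (P \<odot>\<^bsub>N\<^esub> \<iota> s) = \<iota> m"
        "preserves_polynomials (xpow j \<circ> P)"
        by (auto simp: eventually_sequentially)
      have xP: "xpow j \<circ> P \<in> carrier weyl"
        using j(3) PR xpow_torus by (auto simp: carrier_weyl intro!: torus_dops_closed(6))
      have sM: "s \<in> carrier M" "m \<in> carrier M" using s S j W.filt_closed by blast+
      have a: "(xpow j \<circ> P) \<odot>\<^bsub>M\<^esub> s \<in> carrier M" using xP sM by (intro W.smult_closed)
      have "\<iota> ((xpow j \<circ> P) \<odot>\<^bsub>M\<^esub> s) = \<iota> m"
        using j xP sM PR \<iota>_closed by (simp add: \<iota>_act X.act_comp xpow_torus)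
      then have "\<iota> ((xpow j \<circ> P) \<odot>\<^bsub>M\<^esub> s \<ominus>\<^bsub>M\<^esub> m) = \<zero>\<^bsub>N\<^esub>"
        using a sM \<iota>_closed by (simp add: W.M.minus_eq \<iota>_add \<iota>_uminus X.M.r_neg)
      from \<iota>_kernel[OF _ this]
      have "eventually (\<lambda>i. xpow i \<odot>\<^bsub>M\<^esub> ((xpow j \<circ> P) \<odot>\<^bsub>M\<^esub> s \<ominus>\<^bsub>M\<^esub> m) = \<zero>\<^bsub>M\<^esub>) sequentially"
        using a sM by simp
      then obtain I where I: "\<And>i. i \<ge> I \<Longrightarrow> xpow i \<odot>\<^bsub>M\<^esub> ((xpow j \<circ> P) \<odot>\<^bsub>M\<^esub> s \<ominus>\<^bsub>M\<^esub> m) = \<zero>\<^bsub>M\<^esub>"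
        by (auto simp: eventually_sequentially)
      have "(xpow n \<circ> P) \<odot>\<^bsub>M\<^esub> s \<in> W.filt S (k - 1)" if "n \<ge> I + j" for n
      proof -
        \<comment> \<open>\<open>j\<close> powers clear the denominators, the remaining
          \<open>i\<close> kill the torsion of the difference.\<close>
        define i where "i = n - j"
        have n: "n = i + j" "i \<ge> I" using that by (auto simp: i_def)
        have c: "xpow i \<odot>\<^bsub>M\<^esub> ((xpow j \<circ> P) \<odot>\<^bsub>M\<^esub> s) \<in> carrier M" "xpow i \<odot>\<^bsub>M\<^esub> m \<in> carrier M"
          using a sM by (auto intro: W.smult_closed xpow_weyl)
        have "xpow i \<odot>\<^bsub>M\<^esub> ((xpow j \<circ> P) \<odot>\<^bsub>M\<^esub> s) \<ominus>\<^bsub>M\<^esub> xpow i \<odot>\<^bsub>M\<^esub> m = \<zero>\<^bsub>M\<^esub>"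
          using I[OF n(2)] a sM by (simp add: W.M.minus_eq W.smult_r_distr W.act_minus_right xpow_weyl)
        then have "xpow i \<odot>\<^bsub>M\<^esub> ((xpow j \<circ> P) \<odot>\<^bsub>M\<^esub> s) = xpow i \<odot>\<^bsub>M\<^esub> m"
          using c W.minus_eq_zeroD by blast
        moreover have "xpow n \<circ> P = xpow i \<circ> (xpow j \<circ> P)"
          by (simp add: n xpow_add comp_assoc)
        ultimately have "(xpow n \<circ> P) \<odot>\<^bsub>M\<^esub> s = xpow i \<odot>\<^bsub>M\<^esub> m"
          using xP sM by (simp add: W.act_comp xpow_weyl)
        then show ?thesis using W.filt_act[OF S(2) xpow_filt j(1)] by simp
      qed
      then show ?thesis by (auto simp: eventually_sequentially)
    qed
    then have "eventually (\<lambda>n. (\<forall>s\<in>S. (xpow n \<circ> P) \<odot>\<^bsub>M\<^esub> s \<in> W.filt S (k - 1)) \<and>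
        preserves_polynomials (xpow n \<circ> P)) sequentially"
      using S(1) clear_denominators[OF PR] by (intro eventually_conj eventually_ball_finite) auto
    then obtain n where n: "\<And>s. s \<in> S \<Longrightarrow> (xpow n \<circ> P) \<odot>\<^bsub>M\<^esub> s \<in> W.filt S (k - 1)"
      "preserves_polynomials (xpow n \<circ> P)"
      by (auto simp: eventually_sequentially)
    have sym: "has_symbol UNIV (0 + k) (xpow n \<circ> P) (\<lambda>x y. tpow x (vec (int n)) * f x y)"
      using xpow_symbol P(1) by (rule has_symbol_comp) simp
    then have sym: "has_symbol UNIV k (xpow n \<circ> P) (\<lambda>x y. tpow x (vec (int n)) * f x y)" by simp
    obtain c where c: "c \<in> order_filt k" "dop c = xpow n \<circ> P"
      "symb k c p = tpow (cot_base p) (vec (int n)) * f (cot_base p) (log_fibre p)"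
      using has_symbol_order_filt[OF sym n(2)] p by metis
    have "dop c \<odot>\<^bsub>M\<^esub> u \<in> W.filt S (l + k - 1)" if "u \<in> W.filt S l" for l u
    proof (rule W.filt_lower[OF S(2) _ _ that])
      show "dop c \<in> weyl_filt k" using c(1) by (simp add: weyl_filt_def)
      show "dop c \<odot>\<^bsub>M\<^esub> s \<in> W.filt S (k - 1)" if "s \<in> S" for s
        using n(1)[OF that] by (simp only: c(2))
    qed
    then have "symb k c p = 0" using p' c(1) unfolding gr_support_def gen_filt_eq by blast
    then show "f (cot_base p) (log_fibre p) = 0" using c(3) tpow_nonzero[OF x] by simp
  qed
next
  assume p': "(cot_base p, log_fibre p) \<in> log_support N (\<iota> ` S)"
  show "p \<in> gr_support M S"
    unfolding gr_support_def gen_filt_eq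
  proof (intro CollectI allI ballI impI)
    fix k c assume c: "c \<in> order_filt k"
      and low: "\<forall>l. \<forall>u\<in>W.filt S l. dop c \<odot>\<^bsub>M\<^esub> u \<in> W.filt S (l + k - 1)"
    obtain f where f: "has_symbol UNIV k (dop c) f" "preserves_polynomials (dop c)"
      "f (cot_base p) (log_fibre p) = symb k c p"
      using order_filtE[OF c] p by metis
    have "dop c \<odot>\<^bsub>N\<^esub> \<iota> s \<in> X.filt (\<iota> ` S) (k - 1)" if s: "s \<in> S" for s
    proof -
      have "dop c \<odot>\<^bsub>M\<^esub> s \<in> W.filt S (0 + k - 1)" using low W.filt_gen[OF S(2) s] by blast
      then have "\<iota> (dop c \<odot>\<^bsub>M\<^esub> s) \<in> X.filt (\<iota> ` S) (k - 1)" using \<iota>_filt[OF S(2)] by simp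
      moreover have "dop c \<in> carrier weyl" using c W.F_closed by (auto simp: weyl_filt_def)
      ultimately show ?thesis using \<iota>_act s S by auto
    qed
    then have "f (cot_base p) (log_fibre p) = 0" using p' f(1) unfolding log_support_def by blast
    then show "symb k c p = 0" using f(3) by simp
  qed
qed

text \<open>Elements of \<open>N\<close> enter the image of \<open>M\<close> only after
  multiplication by some \<open>xpow j\<close>. If \<open>P\<close> lowers the filtration of the
  multiplied set, then \<open>P \<circ> xpow j\<close> lowers that of \<open>S\<close>, and the
  symbols differ by a factor without zeros.\<close>

lemma log_support_xpow:
  assumes S: "S \<subseteq> carrier N"
  shows "log_support N S \<subseteq> log_support N ((\<lambda>s. xpow j \<odot>\<^bsub>N\<^esub> s) ` S)"
proof (clarsimp simp: log_support_def)
  let ?S = "(\<lambda>s. xpow j \<odot>\<^bsub>N\<^esub> s) ` S"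
  fix x y k P f
  assume x: "x \<in> torus" and *: "\<forall>k P f. has_symbol UNIV k P f \<longrightarrow>
      (\<forall>s\<in>S. P \<odot>\<^bsub>N\<^esub> s \<in> X.filt S (k - 1)) \<longrightarrow> f x y = 0"
    and P: "has_symbol UNIV k P f" "\<forall>s\<in>S. P \<odot>\<^bsub>N\<^esub> (xpow j \<odot>\<^bsub>N\<^esub> s) \<in> X.filt ?S (k - 1)"
  have S': "?S \<subseteq> carrier N" using S X.smult_closed[OF xpow_torus] by auto
  have sub: "u \<in> X.filt S l" if "u \<in> X.filt ?S l" for u l
    using that
  proof (induction rule: X.span_induct)
    case zero
    show ?case by (rule X.span_zero)
  next
    case (gen Q t)
    then obtain s where s: "s \<in> S" "t = xpow j \<odot>\<^bsub>N\<^esub> s" by blast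
    have "Q \<circ> xpow j \<in> torus_filt (l + 0)"
      using gen(1) xpow_symbol by (intro torus_filt_closed(6)) (auto simp: torus_filt_def)
    then have "(Q \<circ> xpow j) \<odot>\<^bsub>N\<^esub> s \<in> X.filt S l" using s by (intro X.span_incl) auto
    moreover have "(Q \<circ> xpow j) \<odot>\<^bsub>N\<^esub> s = Q \<odot>\<^bsub>N\<^esub> t"
      using X.act_comp[OF X.F_closed[OF gen(1)] xpow_torus] s S by auto
    ultimately show ?case by simp
  next
    case (add x y)
    then show ?case by (intro X.span_add)
  qed (use S' X.F_sub X.F_uminus in auto)
  have "has_symbol UNIV (k + 0) (P \<circ> xpow j) (\<lambda>x y. f x y * tpow x (vec (int j)))"
    using P(1) xpow_symbol by (rule has_symbol_comp) simp
  moreover have "(P \<circ> xpow j) \<odot>\<^bsub>N\<^esub> s \<in> X.filt S (k - 1)" if "s \<in> S" for s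
    using sub P(2) that S X.act_comp[OF has_symbol_carrier[OF P(1)] xpow_torus, of s] by auto
  ultimately have "f x y * tpow x (vec (int j)) = 0"
    using *[rule_format, of k "P \<circ> xpow j" "\<lambda>x y. f x y * tpow x (vec (int j))"] by simp
  then show "f x y = 0" using tpow_nonzero[OF x] by simp
qed

text \<open>The union over finite sets survives the passage to \<open>N\<close>: a finite subset of
  \<open>N\<close> is moved into the image of \<open>M\<close> by one power of
  \<open>x_1 ... x_n\<close>, which does not shrink its support.\<close>

theorem char_variety_iff:
  assumes p: "p \<in> cot_torus"
  shows "p \<in> char_variety M \<longleftrightarrow>
    (\<exists>S. finite S \<and> S \<subseteq> carrier N \<and> (cot_base p, log_fibre p) \<in> log_support N S)"
proof
  assume "p \<in> char_variety M"
  then obtain S where S: "finite S" "S \<subseteq> carrier M" "p \<in> gr_support M S"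
    by (auto simp: char_variety_def)
  then have "(cot_base p, log_fibre p) \<in> log_support N (\<iota> ` S)" using gr_support_iff p by blast
  then show "\<exists>S. finite S \<and> S \<subseteq> carrier N \<and> (cot_base p, log_fibre p) \<in> log_support N S"
    using S \<iota>_closed by (intro exI[of _ "\<iota> ` S"]) auto
next
  assume "\<exists>S. finite S \<and> S \<subseteq> carrier N \<and> (cot_base p, log_fibre p) \<in> log_support N S"
  then obtain S where S: "finite S" "S \<subseteq> carrier N" "(cot_base p, log_fibre p) \<in> log_support N S" by blast
  have "eventually (\<lambda>k. \<forall>s\<in>S. xpow k \<odot>\<^bsub>N\<^esub> s \<in> \<iota> ` carrier M) sequentially"
    using S \<iota>_surj by (intro eventually_ball_finite) auto
  then obtain k where "\<forall>s\<in>S. xpow k \<odot>\<^bsub>N\<^esub> s \<in> \<iota> ` carrier M"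
    by (auto simp: eventually_sequentially)
  then have "(\<lambda>s. xpow k \<odot>\<^bsub>N\<^esub> s) ` S \<subseteq> \<iota> ` carrier M" by blast
  moreover have "finite ((\<lambda>s. xpow k \<odot>\<^bsub>N\<^esub> s) ` S)" using S(1) by blast
  ultimately obtain S' where S': "finite S'" "S' \<subseteq> carrier M" "\<iota> ` S' = (\<lambda>s. xpow k \<odot>\<^bsub>N\<^esub> s) ` S"
    by (metis finite_subset_image)
  then have "p \<in> gr_support M S'" using gr_support_iff[OF S'(1,2) p] log_support_xpow[OF S(2), of k] S(3) by auto
  then show "p \<in> char_variety M" using S' by (auto simp: char_variety_def)
qed

end

section \<open>Noetherianity of the Rees module of a free module over the operators on the
  torus\<close>

section \<open>Independence of the good filtration\<close>

text \<open>\<open>J\<close> collects the indices of \<open>I\<close> at which \<open>g\<close> is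
  minimal among all later ones; beyond any bound, a minimum of \<open>g\<close> supplies one
  more.\<close>

lemma mono_on_infinite_subset:
  fixes g :: "nat \<Rightarrow> nat"
  assumes "infinite I"
  obtains J where "J \<subseteq> I" "infinite J" "\<And>i j. i \<in> J \<Longrightarrow> j \<in> J \<Longrightarrow> i \<le> j \<Longrightarrow> g i \<le> g j"
proof -
  define J where "J = {i \<in> I. \<forall>j\<in>I. i \<le> j \<longrightarrow> g i \<le> g j}"
  have "\<exists>i>n. i \<in> J" for n
  proof -
    have "\<exists>i. i \<in> I \<and> i > n" using assms by (auto simp: infinite_nat_iff_unbounded)
    then obtain i where i: "i \<in> I \<and> i > n" "\<And>j. j \<in> I \<and> j > n \<Longrightarrow> g i \<le> g j"
      using ex_has_least_nat[of "\<lambda>i. i \<in> I \<and> i > n" _ g] by blast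
    then have "i \<in> J" by (auto simp: J_def)
    then show ?thesis using i by blast
  qed
  then have "infinite J" by (auto simp: infinite_nat_iff_unbounded)
  then show ?thesis by (rule that[rotated]) (auto simp: J_def)
qed

text \<open>Dickson's lemma for finitely many coordinates, by passing to an infinite subset for one
  coordinate after the other.\<close>

lemma dickson:
  fixes G :: "(nat \<Rightarrow> nat) set"
  assumes "finite G"
  obtains i j where "i < j" "\<And>g. g \<in> G \<Longrightarrow> g i \<le> g j"
proof -
  have "\<exists>J. infinite J \<and> (\<forall>g\<in>G. \<forall>i\<in>J. \<forall>j\<in>J. i \<le> j \<longrightarrow> g i \<le> g j)"
    using assms
  proof (induction G)
    case empty
    then show ?case using infinite_UNIV_nat by blast
  next
    case (insert g G)
    then obtain I where I: "infinite I" "\<forall>g\<in>G. \<forall>i\<in>I. \<forall>j\<in>I. i \<le> j \<longrightarrow> g i \<le> g j" by blast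
    obtain J where "J \<subseteq> I" "infinite J" "\<And>i j. i \<in> J \<Longrightarrow> j \<in> J \<Longrightarrow> i \<le> j \<Longrightarrow> g i \<le> g j"
      using mono_on_infinite_subset[OF I(1)] by blast
    then show ?case using I(2) by (intro exI[of _ J]) blast
  qed
  then obtain J where J: "infinite J" "\<forall>g\<in>G. \<forall>i\<in>J. \<forall>j\<in>J. i \<le> j \<longrightarrow> g i \<le> g j" by blast
  obtain i where i: "i \<in> J" using J(1) by fastforce
  obtain j where "j \<in> J" "i < j" using J(1) by (auto simp: infinite_nat_iff_unbounded)
  then show ?thesis using that J(2) i by (meson less_imp_le)
qed

type_synonym 'n mon = "(nat ^ 'n) \<times> (nat ^ 'n) \<times> nat"

text \<open>Monomials are ordered by their codes: the order is well-founded, and total since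
  \<open>code\<close> is injective. Multiplying by a variable multiplies the code by a fixed factor
  above 1, hence respects the order.\<close>

locale monomial_code =
  fixes code :: "('n::finite) mon \<Rightarrow> nat" and p q :: "'n \<Rightarrow> nat"
  assumes inj_code: "inj code" and code_x: "code (a + axis i 1, b, s) = p i * code (a, b, s)"
    and code_theta: "code (a, b + axis i 1, s) = q i * code (a, b, s)"
    and code_pos: "code m > 0" and p: "p i > 1" and q: "q i > 1"

text \<open>A monomial order for free: sending the variables to distinct primes embeds the monoid of
  monomials into the positive integers under multiplication.\<close>

lemma monomial_code_exists: "\<exists>code p q. monomial_code (code :: ('n::finite) mon \<Rightarrow> nat) p q"
proof -
  obtain P :: "nat \<Rightarrow> nat" where P: "inj P" "\<And>i. Factorial_Ring.prime (P i)"
    using infinite_countable_subset[OF primes_infinite] by (auto simp: image_subset_iff)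
  obtain e :: "'n \<Rightarrow> nat" where e: "inj e"
    using finite_imp_inj_to_nat_seg[of "UNIV :: 'n set"] by auto
  \<comment> \<open>The residues modulo 3 keep the primes of the \<open>x\<^sub>i\<close>, of the
    \<open>\<theta>\<^sub>i\<close> and of the basis vectors apart. Basis vectors do not multiply,
    so each index \<open>s\<close> gets its own prime instead of an exponent.\<close>
  define p where "p i = P (3 * e i)" for i
  define q where "q i = P (3 * e i + 1)" for i
  define t where "t s = P (3 * s + 2)" for s
  define code where "code m = (case m of (a, b, s) \<Rightarrow>
     (\<Prod>i\<in>UNIV. p i ^ (a $ i)) * (\<Prod>i\<in>UNIV. q i ^ (b $ i)) * t s)" for m :: "'n mon"
  have pr: "Factorial_Ring.prime (p i)" "Factorial_Ring.prime (q i)" "Factorial_Ring.prime (t s)" for i s by (simp_all add: p_def q_def t_def P)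
  have P_eq: "P i = P j \<longleftrightarrow> i = j" for i j using P(1) by (auto dest: injD)
  have ne: "p i = p j \<longleftrightarrow> i = j" "q i = q j \<longleftrightarrow> i = j" "t s = t s' \<longleftrightarrow> s = s'"
    "p i \<noteq> q j" "q j \<noteq> p i" "p i \<noteq> t s" "t s \<noteq> p i" "q i \<noteq> t s" "t s \<noteq> q i" for i j s s'
    using e by (auto simp: p_def q_def t_def P_eq dest: injD) presburger+
  have pos: "code m > 0" for m
    using pr by (auto simp: code_def prime_gt_0_nat split: prod.splits intro!: prod_pos)
  have nz: "p i \<noteq> 0" "q i \<noteq> 0" "t s \<noteq> 0" for i s using pr by (auto simp: prime_gt_0_nat)
  have mult: "multiplicity r (code (a, b, s)) = (\<Sum>i\<in>UNIV. a $ i * multiplicity r (p i)) +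
      (\<Sum>i\<in>UNIV. b $ i * multiplicity r (q i)) + multiplicity r (t s)" if "Factorial_Ring.prime r" for r a b s
  proof -
    have "prime_elem r" using that by simp
    then show ?thesis
      using nz by (simp add: code_def prime_elem_multiplicity_mult_distrib
          prime_elem_multiplicity_prod_distrib prime_elem_multiplicity_power_distrib image_iff prod_zero_iff)
  qed
  have self: "multiplicity r r' = (if r = r' then 1 else 0)" if "Factorial_Ring.prime r" "Factorial_Ring.prime r'" for r r' :: nat
    using that prime_multiplicity_other[of r r'] by auto
  have "inj code"
  proof (rule injI)
    fix m m' assume eq: "code m = code m'"
    obtain a b s a' b' s' where m: "m = (a, b, s)" "m' = (a', b', s')" by (cases m, cases m') auto
    have "a $ i = a' $ i" for i
      using mult[OF pr(1)[of i], of a b s] mult[OF pr(1)[of i], of a' b' s'] eq m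
      by (simp add: self pr ne if_distrib cong: if_cong)
    moreover have "b $ i = b' $ i" for i
      using mult[OF pr(2)[of i], of a b s] mult[OF pr(2)[of i], of a' b' s'] eq m
      by (simp add: self pr ne if_distrib cong: if_cong)
    moreover have "s = s'"
      using mult[OF pr(3)[of s], of a b s] mult[OF pr(3)[of s], of a' b' s'] eq m
      by (simp add: self pr ne if_distrib split: if_splits)
    ultimately show "m = m'" using m by (simp add: vec_eq_iff)
  qed
  moreover have "(\<Prod>j\<in>UNIV. r j ^ ((v + axis i 1) $ j)) = r i * (\<Prod>j\<in>UNIV. r j ^ (v $ j))"
    for r :: "'n \<Rightarrow> nat" and v :: "nat ^ 'n" and i
  proof -
    have "(\<Prod>j\<in>UNIV. r j ^ (v $ j)) = r i ^ (v $ i) * (\<Prod>j\<in>UNIV-{i}. r j ^ (v $ j))"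
      by (rule prod.remove) auto
    then show ?thesis using prod_axis_Suc[of "\<lambda>j k. r j ^ k" v i] by (simp add: power_add)
  qed
  moreover have "p i > 1" "q i > 1" for i using pr prime_gt_1_nat by blast+
  ultimately have "monomial_code code p q"
    using pos by unfold_locales (simp_all add: code_def)
  then show ?thesis by blast
qed

definition wmon :: "nat ^ 'n \<Rightarrow> int ^ ('n::finite) \<Rightarrow> complex" where
  "wmon b w = (\<Prod>i\<in>UNIV. of_int (w $ i) ^ (b $ i))"

lemma wmon_0 [simp]: "wmon 0 w = 1"
  by (simp add: wmon_def)

lemma wmon_Suc: "wmon (b + axis i 1) w = of_int (w $ i) * wmon b w"
proof -
  have "wmon b w = of_int (w $ i) ^ (b $ i) * (\<Prod>j\<in>UNIV-{i}. of_int (w $ j) ^ (b $ j))"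
    unfolding wmon_def by (rule prod.remove) auto
  then show ?thesis
    using prod_axis_Suc[of "\<lambda>j k. of_int (w $ j) ^ k :: complex" b i]
    by (simp add: wmon_def flip: Suc_eq_plus1)
qed

text \<open>A coefficient family on the monomials \<open>x\<^sup>a \<theta>\<^sup>b e\<^sub>s\<close> of a free module, read as a tuple of operators.\<close>

definition tuple_op :: "(('n::finite) mon \<Rightarrow>\<^sub>0 complex) \<Rightarrow> nat \<Rightarrow> 'n dop" where
  "tuple_op c s = (\<Sum>m\<in>Poly_Mapping.keys c. if snd (snd m) = s then
     shift_op (ivec (fst m)) (\<lambda>w. Poly_Mapping.lookup c m * wmon (fst (snd m)) w) else 0)"

lemma tuple_op_superset:
  assumes "finite A" "Poly_Mapping.keys c \<subseteq> A"
  shows "tuple_op c s = (\<Sum>m\<in>A. if snd (snd m) = s then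
     shift_op (ivec (fst m)) (\<lambda>w. Poly_Mapping.lookup c m * wmon (fst (snd m)) w) else 0)"
proof -
  have "shift_op u (\<lambda>w. 0) = 0" for u :: "int ^ 'a"
    using shift_op_zero[of u] by (simp add: zero_fun_def)
  then show ?thesis
    unfolding tuple_op_def by (intro sum.mono_neutral_left) (use assms in \<open>auto simp: in_keys_iff\<close>)
qed

lemma tuple_op_add: "tuple_op (c + d) s = tuple_op c s + tuple_op d s"
proof -
  let ?A = "Poly_Mapping.keys c \<union> Poly_Mapping.keys d"
  have "shift_op u (\<lambda>w. (x + y) * g w) = shift_op u (\<lambda>w. x * g w) + shift_op u (\<lambda>w. y * g w)"
    for u :: "int ^ 'a" and x y g
    using shift_op_add[of u "\<lambda>w. x * g w" "\<lambda>w. y * g w"] by (simp add: plus_fun_def distrib_right)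
  then show ?thesis
    using keys_add[of c d] by (subst (1 2 3) tuple_op_superset[of ?A])
      (auto simp: lookup_add sum.distrib[symmetric] intro!: sum.cong)
qed

lemma tuple_op_0 [simp]: "tuple_op 0 s = 0"
  by (simp add: tuple_op_def)

lemma tuple_op_sum: "tuple_op (\<Sum>i\<in>I. c i) s = (\<Sum>i\<in>I. tuple_op (c i) s)"
  by (induction I rule: infinite_finite_induct) (auto simp: tuple_op_add)

lemma tuple_op_single: "tuple_op (Poly_Mapping.single (a, b, t) c) s =
    (if t = s then shift_op (ivec a) (\<lambda>w. c * wmon b w) else 0)"
  by (simp add: tuple_op_superset[of "{(a, b, t)}"])

lemma shift_op_apply: "shift_op u p (shift_op v q f) = shift_op (u + v) (\<lambda>w. p (w + v) * q w) f"
  using fun_cong[OF shift_op_comp, of u p v q f] by simp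

definition scale_coeffs :: "complex \<Rightarrow> ('k \<Rightarrow>\<^sub>0 complex) \<Rightarrow> ('k \<Rightarrow>\<^sub>0 complex)" where
  "scale_coeffs x c = Poly_Mapping.map ((*) x) c"

lemma lookup_scale_coeffs [simp]: "Poly_Mapping.lookup (scale_coeffs x c) m = x * Poly_Mapping.lookup c m"
  by (simp add: scale_coeffs_def Poly_Mapping.map.rep_eq when_def)

lemma keys_scale_coeffs: "Poly_Mapping.keys (scale_coeffs x c) \<subseteq> Poly_Mapping.keys c"
  by (auto simp: in_keys_iff)

lemma torus_dops_diff: "P \<in> carrier torus_dops \<Longrightarrow> P (a - b) = P a - P b"
  using torus_dops_additive[of P "a - b" b] by simp

lemma torus_sum_comp_right: "R \<in> carrier torus_dops \<Longrightarrow> R \<circ> (\<Sum>i\<in>I. Q i) = (\<Sum>i\<in>I. R \<circ> Q i)"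
proof (induction I rule: infinite_finite_induct)
  case (insert i I)
  then show ?case by (simp add: fun_eq_iff torus_dops_additive)
qed (use torus_dops_additive[of R 0 0] in \<open>auto simp: fun_eq_iff\<close>)

lemma tuple_op_scale: "tuple_op (scale_coeffs x c) s = shift_op 0 (\<lambda>_. x) \<circ> tuple_op c s"
proof -
  have "shift_op 0 (\<lambda>_. x) \<in> carrier torus_dops"
    by (rule has_symbol_carrier[OF has_symbol_shift_one[of 0 UNIV]]) simp
  then have "shift_op 0 (\<lambda>_. x) \<circ> tuple_op c s = (\<Sum>m\<in>Poly_Mapping.keys c. shift_op 0 (\<lambda>_. x) \<circ> (if snd (snd m) = s then
     shift_op (ivec (fst m)) (\<lambda>w. Poly_Mapping.lookup c m * wmon (fst (snd m)) w) else 0))"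
    unfolding tuple_op_def by (rule torus_sum_comp_right)
  also have "\<dots> = tuple_op (scale_coeffs x c) s"
    by (subst tuple_op_superset[OF finite_keys keys_scale_coeffs], intro sum.cong refl)
      (auto simp: shift_op_apply mult.assoc fun_eq_iff)
  finally show ?thesis by simp
qed

text \<open>The order filtration on the free module of rank \<open>r\<close>: the
  \<open>x\<^sub>i\<close> have order 0, so only the exponent of \<open>\<theta>\<close> is
  bounded.\<close>

definition bounded_coeffs :: "int \<Rightarrow> nat \<Rightarrow> (('n::finite) mon \<Rightarrow>\<^sub>0 complex) \<Rightarrow> bool" where
  "bounded_coeffs l r c \<longleftrightarrow> (\<forall>(a, b, s)\<in>Poly_Mapping.keys c. int (vdeg b) \<le> l \<and> s < r)"

lemma bounded_coeffs_add: "bounded_coeffs l r c \<Longrightarrow> bounded_coeffs l r d \<Longrightarrow> bounded_coeffs l r (c + d)"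
  using keys_add[of c d] unfolding bounded_coeffs_def by blast

lemma bounded_coeffs_scale: "bounded_coeffs l r c \<Longrightarrow> bounded_coeffs l r (scale_coeffs x c)"
  using keys_scale_coeffs[of x c] unfolding bounded_coeffs_def by blast

lemma bounded_coeffs_mono: "bounded_coeffs l r c \<Longrightarrow> l \<le> l' \<Longrightarrow> bounded_coeffs l' r c"
  unfolding bounded_coeffs_def by force

definition x_times :: "'n \<Rightarrow> (('n::finite) mon \<Rightarrow>\<^sub>0 complex) \<Rightarrow> ('n mon \<Rightarrow>\<^sub>0 complex)" where
  "x_times i c = (\<Sum>(a, b, s)\<in>Poly_Mapping.keys c.
     Poly_Mapping.single (a + axis i 1, b, s) (Poly_Mapping.lookup c (a, b, s)))"

text \<open>Left multiplication by \<open>\<theta>\<^sub>i\<close> in normal form; the second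
  summand comes from
  \<open>\<theta>\<^sub>i x^a = x^a (\<theta>\<^sub>i + a\<^sub>i)\<close>.\<close>

definition theta_times :: "'n \<Rightarrow> (('n::finite) mon \<Rightarrow>\<^sub>0 complex) \<Rightarrow> ('n mon \<Rightarrow>\<^sub>0 complex)" where
  "theta_times i c = (\<Sum>(a, b, s)\<in>Poly_Mapping.keys c.
     Poly_Mapping.single (a, b + axis i 1, s) (Poly_Mapping.lookup c (a, b, s)) +
     Poly_Mapping.single (a, b, s) (of_nat (a $ i) * Poly_Mapping.lookup c (a, b, s)))"

lemma theta_torus: "theta i \<in> carrier torus_dops" "theta i \<in> torus_filt 1"
proof -
  have "leading_form (0 + 1) (\<lambda>w. of_int (w $ i) * 1) (\<lambda>y. y $ i * 1)"
    by (rule leading_form.coord[OF leading_form.const])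
  from has_symbol.shift[OF _ this, of 0 UNIV]
  have "has_symbol UNIV 1 (theta i) (\<lambda>x y. tpow x 0 * (y $ i * 1))" by (simp add: theta_eq)
  then show "theta i \<in> carrier torus_dops" "theta i \<in> torus_filt 1"
    using has_symbol_carrier by (auto simp: torus_filt_def)
qed

lemma x_one_torus: "shift_op (axis i 1) (\<lambda>_. 1) \<in> torus_filt 0"
  using has_symbol_shift_one[of _ UNIV 1] by (auto simp: torus_filt_def)

lemma tuple_op_x_times: "tuple_op (x_times i c) s = shift_op (axis i 1) (\<lambda>_. 1) \<circ> tuple_op c s"
proof -
  have "shift_op (axis i 1) (\<lambda>_. 1) \<in> carrier torus_dops"
    using x_one_torus torus_filt_closed(1) by blast
  then show ?thesis
    unfolding x_times_def tuple_op_sum tuple_op_def[of c]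
    by (subst torus_sum_comp_right, assumption, intro sum.cong refl)
      (auto simp: tuple_op_single case_prod_unfold shift_op_apply ivec_add ivec_axis add.commute fun_eq_iff)
qed

lemma tuple_op_theta_times: "tuple_op (theta_times i c) s = theta i \<circ> tuple_op c s"
proof -
  have *: "shift_op u (\<lambda>w. x * (of_int (w $ i) * g w)) + shift_op u (\<lambda>w. of_int (u $ i) * x * g w) =
    theta i \<circ> shift_op u (\<lambda>w. x * g w)" for u :: "int ^ 'a" and g x
    unfolding theta_comp shift_op_add[symmetric]
    by (rule arg_cong[where f = "shift_op u"]) (auto simp: fun_eq_iff algebra_simps)
  show ?thesis
    unfolding theta_times_def tuple_op_sum tuple_op_def[of c] torus_sum_comp_right[OF theta_torus(1)]
  proof (intro sum.cong refl, clarify)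
    fix a b t
    show "tuple_op (Poly_Mapping.single (a, b + axis i 1, t) (Poly_Mapping.lookup c (a, b, t)) +
        Poly_Mapping.single (a, b, t) (of_nat (a $ i) * Poly_Mapping.lookup c (a, b, t))) s =
      theta i \<circ> (if snd (snd (a, b, t)) = s then shift_op (ivec (fst (a, b, t)))
          (\<lambda>w. Poly_Mapping.lookup c (a, b, t) * wmon (fst (snd (a, b, t))) w) else 0)"
      using *[of "ivec a" "Poly_Mapping.lookup c (a, b, t)" "wmon b"] torus_dops_additive[OF theta_torus(1), of i 0 0]
      by (auto simp: tuple_op_add tuple_op_single wmon_Suc ivec_def fun_eq_iff)
  qed
qed

lemma bounded_x_times: "bounded_coeffs l r c \<Longrightarrow> bounded_coeffs l r (x_times i c)"
proof -
  assume c: "bounded_coeffs l r c"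
  have "Poly_Mapping.keys (x_times i c) \<subseteq> (\<Union>m\<in>Poly_Mapping.keys c. {(fst m + axis i 1, snd m)})"
    unfolding x_times_def by (rule order.trans[OF keys_sum]) (auto split: if_splits)
  then show ?thesis using c unfolding bounded_coeffs_def by fastforce
qed

lemma keys_theta_times: "Poly_Mapping.keys (theta_times i c) \<subseteq>
    (\<Union>m\<in>Poly_Mapping.keys c. {m, (fst m, fst (snd m) + axis i 1, snd (snd m))})"
  unfolding theta_times_def
proof (rule order.trans[OF keys_sum], rule UN_mono[OF subset_refl])
  fix m :: "'a mon"
  show "Poly_Mapping.keys (case m of (a, b, s) \<Rightarrow> Poly_Mapping.single (a, b + axis i 1, s) (Poly_Mapping.lookup c (a, b, s)) +
     Poly_Mapping.single (a, b, s) (of_nat (a $ i) * Poly_Mapping.lookup c (a, b, s))) \<subseteq>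
    {m, (fst m, fst (snd m) + axis i 1, snd (snd m))}"
    by (cases m) (auto split: if_splits dest!: subsetD[OF keys_add])
qed

lemma bounded_theta_times: "bounded_coeffs l r c \<Longrightarrow> bounded_coeffs (l + 1) r (theta_times i c)"
  using keys_theta_times[of i c] unfolding bounded_coeffs_def by (fastforce simp: vdeg_add)

context monomial_code
begin

definition lead :: "('n mon \<Rightarrow>\<^sub>0 complex) \<Rightarrow> 'n mon \<Rightarrow> bool" where
  "lead c m \<longleftrightarrow> m \<in> Poly_Mapping.keys c \<and> (\<forall>m'\<in>Poly_Mapping.keys c. code m' \<le> code m)"

lemma lead_exists: assumes "c \<noteq> 0" obtains m where "lead c m"
proof -
  have "Max (code ` Poly_Mapping.keys c) \<in> code ` Poly_Mapping.keys c" using assms by (intro Max_in) auto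
  then obtain m where m: "m \<in> Poly_Mapping.keys c" "code m = Max (code ` Poly_Mapping.keys c)" by auto
  have "code m' \<le> code m" if "m' \<in> Poly_Mapping.keys c" for m'
    unfolding m(2) using that by (intro Max_ge) auto
  then show ?thesis using that m(1) unfolding lead_def by blast
qed

lemma lead_x_times:
  assumes "lead c (a, b, s)"
  shows "lead (x_times i c) (a + axis i 1, b, s)"
    "Poly_Mapping.lookup (x_times i c) (a + axis i 1, b, s) = Poly_Mapping.lookup c (a, b, s)"
proof -
  have "Poly_Mapping.lookup (x_times i c) (a + axis i 1, b, s) =
    (\<Sum>m\<in>Poly_Mapping.keys c. if m = (a, b, s) then Poly_Mapping.lookup c m else 0)"
    unfolding x_times_def lookup_sum by (rule sum.cong) (auto simp: lookup_single when_def split: if_splits)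
  then show l: "Poly_Mapping.lookup (x_times i c) (a + axis i 1, b, s) = Poly_Mapping.lookup c (a, b, s)"
    using assms by (simp add: lead_def)
  have "Poly_Mapping.keys (x_times i c) \<subseteq> (\<Union>m\<in>Poly_Mapping.keys c. {(fst m + axis i 1, snd m)})"
    unfolding x_times_def by (rule order.trans[OF keys_sum]) (auto split: if_splits)
  moreover have "code (fst m + axis i 1, snd m) \<le> code (a + axis i 1, b, s)" if "m \<in> Poly_Mapping.keys c" for m
    using assms that by (cases m) (auto simp: lead_def code_x)
  ultimately show "lead (x_times i c) (a + axis i 1, b, s)"
    using l assms by (auto simp: lead_def in_keys_iff)
qed

text \<open>The corrections produced by reordering are multiples of monomials already in
  \<open>c\<close>, whose codes are strictly below that of \<open>\<theta>\<^sub>i\<close> times the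
  leading one.\<close>

lemma lead_theta_times:
  assumes "lead c (a, b, s)"
  shows "lead (theta_times i c) (a, b + axis i 1, s)"
    "Poly_Mapping.lookup (theta_times i c) (a, b + axis i 1, s) = Poly_Mapping.lookup c (a, b, s)"
proof -
  have less: "code m < code (a, b + axis i 1, s)" if "m \<in> Poly_Mapping.keys c" for m
  proof -
    have "code m \<le> code (a, b, s)" using assms that by (auto simp: lead_def)
    also have "\<dots> < code (a, b + axis i 1, s)" using q[of i] code_pos by (simp add: code_theta)
    finally show ?thesis .
  qed
  then have "(a, b + axis i 1, s) \<notin> Poly_Mapping.keys c" by blast
  then have "Poly_Mapping.lookup (theta_times i c) (a, b + axis i 1, s) =
    (\<Sum>m\<in>Poly_Mapping.keys c. if m = (a, b, s) then Poly_Mapping.lookup c m else 0)"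
    unfolding theta_times_def lookup_sum by (intro sum.cong) (auto simp: lookup_single lookup_add when_def in_keys_iff split: if_splits)
  then show l: "Poly_Mapping.lookup (theta_times i c) (a, b + axis i 1, s) = Poly_Mapping.lookup c (a, b, s)"
    using assms by (simp add: lead_def)
  have "code m' \<le> code (a, b + axis i 1, s)" if "m' \<in> Poly_Mapping.keys (theta_times i c)" for m'
  proof -
    obtain m where m: "m \<in> Poly_Mapping.keys c" "m' = m \<or> m' = (fst m, fst (snd m) + axis i 1, snd (snd m))"
      using subsetD[OF keys_theta_times \<open>m' \<in> _\<close>] by blast
    have "code (fst m, fst (snd m) + axis i 1, snd (snd m)) \<le> code (a, b + axis i 1, s)"
      using assms m by (cases m) (auto simp: lead_def code_theta)
    then show ?thesis using less[OF m(1)] m(2) by auto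
  qed
  then show "lead (theta_times i c) (a, b + axis i 1, s)"
    using l assms by (auto simp: lead_def in_keys_iff)
qed

text \<open>The multiplier is \<open>\<theta>^v x^u\<close>, where only \<open>\<theta>^v\<close>
  has positive order. That the leading coefficient is unchanged permits exact cancellation against
  another element with the same leading monomial.\<close>

lemma lead_multiple:
  assumes "lead c (a, b, s)" "bounded_coeffs l r c"
  obtains d R where "R \<in> torus_filt (int (vdeg v))" "\<forall>t. tuple_op d t = R \<circ> tuple_op c t"
    "lead d (a + u, b + v, s)" "Poly_Mapping.lookup d (a + u, b + v, s) = Poly_Mapping.lookup c (a, b, s)"
    "bounded_coeffs (l + int (vdeg v)) r d"
proof -
  define good where "good u v d R \<longleftrightarrow> R \<in> torus_filt (int (vdeg v)) \<and> (\<forall>t. tuple_op d t = R \<circ> tuple_op c t) \<and>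
    lead d (a + u, b + v, s) \<and> Poly_Mapping.lookup d (a + u, b + v, s) = Poly_Mapping.lookup c (a, b, s) \<and>
    bounded_coeffs (l + int (vdeg v)) r d" for u v d R
  have "\<exists>d R. good u v d R"
  proof (induction v rule: vec_nat_induct)
    case zero
    show ?case
    proof (induction u rule: vec_nat_induct)
      case zero
      have "good 0 0 c id" using assms torus_filt_closed(3) by (simp add: good_def)
      then show ?case by blast
    next
      case (step u i)
      then obtain d R where d: "good u 0 d R" by blast
      have "shift_op (axis i 1) (\<lambda>_. 1) \<circ> R \<in> torus_filt (0 + 0)"
        using x_one_torus d by (intro torus_filt_closed(6)) (simp_all add: good_def)
      then have "good (u + axis i 1) 0 (x_times i d) (shift_op (axis i 1) (\<lambda>_. 1) \<circ> R)"
        using d lead_x_times[of d "a + u" b s i]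
        by (simp add: good_def tuple_op_x_times comp_assoc bounded_x_times add.assoc)
      then show ?case by blast
    qed
  next
    case (step v i)
    then obtain d R where d: "good u v d R" by blast
    have "theta i \<circ> R \<in> torus_filt (1 + int (vdeg v))"
      using theta_torus(2) d by (intro torus_filt_closed(6)) (simp_all add: good_def)
    then have "good u (v + axis i 1) (theta_times i d) (theta i \<circ> R)"
      using d lead_theta_times[of d "a + u" "b + v" s i] bounded_theta_times[of "l + int (vdeg v)" r d i]
      by (simp add: good_def tuple_op_theta_times comp_assoc add.assoc vdeg_add add.commute[of 1])
    then show ?case by blast
  qed
  then show ?thesis using that unfolding good_def by blast
qed

text \<open>Noetherianity of the Rees module of a free module: the minimal-leading-term argument.\<close>

lemma rees_noetherian_coeffs:
  fixes c :: "nat \<Rightarrow> ('n mon \<Rightarrow>\<^sub>0 complex)" and l :: "nat \<Rightarrow> int"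
  assumes bd: "\<And>j. bounded_coeffs (l j) r (c j)"
  shows "\<exists>j R. (\<forall>i<j. R i \<in> torus_filt (l j - l i)) \<and>
    (\<forall>s. tuple_op (c j) s = (\<Sum>i<j. R i \<circ> tuple_op (c i) s))"
proof -
  \<comment> \<open>\<open>d\<close> is a remainder of the \<open>j\<close>-th element modulo its
    predecessors, reached without exceeding the order bounds.\<close>
  define reduct where "reduct j d \<longleftrightarrow> bounded_coeffs (l j) r d \<and> (\<exists>R. (\<forall>i<j. R i \<in> torus_filt (l j - l i)) \<and>
    (\<forall>s. tuple_op (c j) s = tuple_op d s + (\<Sum>i<j. R i \<circ> tuple_op (c i) s)))" for j d
  have start: "reduct j (c j)" for j
    unfolding reduct_def
  proof (intro conjI bd exI[of _ "\<lambda>_. 0"] allI impI)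
    show "0 \<in> torus_filt (l j - l i)" for i by (rule torus_filt_closed)
    have "(\<Sum>i<j. (0 :: 'n dop) \<circ> tuple_op (c i) s) = 0" for s by (rule sum.neutral) (auto simp: fun_eq_iff)
    then show "tuple_op (c j) s = tuple_op (c j) s + (\<Sum>i<j. 0 \<circ> tuple_op (c i) s)" for s
      by (simp only: add_0_right)
  qed
  show ?thesis
  proof (cases "\<exists>j. reduct j 0")
    case True
    then show ?thesis unfolding reduct_def by auto
  next
    case False
    have "\<exists>d m. reduct j d \<and> lead d m \<and> (\<forall>d' m'. reduct j d' \<longrightarrow> lead d' m' \<longrightarrow> code m \<le> code m')" for j
    proof -
      have "c j \<noteq> 0" using start[of j] False by metis
      then obtain m where "lead (c j) m" by (rule lead_exists)
      then have "\<exists>dm. reduct j (fst dm) \<and> lead (fst dm) (snd dm)" using start[of j] by (intro exI[of _ "(c j, m)"]) simp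
      then obtain dm where "reduct j (fst dm) \<and> lead (fst dm) (snd dm)"
        "\<And>dm'. reduct j (fst dm') \<and> lead (fst dm') (snd dm') \<Longrightarrow> code (snd dm) \<le> code (snd dm')"
        using ex_has_least_nat[of "\<lambda>dm. reduct j (fst dm) \<and> lead (fst dm) (snd dm)" _ "\<lambda>dm. code (snd dm)"]
        by blast
      then show ?thesis by (intro exI[of _ "fst dm"] exI[of _ "snd dm"]) auto
    qed
    then obtain d m where dm: "\<And>j. reduct j (d j)" "\<And>j. lead (d j) (m j)"
      "\<And>j d' m'. reduct j d' \<Longrightarrow> lead d' m' \<Longrightarrow> code (m j) \<le> code m'"
      by metis
    define a b s where "a j = fst (m j)" and "b j = fst (snd (m j))" and "s j = snd (snd (m j))" for j
    have m_eq: "m j = (a j, b j, s j)" for j by (simp add: a_def b_def s_def)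
    have key: "int (vdeg (b j)) \<le> l j" "s j < r" for j
      using dm(1,2)[of j] unfolding reduct_def bounded_coeffs_def lead_def m_eq by blast+
    \<comment> \<open>The coordinates fed to Dickson's lemma. \<open>s\<close> together with
      \<open>r - s\<close> forces equal components; the slack \<open>l j - vdeg (b j)\<close> bounds
      the order of the multiplier by \<open>l j - l i\<close>, which divisibility of monomials alone
      would not give.\<close>
    define G where "G = range (\<lambda>k j. a j $ k) \<union> range (\<lambda>k j. b j $ k) \<union>
      {s, \<lambda>j. r - s j, \<lambda>j. nat (l j - int (vdeg (b j)))}"
    have "finite G" by (simp add: G_def)
    then obtain i j where ij: "i < j" "\<And>g. g \<in> G \<Longrightarrow> g i \<le> g j" by (rule dickson) blast
    have le: "a i $ k \<le> a j $ k" "b i $ k \<le> b j $ k" for k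
      using ij(2)[of "\<lambda>j. a j $ k"] ij(2)[of "\<lambda>j. b j $ k"] by (auto simp: G_def)
    have s_eq: "s i = s j"
      using ij(2)[of s] ij(2)[of "\<lambda>j. r - s j"] key(2)[of i] key(2)[of j] by (auto simp: G_def)
    have deg: "l i - int (vdeg (b i)) \<le> l j - int (vdeg (b j))"
      using ij(2)[of "\<lambda>j. nat (l j - int (vdeg (b j)))"] key(1)[of i] key(1)[of j] by (auto simp: G_def)
    define u v where "u = a j - a i" and "v = b j - b i"
    have uv: "a i + u = a j" "b i + v = b j" using le by (simp_all add: u_def v_def vec_eq_iff)
    have vdeg_v: "int (vdeg v) \<le> l j - l i" using deg arg_cong[OF uv(2), of vdeg] unfolding vdeg_add by linarith
    have mij: "m i = (a i, b i, s j)" "m j = (a i + u, b i + v, s j)" by (simp_all add: m_eq uv s_eq)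
    have lead_i: "lead (d i) (a i, b i, s j)" "bounded_coeffs (l i) r (d i)"
      using dm(1,2)[of i] by (simp_all only: mij reduct_def)
    obtain e T where e: "T \<in> torus_filt (int (vdeg v))" "\<forall>t. tuple_op e t = T \<circ> tuple_op (d i) t"
      "lead e (a i + u, b i + v, s j)"
      "Poly_Mapping.lookup e (a i + u, b i + v, s j) = Poly_Mapping.lookup (d i) (a i, b i, s j)"
      "bounded_coeffs (l i + int (vdeg v)) r e"
      by (rule lead_multiple[OF lead_i, of v u], rule that)
    note e = e(1) e(2)[rule_format] e(3,4)[folded mij] e(5)
    have T: "T \<in> torus_filt (l j - l i)" using e(1) vdeg_v by (rule torus_filt_closed)
    obtain Ri where Ri: "\<And>k. k < i \<Longrightarrow> Ri k \<in> torus_filt (l i - l k)"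
      "\<And>t. tuple_op (c i) t = tuple_op (d i) t + (\<Sum>k<i. Ri k \<circ> tuple_op (c k) t)"
      using dm(1)[of i] unfolding reduct_def by blast
    obtain Rj where Rj: "\<And>k. k < j \<Longrightarrow> Rj k \<in> torus_filt (l j - l k)"
      "\<And>t. tuple_op (c j) t = tuple_op (d j) t + (\<Sum>k<j. Rj k \<circ> tuple_op (c k) t)"
      using dm(1)[of j] unfolding reduct_def by blast
    \<comment> \<open>The scalar that cancels the leading term of \<open>d j\<close> against the
      multiple of \<open>d i\<close>; the result contradicts the minimality of the leading code of
      \<open>d j\<close>.\<close>
    define x where "x = Poly_Mapping.lookup (d j) (m j) / Poly_Mapping.lookup e (m j)"
    have e0: "Poly_Mapping.lookup e (m j) \<noteq> 0" using e(3) by (simp add: lead_def in_keys_iff)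
    define d' where "d' = d j + scale_coeffs (- x) e"
    define Sc :: "'n dop" where "Sc = shift_op 0 (\<lambda>_. - x)"
    have Sc: "Sc \<in> torus_filt 0" unfolding Sc_def torus_filt_def using has_symbol_shift_one[of 0 UNIV "-x"] by blast
    define XT where "XT = Sc \<circ> T"
    have XT: "XT \<in> torus_filt (l j - l i)" unfolding XT_def using torus_filt_closed(6)[OF Sc T] by simp
    have XT': "XT \<in> carrier torus_dops" using XT torus_filt_closed(1) by blast
    \<comment> \<open>The remainder \<open>d i\<close> is rewritten as \<open>c i\<close> minus a
      combination of earlier elements, so the cofactors change at \<open>i\<close> and below
      \<open>i\<close>.\<close>
    define R where "R k = (if k < i then Rj k + (XT \<circ> Ri k) else if k = i then Rj k - XT else Rj k)" for k
    have "reduct j d'"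
      unfolding reduct_def
    proof (intro conjI exI[of _ R] allI impI)
      show "bounded_coeffs (l j) r d'"
        unfolding d'_def using dm(1)[of j] e(5) vdeg_v
        by (intro bounded_coeffs_add bounded_coeffs_scale)
          (auto simp: reduct_def elim!: bounded_coeffs_mono)
    next
      fix k assume "k < j"
      then show "R k \<in> torus_filt (l j - l k)"
        using Rj(1)[of k] torus_filt_closed(6)[OF XT Ri(1), of k] XT torus_filt_closed(4)[OF _ torus_filt_closed(5)]
        by (auto simp: R_def intro!: torus_filt_closed(4))
    next
      fix t
      let ?C = "\<lambda>k. tuple_op (c k) t"
      have di: "tuple_op (d i) t = ?C i - (\<Sum>k<i. Ri k \<circ> ?C k)" using Ri(2)[of t] by simp
      have "(XT \<circ> tuple_op (d i) t) = (XT \<circ> ?C i) - (XT \<circ> (\<Sum>k<i. Ri k \<circ> ?C k))"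
        unfolding di using XT' by (simp add: fun_eq_iff torus_dops_diff)
      then have XTd: "(XT \<circ> tuple_op (d i) t) = (XT \<circ> ?C i) - (\<Sum>k<i. XT \<circ> (Ri k \<circ> ?C k))"
        unfolding torus_sum_comp_right[OF XT'] .
      have "(\<Sum>k<j. R k \<circ> ?C k) = (\<Sum>k<j. (Rj k \<circ> ?C k) + (if k < i then XT \<circ> (Ri k \<circ> ?C k) else if k = i then - (XT \<circ> ?C k) else 0))"
        by (rule sum.cong) (auto simp: R_def fun_eq_iff)
      also have "\<dots> = (\<Sum>k<j. Rj k \<circ> ?C k) + ((\<Sum>k<i. XT \<circ> (Ri k \<circ> ?C k)) - (XT \<circ> ?C i))"
      proof -
        have "{..<j} = {..<i} \<union> {i} \<union> {i<..<j}" using ij(1) by auto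
        then have "(\<Sum>k<j. (if k < i then XT \<circ> (Ri k \<circ> ?C k) else if k = i then - (XT \<circ> ?C k) else 0)) =
          (\<Sum>k\<in>{..<i} \<union> {i} \<union> {i<..<j}. (if k < i then XT \<circ> (Ri k \<circ> ?C k) else if k = i then - (XT \<circ> ?C k) else 0))"
          by simp
        also have "\<dots> = (\<Sum>k<i. XT \<circ> (Ri k \<circ> ?C k)) + - (XT \<circ> ?C i) + 0"
          by (subst sum.union_disjoint, simp, simp, force, subst sum.union_disjoint) auto
        finally show ?thesis by (simp add: sum.distrib)
      qed
      also have "\<dots> = (\<Sum>k<j. Rj k \<circ> ?C k) - (XT \<circ> tuple_op (d i) t)" unfolding XTd by simp
      finally have eq: "(\<Sum>k<j. R k \<circ> ?C k) = (\<Sum>k<j. Rj k \<circ> ?C k) - (XT \<circ> tuple_op (d i) t)" .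
      have "tuple_op d' t = tuple_op (d j) t + (XT \<circ> tuple_op (d i) t)"
        by (simp add: d'_def tuple_op_add tuple_op_scale e(2) Sc_def[symmetric] XT_def comp_assoc)
      then show "?C j = tuple_op d' t + (\<Sum>k<j. R k \<circ> ?C k)"
        unfolding Rj(2)[of t] eq by simp
    qed
    moreover have "d' \<noteq> 0" using \<open>reduct j d'\<close> False by metis
    then obtain m' where m': "lead d' m'" by (rule lead_exists)
    have "Poly_Mapping.lookup d' (m j) = 0" using e0 by (simp add: d'_def lookup_add x_def)
    then have "m' \<noteq> m j" using m' by (auto simp: lead_def in_keys_iff)
    have "m' \<in> Poly_Mapping.keys (d j) \<union> Poly_Mapping.keys e"
      using m' keys_add[of "d j" "scale_coeffs (- x) e"] keys_scale_coeffs[of "- x" e] unfolding lead_def d'_def by blast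
    then have "code m' \<le> code (m j)" using dm(2)[of j] e(3) unfolding lead_def by blast
    then have "code m' < code (m j)" using \<open>m' \<noteq> m j\<close> inj_code by (metis inj_eq le_neq_implies_less)
    ultimately show ?thesis using dm(3)[of j d' m'] m' by simp
  qed
qed

end

lemmas op_apply = plus_fun_apply zero_fun_apply minus_apply uminus_apply comp_apply

declare op_apply [simp del]

text \<open>Multiplying the weight by \<open>w\<^sub>i\<close> amounts to composing with
  \<open>\<theta>\<^sub>i - u\<^sub>i\<close> on the left, because the shift by \<open>u\<close>
  changes the eigenvalue of \<open>\<theta>\<^sub>i\<close> by \<open>u\<^sub>i\<close>.\<close>

lemma tuple_op_realize_shift:
  assumes "leading_form k p h" "\<And>i. 0 \<le> u $ i"
  shows "\<exists>c. bounded_coeffs k (Suc s) c \<and> tuple_op c s = shift_op u p \<and> (\<forall>t. t \<noteq> s \<longrightarrow> tuple_op c t = 0)"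
proof -
  define good where "good k p c \<longleftrightarrow> bounded_coeffs k (Suc s) c \<and> tuple_op c s = shift_op u p \<and>
    (\<forall>t. t \<noteq> s \<longrightarrow> tuple_op c t = 0)" for k p c
  have add: "good k (p + q) (c + d)" if "good k p c" "good k q d" for k p q c d
    using that by (auto simp: good_def tuple_op_add shift_op_add intro: bounded_coeffs_add)
  have "\<exists>c. good k p c"
    using assms(1)
  proof (induction rule: leading_form.induct)
    case (zero k)
    have "good k 0 0" by (simp add: good_def bounded_coeffs_def)
    then show ?case by (auto simp: zero_fun_def)
  next
    case (const a)
    have "u = ivec (\<chi> i. nat (u $ i))" using assms(2) by (simp add: ivec_def vec_eq_iff)
    then have "good 0 (\<lambda>_. a) (Poly_Mapping.single ((\<chi> i. nat (u $ i)), 0, s) a)"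
      by (simp add: good_def bounded_coeffs_def tuple_op_single)
    then show ?case by blast
  next
    case (coord k p h i)
    then obtain c where c: "good k p c" by blast
    define d where "d = theta_times i c + scale_coeffs (- of_int (u $ i)) c"
    have "tuple_op d s = (theta i \<circ> shift_op u p) + (shift_op 0 (\<lambda>_. - of_int (u $ i)) \<circ> shift_op u p)"
      using c by (simp add: d_def tuple_op_add tuple_op_theta_times tuple_op_scale good_def)
    also have "\<dots> = shift_op u ((\<lambda>w. of_int ((w + u) $ i) * p w) + (\<lambda>w. - of_int (u $ i) * p w))"
      by (simp add: theta_comp shift_op_comp shift_op_add)
    also have "(\<lambda>w. of_int ((w + u) $ i) * p w) + (\<lambda>w. - of_int (u $ i) * p w) = (\<lambda>w. of_int (w $ i) * p w)"
      by (auto simp: fun_eq_iff algebra_simps op_apply)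
    finally have "tuple_op d s = shift_op u (\<lambda>w. of_int (w $ i) * p w)" .
    moreover have "tuple_op d t = 0" if "t \<noteq> s" for t
    proof -
      have "tuple_op c t = 0" using c that by (simp add: good_def)
      then have "tuple_op d t = (theta i \<circ> (0 :: 'a dop)) + (shift_op 0 (\<lambda>_. - of_int (u $ i)) \<circ> (0 :: 'a dop))"
        by (simp only: d_def tuple_op_add tuple_op_theta_times tuple_op_scale)
      then show ?thesis by (simp add: fun_eq_iff theta_eq op_apply)
    qed
    moreover have "bounded_coeffs (k + 1) (Suc s) d"
      using c unfolding d_def good_def
      by (intro bounded_coeffs_add bounded_theta_times) (auto intro: bounded_coeffs_mono[OF bounded_coeffs_scale])
    ultimately have "good (k + 1) (\<lambda>w. of_int (w $ i) * p w) d" by (simp add: good_def)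
    then show ?case by blast
  next
    case (add k p h q g)
    then show ?case using \<open>\<And>k p q c d. good k p c \<Longrightarrow> good k q d \<Longrightarrow> good k (p + q) (c + d)\<close> by blast
  next
    case (lift k p h)
    then obtain c where "good k p c" by blast
    then have "good (k + 1) p c" using bounded_coeffs_mono[of k _ c "k + 1"] by (simp add: good_def)
    then show ?case by blast
  qed
  then show ?thesis by (simp only: good_def)
qed

lemma tuple_op_realize:
  fixes P :: "('n::finite) dop"
  assumes "P \<in> torus_filt k"
  shows "eventually (\<lambda>n. \<exists>c. bounded_coeffs k (Suc s) c \<and> tuple_op c s = xpow n \<circ> P \<and>
    (\<forall>t. t \<noteq> s \<longrightarrow> tuple_op c t = 0)) sequentially"
proof -
  define good where "good n P \<longleftrightarrow> (\<exists>c. bounded_coeffs k (Suc s) c \<and> tuple_op c s = xpow n \<circ> P \<and>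
    (\<forall>t. t \<noteq> s \<longrightarrow> tuple_op c t = 0))" for n and P :: "'n dop"
  obtain f where "has_symbol UNIV k P f" using assms by (auto simp: torus_filt_def)
  then have "\<exists>N. \<forall>n\<ge>N. good n P"
  proof (induction rule: has_symbol.induct)
    case zero
    have "good n 0" for n
      unfolding good_def by (intro exI[of _ 0]) (auto simp: bounded_coeffs_def xpow_def fun_eq_iff op_apply)
    then show ?case by blast
  next
    case (shift u p h)
    define N where "N = nat (Max (range (\<lambda>i. \<bar>u $ i\<bar>)))"
    have N: "\<bar>u $ i\<bar> \<le> int N" for i
    proof -
      have "\<bar>u $ i\<bar> \<le> Max (range (\<lambda>i. \<bar>u $ i\<bar>))" by (rule Max_ge) auto
      then show ?thesis unfolding N_def by linarith
    qed
    have "good n (shift_op u p)" if "n \<ge> N" for n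
    proof -
      have "0 \<le> (vec (int n) + u) $ i" for i using N[of i] that by simp
      from tuple_op_realize_shift[OF shift.hyps(2) this, of s]
      show ?thesis by (simp add: good_def xpow_def shift_op_comp)
    qed
    then show ?case by blast
  next
    case (add P f Q g)
    then obtain M N where MN: "\<forall>n\<ge>M. good n P" "\<forall>n\<ge>N. good n Q" by blast
    have "good n (P + Q)" if "n \<ge> max M N" for n
    proof -
      obtain c where c: "bounded_coeffs k (Suc s) c" "tuple_op c s = xpow n \<circ> P" "\<forall>t. t \<noteq> s \<longrightarrow> tuple_op c t = 0"
        using MN(1) \<open>n \<ge> max M N\<close> by (auto simp: good_def)
      obtain d where d: "bounded_coeffs k (Suc s) d" "tuple_op d s = xpow n \<circ> Q" "\<forall>t. t \<noteq> s \<longrightarrow> tuple_op d t = 0"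
        using MN(2) \<open>n \<ge> max M N\<close> by (auto simp: good_def)
      have eq: "tuple_op (c + d) s = xpow n \<circ> (P + Q)"
        using c(2) d(2) shift_comp_plus[of _ _ P Q] by (simp only: tuple_op_add xpow_def)
      show ?thesis
        unfolding good_def using c d eq
        by (intro exI[of _ "c + d"]) (auto simp: tuple_op_add intro: bounded_coeffs_add)
    qed
    then show ?case by blast
  qed auto
  then show ?thesis by (simp add: good_def eventually_sequentially)
qed

text \<open>The result on coefficient families covers nonnegative exponents of \<open>x\<close>.
  Each tuple is multiplied by its own power of \<open>x_1 ... x_n\<close>, and since these powers
  are invertible of order 0 they can be removed from the resulting relation.\<close>

lemma rees_noetherian:
  fixes U :: "nat \<Rightarrow> nat \<Rightarrow> ('n::finite) dop" and l :: "nat \<Rightarrow> int"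
  assumes U: "\<And>j t. t < r \<Longrightarrow> U j t \<in> torus_filt (l j)"
  shows "\<exists>j R. (\<forall>i<j. R i \<in> torus_filt (l j - l i)) \<and> (\<forall>t<r. U j t = (\<Sum>i<j. R i \<circ> U i t))"
proof -
  have "\<exists>n c. bounded_coeffs (l j) r c \<and> (\<forall>t<r. tuple_op c t = xpow n \<circ> U j t)" for j
  proof -
    have "eventually (\<lambda>n. \<forall>t\<in>{..<r}. \<exists>c. bounded_coeffs (l j) (Suc t) c \<and> tuple_op c t = xpow n \<circ> U j t \<and>
        (\<forall>t'. t' \<noteq> t \<longrightarrow> tuple_op c t' = 0)) sequentially"
      using tuple_op_realize[OF U] by (intro eventually_ball_finite) auto
    then obtain n where "\<forall>t\<in>{..<r}. \<exists>c. bounded_coeffs (l j) (Suc t) c \<and> tuple_op c t = xpow n \<circ> U j t \<and>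
        (\<forall>t'. t' \<noteq> t \<longrightarrow> tuple_op c t' = 0)" by (auto simp: eventually_sequentially)
    then obtain c where c: "\<And>t. t < r \<Longrightarrow> bounded_coeffs (l j) (Suc t) (c t)"
      "\<And>t. t < r \<Longrightarrow> tuple_op (c t) t = xpow n \<circ> U j t"
      "\<And>t t'. t < r \<Longrightarrow> t' \<noteq> t \<Longrightarrow> tuple_op (c t) t' = 0"
      by (metis lessThan_iff)
    have "bounded_coeffs (l j) r (\<Sum>t<r'. c t)" if "r' \<le> r" for r'
      using that
    proof (induction r')
      case (Suc t)
      have "bounded_coeffs (l j) r (c t)"
        using c(1)[of t] Suc.prems unfolding bounded_coeffs_def by fastforce
      then show ?case using Suc by (auto intro: bounded_coeffs_add)
    qed (simp add: bounded_coeffs_def)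
    moreover have "tuple_op (\<Sum>t<r. c t) t' = xpow n \<circ> U j t'" if "t' < r" for t'
    proof -
      have "tuple_op (\<Sum>t<r. c t) t' = (\<Sum>t<r. if t = t' then xpow n \<circ> U j t' else 0)"
        unfolding tuple_op_sum using c by (intro sum.cong) auto
      then show ?thesis using that by simp
    qed
    ultimately show ?thesis by blast
  qed
  then obtain n c where c: "\<And>j. bounded_coeffs (l j) r (c j)" "\<And>j t. t < r \<Longrightarrow> tuple_op (c j) t = xpow (n j) \<circ> U j t"
    by metis
  obtain code :: "'n mon \<Rightarrow> nat" and p q where "monomial_code code p q" using monomial_code_exists by blast
  from monomial_code.rees_noetherian_coeffs[OF this, of l r c] c(1)
  obtain j R where R: "\<And>i. i < j \<Longrightarrow> R i \<in> torus_filt (l j - l i)"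
    "\<And>s. tuple_op (c j) s = (\<Sum>i<j. R i \<circ> tuple_op (c i) s)" by blast
  have x0: "xpow m \<in> torus_filt 0" "xinv m \<in> torus_filt 0" for m
    using xpow_symbol xinv_symbol by (auto simp: torus_filt_def)
  define R' where "R' i = xinv (n j) \<circ> (R i \<circ> xpow (n i))" for i
  have "R' i \<in> torus_filt (l j - l i)" if "i < j" for i
    using torus_filt_closed(6)[OF x0(2) torus_filt_closed(6)[OF R(1)[OF that] x0(1)]] by (simp add: R'_def)
  moreover have "U j t = (\<Sum>i<j. R' i \<circ> U i t)" if t: "t < r" for t
  proof -
    have "U j t = xinv (n j) \<circ> (xpow (n j) \<circ> U j t)"
      by (simp only: o_assoc xinv_xpow id_comp)
    also have "xpow (n j) \<circ> U j t = (\<Sum>i<j. R i \<circ> (xpow (n i) \<circ> U i t))"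
      using R(2)[of t] c(2)[OF t] by simp
    also have "xinv (n j) \<circ> \<dots> = (\<Sum>i<j. R' i \<circ> U i t)"
      by (simp add: torus_sum_comp_right xinv_torus R'_def comp_assoc)
    finally show ?thesis .
  qed
  ultimately show ?thesis by blast
qed

section \<open>Dependence of the support on the generating set\<close>

locale torus_module = filtered_dop_module torus_dops N torus_filt
  for N :: "(('n::finite) dop, 'v) module" (structure)
begin

text \<open>The homomorphism from a free module to \<open>N\<close> that sends the
  \<open>t\<close>-th basis vector to \<open>e t\<close>; through it relations among tuples of
  operators become relations in \<open>N\<close>.\<close>

primrec eval_tuple :: "(nat \<Rightarrow> 'v) \<Rightarrow> (nat \<Rightarrow> 'n dop) \<Rightarrow> nat \<Rightarrow> 'v" where
  "eval_tuple e U 0 = \<zero>\<^bsub>N\<^esub>"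
| "eval_tuple e U (Suc n) = eval_tuple e U n \<oplus>\<^bsub>N\<^esub> U n \<odot>\<^bsub>N\<^esub> e n"

lemma eval_tuple_closed:
  "(\<And>t. t < n \<Longrightarrow> U t \<in> carrier torus_dops) \<Longrightarrow> (\<And>t. t < n \<Longrightarrow> e t \<in> carrier N) \<Longrightarrow>
    eval_tuple e U n \<in> carrier N"
  by (induction n) (auto intro: smult_closed)

lemma eval_tuple_add:
  assumes "\<And>t. t < n \<Longrightarrow> U t \<in> carrier torus_dops" "\<And>t. t < n \<Longrightarrow> V t \<in> carrier torus_dops"
    "\<And>t. t < n \<Longrightarrow> e t \<in> carrier N"
  shows "eval_tuple e (\<lambda>t. U t + V t) n = eval_tuple e U n \<oplus>\<^bsub>N\<^esub> eval_tuple e V n"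
  using assms
proof (induction n)
  case (Suc n)
  have "eval_tuple e U n \<in> carrier N" "eval_tuple e V n \<in> carrier N"
    "U n \<odot>\<^bsub>N\<^esub> e n \<in> carrier N" "V n \<odot>\<^bsub>N\<^esub> e n \<in> carrier N"
    using Suc.prems by (auto intro!: eval_tuple_closed smult_closed)
  then show ?case using Suc by (simp add: act_add M.a_ac)
qed simp

lemma eval_tuple_act:
  assumes "R \<in> carrier torus_dops" "\<And>t. t < n \<Longrightarrow> U t \<in> carrier torus_dops" "\<And>t. t < n \<Longrightarrow> e t \<in> carrier N"
  shows "eval_tuple e (\<lambda>t. R \<circ> U t) n = R \<odot>\<^bsub>N\<^esub> eval_tuple e U n"
  using assms
proof (induction n)
  case (Suc n)
  have "eval_tuple e U n \<in> carrier N" "U n \<odot>\<^bsub>N\<^esub> e n \<in> carrier N"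
    using Suc.prems by (auto intro!: eval_tuple_closed smult_closed)
  then show ?case using Suc by (simp add: act_comp smult_r_distr)
qed (simp add: act_zero_right)

lemma eval_tuple_zero: "(\<And>t. t < n \<Longrightarrow> e t \<in> carrier N) \<Longrightarrow> eval_tuple e (\<lambda>_. 0) n = \<zero>\<^bsub>N\<^esub>"
  by (induction n) (auto simp: act_zero)

lemma eval_tuple_cong: "(\<And>t. t < n \<Longrightarrow> U t = V t) \<Longrightarrow> eval_tuple e U n = eval_tuple e V n"
  by (induction n) auto

lemma eval_tuple_unit:
  assumes "t < n" "P \<in> carrier torus_dops" "\<And>t. t < n \<Longrightarrow> e t \<in> carrier N"
  shows "eval_tuple e (\<lambda>t'. if t' = t then P else 0) n = P \<odot>\<^bsub>N\<^esub> e t"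
  using assms
proof (induction n)
  case (Suc n)
  show ?case
  proof (cases "t = n")
    case True
    have "eval_tuple e (\<lambda>t'. if t' = t then P else 0) n = eval_tuple e (\<lambda>_. 0) n"
      using True by (intro eval_tuple_cong) auto
    then show ?thesis using True Suc.prems by (simp add: eval_tuple_zero smult_closed)
  next
    case False
    then show ?thesis using Suc by (simp add: act_zero smult_closed)
  qed
qed simp

lemma filt_eval_tuple:
  assumes e: "\<And>t. t < r \<Longrightarrow> e t \<in> carrier N" and S: "S = e ` {..<r}" and "u \<in> filt S l"
  shows "\<exists>U. (\<forall>t<r. U t \<in> torus_filt l) \<and> u = eval_tuple e U r"
  using assms(3)
proof (induction rule: span_induct)
  case zero
  then show ?case using e torus_filt_closed(2) by (intro exI[of _ "\<lambda>_. 0"]) (auto simp: eval_tuple_zero)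
next
  case (gen P s)
  then obtain t where t: "t < r" "s = e t" using S by blast
  then show ?case
    using gen e torus_filt_closed(2) F_closed[OF gen(1)]
    by (intro exI[of _ "\<lambda>t'. if t' = t then P else 0"]) (auto simp: eval_tuple_unit)
next
  case (add x y)
  then obtain U V where "\<forall>t<r. U t \<in> torus_filt l" "x = eval_tuple e U r"
    "\<forall>t<r. V t \<in> torus_filt l" "y = eval_tuple e V r" by blast
  moreover from this have "eval_tuple e (\<lambda>t. U t + V t) r = eval_tuple e U r \<oplus>\<^bsub>N\<^esub> eval_tuple e V r"
    using e F_closed by (intro eval_tuple_add) blast+
  ultimately show ?case
    by (intro exI[of _ "\<lambda>t. U t + V t"]) (auto intro: torus_filt_closed(4))
qed (use S e F_sub F_uminus in auto)

lemma funpow_torus_filt: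
  assumes "has_symbol UNIV k P f"
  shows "has_symbol UNIV (int j * k) (P ^^ j) (\<lambda>x y. f x y ^ j)"
proof (induction j)
  case 0
  then show ?case using has_symbol_id[of UNIV] by (simp add: id_def)
next
  case (Suc j)
  have "has_symbol UNIV (k + int j * k) (P \<circ> P ^^ j) (\<lambda>x y. f x y * f x y ^ j)"
    using assms Suc by (rule has_symbol_comp) simp
  then show ?case by (simp add: algebra_simps)
qed

text \<open>If \<open>P\<close> lowers the filtration generated by \<open>S'\<close> relative to its order, then the elements \<open>P\<^sup>j s\<close> lie
  in unexpectedly low degree; noetherianity of the Rees module makes one of them a combination of its
  predecessors, so that a relation with principal symbol \<open>f\<^sup>j\<close> kills \<open>s\<close>.\<close>

lemma power_symbol_annihilates:
  assumes S': "finite S'" "S' \<subseteq> carrier N" and s: "s \<in> filt S' a"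
    and P: "has_symbol UNIV k P f" "\<And>s'. s' \<in> S' \<Longrightarrow> P \<odot>\<^bsub>N\<^esub> s' \<in> filt S' (k - 1)"
  shows "\<exists>j Q. has_symbol UNIV (int j * k) Q (\<lambda>x y. f x y ^ j) \<and> Q \<odot>\<^bsub>N\<^esub> s = \<zero>\<^bsub>N\<^esub>"
proof -
  obtain e r where er: "S' = e ` {i::nat. i < r}"
    using finite_imp_nat_seg_image_inj_on[OF S'(1)] by blast
  then have er: "S' = e ` {..<r}" by auto
  have e: "e t \<in> carrier N" if "t < r" for t using er S'(2) that by auto
  have sN: "s \<in> carrier N" using s filt_closed[OF S'(2)] by blast
  have Pc: "P \<in> torus_filt k" using P(1) by (auto simp: torus_filt_def)
  have Pj: "P ^^ j \<in> carrier torus_dops" for j using funpow_torus_filt[OF P(1)] by (rule has_symbol_carrier)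
  \<comment> \<open>\<open>P^j\<close> has order \<open>j k\<close>, but each application gains one
    step: \<open>P^j s\<close> lies in degree \<open>a + j (k - 1)\<close>.\<close>
  define l where "l j = a + int j * (k - 1)" for j
  have "(P ^^ j) \<odot>\<^bsub>N\<^esub> s \<in> filt S' (l j)" for j
  proof (induction j)
    case 0
    then show ?case using s sN by (simp add: l_def act_id[unfolded id_def] id_def)
  next
    case (Suc j)
    have "(P ^^ Suc j) \<odot>\<^bsub>N\<^esub> s = P \<odot>\<^bsub>N\<^esub> ((P ^^ j) \<odot>\<^bsub>N\<^esub> s)"
      using act_comp[OF F_closed[OF Pc] Pj sN] by simp
    also have "\<dots> \<in> filt S' (l j + k - 1)"
      using filt_lower[OF S'(2) Pc P(2) Suc] by blast
    also have "l j + k - 1 = l (Suc j)" by (simp add: l_def algebra_simps)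
    finally show ?case .
  qed
  then have "\<exists>U. (\<forall>t<r. U t \<in> torus_filt (l j)) \<and> (P ^^ j) \<odot>\<^bsub>N\<^esub> s = eval_tuple e U r" for j
    using filt_eval_tuple[of r e S', OF e er] by blast
  then obtain U where U: "\<And>j t. t < r \<Longrightarrow> U j t \<in> torus_filt (l j)"
    "\<And>j. (P ^^ j) \<odot>\<^bsub>N\<^esub> s = eval_tuple e (U j) r" by metis
  obtain j R where R: "\<And>i. i < j \<Longrightarrow> R i \<in> torus_filt (l j - l i)"
    "\<And>t. t < r \<Longrightarrow> U j t = (\<Sum>i<j. R i \<circ> U i t)"
    using rees_noetherian[of r U l] U(1) by blast
  have Rc: "R i \<in> carrier torus_dops" if "i < j" for i using R(1)[OF that] F_closed by blast
  have Uc: "U i t \<in> carrier torus_dops" if "t < r" for i t using U(1)[OF that] F_closed by blast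
  have sum: "(\<Sum>i<n. R i \<circ> U i t) \<in> carrier torus_dops" if "n \<le> j" "t < r" for n t
    using that by (induction n) (auto intro!: torus_dops_closed Rc Uc)
  have sumP: "(\<Sum>i<n. R i \<circ> P ^^ i) \<in> carrier torus_dops" if "n \<le> j" for n
    using that by (induction n) (auto intro!: torus_dops_closed Rc Pj)
  have "eval_tuple e (\<lambda>t. \<Sum>i<n. R i \<circ> U i t) r = (\<Sum>i<n. R i \<circ> P ^^ i) \<odot>\<^bsub>N\<^esub> s" if "n \<le> j" for n
    using that
  proof (induction n)
    case 0
    then show ?case using e sN by (simp add: eval_tuple_zero act_zero)
  next
    case (Suc n)
    have n: "n < j" using Suc.prems by simp
    have "eval_tuple e (\<lambda>t. (\<Sum>i<n. R i \<circ> U i t) + (R n \<circ> U n t)) r =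
      eval_tuple e (\<lambda>t. \<Sum>i<n. R i \<circ> U i t) r \<oplus>\<^bsub>N\<^esub> eval_tuple e (\<lambda>t. R n \<circ> U n t) r"
      using sum n e by (intro eval_tuple_add) (auto intro!: torus_dops_closed Rc Uc)
    also have "eval_tuple e (\<lambda>t. R n \<circ> U n t) r = R n \<odot>\<^bsub>N\<^esub> ((P ^^ n) \<odot>\<^bsub>N\<^esub> s)"
      using n Uc e by (simp add: eval_tuple_act Rc U(2))
    also have "\<dots> = (R n \<circ> P ^^ n) \<odot>\<^bsub>N\<^esub> s"
      using n sN by (simp add: act_comp Rc Pj)
    also have "eval_tuple e (\<lambda>t. \<Sum>i<n. R i \<circ> U i t) r = (\<Sum>i<n. R i \<circ> P ^^ i) \<odot>\<^bsub>N\<^esub> s"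
      using Suc by simp
    also have "(\<Sum>i<n. R i \<circ> P ^^ i) \<odot>\<^bsub>N\<^esub> s \<oplus>\<^bsub>N\<^esub> (R n \<circ> P ^^ n) \<odot>\<^bsub>N\<^esub> s =
      ((\<Sum>i<n. R i \<circ> P ^^ i) + (R n \<circ> P ^^ n)) \<odot>\<^bsub>N\<^esub> s"
      using n sN sumP[of n] torus_dops_closed(6)[OF Rc[OF n] Pj] by (simp add: act_add)
    finally show ?case by simp
  qed
  from this[OF order_refl]
  have eq: "(P ^^ j) \<odot>\<^bsub>N\<^esub> s = (\<Sum>i<j. R i \<circ> P ^^ i) \<odot>\<^bsub>N\<^esub> s"
    unfolding U(2)[of j] using eval_tuple_cong[of r "U j" "\<lambda>t. \<Sum>i<j. R i \<circ> U i t" e] R(2) by simp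
  define Q where "Q = P ^^ j - (\<Sum>i<j. R i \<circ> P ^^ i)"
  have "Q \<odot>\<^bsub>N\<^esub> s = \<zero>\<^bsub>N\<^esub>"
    unfolding Q_def using eq sN Pj[of j] sumP[of j]
    by (simp add: act_diff M.minus_eq M.r_neg smult_closed)
  moreover have "has_symbol UNIV (int j * k) (R i \<circ> P ^^ i) (\<lambda>_ _. 0)" if ij: "i < j" for i
  proof -
    obtain g where "has_symbol UNIV (l j - l i) (R i) g" using R(1)[OF ij] by (auto simp: torus_filt_def)
    then have "has_symbol UNIV ((l j - l i) + int i * k) (R i \<circ> P ^^ i) (\<lambda>x y. g x y * f x y ^ i)"
      using funpow_torus_filt[OF P(1)] by (rule has_symbol_comp) simp
    \<comment> \<open>The order is \<open>(l j - l i) + i k = j k - (j - i)\<close>, strictly below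
      \<open>j k\<close>, so these terms do not contribute to the symbol.\<close>
    then show ?thesis by (rule has_symbol_mono) (use ij in \<open>simp add: l_def algebra_simps\<close>)
  qed
  then have "has_symbol UNIV (int j * k) (\<Sum>i<j. R i \<circ> P ^^ i) (\<lambda>x y. \<Sum>i<j. 0)"
    by (intro has_symbol_sum) auto
  then have "has_symbol UNIV (int j * k) Q (\<lambda>x y. f x y ^ j - (\<Sum>i<j. 0))"
    unfolding Q_def by (intro has_symbol_diff funpow_torus_filt P(1))
  ultimately show ?thesis by auto
qed

text \<open>Each generator \<open>s\<close> is annihilated by an operator whose symbol is a power of
  \<open>f\<close>; the product of these over \<open>S\<close> lowers the filtration of
  \<open>S\<close>, and its symbol is again a power of \<open>f\<close>. So the annihilators compare
  up to radical, and zero sets see no more than that.\<close>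

theorem log_support_mono:
  assumes S: "finite S" "S \<subseteq> carrier N" and S': "finite S'" "S' \<subseteq> carrier N"
    and sub: "\<And>s. s \<in> S \<Longrightarrow> \<exists>a. s \<in> filt S' a"
  shows "log_support N S \<subseteq> log_support N S'"
  unfolding log_support_def
proof clarify
  fix x y k P f
  assume supp: "\<forall>k P f. has_symbol UNIV k P f \<longrightarrow> (\<forall>s\<in>S. P \<odot>\<^bsub>N\<^esub> s \<in> filt S (k - 1)) \<longrightarrow> f x y = 0"
    and x: "x \<in> torus" and P: "has_symbol UNIV k P f" "\<forall>s\<in>S'. P \<odot>\<^bsub>N\<^esub> s \<in> filt S' (k - 1)"
  have "\<exists>Q K j. has_symbol UNIV K Q (\<lambda>x y. f x y ^ j) \<and> (\<forall>s\<in>S0. Q \<odot>\<^bsub>N\<^esub> s \<in> filt S (K - 1))"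
    if "finite S0" "S0 \<subseteq> S" for S0
    using that
  proof (induction S0)
    case empty
    have "has_symbol UNIV 0 id (\<lambda>x y. f x y ^ 0)" using has_symbol_id[of UNIV] by simp
    then show ?case by blast
  next
    case (insert s S0)
    then obtain Q K j where Q: "has_symbol UNIV K Q (\<lambda>x y. f x y ^ j)" "\<forall>s\<in>S0. Q \<odot>\<^bsub>N\<^esub> s \<in> filt S (K - 1)"
      by blast
    obtain a where a: "s \<in> filt S' a" using sub insert.prems by blast
    obtain j' Q' where Q': "has_symbol UNIV (int j' * k) Q' (\<lambda>x y. f x y ^ j')" "Q' \<odot>\<^bsub>N\<^esub> s = \<zero>\<^bsub>N\<^esub>"
      using power_symbol_annihilates[OF S' a P(1)] P(2) by blast
    let ?K = "K + int j' * k"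
    have c: "Q \<in> carrier torus_dops" "Q' \<in> carrier torus_dops"
      using Q(1) Q'(1) by (auto intro: has_symbol_carrier)
    have c': "(Q \<circ> Q') - (Q' \<circ> Q) \<in> torus_filt (?K - 1)"
      using has_symbol_comm[OF Q(1) Q'(1)] by (auto simp: torus_filt_def)
    have "(Q \<circ> Q') \<odot>\<^bsub>N\<^esub> t \<in> filt S (?K - 1)" if t: "t \<in> insert s S0" for t
    proof (cases "t = s")
      case True
      then show ?thesis using Q'(2) c insert.prems S(2) act_zero_right span_zero by (auto simp: act_comp)
    next
      case False
      then have tS: "t \<in> S0" "t \<in> S" "t \<in> carrier N" using t insert.prems S(2) by auto
      \<comment> \<open>Exchanging \<open>Q\<close> and \<open>Q'\<close> brings \<open>Q\<close>
        next to \<open>t\<close>, where it gains a step; the commutator itself is one order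
        lower.\<close>
      have "(Q \<circ> Q') \<odot>\<^bsub>N\<^esub> t = (((Q \<circ> Q') - (Q' \<circ> Q)) + (Q' \<circ> Q)) \<odot>\<^bsub>N\<^esub> t" by simp
      also have "\<dots> = ((Q \<circ> Q') - (Q' \<circ> Q)) \<odot>\<^bsub>N\<^esub> t \<oplus>\<^bsub>N\<^esub> (Q' \<circ> Q) \<odot>\<^bsub>N\<^esub> t"
        using c tS by (intro act_add R_diff R_closed)
      also have "(Q' \<circ> Q) \<odot>\<^bsub>N\<^esub> t = Q' \<odot>\<^bsub>N\<^esub> (Q \<odot>\<^bsub>N\<^esub> t)" using c tS by (intro act_comp)
      also have "((Q \<circ> Q') - (Q' \<circ> Q)) \<odot>\<^bsub>N\<^esub> t \<oplus>\<^bsub>N\<^esub> Q' \<odot>\<^bsub>N\<^esub> (Q \<odot>\<^bsub>N\<^esub> t) \<in> filt S (?K - 1)"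
      proof (rule span_add)
        show "((Q \<circ> Q') - (Q' \<circ> Q)) \<odot>\<^bsub>N\<^esub> t \<in> filt S (?K - 1)" using c' tS by (intro span_incl)
        have "Q' \<in> torus_filt (int j' * k)" using Q'(1) by (auto simp: torus_filt_def)
        from filt_act[OF S(2) this, of "Q \<odot>\<^bsub>N\<^esub> t" "K - 1"] show "Q' \<odot>\<^bsub>N\<^esub> (Q \<odot>\<^bsub>N\<^esub> t) \<in> filt S (?K - 1)"
          using Q(2) tS by (simp add: algebra_simps)
      qed
      finally show ?thesis .
    qed
    moreover have "has_symbol UNIV ?K (Q \<circ> Q') (\<lambda>x y. f x y ^ j * f x y ^ j')"
      using Q(1) Q'(1) by (rule has_symbol_comp) simp
    then have "has_symbol UNIV ?K (Q \<circ> Q') (\<lambda>x y. f x y ^ (j + j'))" by (simp add: power_add)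
    ultimately show ?case by blast
  qed
  from this[OF S(1) order_refl] obtain Q K j where "has_symbol UNIV K Q (\<lambda>x y. f x y ^ j)"
    "\<forall>s\<in>S. Q \<odot>\<^bsub>N\<^esub> s \<in> filt S (K - 1)" by blast
  then have "f x y ^ j = 0" using supp by blast
  then show "f x y = 0" by simp
qed

end

section \<open>Unimodular splitting of the exponent lattice along \<open>A\<close>\<close>

section \<open>Splitting the torus\<close>

lemma comp_plus_torus: "P \<in> carrier torus_dops \<Longrightarrow> P \<circ> (Q + Q') = (P \<circ> Q) + (P \<circ> Q')"
  by (simp add: fun_eq_iff op_apply torus_dops_additive)

lemma comp_zero_torus: "P \<in> carrier torus_dops \<Longrightarrow> P \<circ> 0 = 0"
  using torus_dops_additive[of P 0 0] by (simp add: fun_eq_iff op_apply)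

lemma matrix_vector_mult_diff: "M *v (u - v) = M *v u - M *v (v :: 'a::ring_1 ^ 'n)"
  by (simp add: matrix_vector_mult_def vec_eq_iff sum_subtractf algebra_simps)

lemma matrix_vector_mult_plus: "M *v (u + v) = M *v u + M *v (v :: 'a::ring_1 ^ 'n)"
  by (simp add: matrix_vector_mult_def vec_eq_iff sum.distrib algebra_simps)

lemma matrix_vector_mult_zero [simp]: "M *v (0 :: 'a::ring_1 ^ 'n) = 0"
  by (simp add: matrix_vector_mult_def vec_eq_iff)

lemma matrix_add_vector_mult: "(M + N) *v v = M *v v + N *v (v :: 'a::ring_1 ^ 'n)"
  by (simp add: matrix_vector_mult_def vec_eq_iff sum.distrib algebra_simps)

lemma map_matrix_of_int_mult:
  "map_matrix of_int (M ** N) = map_matrix of_int M ** (map_matrix of_int N :: 'a::ring_1 ^ 'k ^ 'm)"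
  by (simp add: map_matrix_def matrix_matrix_mult_def vec_eq_iff)

lemma map_matrix_of_int_one: "map_matrix of_int (mat 1) = (mat 1 :: 'a::ring_1 ^ 'm ^ 'm)"
  by (auto simp: map_matrix_def mat_def vec_eq_iff)

lemma map_matrix_of_int_add:
  "map_matrix of_int (M + N) = map_matrix of_int M + (map_matrix of_int N :: 'a::ring_1 ^ 'k ^ 'm)"
  by (simp add: map_matrix_def vec_eq_iff)

lemma map_matrix_of_int_zero: "map_matrix of_int 0 = (0 :: 'a::ring_1 ^ 'k ^ 'm)"
  by (simp add: map_matrix_def vec_eq_iff)

lemma map_matrix_of_int_eq:
  "map_matrix of_int M = (map_matrix of_int N :: 'a::ring_char_0 ^ 'k ^ 'm) \<longleftrightarrow> M = N"
  by (simp add: map_matrix_def vec_eq_iff)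

lemma sum_UNIV_Plus: "(\<Sum>k\<in>UNIV. f k) = (\<Sum>i\<in>UNIV. f (Inl i)) + (\<Sum>j\<in>UNIV. f (Inr j))"
  for f :: "'a::finite + 'b::finite \<Rightarrow> 'c::comm_monoid_add"
  by (simp flip: UNIV_Plus_UNIV add: sum.Plus comp_def)

lemma matrix_eqI: "(\<And>v. M *v v = N *v (v :: 'a::ring_1 ^ 'n::finite)) \<Longrightarrow> M = N"
proof -
  assume *: "\<And>v. M *v v = N *v v"
  have "M $ i $ j = N $ i $ j" for i j
    using arg_cong[OF *[of "axis j 1"], of "\<lambda>v. v $ i"]
    by (simp add: matrix_vector_mult_def axis_def if_distrib cong: if_cong)
  then show ?thesis by (simp add: vec_eq_iff)
qed

text \<open>Integer matrices with \<open>[R | B]\<close> inverse to \<open>[A; L]\<close>; they split the \<open>n\<close>-torus as the product of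
  the acting torus (via \<open>A\<close>) and the quotient torus (via \<open>L = K\<^sup>-\<^sup>1 A\<^sup>\<bottom>\<close>).\<close>

locale split_torus =
  fixes A :: "int ^ ('n::finite) ^ ('d::finite)" and L :: "int ^ 'n ^ ('m::finite)"
    and R :: "int ^ 'd ^ 'n" and B :: "int ^ 'm ^ 'n"
  assumes AR: "A ** R = mat 1" and AB: "A ** B = 0" and LR: "L ** R = 0" and LB: "L ** B = mat 1"
    and RABL: "R ** A + B ** L = mat 1"

text \<open>The spanning condition on \<open>B\<close> enters here: the columns of \<open>C\<close>
  lie in the integer kernel of \<open>A\<close>, so \<open>C = B K'\<close> with integral
  \<open>K'\<close>, and \<open>K K' = A\<^sup>\<bottom> C = 1\<close>. Hence \<open>K\<close> is
  unimodular and \<open>L = K' A\<^sup>\<bottom>\<close> is an integer matrix.\<close>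

lemma split_torus_exists:
  fixes A :: "int ^ ('n::finite) ^ 'd" and Atil :: "int ^ 'n ^ (('d::finite) + ('m::finite))"
    and B :: "int ^ 'm ^ 'n"
  assumes inv: "invertible Atil" and top: "\<And>i. Atil $ Inl i = A $ i" and B: "spans_integer_kernel A B"
  obtains L R where "split_torus A L R B" "eta_matrix Atil B = map_matrix of_int L"
proof -
  obtain Ai where Ai: "Atil ** Ai = mat 1" "Ai ** Atil = mat 1"
    using inv by (auto simp: invertible_def)
  define R :: "int ^ 'd ^ 'n" where "R = (\<chi> i j. Ai $ i $ Inl j)"
  define C :: "int ^ 'm ^ 'n" where "C = (\<chi> i j. Ai $ i $ Inr j)"
  define P where "P = lower_rows Atil"
  have ent: "(\<Sum>k\<in>UNIV. Atil $ i $ k * Ai $ k $ j) = (if i = j then 1 else 0)" for i j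
    using arg_cong[OF Ai(1), of "\<lambda>M. M $ i $ j"] by (simp add: matrix_matrix_mult_def mat_def)
  have AR: "A ** R = mat 1"
    using ent[of "Inl _" "Inl _"] by (simp add: matrix_matrix_mult_def mat_def R_def top vec_eq_iff)
  have AC: "A ** C = 0"
    using ent[of "Inl _" "Inr _"] by (simp add: matrix_matrix_mult_def mat_def C_def top vec_eq_iff)
  have PR: "P ** R = 0"
    using ent[of "Inr _" "Inl _"] by (simp add: matrix_matrix_mult_def mat_def R_def P_def lower_rows_def vec_eq_iff)
  have PC: "P ** C = mat 1"
    using ent[of "Inr _" "Inr _"] by (simp add: matrix_matrix_mult_def mat_def C_def P_def lower_rows_def vec_eq_iff)
  have RACP: "R ** A + C ** P = mat 1"
  proof -
    have "R ** A + C ** P = Ai ** Atil"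
      by (simp add: matrix_matrix_mult_def vec_eq_iff R_def C_def P_def lower_rows_def sum_UNIV_Plus top)
    then show ?thesis using Ai(2) by simp
  qed
  have "A *v (B *v v) = 0" for v using B unfolding spans_integer_kernel_def by blast
  then have AB: "A ** B = 0"
    by (intro matrix_eqI) (simp flip: matrix_vector_mul_assoc)
  have "\<exists>k. B *v k = C *v axis j 1" for j
  proof -
    have "A *v (C *v axis j 1) = 0" by (simp add: matrix_vector_mul_assoc AC)
    then have "C *v axis j 1 \<in> range ((*v) B)" using B unfolding spans_integer_kernel_def by simp
    then show ?thesis by (metis imageE)
  qed
  then obtain k where k: "\<And>j. B *v k j = C *v axis j 1" by metis
  define K' :: "int ^ 'm ^ 'm" where "K' = (\<chi> i j. k j $ i)"
  have BK': "B ** K' = C"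
  proof -
    have "(B ** K') $ i $ j = C $ i $ j" for i j
      using arg_cong[OF k[of j], of "\<lambda>v. v $ i"]
      by (simp add: matrix_matrix_mult_def matrix_vector_mult_def K'_def axis_def if_distrib cong: if_cong)
    then show ?thesis by (simp add: vec_eq_iff)
  qed
  define K where "K = P ** B"
  have KK': "K ** K' = mat 1" unfolding K_def by (simp add: BK' PC flip: matrix_mul_assoc)
  let ?c = "map_matrix of_int :: int ^ 'm ^ 'm \<Rightarrow> complex ^ 'm ^ 'm"
  have c1: "?c K ** ?c K' = mat 1" by (simp add: KK' map_matrix_of_int_one flip: map_matrix_of_int_mult)
  \<comment> \<open>That a right inverse is also a left inverse is used over the field
    \<open>\<complex>\<close> and carried back to integer entries.\<close>
  then have c2: "?c K' ** ?c K = mat 1" using matrix_left_right_inverse by blast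
  then have "?c (K' ** K) = ?c (mat 1)" by (simp add: map_matrix_of_int_mult map_matrix_of_int_one)
  then have K'K: "K' ** K = mat 1" by (simp only: map_matrix_of_int_eq)
  define L where "L = K' ** P"
  have "split_torus A L R B"
  proof
    show "A ** R = mat 1" "A ** B = 0" by (fact AR AB)+
    show "L ** R = 0" unfolding L_def by (simp add: PR flip: matrix_mul_assoc)
    show "L ** B = mat 1" unfolding L_def using K'K by (simp add: K_def matrix_mul_assoc)
    show "R ** A + B ** L = mat 1" unfolding L_def using RACP by (simp add: BK' matrix_mul_assoc)
  qed
  moreover have "eta_matrix Atil B = map_matrix of_int L"
  proof -
    have "?c K ** matrix_inv (?c K) = mat 1 \<and> matrix_inv (?c K) ** ?c K = mat 1"
      unfolding matrix_inv_def by (rule someI[of _ "?c K'"]) (use c1 c2 in auto)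
    then have "matrix_inv (?c K) ** ?c K = mat 1" ..
    then have "matrix_inv (?c K) ** ?c K ** ?c K' = ?c K'" by simp
    then have "matrix_inv (?c K) = ?c K'" using c1 by (simp flip: matrix_mul_assoc)
    then show ?thesis by (simp add: eta_matrix_def L_def K_def P_def map_matrix_of_int_mult)
  qed
  ultimately show ?thesis by (rule that)
qed

lemma power_int_sum:
  fixes x :: "'a::field"
  assumes "x \<noteq> 0" shows "x powi (\<Sum>i\<in>I. f i) = (\<Prod>i\<in>I. x powi f i)"
  by (induction I rule: infinite_finite_induct) (auto simp: power_int_add assms)

lemma prod_power_int: "(\<Prod>i\<in>I. f i) powi k = (\<Prod>i\<in>I. (f i :: 'a::field) powi k)"
  by (induction I rule: infinite_finite_induct) (auto simp: power_int_mult_distrib)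

definition torus_map :: "int ^ 'm ^ ('n::finite) \<Rightarrow> complex ^ 'n \<Rightarrow> complex ^ ('m::finite)" where
  "torus_map B x = (\<chi> j. tpow x (column j B))"

lemma tpow_matrix:
  assumes "x \<in> torus" shows "tpow x (B *v v) = tpow (torus_map B x) v"
proof -
  have x: "x $ i \<noteq> 0" for i using assms by (simp add: torus_def)
  have "tpow x (B *v v) = (\<Prod>i\<in>UNIV. \<Prod>j\<in>UNIV. (x $ i) powi (B $ i $ j * v $ j))"
    by (simp add: tpow_def matrix_vector_mult_def power_int_sum x)
  also have "\<dots> = (\<Prod>j\<in>UNIV. \<Prod>i\<in>UNIV. (x $ i) powi (B $ i $ j * v $ j))"
    by (rule prod.swap)
  also have "\<dots> = tpow (torus_map B x) v"
    by (simp add: tpow_def torus_map_def column_def prod_power_int power_int_mult)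
  finally show ?thesis .
qed

lemma torus_map_torus: "x \<in> torus \<Longrightarrow> torus_map B x \<in> torus"
  using tpow_nonzero by (auto simp: torus_def torus_map_def)

lemma torus_map_comp:
  assumes "x \<in> torus" shows "torus_map D (torus_map B x) = torus_map (B ** D) x"
proof -
  have "column j (B ** D) = B *v column j D" for j
    by (simp add: column_def matrix_matrix_mult_def matrix_vector_mult_def vec_eq_iff)
  then show ?thesis by (simp add: torus_map_def[of D] torus_map_def[of "B ** D"] tpow_matrix[OF assms])
qed

lemma tpow_axis: "tpow x (axis i 1) = x $ i"
proof -
  have "tpow x (axis i 1) = (\<Prod>j\<in>UNIV. if j = i then x $ i else 1)"
    unfolding tpow_def by (rule prod.cong) (auto simp: axis_def)
  then show ?thesis by simp
qed

lemma torus_map_one: "torus_map (mat 1) x = x"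
proof -
  have "column j (mat 1) = axis j (1::int)" for j :: 'a
    by (auto simp: column_def mat_def axis_def vec_eq_iff)
  then show ?thesis by (simp add: torus_map_def tpow_axis)
qed

section \<open>Operators on \<open>Z\<close> as operators of degree zero on \<open>X\<close>\<close>

section \<open>The homomorphism between the rings of differential operators\<close>

lemma shift_op_sum: "shift_op u (\<lambda>w. \<Sum>i\<in>I. p i w) = (\<Sum>i\<in>I. shift_op u (p i))"
proof (induction I rule: infinite_finite_induct)
  case (insert i I)
  then show ?case using shift_op_add[of u "p i" "\<lambda>w. \<Sum>i\<in>I. p i w"] by (simp add: plus_fun_def)
qed (use shift_op_zero[of u] in \<open>auto simp: zero_fun_def\<close>)

definition push :: "(int ^ 'm \<Rightarrow> int ^ 'n) \<Rightarrow> ('m::finite) laurent \<Rightarrow> ('n::finite) laurent" where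
  "push h g = (\<Sum>v\<in>Poly_Mapping.keys g. Poly_Mapping.single (h v) (Poly_Mapping.lookup g v))"

lemma push_superset:
  assumes "finite V" "Poly_Mapping.keys g \<subseteq> V"
  shows "push h g = (\<Sum>v\<in>V. Poly_Mapping.single (h v) (Poly_Mapping.lookup g v))"
  unfolding push_def by (rule sum.mono_neutral_left) (use assms in \<open>auto simp: in_keys_iff\<close>)

lemma push_add: "push h (f + g) = push h f + push h g"
proof -
  let ?V = "Poly_Mapping.keys f \<union> Poly_Mapping.keys g"
  show ?thesis
    using keys_add[of f g] by (subst (1 2 3) push_superset[of ?V])
      (auto simp: lookup_add single_add sum.distrib)
qed

lemma push_0 [simp]: "push h 0 = 0"
  by (simp add: push_def)

lemma push_single [simp]: "push h (Poly_Mapping.single v c) = Poly_Mapping.single (h v) c"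
  by (simp add: push_superset[of "{v}"])

context split_torus
begin

lemma AB_v: "A *v (B *v v) = 0" by (simp add: matrix_vector_mul_assoc AB)
lemma LB_v: "L *v (B *v v) = v" by (simp add: matrix_vector_mul_assoc LB)
lemma kernel_A: assumes "A *v u = 0" shows "u = B *v (L *v u)"
proof -
  have "u = (R ** A + B ** L) *v u" by (simp add: RABL)
  also have "\<dots> = R *v (A *v u) + B *v (L *v u)"
    by (simp add: matrix_add_vector_mult matrix_vector_mul_assoc)
  finally show ?thesis using assms by simp
qed

text \<open>Write \<open>w = (w - B L w) + B L w\<close>: the first part is carried along unchanged,
  while \<open>Q\<close> acts on the monomial with exponent \<open>L w\<close> and its result is put
  back through \<open>B\<close>. Defined for every map \<open>Q\<close>, with no presentation
  chosen, the construction is visibly additive.\<close>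

definition pull :: "'m dop \<Rightarrow> 'n dop" where
  "pull Q f = (\<Sum>w\<in>Poly_Mapping.keys f. Poly_Mapping.single 0 (Poly_Mapping.lookup f w) *
     push (\<lambda>v. w - B *v (L *v w) + B *v v) (Q (Poly_Mapping.single (L *v w) 1)))"

lemma pull_shift_op: "pull (shift_op v q) = shift_op (B *v v) (\<lambda>w. q (L *v w))"
proof
  fix f :: "'n laurent"
  have "w - B *v (L *v w) + B *v (L *v w + v) = w + B *v v" for w
    by (simp add: matrix_vector_mult_plus)
  then show "pull (shift_op v q) f = shift_op (B *v v) (\<lambda>w. q (L *v w)) f"
    unfolding pull_def shift_op_def[of "B *v v"] shift_op_single push_single mult_single
    by (simp only: add_0_left mult_1_left)
qed

lemma pull_add: "pull (P + Q) = pull P + pull Q"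
  by (rule ext) (simp add: pull_def op_apply push_add distrib_left sum.distrib)

lemma pull_zero: "pull 0 = 0"
  by (rule ext) (simp add: pull_def op_apply)

abbreviation "LC \<equiv> map_matrix of_int L :: complex ^ 'n ^ 'm"

lemma pull_symbol:
  assumes "has_symbol UNIV k Q g"
  shows "has_symbol {u. A *v u = 0} k (pull Q) (\<lambda>x y. g (torus_map B x) (LC *v y))"
  using assms
proof (induction rule: has_symbol.induct)
  case zero
  then show ?case using has_symbol.zero by (simp add: pull_zero)
next
  case (shift v q h)
  have "has_symbol {u. A *v u = 0} k (shift_op (B *v v) (\<lambda>w. q (L *v w)))
     (\<lambda>x y. tpow x (B *v v) * h (LC *v y))"
    using shift AB_v by (intro has_symbol.shift leading_form_linear) auto
  then show ?case unfolding pull_shift_op by (rule has_symbol.cong) (simp add: tpow_matrix)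
next
  case (add P f Q g)
  then show ?case unfolding pull_add by (intro has_symbol.add)
next
  case (cong P f g)
  show ?case by (rule has_symbol.cong[OF cong.IH]) (use cong.hyps torus_map_torus in auto)
qed

lemma pull_torus: "Q \<in> carrier torus_dops \<Longrightarrow> pull Q \<in> carrier torus_dops"
proof -
  assume "Q \<in> carrier torus_dops"
  then obtain k g where "has_symbol UNIV k Q g" by (auto simp: carrier_torus_dops)
  then show ?thesis by (rule has_symbol_carrier[OF pull_symbol])
qed

text \<open>\<open>L B = 1\<close> is the point: after a shift by \<open>B v\<close> the weight is
  evaluated at \<open>L (w + B v) = L w + v\<close>.\<close>

lemma pull_comp:
  assumes "P \<in> carrier torus_dops" "Q \<in> carrier torus_dops"
  shows "pull (P \<circ> Q) = pull P \<circ> pull Q"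
proof -
  have step: "pull (shift_op u p \<circ> Q) = pull (shift_op u p) \<circ> pull Q" for u p
  proof -
    obtain k g where "has_symbol UNIV k Q g" using assms(2) by (auto simp: carrier_torus_dops)
    then show ?thesis
    proof (induction rule: has_symbol.induct)
      case zero
      have "shift_op u p \<circ> 0 = (0 :: 'm dop)" by (simp add: fun_eq_iff op_apply)
      then have "pull (shift_op u p \<circ> 0) = pull (shift_op u p) \<circ> pull 0"
        by (simp only: pull_zero pull_shift_op) (simp add: fun_eq_iff op_apply)
      then show ?case .
    next
      case (shift v q h)
      show ?case
        by (simp add: shift_op_comp pull_shift_op matrix_vector_mult_plus LB_v)
    next
      case (add P f Q g)
      then show ?case by (simp add: shift_comp_plus pull_add pull_shift_op)
    qed auto
  qed
  obtain k f where "has_symbol UNIV k P f" using assms(1) by (auto simp: carrier_torus_dops)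
  then show ?thesis
  proof (induction rule: has_symbol.induct)
    case zero
    have "0 \<circ> Q = (0 :: 'm dop)" by (simp add: fun_eq_iff op_apply)
    then have "pull (0 \<circ> Q) = pull 0 \<circ> pull Q"
      by (simp only: pull_zero) (simp add: fun_eq_iff op_apply)
    then show ?case .
  next
    case (shift v q h)
    show ?case by (rule step)
  next
    case (add P f P' g)
    then show ?case by (simp add: comp_plus_left pull_add)
  qed auto
qed

lemma pull_lconst: "pull (lmult (lconst c)) = lmult (lconst c)"
  by (simp add: lmult_lconst pull_shift_op)

lemma pull_lmon: "pull (lmult (lmon v)) = lmult (lmon (B *v v))"
  by (simp add: lmult_lmon pull_shift_op)

lemma pull_id: "pull id = id"
  using pull_lconst[of 1] by (simp add: lmult_lconst shift_op_one)

lemma pull_theta: "pull (theta j) = (\<lambda>f. \<Sum>i\<in>UNIV. lconst (LC $ j $ i) * theta i f)"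
proof -
  have "pull (theta j) = shift_op 0 (\<lambda>w. \<Sum>i\<in>UNIV. of_int (L $ j $ i) * of_int (w $ i))"
    unfolding theta_eq pull_shift_op matrix_vector_mult_zero by (simp add: matrix_vector_mult_def)
  also have "\<dots> = (\<lambda>f. \<Sum>i\<in>UNIV. lconst (LC $ j $ i) * theta i f)"
    by (rule ext) (simp add: shift_op_sum sum_apply lconst_times theta_eq shift_op_apply map_matrix_def)
  finally show ?thesis .
qed

lemma lmult_torus: "lmult (lconst c) \<in> carrier torus_dops" "lmult (lmon u) \<in> carrier torus_dops"
  using has_symbol_carrier[OF has_symbol_shift_one[of _ UNIV]] by (auto simp: lmult_lconst lmult_lmon)

text \<open>\<open>pull\<close> satisfies the characterisation. For uniqueness, constants, monomials
  and the \<open>\<theta>\<^sub>j\<close> produce every shift with polynomial weight, and sums of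
  these exhaust the ring; \<open>extensional\<close> fixes the values outside the ring.\<close>

lemma delta_hom_eq:
  assumes eta: "eta_matrix Atil B = LC"
  shows "delta_hom Atil B = restrict pull (carrier torus_dops)"
  unfolding delta_hom_def eta
proof (rule the_equality)
  let ?D = "carrier torus_dops :: 'm dop set"
  show "restrict pull ?D \<in> ring_hom torus_dops torus_dops \<and> restrict pull ?D \<in> extensional ?D \<and>
     (\<forall>c. restrict pull ?D (lmult (lconst c)) = lmult (lconst c)) \<and>
     (\<forall>v. restrict pull ?D (lmult (lmon v)) = lmult (lmon (B *v v))) \<and>
     (\<forall>j. restrict pull ?D (theta j) = (\<lambda>f. \<Sum>i\<in>UNIV. lconst (LC $ j $ i) * theta i f))"
    using pull_lconst pull_lmon pull_theta theta_torus(1)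
    by (auto simp: ring_hom_def lmult_torus pull_torus pull_comp pull_add pull_id torus_dops_closed)
next
  fix \<phi> assume \<phi>: "\<phi> \<in> ring_hom torus_dops torus_dops \<and> \<phi> \<in> extensional (carrier torus_dops) \<and>
     (\<forall>c. \<phi> (lmult (lconst c)) = lmult (lconst c)) \<and>
     (\<forall>v. \<phi> (lmult (lmon v)) = lmult (lmon (B *v v))) \<and>
     (\<forall>j. \<phi> (theta j) = (\<lambda>f. \<Sum>i\<in>UNIV. lconst (LC $ j $ i) * theta i f))"
  have mult: "\<phi> (P \<circ> Q) = \<phi> P \<circ> \<phi> Q" if "P \<in> carrier torus_dops" "Q \<in> carrier torus_dops" for P Q
    using ring_hom_mult[of \<phi> torus_dops torus_dops P Q] \<phi> that by simp
  have add: "\<phi> (P + Q) = \<phi> P + \<phi> Q" if "P \<in> carrier torus_dops" "Q \<in> carrier torus_dops" for P Q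
    using ring_hom_add[of \<phi> torus_dops torus_dops P Q] \<phi> that by simp
  define agree where "agree P \<longleftrightarrow> P \<in> carrier torus_dops \<and> \<phi> P = pull P" for P
  have a_mult: "agree (P \<circ> Q)" if "agree P" "agree Q" for P Q
    using that by (simp add: agree_def mult pull_comp torus_dops_closed)
  have a_add: "agree (P + Q)" if "agree P" "agree Q" for P Q
    using that by (simp add: agree_def add pull_add torus_dops_closed)
  have a_const: "agree (lmult (lconst c))" for c using \<phi> by (simp add: agree_def lmult_torus pull_lconst)
  have a_mon: "agree (lmult (lmon v))" for v using \<phi> by (simp add: agree_def lmult_torus pull_lmon)
  have a_theta: "agree (theta j)" for j using \<phi> by (simp add: agree_def theta_torus(1) pull_theta)
  have a_zero: "agree 0"
  proof -
    have "lmult (lconst 0) = (0 :: 'm dop)" by (simp add: lmult_def lconst_def fun_eq_iff op_apply)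
    then show ?thesis using a_const[of 0] by simp
  qed
  have a_shift: "agree (shift_op u p)" if "leading_form k p h" for u p k h
    using that
  proof (induction rule: leading_form.induct)
    case (zero k)
    show ?case using a_zero by simp
  next
    case (const c)
    have "shift_op u (\<lambda>_. c) = lmult (lconst c) \<circ> lmult (lmon u)"
      by (simp add: lmult_lconst lmult_lmon shift_op_comp)
    then show ?case using a_mult[OF a_const a_mon] by simp
  next
    case (coord k p h i)
    have "(theta i \<circ> shift_op u p) + (lmult (lconst (- of_int (u $ i))) \<circ> shift_op u p) =
      shift_op u ((\<lambda>w. of_int ((w + u) $ i) * p w) + (\<lambda>w. - of_int (u $ i) * p w))"
      by (simp add: theta_comp lmult_lconst shift_op_comp shift_op_add)
    also have "(\<lambda>w. of_int ((w + u) $ i) * p w) + (\<lambda>w. - of_int (u $ i) * p w) = (\<lambda>w. of_int (w $ i) * p w)"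
      by (auto simp: fun_eq_iff algebra_simps op_apply)
    finally show ?case using a_add[OF a_mult[OF a_theta coord.IH] a_mult[OF a_const coord.IH]] by metis
  next
    case (add k p h q g)
    then show ?case using a_add by (simp add: shift_op_add)
  next
    case (lift k p h)
    then show ?case by simp
  qed
  have "agree P" if P: "P \<in> carrier torus_dops" for P
  proof -
    obtain k f where "has_symbol UNIV k P f" using P by (auto simp: carrier_torus_dops)
    then show ?thesis
      by (induction rule: has_symbol.induct) (auto intro: a_zero a_shift a_add)
  qed
  then show "\<phi> = restrict pull (carrier torus_dops)"
    using \<phi> by (intro extensionalityI[of _ "carrier torus_dops"]) (auto simp: agree_def)
qed

end

section \<open>The tensor product with the operators on the torus\<close>

section \<open>Restriction to the torus as a localization\<close>

locale tensor_setup = W: filtered_dop_module weyl M weyl_filt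
  for M :: "(('n::finite) dop, 'v) module"
begin

abbreviation "FG \<equiv> tensor_free torus_dops M"
abbreviation "NL \<equiv> tensor_null torus_dops weyl M"
abbreviation "cl \<equiv> tensor_class torus_dops weyl M"
abbreviation "N \<equiv> torus_restriction M"

definition tens :: "'n dop \<Rightarrow> 'v \<Rightarrow> ('n dop \<times> 'v \<Rightarrow>\<^sub>0 int) set" where
  "tens P u = cl (frag_of (P, u))"

definition lact :: "'n dop \<Rightarrow> ('n dop \<times> 'v \<Rightarrow>\<^sub>0 int) \<Rightarrow> ('n dop \<times> 'v \<Rightarrow>\<^sub>0 int)" where
  "lact P = frag_extend (\<lambda>(Q, u). frag_of (P \<circ> Q, u))"

lemma FG_group: "comm_group FG" "group FG"
  unfolding tensor_free_def by (rule abelian_free_Abelian_group) simp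

lemma FG_simps [simp]:
  "x \<in> carrier FG \<longleftrightarrow> Poly_Mapping.keys x \<subseteq> carrier torus_dops \<times> carrier M"
  "x \<otimes>\<^bsub>FG\<^esub> y = x + y" "\<one>\<^bsub>FG\<^esub> = 0"
  by (simp_all add: tensor_free_def)

lemma FG_inv [simp]: "x \<in> carrier FG \<Longrightarrow> inv\<^bsub>FG\<^esub> x = - x"
  by (simp add: tensor_free_def)

lemma FG_diff: "x \<in> carrier FG \<Longrightarrow> y \<in> carrier FG \<Longrightarrow> x - y \<in> carrier FG"
  using keys_diff[of x y] by auto

lemma FG_add: "x \<in> carrier FG \<Longrightarrow> y \<in> carrier FG \<Longrightarrow> x + y \<in> carrier FG"
  using keys_add[of x y] by auto

lemma FG_frag: "frag_of (P, u) \<in> carrier FG \<longleftrightarrow> P \<in> carrier torus_dops \<and> u \<in> carrier M"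
  by simp

lemma relations_closed: "tensor_relations torus_dops weyl M \<subseteq> carrier FG"
  unfolding tensor_relations_def
  by (auto intro!: FG_diff simp del: FG_simps(1)
      simp: FG_frag torus_dops_closed weyl_subset W.smult_closed)

lemma NL_subgroup: "subgroup NL FG"
  unfolding tensor_null_def by (rule group.generate_is_subgroup[OF FG_group(2) relations_closed])

lemma NL_normal: "NL \<lhd> FG"
  using NL_subgroup FG_group(1) by (simp add: comm_group.normal_iff_subgroup)

lemma NL_closed:
  "0 \<in> NL" "x \<in> NL \<Longrightarrow> x \<in> carrier FG" "x \<in> NL \<Longrightarrow> y \<in> NL \<Longrightarrow> x + y \<in> NL" "x \<in> NL \<Longrightarrow> - x \<in> NL"
  "x \<in> NL \<Longrightarrow> y \<in> NL \<Longrightarrow> x - y \<in> NL"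
proof -
  show z: "0 \<in> NL" using subgroup.one_closed[OF NL_subgroup] by simp
  show c: "x \<in> carrier FG" if "x \<in> NL" for x using subgroup.mem_carrier[OF NL_subgroup that] .
  show a: "x + y \<in> NL" if "x \<in> NL" "y \<in> NL" for x y using subgroup.m_closed[OF NL_subgroup that] by simp
  show u: "- x \<in> NL" if "x \<in> NL" for x
    using subgroup.m_inv_closed[OF NL_subgroup that] c[OF that] by (simp del: FG_simps(1))
  show "x - y \<in> NL" if "x \<in> NL" "y \<in> NL" using a[OF that(1) u[OF that(2)]] by simp
qed

lemma cl_eq: "cl c = (\<lambda>x. x + c) ` NL"
  by (auto simp: tensor_class_def r_coset_def)

lemma cl_eq_iff: "cl c = cl c' \<longleftrightarrow> c - c' \<in> NL"
proof
  assume "cl c = cl c'"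
  moreover have "c \<in> cl c" using NL_closed(1) by (force simp: cl_eq)
  ultimately show "c - c' \<in> NL" by (auto simp: cl_eq)
next
  assume *: "c - c' \<in> NL"
  show "cl c = cl c'"
    unfolding cl_eq
  proof (intro equalityI subsetI)
    fix z assume "z \<in> (\<lambda>x. x + c) ` NL"
    then obtain x where "x \<in> NL" "z = x + c" by blast
    then show "z \<in> (\<lambda>x. x + c') ` NL"
      using NL_closed(3)[OF _ *, of x] by (intro image_eqI[of _ _ "x + (c - c')"]) auto
  next
    fix z assume "z \<in> (\<lambda>x. x + c') ` NL"
    then obtain x where "x \<in> NL" "z = x + c'" by blast
    then show "z \<in> (\<lambda>x. x + c) ` NL"
      using NL_closed(5)[OF _ *, of x] by (intro image_eqI[of _ _ "x - (c - c')"]) auto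
  qed
qed

lemma carrier_N: "carrier N = cl ` carrier FG"
  by (simp add: torus_restriction_def extend_scalars_def Let_def carrier_FactGroup tensor_class_def)

lemma zero_N: "\<zero>\<^bsub>N\<^esub> = cl 0"
  by (simp add: torus_restriction_def extend_scalars_def Let_def cl_eq)

lemma add_N: "c \<in> carrier FG \<Longrightarrow> c' \<in> carrier FG \<Longrightarrow> cl c \<oplus>\<^bsub>N\<^esub> cl c' = cl (c + c')"
  using normal.rcos_sum[OF NL_normal, of c c']
  by (simp add: torus_restriction_def extend_scalars_def Let_def tensor_class_def)

lemma lact_simps: "lact P 0 = 0" "lact P (c + d) = lact P c + lact P d" "lact P (c - d) = lact P c - lact P d"
  "lact P (- c) = - lact P c" "lact P (frag_of (Q, u)) = frag_of (P \<circ> Q, u)"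
  by (simp_all add: lact_def frag_extend_add frag_extend_diff frag_extend_minus)

lemma FG_induct [consumes 1, case_names zero frag diff]:
  assumes "c \<in> carrier FG" "Q 0" "\<And>P u. P \<in> carrier torus_dops \<Longrightarrow> u \<in> carrier M \<Longrightarrow> Q (frag_of (P, u))"
    "\<And>a b. Q a \<Longrightarrow> Q b \<Longrightarrow> Q (a - b)"
  shows "Q c"
  using assms(1)[unfolded FG_simps] by (induction rule: frag_induction) (use assms in auto)

lemma lact_closed: assumes P: "P \<in> carrier torus_dops" and c: "c \<in> carrier FG" shows "lact P c \<in> carrier FG"
  using c
proof (induction rule: FG_induct)
  case (diff a b)
  then show ?case unfolding lact_simps by (rule FG_diff)
qed (use P in \<open>simp_all add: lact_simps torus_dops_closed\<close>)

lemma relationI: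
  "P \<in> carrier torus_dops \<Longrightarrow> Q \<in> carrier torus_dops \<Longrightarrow> u \<in> carrier M \<Longrightarrow>
    frag_of (P + Q, u) - frag_of (P, u) - frag_of (Q, u) \<in> NL"
  "P \<in> carrier torus_dops \<Longrightarrow> u \<in> carrier M \<Longrightarrow> w \<in> carrier M \<Longrightarrow>
    frag_of (P, u \<oplus>\<^bsub>M\<^esub> w) - frag_of (P, u) - frag_of (P, w) \<in> NL"
  "P \<in> carrier torus_dops \<Longrightarrow> Q \<in> carrier weyl \<Longrightarrow> u \<in> carrier M \<Longrightarrow>
    frag_of (P \<circ> Q, u) - frag_of (P, Q \<odot>\<^bsub>M\<^esub> u) \<in> NL"
proof -
  have incl: "x \<in> NL" if "x \<in> tensor_relations torus_dops weyl M" for x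
    unfolding tensor_null_def using that by (rule generate.incl)
  show "frag_of (P + Q, u) - frag_of (P, u) - frag_of (Q, u) \<in> NL"
    if "P \<in> carrier torus_dops" "Q \<in> carrier torus_dops" "u \<in> carrier M"
    by (rule incl, unfold tensor_relations_def torus_dops_simps, rule UnI1, rule UnI1)
      (intro CollectI exI conjI, rule refl, (rule that)+)
  show "frag_of (P, u \<oplus>\<^bsub>M\<^esub> w) - frag_of (P, u) - frag_of (P, w) \<in> NL"
    if "P \<in> carrier torus_dops" "u \<in> carrier M" "w \<in> carrier M"
    by (rule incl, unfold tensor_relations_def torus_dops_simps, rule UnI1, rule UnI2)
      (intro CollectI exI conjI, rule refl, (rule that)+)
  show "frag_of (P \<circ> Q, u) - frag_of (P, Q \<odot>\<^bsub>M\<^esub> u) \<in> NL"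
    if "P \<in> carrier torus_dops" "Q \<in> carrier weyl" "u \<in> carrier M"
    by (rule incl, unfold tensor_relations_def torus_dops_simps, rule UnI2)
      (intro CollectI exI conjI, rule refl, (rule that)+)
qed

lemma relation_cases:
  assumes "x \<in> tensor_relations torus_dops weyl M"
  obtains P Q u where "P \<in> carrier torus_dops" "Q \<in> carrier torus_dops" "u \<in> carrier M"
      "x = frag_of (P + Q, u) - frag_of (P, u) - frag_of (Q, u)"
    | P u w where "P \<in> carrier torus_dops" "u \<in> carrier M" "w \<in> carrier M"
      "x = frag_of (P, u \<oplus>\<^bsub>M\<^esub> w) - frag_of (P, u) - frag_of (P, w)"
    | P Q u where "P \<in> carrier torus_dops" "Q \<in> carrier weyl" "u \<in> carrier M"
      "x = frag_of (P \<circ> Q, u) - frag_of (P, Q \<odot>\<^bsub>M\<^esub> u)"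
  using assms unfolding tensor_relations_def torus_dops_simps
  apply (elim UnE CollectE exE conjE)
    apply (rule that(1); assumption)
   apply (rule that(2); assumption)
  apply (rule that(3); assumption)
  done

text \<open>Left composition carries each relation to a relation of the same kind; for sums of
  operators this uses that \<open>P\<close> is an additive map.\<close>

lemma lact_NL: assumes P: "P \<in> carrier torus_dops" and x: "x \<in> NL" shows "lact P x \<in> NL"
proof -
  have "subgroup {x \<in> carrier FG. lact P x \<in> NL} FG"
  proof (rule group.subgroupI[OF FG_group(2)])
    show "{x \<in> carrier FG. lact P x \<in> NL} \<noteq> {}"
      using NL_closed(1) by (intro ex_in_conv[THEN iffD1] exI[of _ 0]) (simp add: lact_simps)
  next
    fix a assume "a \<in> {x \<in> carrier FG. lact P x \<in> NL}"
    then show "inv\<^bsub>FG\<^esub> a \<in> {x \<in> carrier FG. lact P x \<in> NL}"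
      using NL_closed(4) by (auto simp: lact_simps)
  next
    fix a b assume "a \<in> {x \<in> carrier FG. lact P x \<in> NL}" "b \<in> {x \<in> carrier FG. lact P x \<in> NL}"
    then show "a \<otimes>\<^bsub>FG\<^esub> b \<in> {x \<in> carrier FG. lact P x \<in> NL}"
      using NL_closed(3) FG_add[of a b] by (auto simp: lact_simps simp del: FG_simps(1))
  qed auto
  moreover have "tensor_relations torus_dops weyl M \<subseteq> {x \<in> carrier FG. lact P x \<in> NL}"
  proof
    fix x assume x: "x \<in> tensor_relations torus_dops weyl M"
    have "lact P x \<in> NL"
      using x
    proof (cases rule: relation_cases)
      case (1 Q Q' u)
      then show ?thesis
        using relationI(1)[of "P \<circ> Q" "P \<circ> Q'" u] P
        by (simp add: lact_simps torus_dops_closed comp_plus_torus)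
    next
      case (2 Q u w)
      then show ?thesis using relationI(2)[of "P \<circ> Q" u w] P by (simp add: lact_simps torus_dops_closed)
    next
      case (3 Q Q' u)
      then show ?thesis
        using relationI(3)[of "P \<circ> Q" Q' u] P by (simp add: lact_simps torus_dops_closed comp_assoc)
    qed
    then show "x \<in> {x \<in> carrier FG. lact P x \<in> NL}" using relations_closed x by blast
  qed
  ultimately have "NL \<subseteq> {x \<in> carrier FG. lact P x \<in> NL}"
    unfolding tensor_null_def by (intro group.generate_subgroup_incl[OF FG_group(2)])
  then show ?thesis using x by blast
qed

text \<open>All representatives of a class are sent to the same class, so the union in the
  definition of the action is over equal sets.\<close>

lemma act_N:
  assumes P: "P \<in> carrier torus_dops" and c: "c \<in> carrier FG"
  shows "P \<odot>\<^bsub>N\<^esub> cl c = cl (lact P c)"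
proof -
  have "P \<odot>\<^bsub>N\<^esub> cl c = (\<Union>c'\<in>cl c. cl (lact P c'))"
    by (simp add: torus_restriction_def extend_scalars_def Let_def lact_def)
  moreover have "cl (lact P c') = cl (lact P c)" if c': "c' \<in> cl c" for c'
  proof -
    obtain x where "x \<in> NL" "c' = x + c" using c' by (auto simp: cl_eq)
    then show ?thesis using lact_NL[OF P] by (simp add: cl_eq_iff lact_simps)
  qed
  moreover have "c \<in> cl c" using NL_closed(1) by (force simp: cl_eq)
  ultimately show ?thesis by blast
qed

lemma N_group: "abelian_group N"
proof -
  let ?Q = "FG Mod NL"
  have eq: "carrier N = carrier ?Q" "x \<oplus>\<^bsub>N\<^esub> y = x \<otimes>\<^bsub>?Q\<^esub> y" "\<zero>\<^bsub>N\<^esub> = \<one>\<^bsub>?Q\<^esub>" for x y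
    by (simp_all add: torus_restriction_def extend_scalars_def Let_def)
  interpret Q: comm_group ?Q
    by (rule comm_group.abelian_FactGroup[OF FG_group(1) NL_subgroup])
  show ?thesis
  proof (rule abelian_groupI, unfold eq)
    fix x y z assume "x \<in> carrier ?Q" "y \<in> carrier ?Q" "z \<in> carrier ?Q"
    then show "x \<otimes>\<^bsub>?Q\<^esub> y \<otimes>\<^bsub>?Q\<^esub> z = x \<otimes>\<^bsub>?Q\<^esub> (y \<otimes>\<^bsub>?Q\<^esub> z)" by (rule Q.m_assoc)
  next
    fix x y assume "x \<in> carrier ?Q" "y \<in> carrier ?Q"
    then show "x \<otimes>\<^bsub>?Q\<^esub> y \<in> carrier ?Q" "x \<otimes>\<^bsub>?Q\<^esub> y = y \<otimes>\<^bsub>?Q\<^esub> x"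
      by (rule Q.m_closed, rule Q.m_comm)
  next
    fix x assume x: "x \<in> carrier ?Q"
    then show "\<one>\<^bsub>?Q\<^esub> \<otimes>\<^bsub>?Q\<^esub> x = x" by (rule Q.l_one)
    show "\<exists>y\<in>carrier ?Q. y \<otimes>\<^bsub>?Q\<^esub> x = \<one>\<^bsub>?Q\<^esub>" using x Q.l_inv Q.inv_closed by blast
  qed (rule Q.one_closed)
qed

lemma lact_add: assumes "c \<in> carrier FG" "P \<in> carrier torus_dops" "Q \<in> carrier torus_dops"
  shows "lact (P + Q) c - (lact P c + lact Q c) \<in> NL"
  using assms(1)
proof (induction rule: FG_induct)
  case zero
  then show ?case by (simp add: lact_simps NL_closed)
next
  case (frag S u)
  then show ?case
    using relationI(1)[of "P \<circ> S" "Q \<circ> S" u] assms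
    by (simp add: lact_simps torus_dops_closed comp_plus_left diff_diff_eq)
next
  case (diff a b)
  from NL_closed(5)[OF diff.IH] show ?case by (simp add: lact_simps algebra_simps)
qed

lemma lact_comp: assumes "c \<in> carrier FG" shows "lact (P \<circ> Q) c = lact P (lact Q c)"
  using assms by (induction rule: FG_induct) (simp_all add: lact_simps comp_assoc)

lemma lact_id: assumes "c \<in> carrier FG" shows "lact id c = c"
  using assms by (induction rule: FG_induct) (auto simp: lact_simps comp_def)

lemma N_module: "left_module torus_dops N"
proof (intro left_module.intro left_module_axioms.intro ring_torus_dops N_group)
  fix P Q :: "'n dop" and x y assume PQ: "P \<in> carrier torus_dops" "Q \<in> carrier torus_dops" and "x \<in> carrier N"
  then obtain c where c: "c \<in> carrier FG" "x = cl c" unfolding carrier_N by blast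
  show "(P \<oplus>\<^bsub>torus_dops\<^esub> Q) \<odot>\<^bsub>N\<^esub> x = P \<odot>\<^bsub>N\<^esub> x \<oplus>\<^bsub>N\<^esub> Q \<odot>\<^bsub>N\<^esub> x"
    using PQ c lact_add[of c P Q] lact_closed[of P c] lact_closed[of Q c]
    by (simp add: act_N add_N cl_eq_iff torus_dops_closed del: FG_simps(1))
  show "(P \<otimes>\<^bsub>torus_dops\<^esub> Q) \<odot>\<^bsub>N\<^esub> x = P \<odot>\<^bsub>N\<^esub> (Q \<odot>\<^bsub>N\<^esub> x)"
    using PQ c lact_closed[of Q c] by (simp add: act_N lact_comp torus_dops_closed del: FG_simps(1))
next
  fix P :: "'n dop" and x assume P: "P \<in> carrier torus_dops" and "x \<in> carrier N"
  then obtain c where c: "c \<in> carrier FG" "x = cl c" unfolding carrier_N by blast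
  show "P \<odot>\<^bsub>N\<^esub> x \<in> carrier N"
    using c P lact_closed[of P c] by (simp add: act_N carrier_N del: FG_simps(1))
  fix y assume "y \<in> carrier N"
  then obtain d where d: "d \<in> carrier FG" "y = cl d" unfolding carrier_N by blast
  show "P \<odot>\<^bsub>N\<^esub> (x \<oplus>\<^bsub>N\<^esub> y) = P \<odot>\<^bsub>N\<^esub> x \<oplus>\<^bsub>N\<^esub> P \<odot>\<^bsub>N\<^esub> y"
    using P c d lact_closed[of P c] lact_closed[of P d] FG_add[of c d]
    by (simp add: act_N add_N lact_simps del: FG_simps(1))
next
  fix x assume "x \<in> carrier N"
  then obtain c where c: "c \<in> carrier FG" "x = cl c" unfolding carrier_N by blast
  then show "\<one>\<^bsub>torus_dops\<^esub> \<odot>\<^bsub>N\<^esub> x = x"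
    by (simp add: act_N lact_id torus_dops_closed del: FG_simps(1))
qed

sublocale X: torus_module N
  by (intro torus_module.intro filtered_dop_moduleI_torus N_module)

lemma tens_closed: "P \<in> carrier torus_dops \<Longrightarrow> u \<in> carrier M \<Longrightarrow> tens P u \<in> carrier N"
  unfolding tens_def carrier_N by (intro imageI) simp

lemma act_tens: "P \<in> carrier torus_dops \<Longrightarrow> Q \<in> carrier torus_dops \<Longrightarrow> u \<in> carrier M \<Longrightarrow>
    P \<odot>\<^bsub>N\<^esub> tens Q u = tens (P \<circ> Q) u"
  unfolding tens_def by (subst act_N) (simp_all add: lact_simps)

lemma tens_add_right: "P \<in> carrier torus_dops \<Longrightarrow> u \<in> carrier M \<Longrightarrow> w \<in> carrier M \<Longrightarrow>
    tens P (u \<oplus>\<^bsub>M\<^esub> w) = tens P u \<oplus>\<^bsub>N\<^esub> tens P w"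
  unfolding tens_def using relationI(2)[of P u w] FG_add[of "frag_of (P, u)" "frag_of (P, w)"]
  by (simp add: add_N cl_eq_iff diff_diff_eq)

lemma tens_add_left: "P \<in> carrier torus_dops \<Longrightarrow> Q \<in> carrier torus_dops \<Longrightarrow> u \<in> carrier M \<Longrightarrow>
    tens (P + Q) u = tens P u \<oplus>\<^bsub>N\<^esub> tens Q u"
  unfolding tens_def using relationI(1)[of P Q u]
  by (simp add: add_N cl_eq_iff diff_diff_eq)

lemma tens_comp: "P \<in> carrier torus_dops \<Longrightarrow> Q \<in> carrier weyl \<Longrightarrow> u \<in> carrier M \<Longrightarrow>
    tens (P \<circ> Q) u = tens P (Q \<odot>\<^bsub>M\<^esub> u)"
  unfolding tens_def using relationI(3) by (simp add: cl_eq_iff)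

lemma cl_diff: assumes "a \<in> carrier FG" "b \<in> carrier FG" shows "cl (a - b) = cl a \<ominus>\<^bsub>N\<^esub> cl b"
proof -
  have "cl (a - b) \<oplus>\<^bsub>N\<^esub> cl b = cl a" using assms FG_diff[OF assms] by (simp add: add_N del: FG_simps(1))
  moreover have "cl a \<in> carrier N" "cl b \<in> carrier N" "cl (a - b) \<in> carrier N"
    using assms FG_diff[OF assms] unfolding carrier_N by blast+
  ultimately show ?thesis
    by (metis X.M.a_assoc X.M.minus_eq X.M.r_neg X.M.r_zero X.M.a_inv_closed)
qed

lemma N_induct [consumes 1, case_names zero tens diff]:
  assumes "n \<in> carrier N" "Q \<zero>\<^bsub>N\<^esub>" "\<And>P u. P \<in> carrier torus_dops \<Longrightarrow> u \<in> carrier M \<Longrightarrow> Q (tens P u)"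
    "\<And>a b. a \<in> carrier N \<Longrightarrow> b \<in> carrier N \<Longrightarrow> Q a \<Longrightarrow> Q b \<Longrightarrow> Q (a \<ominus>\<^bsub>N\<^esub> b)"
  shows "Q n"
proof -
  obtain c where c: "c \<in> carrier FG" "n = cl c" using assms(1) unfolding carrier_N by blast
  have "c \<in> carrier FG \<and> Q (cl c)"
    using c(1)
  proof (induction rule: FG_induct)
    case zero
    then show ?case using assms(2) by (simp add: zero_N)
  next
    case (frag P u)
    then show ?case using assms(3)[of P u] by (simp add: tens_def)
  next
    case (diff a b)
    then show ?case
      using assms(4)[of "cl a" "cl b"] FG_diff[of a b] by (simp add: cl_diff carrier_N del: FG_simps(1))
  qed
  then show ?thesis using c by simp
qed

text \<open>The hom sending \<open>P \<otimes> u\<close> to \<open>(x\<^sup>k P) u\<close> is only defined when \<open>x\<^sup>k P\<close> lies in the Weyl algebra; each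
  relation of the tensor product is respected for all large \<open>k\<close>.\<close>

lemma tens_kernel:
  assumes m: "m \<in> carrier M" and zero: "tens id m = \<zero>\<^bsub>N\<^esub>"
  shows "eventually (\<lambda>k. xpow k \<odot>\<^bsub>M\<^esub> m = \<zero>\<^bsub>M\<^esub>) sequentially"
proof -
  \<comment> \<open>The value zero where \<open>x^k P\<close> leaves the Weyl algebra is a mere
    default: for each \<open>P\<close> on the torus it occurs for finitely many \<open>k\<close>
    only.\<close>
  define f where "f k Pu = (if preserves_polynomials (xpow k \<circ> fst Pu) then (xpow k \<circ> fst Pu) \<odot>\<^bsub>M\<^esub> snd Pu else \<zero>\<^bsub>M\<^esub>)"
    for k and Pu :: "'n dop \<times> 'v"
  have xP: "xpow k \<circ> P \<in> carrier weyl" if "P \<in> carrier torus_dops" "preserves_polynomials (xpow k \<circ> P)" for k P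
    using that by (auto simp: carrier_weyl intro!: torus_dops_closed(6) xpow_torus)
  have "\<exists>h. h \<in> hom FG (add_monoid M) \<and> (\<forall>P u. P \<in> carrier torus_dops \<longrightarrow> u \<in> carrier M \<longrightarrow> h (frag_of (P, u)) = f k (P, u))" for k
  proof -
    have "f k ` (carrier torus_dops \<times> carrier M) \<subseteq> carrier (add_monoid M)"
      using xP by (auto simp: f_def intro!: W.smult_closed)
    from W.M.a_comm_group comm_group.free_Abelian_group_universal[OF _ this]
    obtain h where "h \<in> hom FG (add_monoid M)"
      "\<And>x. x \<in> carrier torus_dops \<times> carrier M \<Longrightarrow> h (frag_of x) = f k x"
      unfolding tensor_free_def by blast
    then show ?thesis by auto
  qed
  then obtain h where h: "\<And>k. h k \<in> hom FG (add_monoid M)"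
    "\<And>k P u. P \<in> carrier torus_dops \<Longrightarrow> u \<in> carrier M \<Longrightarrow> h k (frag_of (P, u)) = f k (P, u)"
    by metis
  have gh: "group_hom FG (add_monoid M) (h k)" for k
    by (simp add: group_hom_def group_hom_axioms_def h FG_group W.M.a_group)
  have h_add: "h k (a + b) = h k a \<oplus>\<^bsub>M\<^esub> h k b" if "a \<in> carrier FG" "b \<in> carrier FG" for k a b
    using hom_mult[OF h(1) that] by simp
  have h_closed: "h k a \<in> carrier M" if "a \<in> carrier FG" for k a
    using hom_in_carrier[OF h(1) that] by simp
  have h_minus: "h k (- a) = \<ominus>\<^bsub>M\<^esub> h k a" if "a \<in> carrier FG" for k a
    using group_hom.hom_inv[OF gh that] that by (simp add: a_inv_def del: FG_simps(1))
  have h_zero: "h k 0 = \<zero>\<^bsub>M\<^esub>" for k using group_hom.hom_one[OF gh] by simp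
  have h_diff: "h k (a - b) = h k a \<ominus>\<^bsub>M\<^esub> h k b" if "a \<in> carrier FG" "b \<in> carrier FG" for k a b
    using h_add[OF that(1), of "- b" k] h_minus[OF that(2)] that by (simp add: W.M.minus_eq)
  have fr: "frag_of (P, u) \<in> carrier FG" if "P \<in> carrier torus_dops" "u \<in> carrier M" for P u
    using that by simp
  have cancel: "(a \<oplus>\<^bsub>M\<^esub> b) \<ominus>\<^bsub>M\<^esub> a \<ominus>\<^bsub>M\<^esub> b = \<zero>\<^bsub>M\<^esub>" if "a \<in> carrier M" "b \<in> carrier M" for a b
  proof -
    have "(a \<oplus>\<^bsub>M\<^esub> b) \<ominus>\<^bsub>M\<^esub> a \<ominus>\<^bsub>M\<^esub> b = (a \<oplus>\<^bsub>M\<^esub> b) \<oplus>\<^bsub>M\<^esub> (\<ominus>\<^bsub>M\<^esub> a \<oplus>\<^bsub>M\<^esub> \<ominus>\<^bsub>M\<^esub> b)"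
      using that by (simp add: W.M.minus_eq W.M.a_assoc)
    then show ?thesis using that by (simp add: W.M.r_neg flip: W.M.minus_add)
  qed
  have rel: "eventually (\<lambda>k. h k x = \<zero>\<^bsub>M\<^esub>) sequentially" if "x \<in> tensor_relations torus_dops weyl M" for x
    using that
  proof (cases rule: relation_cases)
    case (1 P Q u)
    show ?thesis
      using clear_denominators[OF 1(1)] clear_denominators[OF 1(2)]
    proof eventually_elim
      case (elim k)
      have eq: "xpow k \<circ> (P + Q) = (xpow k \<circ> P) + (xpow k \<circ> Q)" unfolding xpow_def by (rule shift_comp_plus)
      have P: "xpow k \<circ> P \<in> carrier weyl" "xpow k \<circ> Q \<in> carrier weyl" using xP elim 1 by auto
      have "h k (frag_of (P + Q, u)) = h k (frag_of (P, u)) \<oplus>\<^bsub>M\<^esub> h k (frag_of (Q, u))"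
        using 1 elim preserves_polynomials_closed(3)[OF elim] W.act_add[OF P]
        by (simp add: h(2) torus_dops_closed f_def eq)
      then show ?case
        using 1 fr torus_dops_closed(3)[OF 1(1,2)] h_closed[OF fr[OF 1(1,3)], of k] h_closed[OF fr[OF 1(2,3)], of k]
        by (simp add: h_diff FG_diff cancel del: FG_simps(1))
    qed
  next
    case (2 P u w)
    show ?thesis
      using clear_denominators[OF 2(1)]
    proof eventually_elim
      case (elim k)
      have P: "xpow k \<circ> P \<in> carrier weyl" using xP elim 2 by auto
      have "h k (frag_of (P, u \<oplus>\<^bsub>M\<^esub> w)) = h k (frag_of (P, u)) \<oplus>\<^bsub>M\<^esub> h k (frag_of (P, w))"
        using 2 elim W.smult_r_distr[OF P] by (simp add: h(2) f_def)
      then show ?case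
        using 2 fr W.M.a_closed[OF 2(2,3)] h_closed[OF fr[OF 2(1,2)], of k] h_closed[OF fr[OF 2(1,3)], of k]
        by (simp add: h_diff FG_diff cancel del: FG_simps(1))
    qed
  next
    case (3 P Q u)
    show ?thesis
      using clear_denominators[OF 3(1)]
    proof eventually_elim
      case (elim k)
      have P: "xpow k \<circ> P \<in> carrier weyl" using xP elim 3 by auto
      have pQ: "preserves_polynomials (xpow k \<circ> (P \<circ> Q))"
        using preserves_polynomials_closed(6)[OF elim, of Q] 3(2) by (simp add: carrier_weyl comp_assoc)
      have Qc: "Q \<in> carrier torus_dops" using 3(2) by (rule weyl_subset)
      have "h k (frag_of (P \<circ> Q, u)) = h k (frag_of (P, Q \<odot>\<^bsub>M\<^esub> u))"
        using 3 elim pQ Qc W.act_comp[OF P 3(2,3)]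
        by (simp add: h(2) f_def torus_dops_closed W.smult_closed comp_assoc)
      then show ?case
        using 3 fr torus_dops_closed(6)[OF 3(1) Qc] W.smult_closed[OF 3(2,3)]
          h_closed[OF fr[OF 3(1) W.smult_closed[OF 3(2,3)]], of k]
        by (simp add: h_diff W.M.minus_eq W.M.r_neg del: FG_simps(1))
    qed
  qed
  \<comment> \<open>An element of the null subgroup involves finitely many relations, so all large
    \<open>k\<close> respect them simultaneously.\<close>
  have all: "x \<in> carrier FG \<and> eventually (\<lambda>k. h k x = \<zero>\<^bsub>M\<^esub>) sequentially" if "x \<in> NL" for x
    using that unfolding tensor_null_def
  proof (induction rule: generate.induct)
    case one
    then show ?case using h_zero by simp
  next
    case (incl x)
    then show ?case using rel relations_closed by blast
  next
    case (inv x)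
    then have x: "x \<in> carrier FG" using relations_closed by blast
    then have "- x \<in> carrier FG" by simp
    moreover have "eventually (\<lambda>k. h k (- x) = \<zero>\<^bsub>M\<^esub>) sequentially"
      using rel[OF inv] by eventually_elim (simp add: h_minus[OF x])
    ultimately show ?case using x by (simp del: FG_simps(1))
  next
    case (eng x y)
    have "eventually (\<lambda>k. h k (x + y) = \<zero>\<^bsub>M\<^esub>) sequentially"
      using eng.IH(1)[THEN conjunct2] eng.IH(2)[THEN conjunct2]
      by eventually_elim (use eng.IH in \<open>simp add: h_add del: FG_simps(1)\<close>)
    then show ?case using eng.IH FG_add by (simp del: FG_simps(1))
  qed
  have "frag_of (id, m) \<in> NL" using zero by (simp add: tens_def zero_N cl_eq_iff)
  then have "eventually (\<lambda>k. h k (frag_of (id, m)) = \<zero>\<^bsub>M\<^esub>) sequentially" using all by blast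
  then show ?thesis
    by eventually_elim (use m in \<open>simp add: h(2) f_def preserves_xpow torus_dops_closed(2)\<close>)
qed

text \<open>After clearing denominators the operator crosses the tensor sign:
  \<open>x^k (P \<otimes> u) = 1 \<otimes> (x^k P) u\<close>. So every element becomes the image of
  an element of \<open>M\<close>.\<close>

lemma localization: "dop_localization M N (tens id)"
proof (intro dop_localization.intro dop_localization_axioms.intro W.filtered_dop_module_axioms X.filtered_dop_module_axioms)
  show "tens id m \<in> carrier N" if "m \<in> carrier M" for m
    using that torus_dops_closed(2) by (intro tens_closed)
  show "tens id (m \<oplus>\<^bsub>M\<^esub> m') = tens id m \<oplus>\<^bsub>N\<^esub> tens id m'" if "m \<in> carrier M" "m' \<in> carrier M" for m m'
    using that torus_dops_closed(2) by (intro tens_add_right)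
  show "tens id (P \<odot>\<^bsub>M\<^esub> m) = P \<odot>\<^bsub>N\<^esub> tens id m" if "P \<in> carrier weyl" "m \<in> carrier M" for P m
  proof -
    have 1: "id \<in> carrier torus_dops" by (rule torus_dops_closed)
    have "tens id (P \<odot>\<^bsub>M\<^esub> m) = tens (id \<circ> P) m" using 1 that by (intro tens_comp[symmetric])
    also have "id \<circ> P = P \<circ> id" by simp
    also have "tens (P \<circ> id) m = P \<odot>\<^bsub>N\<^esub> tens id m"
      using 1 that(2) weyl_subset[OF that(1)] by (intro act_tens[symmetric])
    finally show ?thesis .
  qed
  show "eventually (\<lambda>k. xpow k \<odot>\<^bsub>M\<^esub> m = \<zero>\<^bsub>M\<^esub>) sequentially" if "m \<in> carrier M" "tens id m = \<zero>\<^bsub>N\<^esub>" for m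
    using that by (rule tens_kernel)
  show "eventually (\<lambda>k. xpow k \<odot>\<^bsub>N\<^esub> n \<in> tens id ` carrier M) sequentially" if "n \<in> carrier N" for n
    using that
  proof (induction rule: N_induct)
    case zero
    have "tens id \<zero>\<^bsub>M\<^esub> = \<zero>\<^bsub>N\<^esub>"
    proof -
      have "tens id \<zero>\<^bsub>M\<^esub> = tens id (0 \<odot>\<^bsub>M\<^esub> \<zero>\<^bsub>M\<^esub>)" by (simp add: W.act_zero)
      also have "\<dots> = tens (id \<circ> 0) \<zero>\<^bsub>M\<^esub>"
        using torus_dops_closed(2) weyl_closed(1) by (intro tens_comp[symmetric]) auto
      also have "id \<circ> 0 = 0 \<circ> (id :: 'n dop)" by simp
      also have "tens (0 \<circ> id) \<zero>\<^bsub>M\<^esub> = 0 \<odot>\<^bsub>N\<^esub> tens id \<zero>\<^bsub>M\<^esub>"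
        using torus_dops_closed(1,2) by (intro act_tens[symmetric]) auto
      also have "\<dots> = \<zero>\<^bsub>N\<^esub>" using tens_closed[OF torus_dops_closed(2)] by (simp add: X.act_zero)
      finally show ?thesis .
    qed
    then show ?case using X.act_zero_right[OF xpow_torus]
      by (intro always_eventually allI) (metis W.M.zero_closed imageI)
  next
    case (tens P u)
    show ?case
      using clear_denominators[OF tens(1)]
    proof eventually_elim
      case (elim k)
      have xP: "xpow k \<circ> P \<in> carrier weyl"
        using tens elim by (auto simp: carrier_weyl intro!: torus_dops_closed(6) xpow_torus)
      have "xpow k \<odot>\<^bsub>N\<^esub> tens P u = tens (id \<circ> (xpow k \<circ> P)) u" using tens by (simp add: act_tens xpow_torus)
      also have "\<dots> = tens id ((xpow k \<circ> P) \<odot>\<^bsub>M\<^esub> u)"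
        using tens xP torus_dops_closed(2) by (intro tens_comp)
      finally show ?case using W.smult_closed[OF xP tens(2)] by blast
    qed
  next
    case (diff a b)
    from diff.IH show ?case
    proof eventually_elim
      case (elim k)
      then obtain m m' where m: "m \<in> carrier M" "m' \<in> carrier M" "xpow k \<odot>\<^bsub>N\<^esub> a = tens id m" "xpow k \<odot>\<^bsub>N\<^esub> b = tens id m'"
        by blast
      have 1: "(id :: 'n dop) \<in> carrier torus_dops" by (rule torus_dops_closed)
      have mi: "(- id) \<odot>\<^bsub>M\<^esub> m' = \<ominus>\<^bsub>M\<^esub> m'" using W.act_uminus[OF weyl_closed(2) m(2)] m(2) by (simp add: W.act_id)
      have "tens id (\<ominus>\<^bsub>M\<^esub> m') = tens (id \<circ> - id) m'"
        unfolding mi[symmetric] using 1 m weyl_closed(5)[OF weyl_closed(2)] by (intro tens_comp[symmetric])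
      also have "id \<circ> - id = - id \<circ> (id :: 'n dop)" by simp
      also have "tens (- id \<circ> id) m' = (- id) \<odot>\<^bsub>N\<^esub> tens id m'"
        using 1 torus_dops_closed(5)[OF 1] m by (intro act_tens[symmetric])
      also have "\<dots> = \<ominus>\<^bsub>N\<^esub> tens id m'" using X.act_uminus[OF 1] tens_closed[OF 1 m(2)] by (simp add: X.act_id)
      finally have neg: "tens id (\<ominus>\<^bsub>M\<^esub> m') = \<ominus>\<^bsub>N\<^esub> tens id m'" .
      have "xpow k \<odot>\<^bsub>N\<^esub> (a \<ominus>\<^bsub>N\<^esub> b) = tens id m \<oplus>\<^bsub>N\<^esub> \<ominus>\<^bsub>N\<^esub> tens id m'"
        using diff m by (simp add: X.M.minus_eq X.smult_r_distr X.act_minus_right xpow_torus)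
      also have "\<dots> = tens id (m \<oplus>\<^bsub>M\<^esub> \<ominus>\<^bsub>M\<^esub> m')" using 1 m by (simp add: tens_add_right neg)
      finally show ?case using m by (metis W.M.a_closed W.M.a_inv_closed imageI)
    qed
  qed
qed

end

section \<open>Weight spaces of the Euler operators and operators of degree zero\<close>

section \<open>Modules with weights for the Euler operators\<close>

definition cst :: "complex \<Rightarrow> ('n::finite) dop" where
  "cst c = shift_op 0 (\<lambda>_. c)"

lemma cst_torus: "cst c \<in> carrier torus_dops"
  unfolding cst_def by (rule has_symbol_carrier[OF has_symbol_shift_one[of 0 UNIV]]) simp

lemma cst_weyl: "(cst c :: ('n::finite) dop) \<in> carrier weyl"
proof -
  have "preserves_polynomials (cst c :: 'n dop)"
    unfolding preserves_polynomials_def cst_def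
  proof safe
    fix g :: "'n laurent" assume "g \<in> polynomials"
    then show "shift_op 0 (\<lambda>_. c) g \<in> polynomials"
      unfolding shift_op_def by (intro polynomials_sum polynomials_single) (auto simp: polynomials_def)
  qed
  then show ?thesis by (simp add: carrier_weyl cst_torus)
qed

lemma cst_comp: "cst c \<circ> cst d = cst (c * d)"
  by (simp add: cst_def shift_op_comp)

lemma cst_add: "cst (c + d) = cst c + cst d"
  using shift_op_add[of 0 "\<lambda>_. c" "\<lambda>_. d"] by (simp add: cst_def plus_fun_def)

lemma cst_one: "cst 1 = id"
  by (simp add: cst_def shift_op_one)

lemma cst_zero: "cst 0 = 0"
  using shift_op_zero[of 0] by (simp add: cst_def zero_fun_def)

lemma cst_commute: assumes "P \<in> carrier torus_dops" shows "cst c \<circ> P = P \<circ> cst c"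
proof -
  obtain k f where "has_symbol UNIV k P f" using assms by (auto simp: carrier_torus_dops)
  then show ?thesis
  proof (induction rule: has_symbol.induct)
    case zero
    have "cst c \<circ> 0 = 0 \<circ> cst c" using comp_zero_torus[OF cst_torus] by (auto simp: fun_eq_iff op_apply)
    then show ?case .
  next
    case (shift u p h)
    show ?case by (simp add: cst_def shift_op_comp mult.commute)
  next
    case (add P f Q g)
    then show ?case by (simp add: comp_plus_torus[OF cst_torus] comp_plus_left)
  qed auto
qed

lemma euler_eq: "euler A i = shift_op 0 (\<lambda>w. of_int ((A *v w) $ i))"
proof
  fix f
  have "shift_op 0 (\<lambda>w. of_int ((A *v w) $ i)) f = shift_op 0 (\<lambda>w. \<Sum>j\<in>UNIV. of_int (A $ i $ j) * of_int (w $ j)) f"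
    by (simp add: matrix_vector_mult_def)
  also have "\<dots> = euler A i f"
    by (simp add: euler_def shift_op_sum sum_apply lconst_times theta_eq shift_op_apply)
  finally show "euler A i f = shift_op 0 (\<lambda>w. of_int ((A *v w) $ i)) f" by simp
qed

lemma euler_symbol:
  "has_symbol {0} 1 (euler A i) (\<lambda>x y. (map_matrix of_int A *v y) $ i)"
proof -
  have "leading_form (0 + 1) (\<lambda>w. of_int (w $ i) * 1) (\<lambda>y. y $ i * 1)"
    by (rule leading_form.coord[OF leading_form.const])
  from leading_form_linear[OF this, of A] have
    "leading_form 1 (\<lambda>w. of_int ((A *v w) $ i)) (\<lambda>y. (map_matrix of_int A *v y) $ i)" by simp
  from has_symbol.shift[OF _ this, of 0 "{0}"] show ?thesis by (simp add: euler_eq)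
qed

lemma euler_torus: "euler A i \<in> carrier torus_dops"
  using euler_symbol by (rule has_symbol_carrier)

lemma euler_weyl: "euler (A :: int ^ ('n::finite) ^ 'd) i \<in> carrier weyl"
proof -
  have "preserves_polynomials (euler A i)"
    unfolding preserves_polynomials_def euler_eq
  proof safe
    fix g :: "'n laurent" assume "g \<in> polynomials"
    then show "shift_op 0 (\<lambda>w. of_int ((A *v w) $ i)) g \<in> polynomials"
      unfolding shift_op_def by (intro polynomials_sum polynomials_single) (auto simp: polynomials_def)
  qed
  then show ?thesis by (simp add: carrier_weyl euler_torus)
qed

text \<open>The Euler operators measure degree: their eigenvalue \<open>(A w)\<^sub>i\<close> grows
  by \<open>(A u)\<^sub>i = \<alpha>\<^sub>i\<close> under a shift by \<open>u\<close>.\<close>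

lemma euler_comm:
  assumes "has_symbol {u. A *v u = \<alpha>} k P f"
  shows "euler A i \<circ> P = (P \<circ> euler A i) + (cst (of_int (\<alpha> $ i)) \<circ> P)"
  using assms
proof (induction rule: has_symbol.induct)
  case zero
  have "euler A i \<circ> 0 = (0 \<circ> euler A i) + (cst (of_int (\<alpha> $ i)) \<circ> 0)"
    unfolding comp_zero_torus[OF euler_torus] comp_zero_torus[OF cst_torus] by (simp add: fun_eq_iff op_apply)
  then show ?case .
next
  case (shift u p h)
  have "(\<lambda>w. of_int ((A *v (w + u)) $ i) * p w) =
      (\<lambda>w. p w * of_int ((A *v w) $ i)) + (\<lambda>w. of_int (\<alpha> $ i) * p w)"
    using shift.hyps(1) by (auto simp: fun_eq_iff op_apply matrix_vector_mult_plus algebra_simps)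
  then have "shift_op u (\<lambda>w. of_int ((A *v (w + u)) $ i) * p w) =
    shift_op u (\<lambda>w. p w * of_int ((A *v w) $ i)) + shift_op u (\<lambda>w. of_int (\<alpha> $ i) * p w)"
    by (simp only: shift_op_add)
  then show ?case by (simp add: euler_eq cst_def shift_op_comp)
next
  case (add P f Q g)
  have "euler A i \<circ> (P + Q) = (euler A i \<circ> P) + (euler A i \<circ> Q)" by (rule comp_plus_torus[OF euler_torus])
  also have "\<dots> = ((P + Q) \<circ> euler A i) + (cst (of_int (\<alpha> $ i)) \<circ> (P + Q))"
    unfolding add.IH comp_plus_left comp_plus_torus[OF cst_torus] by (simp add: ac_simps)
  finally show ?case .
qed auto

lemma shift_one_torus: "shift_op u (\<lambda>_. c) \<in> carrier torus_dops"
  by (rule has_symbol_carrier[OF has_symbol_shift_one[of u UNIV]]) simp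

text \<open>Operator and symbol are split together. Both families are indexed by all degrees and
  vanish off \<open>\<Lambda>\<close>, so that the decompositions of two summands can be merged over
  the union of their supports.\<close>

lemma homogeneous_decomposition:
  assumes "has_symbol UNIV k P f"
  shows "\<exists>\<Lambda> PP ff. finite \<Lambda> \<and> (\<forall>\<alpha>. has_symbol {u. A *v u = \<alpha>} k (PP \<alpha>) (ff \<alpha>)) \<and>
    (\<forall>\<alpha>. \<alpha> \<notin> \<Lambda> \<longrightarrow> PP \<alpha> = 0 \<and> ff \<alpha> = (\<lambda>_ _. 0)) \<and>
    P = (\<Sum>\<alpha>\<in>\<Lambda>. PP \<alpha>) \<and> (\<forall>x\<in>torus. \<forall>y. f x y = (\<Sum>\<alpha>\<in>\<Lambda>. ff \<alpha> x y))"
proof -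
  define good where "good P f \<Lambda> PP ff \<longleftrightarrow> finite \<Lambda> \<and> (\<forall>\<alpha>. has_symbol {u. A *v u = \<alpha>} k (PP \<alpha>) (ff \<alpha>)) \<and>
    (\<forall>\<alpha>. \<alpha> \<notin> \<Lambda> \<longrightarrow> PP \<alpha> = 0 \<and> ff \<alpha> = (\<lambda>_ _. 0)) \<and>
    P = (\<Sum>\<alpha>\<in>\<Lambda>. PP \<alpha>) \<and> (\<forall>x\<in>torus. \<forall>y. f x y = (\<Sum>\<alpha>\<in>\<Lambda>. ff \<alpha> x y))" for P f \<Lambda> PP ff
  have "\<exists>\<Lambda> PP ff. good P f \<Lambda> PP ff"
    using assms
  proof (induction rule: has_symbol.induct)
    case zero
    have "good 0 (\<lambda>_ _. 0) {} (\<lambda>_. 0) (\<lambda>_ _ _. 0)" by (simp add: good_def has_symbol.zero)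
    then show ?case by blast
  next
    case (shift u p h)
    have "good (shift_op u p) (\<lambda>x y. tpow x u * h y) {A *v u}
      (\<lambda>\<alpha>. if \<alpha> = A *v u then shift_op u p else 0) (\<lambda>\<alpha>. if \<alpha> = A *v u then (\<lambda>x y. tpow x u * h y) else (\<lambda>_ _. 0))"
      using shift has_symbol.zero by (auto simp: good_def intro: has_symbol.shift)
    then show ?case by blast
  next
    case (add P f Q g)
    obtain \<Lambda> PP ff where 1: "good P f \<Lambda> PP ff" using add.IH by blast
    obtain \<Lambda>' QQ gg where 2: "good Q g \<Lambda>' QQ gg" using add.IH by blast
    have s: "(\<Sum>\<alpha>\<in>\<Lambda> \<union> \<Lambda>'. PP \<alpha>) = P" "(\<Sum>\<alpha>\<in>\<Lambda> \<union> \<Lambda>'. QQ \<alpha>) = Q"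
      using 1 2 sum.mono_neutral_right[of "\<Lambda> \<union> \<Lambda>'" \<Lambda> PP] sum.mono_neutral_right[of "\<Lambda> \<union> \<Lambda>'" \<Lambda>' QQ]
      by (simp_all add: good_def)
    have t: "(\<Sum>\<alpha>\<in>\<Lambda> \<union> \<Lambda>'. ff \<alpha> x y) = f x y" "(\<Sum>\<alpha>\<in>\<Lambda> \<union> \<Lambda>'. gg \<alpha> x y) = g x y" if "x \<in> torus" for x y
      using 1 2 that sum.mono_neutral_right[of "\<Lambda> \<union> \<Lambda>'" \<Lambda> "\<lambda>\<alpha>. ff \<alpha> x y"]
        sum.mono_neutral_right[of "\<Lambda> \<union> \<Lambda>'" \<Lambda>' "\<lambda>\<alpha>. gg \<alpha> x y"]
      by (simp_all add: good_def)
    have "good (P + Q) (\<lambda>x y. f x y + g x y) (\<Lambda> \<union> \<Lambda>') (\<lambda>\<alpha>. PP \<alpha> + QQ \<alpha>) (\<lambda>\<alpha> x y. ff \<alpha> x y + gg \<alpha> x y)"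
      unfolding good_def
    proof (intro conjI allI impI ballI)
      show "finite (\<Lambda> \<union> \<Lambda>')" using 1 2 by (simp add: good_def)
      show "has_symbol {u. A *v u = \<alpha>} k (PP \<alpha> + QQ \<alpha>) (\<lambda>x y. ff \<alpha> x y + gg \<alpha> x y)" for \<alpha>
        using 1 2 by (intro has_symbol.add) (simp_all add: good_def)
      show "P + Q = (\<Sum>\<alpha>\<in>\<Lambda> \<union> \<Lambda>'. PP \<alpha> + QQ \<alpha>)" by (simp add: sum.distrib s)
      show "f x y + g x y = (\<Sum>\<alpha>\<in>\<Lambda> \<union> \<Lambda>'. ff \<alpha> x y + gg \<alpha> x y)" if "x \<in> torus" for x y
        using that by (simp add: sum.distrib t)
    qed (use 1 2 in \<open>simp_all add: good_def\<close>)
    then show ?case by blast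
  next
    case (cong P f g)
    then obtain \<Lambda> PP ff where "good P f \<Lambda> PP ff" by blast
    then have "good P g \<Lambda> PP ff" using cong.hyps by (simp add: good_def)
    then show ?case by blast
  qed
  then show ?thesis unfolding good_def .
qed

context split_torus
begin

abbreviation "BC \<equiv> map_matrix of_int B :: complex ^ 'm ^ 'n"
abbreviation "AC \<equiv> map_matrix of_int A :: complex ^ 'n ^ 'd"

lemma kernel_AC: assumes "AC *v y = 0" shows "BC *v (LC *v y) = y"
proof -
  have "y = map_matrix of_int (R ** A + B ** L) *v y" by (simp add: RABL map_matrix_of_int_one)
  also have "\<dots> = map_matrix of_int R *v (AC *v y) + BC *v (LC *v y)"
    by (simp add: map_matrix_of_int_add map_matrix_of_int_mult matrix_add_vector_mult matrix_vector_mul_assoc)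
  finally show ?thesis using assms by simp
qed

end

locale weighted_module = split_torus A L R B + torus_module N
  for A :: "int ^ ('n::finite) ^ ('d::finite)" and L :: "int ^ 'n ^ ('m::finite)"
    and R :: "int ^ 'd ^ 'n" and B :: "int ^ 'm ^ 'n" and N :: "('n dop, 'v) module" +
  fixes \<beta> :: "complex ^ 'd" and Gr :: "int ^ 'd \<Rightarrow> 'v set"
  assumes Gr_subgroup: "subgroup (Gr \<alpha>) (add_monoid N)"
    and Gr_weight: "n \<in> Gr \<alpha> \<Longrightarrow> euler A i \<odot>\<^bsub>N\<^esub> n = cst (\<beta> $ i + of_int (\<alpha> $ i)) \<odot>\<^bsub>N\<^esub> n"
    and Gr_act: "has_symbol {u. A *v u = \<gamma>} k P f \<Longrightarrow> n \<in> Gr \<alpha> \<Longrightarrow> P \<odot>\<^bsub>N\<^esub> n \<in> Gr (\<gamma> + \<alpha>)"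
begin

lemma Gr_closed: "n \<in> Gr \<alpha> \<Longrightarrow> n \<in> carrier N"
  using subgroup.mem_carrier[OF Gr_subgroup] by simp

text \<open>Interpolation in the Euler operators: if \<open>\<alpha>'\<close> and
  \<open>\<alpha>\<close> differ in the component \<open>i\<close>, then
  \<open>E\<^sub>i - \<beta>\<^sub>i - \<alpha>'\<^sub>i\<close> kills the piece of degree
  \<open>\<alpha>'\<close> and is an invertible scalar on that of degree \<open>\<alpha>\<close>.
  Products of such factors isolate one degree among finitely many.\<close>

lemma projector:
  assumes "finite \<Lambda>"
  shows "\<exists>Q\<in>carrier torus_dops. (\<forall>n\<in>Gr \<alpha>. Q \<odot>\<^bsub>N\<^esub> n = n) \<and> (\<forall>\<alpha>'\<in>\<Lambda> - {\<alpha>}. \<forall>n\<in>Gr \<alpha>'. Q \<odot>\<^bsub>N\<^esub> n = \<zero>\<^bsub>N\<^esub>)"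
  using assms
proof (induction \<Lambda>)
  case empty
  have "\<forall>n\<in>Gr \<alpha>. id \<odot>\<^bsub>N\<^esub> n = n" using act_id Gr_closed by blast
  then show ?case using torus_dops_closed(2) by blast
next
  case (insert \<alpha>' \<Lambda>)
  then obtain Q where Q: "Q \<in> carrier torus_dops" "\<forall>n\<in>Gr \<alpha>. Q \<odot>\<^bsub>N\<^esub> n = n"
    "\<forall>\<alpha>'\<in>\<Lambda> - {\<alpha>}. \<forall>n\<in>Gr \<alpha>'. Q \<odot>\<^bsub>N\<^esub> n = \<zero>\<^bsub>N\<^esub>" by blast
  show ?case
  proof (cases "\<alpha>' = \<alpha>")
    case True
    then show ?thesis using Q by (intro bexI[of _ Q]) auto
  next
    case False
    then obtain i where i: "\<alpha> $ i \<noteq> \<alpha>' $ i" by (metis vec_eq_iff)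
    define c where "c = inverse (of_int (\<alpha> $ i) - of_int (\<alpha>' $ i) :: complex)"
    define E where "E = euler A i - cst (\<beta> $ i + of_int (\<alpha>' $ i))"
    have E: "E \<in> carrier torus_dops" unfolding E_def by (intro torus_dops_closed euler_torus cst_torus)
    have E_act: "E \<odot>\<^bsub>N\<^esub> n = cst (of_int (\<gamma> $ i) - of_int (\<alpha>' $ i)) \<odot>\<^bsub>N\<^esub> n" if n: "n \<in> Gr \<gamma>" for n \<gamma>
    proof -
      have nN: "n \<in> carrier N" using n by (rule Gr_closed)
      have "cst (of_int (\<gamma> $ i) - of_int (\<alpha>' $ i)) = cst (\<beta> $ i + of_int (\<gamma> $ i)) - (cst (\<beta> $ i + of_int (\<alpha>' $ i)) :: 'n dop)"
        unfolding eq_diff_eq cst_add[symmetric] by (simp add: algebra_simps)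
      then show ?thesis
        using nN n by (simp add: E_def act_diff euler_torus cst_torus Gr_weight)
    qed
    define Q' where "Q' = cst c \<circ> (Q \<circ> E)"
    have Q': "Q' \<in> carrier torus_dops" unfolding Q'_def by (intro torus_dops_closed cst_torus E Q)
    have act: "Q' \<odot>\<^bsub>N\<^esub> n = cst (c * (of_int (\<gamma> $ i) - of_int (\<alpha>' $ i))) \<odot>\<^bsub>N\<^esub> (Q \<odot>\<^bsub>N\<^esub> n)" if n: "n \<in> Gr \<gamma>" for n \<gamma>
    proof -
      let ?d = "cst (of_int (\<gamma> $ i) - of_int (\<alpha>' $ i)) :: 'n dop"
      have nN: "n \<in> carrier N" "E \<odot>\<^bsub>N\<^esub> n \<in> carrier N" "?d \<odot>\<^bsub>N\<^esub> n \<in> carrier N" "Q \<odot>\<^bsub>N\<^esub> n \<in> carrier N"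
        using Gr_closed[OF n] by (auto intro!: smult_closed E Q cst_torus)
      have "Q' \<odot>\<^bsub>N\<^esub> n = cst c \<odot>\<^bsub>N\<^esub> (Q \<odot>\<^bsub>N\<^esub> (?d \<odot>\<^bsub>N\<^esub> n))"
        using nN E Q by (simp add: Q'_def act_comp torus_dops_closed cst_torus E_act[OF n, symmetric])
      also have "\<dots> = cst c \<odot>\<^bsub>N\<^esub> ((Q \<circ> ?d) \<odot>\<^bsub>N\<^esub> n)" using nN Q by (simp add: act_comp cst_torus)
      also have "Q \<circ> ?d = ?d \<circ> Q" by (rule cst_commute[OF Q(1), symmetric])
      also have "cst c \<odot>\<^bsub>N\<^esub> ((?d \<circ> Q) \<odot>\<^bsub>N\<^esub> n) = (cst c \<circ> ?d) \<odot>\<^bsub>N\<^esub> (Q \<odot>\<^bsub>N\<^esub> n)"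
        using nN Q by (simp add: act_comp cst_torus)
      finally show ?thesis by (simp add: cst_comp)
    qed
    have 1: "Q' \<odot>\<^bsub>N\<^esub> n = n" if n: "n \<in> Gr \<alpha>" for n
    proof -
      have "c * (of_int (\<alpha> $ i) - of_int (\<alpha>' $ i)) = 1" using i by (simp add: c_def)
      then show ?thesis using act[OF n] Q(2) n Gr_closed[OF n] by (simp add: cst_one act_id)
    qed
    have 2: "Q' \<odot>\<^bsub>N\<^esub> n = \<zero>\<^bsub>N\<^esub>" if \<gamma>: "\<gamma> \<in> insert \<alpha>' \<Lambda> - {\<alpha>}" and n: "n \<in> Gr \<gamma>" for \<gamma> n
    proof (cases "\<gamma> \<in> \<Lambda>")
      case True
      then show ?thesis using act[OF n] Q(3) \<gamma> n by (simp add: act_zero_right cst_torus)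
    next
      case False
      then have "\<gamma> = \<alpha>'" using \<gamma> by blast
      then show ?thesis using act[OF n] smult_closed[OF Q(1) Gr_closed[OF n]] by (simp add: cst_zero act_zero)
    qed
    show ?thesis using 1 2 Q' by (intro bexI[of _ Q']) auto
  qed
qed

lemma leading_form_matrix:
  "leading_form 1 (\<lambda>w. of_int ((K *v w) $ k)) (\<lambda>y. (map_matrix of_int K *v y) $ k)"
  for K :: "int ^ 'e::finite ^ 'f::finite"
  using leading_form_linear[OF leading_form.coord[OF leading_form.const[of 1], of k], of K] by simp

text \<open>On elements of weight \<open>\<beta>\<close> the Euler operators act as constants, so \<open>\<theta> = B L \<theta> + R A \<theta>\<close> may be
  replaced by \<open>B L \<theta> + R \<beta>\<close>.\<close>

lemma theta_weight_zero:
  assumes n: "n \<in> Gr 0"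
  shows "theta i \<odot>\<^bsub>N\<^esub> n = (shift_op 0 (\<lambda>w. of_int ((B *v (L *v w)) $ i)) +
    cst (\<Sum>j\<in>UNIV. of_int (R $ i $ j) * \<beta> $ j)) \<odot>\<^bsub>N\<^esub> n"
proof -
  have nN: "n \<in> carrier N" using n by (rule Gr_closed)
  define S where "S = (shift_op 0 (\<lambda>w. of_int ((B *v (L *v w)) $ i)) :: 'n dop)"
  define r where "r j = (of_int (R $ i $ j) :: complex)" for j
  have S: "S \<in> carrier torus_dops"
  proof -
    have "S = shift_op 0 (\<lambda>w. of_int (((B ** L) *v w) $ i))" by (simp add: S_def matrix_vector_mul_assoc)
    then show ?thesis
      using has_symbol_carrier[OF has_symbol.shift[OF UNIV_I leading_form_matrix[of "B ** L" i], of 0]] by simp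
  qed
  have cl: "(\<Sum>j\<in>J. cst (r j) \<circ> euler A j) \<in> carrier torus_dops" "(\<Sum>j\<in>J. cst (r j * \<beta> $ j)) \<in> (carrier torus_dops :: 'n dop set)" for J
    by (induction J rule: infinite_finite_induct) (auto intro!: torus_dops_closed cst_torus euler_torus)
  have "theta i = S + (\<Sum>j\<in>UNIV. cst (r j) \<circ> euler A j)"
  proof -
    have w: "w $ i = (B *v (L *v w)) $ i + (\<Sum>j\<in>UNIV. R $ i $ j * (A *v w) $ j)" for w
    proof -
      have "w = (R ** A + B ** L) *v w" by (simp add: RABL)
      then have "w = R *v (A *v w) + B *v (L *v w)" by (simp add: matrix_add_vector_mult matrix_vector_mul_assoc)
      then have "w $ i = (R *v (A *v w) + B *v (L *v w)) $ i" by simp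
      then show ?thesis by (simp add: matrix_vector_mult_def[of R])
    qed
    have "(\<lambda>w. of_int (w $ i)) = (\<lambda>w. of_int ((B *v (L *v w)) $ i)) + (\<lambda>w. \<Sum>j\<in>UNIV. r j * of_int ((A *v w) $ j) :: complex)"
      by (rule ext, subst w) (simp add: op_apply r_def)
    then have "theta i = S + shift_op 0 (\<lambda>w. \<Sum>j\<in>UNIV. r j * of_int ((A *v w) $ j))"
      unfolding theta_eq S_def by (simp only: shift_op_add)
    then show ?thesis by (simp add: shift_op_sum euler_eq cst_def shift_op_comp)
  qed
  moreover have "(\<Sum>j\<in>J. cst (r j) \<circ> euler A j) \<odot>\<^bsub>N\<^esub> n = (\<Sum>j\<in>J. cst (r j * \<beta> $ j)) \<odot>\<^bsub>N\<^esub> n" for J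
  proof (induction J rule: infinite_finite_induct)
    case (insert j J)
    have "(cst (r j) \<circ> euler A j) \<odot>\<^bsub>N\<^esub> n = cst (r j) \<odot>\<^bsub>N\<^esub> (cst (\<beta> $ j) \<odot>\<^bsub>N\<^esub> n)"
      using nN Gr_weight[OF n, of j] by (simp add: act_comp cst_torus euler_torus)
    also have "\<dots> = cst (r j * \<beta> $ j) \<odot>\<^bsub>N\<^esub> n"
      using nN by (simp add: cst_torus flip: act_comp cst_comp)
    finally show ?case
      using insert nN cl by (simp add: act_add cst_torus euler_torus torus_dops_closed)
  qed simp_all
  ultimately have "theta i \<odot>\<^bsub>N\<^esub> n = (S + (\<Sum>j\<in>UNIV. cst (r j * \<beta> $ j))) \<odot>\<^bsub>N\<^esub> n"
    using nN S cl by (simp add: act_add)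
  also have "(\<Sum>j\<in>UNIV. cst (r j * \<beta> $ j)) = (cst (\<Sum>j\<in>UNIV. r j * \<beta> $ j) :: 'n dop)"
    by (simp add: cst_def shift_op_sum)
  finally show ?thesis by (simp add: S_def r_def)
qed

text \<open>Applied coordinate by coordinate, the rewriting of \<open>\<theta>\<^sub>i\<close> turns
  any polynomial in \<open>\<theta>\<close> into one in \<open>L \<theta>\<close>. The constants
  \<open>R \<beta>\<close> are of lower order, so the leading part is merely composed with
  \<open>B\<close>.\<close>

lemma leading_form_reduce:
  assumes "leading_form k p h"
  shows "\<exists>q g. leading_form k q g \<and> (\<forall>y. g y = h (BC *v y)) \<and>
    (\<forall>n\<in>Gr 0. shift_op 0 p \<odot>\<^bsub>N\<^esub> n = shift_op 0 (\<lambda>w. q (L *v w)) \<odot>\<^bsub>N\<^esub> n)"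
proof -
  define good where "good k p h q g \<longleftrightarrow> leading_form k p h \<and> leading_form k q g \<and> (\<forall>y. g y = h (BC *v y)) \<and>
    (\<forall>n\<in>Gr 0. shift_op 0 p \<odot>\<^bsub>N\<^esub> n = shift_op 0 (\<lambda>w. q (L *v w)) \<odot>\<^bsub>N\<^esub> n)" for k p h q g
  have tor: "shift_op 0 p \<in> carrier torus_dops" if "leading_form k p h" for k p and h :: "complex ^ 'n \<Rightarrow> complex"
    using has_symbol_carrier[OF has_symbol.shift[OF UNIV_I that]] .
  have "\<exists>q g. good k p h q g"
    using assms
  proof (induction rule: leading_form.induct)
    case (zero k)
    have "good k 0 0 0 0"
      unfolding good_def by (intro conjI leading_form.zero) (simp_all add: zero_fun_def)
    then show ?case by blast
  next
    case (const c)
    have "good 0 (\<lambda>_. c) (\<lambda>_. c) (\<lambda>_. c) (\<lambda>_. c)" by (simp add: good_def leading_form.const)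
    then show ?case by blast
  next
    case (add k p h p' h')
    obtain q g where 1: "good k p h q g" using add.IH by blast
    obtain q' g' where 2: "good k p' h' q' g'" using add.IH by blast
    have "shift_op 0 (\<lambda>w. (q + q') (L *v w)) = shift_op 0 (\<lambda>w. q (L *v w)) + shift_op 0 (\<lambda>w. q' (L *v w))"
      unfolding shift_op_add[symmetric] by (simp add: plus_fun_def)
    then have "good k (p + p') (h + h') (q + q') (g + g')"
      using 1 2 tor[of k p h] tor[of k p' h'] tor[OF leading_form_linear[of k q g L]] tor[OF leading_form_linear[of k q' g' L]] Gr_closed
      unfolding good_def by (auto simp: op_apply shift_op_add act_add intro: leading_form.add)
    then show ?case by blast
  next
    case (lift k p h)
    then obtain q g where "good k p h q g" by blast
    then have "good (k + 1) p 0 q 0" by (auto simp: good_def op_apply intro: leading_form.lift)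
    then show ?case by blast
  next
    case (coord k p h i)
    then obtain q g where 1: "good k p h q g" by blast
    define b where "b = (\<Sum>j\<in>UNIV. of_int (R $ i $ j) * \<beta> $ j)"
    define S where "S = shift_op 0 (\<lambda>w. of_int ((B *v (L *v w)) $ i)) + cst b"
    have S_eq: "S = shift_op 0 ((\<lambda>w. of_int ((B *v (L *v w)) $ i)) + (\<lambda>_. b))"
      by (simp add: S_def cst_def shift_op_add)
    have "leading_form 1 ((\<lambda>w. of_int ((B *v w) $ i)) + (\<lambda>_. b)) ((\<lambda>y. (BC *v y) $ i) + 0)"
      by (rule leading_form.add[OF leading_form_matrix leading_form_mono[OF leading_form.const]]) simp
    then have b1: "leading_form 1 (\<lambda>w. of_int ((B *v w) $ i) + b) (\<lambda>y. (BC *v y) $ i)"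
      by (simp add: plus_fun_def zero_fun_def)
    have q': "leading_form (1 + k) (\<lambda>w. (of_int ((B *v w) $ i) + b) * q w) (\<lambda>y. (BC *v y) $ i * g y)"
    proof (rule leading_form_mult[OF b1])
      show "leading_form k q g" using 1 by (simp only: good_def)
    qed
    have Sc: "S \<in> carrier torus_dops"
      using tor[OF leading_form_linear[OF b1, of L]] by (simp add: S_eq plus_fun_def)
    have pc: "shift_op 0 p \<in> carrier torus_dops" using tor coord.hyps by blast
    have qc: "shift_op 0 (\<lambda>w. q (L *v w)) \<in> carrier torus_dops"
      using tor[OF leading_form_linear[of k q g L]] 1 by (simp add: good_def)
    have "shift_op 0 (\<lambda>w. of_int (w $ i) * p w) \<odot>\<^bsub>N\<^esub> n =
        shift_op 0 (\<lambda>w. (of_int ((B *v (L *v w)) $ i) + b) * q (L *v w)) \<odot>\<^bsub>N\<^esub> n" if n: "n \<in> Gr 0" for n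
    proof -
      have nN: "n \<in> carrier N" using n by (rule Gr_closed)
      \<comment> \<open>All weights at shift 0 commute, so \<open>\<theta>\<^sub>i\<close> can be
        moved to the right, where it meets an element of \<open>Gr 0\<close> directly.\<close>
      have "shift_op 0 (\<lambda>w. of_int (w $ i) * p w) = shift_op 0 p \<circ> theta i"
        by (simp add: theta_eq shift_op_comp mult.commute)
      then have "shift_op 0 (\<lambda>w. of_int (w $ i) * p w) \<odot>\<^bsub>N\<^esub> n = shift_op 0 p \<odot>\<^bsub>N\<^esub> (S \<odot>\<^bsub>N\<^esub> n)"
        using nN pc theta_weight_zero[OF n, of i] by (simp add: act_comp theta_torus(1) S_def b_def)
      also have "\<dots> = (shift_op 0 p \<circ> S) \<odot>\<^bsub>N\<^esub> n" using nN pc Sc by (simp add: act_comp)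
      also have "shift_op 0 p \<circ> S = S \<circ> shift_op 0 p"
        unfolding S_eq by (simp add: shift_op_comp mult.commute)
      also have "(S \<circ> shift_op 0 p) \<odot>\<^bsub>N\<^esub> n = S \<odot>\<^bsub>N\<^esub> (shift_op 0 (\<lambda>w. q (L *v w)) \<odot>\<^bsub>N\<^esub> n)"
        using nN pc Sc 1 n by (simp add: act_comp good_def)
      also have "\<dots> = (S \<circ> shift_op 0 (\<lambda>w. q (L *v w))) \<odot>\<^bsub>N\<^esub> n" using nN qc Sc by (simp add: act_comp)
      also have "S \<circ> shift_op 0 (\<lambda>w. q (L *v w)) = shift_op 0 (\<lambda>w. (of_int ((B *v (L *v w)) $ i) + b) * q (L *v w))"
        unfolding S_eq shift_op_comp by (simp add: op_apply)
      finally show ?thesis .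
    qed
    then have "good (k + 1) (\<lambda>w. of_int (w $ i) * p w) (\<lambda>y. y $ i * h y) (\<lambda>w. (of_int ((B *v w) $ i) + b) * q w) (\<lambda>y. (BC *v y) $ i * g y)"
      using q' 1 leading_form.coord[of k p h i] by (simp add: good_def add.commute)
    then show ?case by blast
  qed
  then show ?thesis unfolding good_def by blast
qed

text \<open>For \<open>A u = 0\<close> the factor \<open>x^u\<close> is \<open>x^(B L u)\<close>,
  the pull-back of \<open>z^(L u)\<close>; splitting it off on the left leaves a polynomial in
  \<open>\<theta>\<close> acting on \<open>Gr 0\<close>. On \<open>A y = 0\<close> one has
  \<open>y = B L y\<close>, which matches the symbols.\<close>

lemma degree_zero_reduce:
  assumes "has_symbol {u. A *v u = 0} k P f"
  shows "\<exists>Q g. has_symbol UNIV k Q g \<and> (\<forall>n\<in>Gr 0. P \<odot>\<^bsub>N\<^esub> n = pull Q \<odot>\<^bsub>N\<^esub> n) \<and>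
    (\<forall>x\<in>torus. \<forall>y. AC *v y = 0 \<longrightarrow> f x y = g (torus_map B x) (LC *v y))"
proof -
  define good where "good P f Q g \<longleftrightarrow> P \<in> carrier torus_dops \<and> has_symbol UNIV k Q g \<and> (\<forall>n\<in>Gr 0. P \<odot>\<^bsub>N\<^esub> n = pull Q \<odot>\<^bsub>N\<^esub> n) \<and>
    (\<forall>x\<in>torus. \<forall>y. AC *v y = 0 \<longrightarrow> f x y = g (torus_map B x) (LC *v y))" for P f Q g
  have "\<exists>Q g. good P f Q g"
    using assms
  proof (induction rule: has_symbol.induct)
    case zero
    have "good 0 (\<lambda>_ _. 0) 0 (\<lambda>_ _. 0)"
      by (simp add: good_def has_symbol.zero torus_dops_closed pull_zero)
    then show ?case by blast
  next
    case (shift u p h)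
    obtain q g where q: "leading_form k q g" "\<And>y. g y = h (BC *v y)"
      "\<And>n. n \<in> Gr 0 \<Longrightarrow> shift_op 0 p \<odot>\<^bsub>N\<^esub> n = shift_op 0 (\<lambda>w. q (L *v w)) \<odot>\<^bsub>N\<^esub> n"
      using leading_form_reduce[OF shift.hyps(2)] by blast
    have u: "B *v (L *v u) = u" using kernel_A[of u] shift.hyps(1) by simp
    have c: "shift_op 0 p \<in> carrier torus_dops" "shift_op 0 (\<lambda>w. q (L *v w)) \<in> carrier torus_dops"
      using has_symbol_carrier[OF has_symbol.shift[OF UNIV_I shift.hyps(2)]]
        has_symbol_carrier[OF has_symbol.shift[OF UNIV_I leading_form_linear[OF q(1), of L]]] by blast+
    have split: "shift_op u r = shift_op u (\<lambda>_. 1) \<circ> shift_op 0 r" for r by (simp add: shift_op_comp)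
    have "shift_op u p \<odot>\<^bsub>N\<^esub> n = pull (shift_op (L *v u) q) \<odot>\<^bsub>N\<^esub> n" if n: "n \<in> Gr 0" for n
    proof -
      have "shift_op u p \<odot>\<^bsub>N\<^esub> n = shift_op u (\<lambda>_. 1) \<odot>\<^bsub>N\<^esub> (shift_op 0 p \<odot>\<^bsub>N\<^esub> n)"
        using act_comp[OF shift_one_torus c(1) Gr_closed[OF n]] by (simp add: split[of p])
      also have "\<dots> = (shift_op u (\<lambda>_. 1) \<circ> shift_op 0 (\<lambda>w. q (L *v w))) \<odot>\<^bsub>N\<^esub> n"
        using act_comp[OF shift_one_torus c(2) Gr_closed[OF n]] q(3)[OF n] by simp
      also have "\<dots> = pull (shift_op (L *v u) q) \<odot>\<^bsub>N\<^esub> n"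
        unfolding pull_shift_op u by (simp add: shift_op_comp)
      finally show ?thesis .
    qed
    moreover have "tpow x u * h y = tpow (torus_map B x) (L *v u) * g (LC *v y)" if "x \<in> torus" "AC *v y = 0" for x y
      using tpow_matrix[OF that(1), of B "L *v u"] kernel_AC[OF that(2)] by (simp add: u q(2))
    ultimately have "good (shift_op u p) (\<lambda>x y. tpow x u * h y) (shift_op (L *v u) q) (\<lambda>x y. tpow x (L *v u) * g y)"
      using has_symbol.shift[OF UNIV_I q(1)] has_symbol_carrier[OF has_symbol.shift[OF UNIV_I shift.hyps(2)]]
      by (simp add: good_def)
    then show ?case by blast
  next
    case (add P f P' f')
    obtain Q g where 1: "good P f Q g" using add.IH by blast
    obtain Q' g' where 2: "good P' f' Q' g'" using add.IH by blast
    have "good (P + P') (\<lambda>x y. f x y + f' x y) (Q + Q') (\<lambda>x y. g x y + g' x y)"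
      using 1 2 Gr_closed unfolding good_def
      by (auto simp: pull_add act_add pull_torus has_symbol_carrier intro: torus_dops_closed has_symbol.add)
    then show ?case by blast
  next
    case (cong P f f')
    then obtain Q g where "good P f Q g" by blast
    then have "good P f' Q g" using cong.hyps by (auto simp: good_def)
    then show ?case by blast
  qed
  then show ?thesis unfolding good_def by blast
qed

lemma act_sum_isolate:
  assumes "finite \<Lambda>" "Z \<in> carrier torus_dops" "s \<in> carrier N" "\<And>\<alpha>. PP \<alpha> \<in> carrier torus_dops"
    and "\<And>\<alpha>'. \<alpha>' \<in> \<Lambda> - {\<alpha>} \<Longrightarrow> Z \<odot>\<^bsub>N\<^esub> (PP \<alpha>' \<odot>\<^bsub>N\<^esub> s) = \<zero>\<^bsub>N\<^esub>"
  shows "Z \<odot>\<^bsub>N\<^esub> ((\<Sum>\<alpha>'\<in>\<Lambda>. PP \<alpha>') \<odot>\<^bsub>N\<^esub> s) = (if \<alpha> \<in> \<Lambda> then Z \<odot>\<^bsub>N\<^esub> (PP \<alpha> \<odot>\<^bsub>N\<^esub> s) else \<zero>\<^bsub>N\<^esub>)"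
  using assms(1,5)
proof (induction \<Lambda>)
  case empty
  then show ?case using assms by (simp add: act_zero act_zero_right)
next
  case (insert \<gamma> \<Lambda>)
  have c: "(\<Sum>\<alpha>'\<in>\<Lambda>. PP \<alpha>') \<in> carrier torus_dops"
    by (induction \<Lambda> rule: infinite_finite_induct) (auto intro!: torus_dops_closed assms)
  have "Z \<odot>\<^bsub>N\<^esub> ((\<Sum>\<alpha>'\<in>insert \<gamma> \<Lambda>. PP \<alpha>') \<odot>\<^bsub>N\<^esub> s) =
      Z \<odot>\<^bsub>N\<^esub> (PP \<gamma> \<odot>\<^bsub>N\<^esub> s) \<oplus>\<^bsub>N\<^esub> Z \<odot>\<^bsub>N\<^esub> ((\<Sum>\<alpha>'\<in>\<Lambda>. PP \<alpha>') \<odot>\<^bsub>N\<^esub> s)"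
    using insert.hyps assms(2-4) c by (simp add: act_add smult_r_distr smult_closed)
  moreover have "Z \<odot>\<^bsub>N\<^esub> (PP \<gamma> \<odot>\<^bsub>N\<^esub> s) \<in> carrier N" by (intro smult_closed assms)
  moreover have "Z \<odot>\<^bsub>N\<^esub> (PP \<gamma> \<odot>\<^bsub>N\<^esub> s) = \<zero>\<^bsub>N\<^esub>" if "\<gamma> \<noteq> \<alpha>"
    using insert.prems[of \<gamma>] that by blast
  moreover have "Z \<odot>\<^bsub>N\<^esub> ((\<Sum>\<alpha>'\<in>\<Lambda>. PP \<alpha>') \<odot>\<^bsub>N\<^esub> s) = (if \<alpha> \<in> \<Lambda> then Z \<odot>\<^bsub>N\<^esub> (PP \<alpha> \<odot>\<^bsub>N\<^esub> s) else \<zero>\<^bsub>N\<^esub>)"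
    using insert by blast
  moreover have "Z \<odot>\<^bsub>N\<^esub> (PP \<alpha> \<odot>\<^bsub>N\<^esub> s) \<in> carrier N" by (intro smult_closed assms)
  ultimately show ?case using insert.hyps by (cases "\<gamma> = \<alpha>") (auto simp del: sum.insert)
qed

end

locale weighted_delta = weighted_module A L R B N \<beta> Gr
  for A :: "int ^ ('n::finite) ^ ('d::finite)" and L :: "int ^ 'n ^ ('m::finite)"
    and R :: "int ^ 'd ^ 'n" and B :: "int ^ 'm ^ 'n" and N :: "('n dop, 'v) module" and \<beta> Gr +
  fixes Atil :: "int ^ 'n ^ ('d + 'm)"
  assumes eta: "eta_matrix Atil B = map_matrix of_int L"
begin

abbreviation "Dm \<equiv> Delta Atil B N Gr"

lemma Dm_simps: "carrier Dm = Gr 0" "\<zero>\<^bsub>Dm\<^esub> = \<zero>\<^bsub>N\<^esub>" "x \<oplus>\<^bsub>Dm\<^esub> y = x \<oplus>\<^bsub>N\<^esub> y"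
  by (simp_all add: Delta_def)

lemma Dm_act: "Q \<in> carrier torus_dops \<Longrightarrow> Q \<odot>\<^bsub>Dm\<^esub> u = pull Q \<odot>\<^bsub>N\<^esub> u"
  by (simp add: Delta_def delta_hom_eq[OF eta])

lemma Gr0_facts: "\<zero>\<^bsub>N\<^esub> \<in> Gr 0" "x \<in> Gr 0 \<Longrightarrow> y \<in> Gr 0 \<Longrightarrow> x \<oplus>\<^bsub>N\<^esub> y \<in> Gr 0" "x \<in> Gr 0 \<Longrightarrow> \<ominus>\<^bsub>N\<^esub> x \<in> Gr 0"
  using subgroup.one_closed[OF Gr_subgroup[of 0]] subgroup.m_closed[OF Gr_subgroup[of 0]]
    subgroup.m_inv_closed[OF Gr_subgroup[of 0]] by (simp_all add: a_inv_def)

lemma pull_Gr0: assumes "Q \<in> carrier torus_dops" "u \<in> Gr 0" shows "pull Q \<odot>\<^bsub>N\<^esub> u \<in> Gr 0"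
proof -
  obtain k g where "has_symbol UNIV k Q g" using assms(1) by (auto simp: carrier_torus_dops)
  from Gr_act[OF pull_symbol[OF this] assms(2)] show ?thesis by simp
qed

lemma Dm_module: "left_module torus_dops Dm"
proof (intro left_module.intro left_module_axioms.intro ring_torus_dops abelian_groupI)
  fix x assume "x \<in> carrier Dm"
  then show "\<exists>y\<in>carrier Dm. y \<oplus>\<^bsub>Dm\<^esub> x = \<zero>\<^bsub>Dm\<^esub>"
    using Gr0_facts Gr_closed by (intro bexI[of _ "\<ominus>\<^bsub>N\<^esub> x"]) (auto simp: Dm_simps M.l_neg)
qed (auto simp: Dm_simps Dm_act Gr0_facts Gr_closed pull_Gr0 torus_dops_closed pull_add pull_comp pull_id
    act_add act_comp act_id smult_r_distr pull_torus M.a_ac)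

sublocale D: torus_module Dm
  by (intro torus_module.intro filtered_dop_moduleI_torus Dm_module)

lemma filt_Dm_subset:
  assumes S: "S \<subseteq> Gr 0" and "u \<in> D.filt S l" shows "u \<in> filt S l"
  using assms(2)
proof (induction rule: D.span_induct)
  case zero
  show ?case unfolding Dm_simps by (rule span_zero)
next
  case (gen Q s)
  then obtain g where Q: "has_symbol UNIV l Q g" by (auto simp: torus_filt_def)
  then have "pull Q \<in> torus_filt l"
    using has_symbol_subset[OF pull_symbol[OF Q], of UNIV] by (auto simp: torus_filt_def)
  then show ?case using gen has_symbol_carrier[OF Q] by (auto simp: Dm_act intro: span_incl)
next
  case (add x y)
  then show ?case unfolding Dm_simps by (intro span_add)
qed (use S D.F_sub D.F_uminus in \<open>auto simp: Dm_simps\<close>)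

definition is_projector :: "(int ^ 'd) set \<Rightarrow> 'n dop \<Rightarrow> bool" where
  "is_projector \<Lambda> Q \<longleftrightarrow> Q \<in> carrier torus_dops \<and> (\<forall>n\<in>Gr 0. Q \<odot>\<^bsub>N\<^esub> n = n) \<and>
    (\<forall>\<alpha>'\<in>\<Lambda> - {0}. \<forall>n\<in>Gr \<alpha>'. Q \<odot>\<^bsub>N\<^esub> n = \<zero>\<^bsub>N\<^esub>)"

text \<open>The degree-zero component of an operator of order \<open>l\<close> still has order at
  most \<open>l\<close> and acts on \<open>Gr 0\<close> through an operator on \<open>Z\<close> of
  that order. Which degrees must be projected away depends on \<open>u\<close>, hence the finite set
  in front of the quantifier over projectors.\<close>

lemma project_filt:
  assumes S: "S \<subseteq> Gr 0" and "u \<in> filt S l"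
  shows "\<exists>\<Lambda>. finite \<Lambda> \<and> (\<forall>Q. is_projector \<Lambda> Q \<longrightarrow> Q \<odot>\<^bsub>N\<^esub> u \<in> D.filt S l)"
proof -
  have SN: "S \<subseteq> carrier N" using S Gr_closed by blast
  show ?thesis
    using assms(2)
  proof (induction rule: span_induct)
    case zero
    have "Q \<odot>\<^bsub>N\<^esub> \<zero>\<^bsub>N\<^esub> \<in> D.filt S l" if "is_projector {} Q" for Q
      using D.span_zero that unfolding Dm_simps by (simp add: is_projector_def act_zero_right)
    then show ?case by blast
  next
    case (gen P s)
    obtain f where "has_symbol UNIV l P f" using gen by (auto simp: torus_filt_def)
    from homogeneous_decomposition[OF this, of A] obtain \<Lambda> PP ff where \<Lambda>: "finite \<Lambda>"
      "\<And>\<alpha>. has_symbol {u. A *v u = \<alpha>} l (PP \<alpha>) (ff \<alpha>)" "\<And>\<alpha>. \<alpha> \<notin> \<Lambda> \<Longrightarrow> PP \<alpha> = 0" "P = (\<Sum>\<alpha>\<in>\<Lambda>. PP \<alpha>)"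
      by blast
    have s: "s \<in> Gr 0" "s \<in> carrier N" using gen S SN by auto
    have PPs: "PP \<alpha> \<odot>\<^bsub>N\<^esub> s \<in> Gr \<alpha>" for \<alpha> using Gr_act[OF \<Lambda>(2) s(1)] by simp
    have "Q \<odot>\<^bsub>N\<^esub> (P \<odot>\<^bsub>N\<^esub> s) \<in> D.filt S l" if Q: "is_projector \<Lambda> Q" for Q
    proof -
      have "Q \<odot>\<^bsub>N\<^esub> (P \<odot>\<^bsub>N\<^esub> s) = (if 0 \<in> \<Lambda> then Q \<odot>\<^bsub>N\<^esub> (PP 0 \<odot>\<^bsub>N\<^esub> s) else \<zero>\<^bsub>N\<^esub>)"
        unfolding \<Lambda>(4) using Q PPs has_symbol_carrier[OF \<Lambda>(2)] s \<Lambda>(1)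
        by (intro act_sum_isolate) (auto simp: is_projector_def)
      also have "\<dots> = PP 0 \<odot>\<^bsub>N\<^esub> s"
        using Q PPs[of 0] \<Lambda>(3)[of 0] s by (auto simp: is_projector_def act_zero)
      finally have eq: "Q \<odot>\<^bsub>N\<^esub> (P \<odot>\<^bsub>N\<^esub> s) = PP 0 \<odot>\<^bsub>N\<^esub> s" .
      obtain Q' g where Q': "has_symbol UNIV l Q' g" "PP 0 \<odot>\<^bsub>N\<^esub> s = pull Q' \<odot>\<^bsub>N\<^esub> s"
        using degree_zero_reduce[OF \<Lambda>(2)[of 0]] s(1) by blast
      have "Q' \<odot>\<^bsub>Dm\<^esub> s \<in> D.filt S l" using Q'(1) gen(2) by (intro D.span_incl) (auto simp: torus_filt_def)
      then show ?thesis using Q'(2) has_symbol_carrier[OF Q'(1)] by (simp add: eq Dm_act)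
    qed
    then show ?case using \<Lambda>(1) by blast
  next
    case (add x y)
    then obtain \<Lambda> \<Lambda>' where "finite \<Lambda>" "\<And>Q. is_projector \<Lambda> Q \<Longrightarrow> Q \<odot>\<^bsub>N\<^esub> x \<in> D.filt S l"
      "finite \<Lambda>'" "\<And>Q. is_projector \<Lambda>' Q \<Longrightarrow> Q \<odot>\<^bsub>N\<^esub> y \<in> D.filt S l" by blast
    moreover have "is_projector \<Lambda> Q" "is_projector \<Lambda>' Q" "Q \<in> carrier torus_dops" if "is_projector (\<Lambda> \<union> \<Lambda>') Q" for Q
      using that by (auto simp: is_projector_def)
    moreover have "x \<in> carrier N" "y \<in> carrier N" using add.hyps filt_closed[OF SN] by blast+
    moreover have "a \<oplus>\<^bsub>N\<^esub> b \<in> D.filt S l" if "a \<in> D.filt S l" "b \<in> D.filt S l" for a b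
      using D.span_add[OF that] by (simp add: Dm_simps)
    ultimately show ?case by (intro exI[of _ "\<Lambda> \<union> \<Lambda>'"]) (simp add: smult_r_distr)
  qed (use SN F_sub F_uminus in auto)
qed

text \<open>\<open>E\<^sub>i - \<beta>\<^sub>i\<close> annihilates \<open>S\<close> and has symbol
  \<open>(A y)\<^sub>i\<close>, which confines the support to \<open>A y = 0\<close>. There, an
  operator on \<open>Z\<close> is tested on \<open>X\<close> through \<open>pull\<close>, and one on
  \<open>X\<close> is tested on \<open>Z\<close> through its homogeneous components, each brought to
  degree zero.\<close>

theorem log_support_weighted:
  assumes S: "finite S" "S \<subseteq> Gr 0"
  shows "(x, y) \<in> log_support N S \<longleftrightarrow>
    x \<in> torus \<and> AC *v y = 0 \<and> (torus_map B x, LC *v y) \<in> log_support Dm S"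
proof
  assume xy: "(x, y) \<in> log_support N S"
  then have x: "x \<in> torus" and supp: "\<And>k P f. has_symbol UNIV k P f \<Longrightarrow>
      (\<And>s. s \<in> S \<Longrightarrow> P \<odot>\<^bsub>N\<^esub> s \<in> filt S (k - 1)) \<Longrightarrow> f x y = 0"
    by (auto simp: log_support_def)
  have "(AC *v y) $ i = 0" for i
  proof -
    have sym: "has_symbol UNIV 1 (euler A i - cst (\<beta> $ i)) (\<lambda>x y. (AC *v y) $ i - 0)"
    proof (rule has_symbol_diff)
      show "has_symbol UNIV 1 (euler A i) (\<lambda>x y. (AC *v y) $ i)"
        by (rule has_symbol_subset[OF euler_symbol]) simp
      show "has_symbol UNIV 1 (cst (\<beta> $ i)) (\<lambda>_ _. 0)"
        unfolding cst_def by (rule has_symbol_mono[OF has_symbol_shift_one]) auto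
    qed
    have "(euler A i - cst (\<beta> $ i)) \<odot>\<^bsub>N\<^esub> s \<in> filt S (1 - 1)" if s: "s \<in> S" for s
    proof -
      have "s \<in> Gr 0" "s \<in> carrier N" using s S Gr_closed by auto
      then have "(euler A i - cst (\<beta> $ i)) \<odot>\<^bsub>N\<^esub> s = \<zero>\<^bsub>N\<^esub>"
        using Gr_weight[of s 0 i] by (simp add: act_diff euler_torus cst_torus M.minus_eq M.r_neg smult_closed)
      then show ?thesis using span_zero by simp
    qed
    then show ?thesis using supp[OF sym] by simp
  qed
  then have "AC *v y = 0" by (simp add: vec_eq_iff)
  moreover have "(torus_map B x, LC *v y) \<in> log_support Dm S"
    unfolding log_support_def
  proof (intro CollectI case_prodI conjI allI impI torus_map_torus x)
    fix k Q g assume Q: "has_symbol UNIV k Q g" "\<forall>s\<in>S. Q \<odot>\<^bsub>Dm\<^esub> s \<in> D.filt S (k - 1)"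
    have "pull Q \<odot>\<^bsub>N\<^esub> s \<in> filt S (k - 1)" if "s \<in> S" for s
      using filt_Dm_subset[OF S(2)] Q(2) that has_symbol_carrier[OF Q(1)] by (simp add: Dm_act)
    then show "g (torus_map B x) (LC *v y) = 0"
      using supp[OF has_symbol_subset[OF pull_symbol[OF Q(1)] subset_UNIV]] by simp
  qed
  ultimately show "x \<in> torus \<and> AC *v y = 0 \<and> (torus_map B x, LC *v y) \<in> log_support Dm S" using x by blast
next
  assume *: "x \<in> torus \<and> AC *v y = 0 \<and> (torus_map B x, LC *v y) \<in> log_support Dm S"
  then have x: "x \<in> torus" and y: "AC *v y = 0" and supp: "\<And>k Q g. has_symbol UNIV k Q g \<Longrightarrow>
      (\<And>s. s \<in> S \<Longrightarrow> Q \<odot>\<^bsub>Dm\<^esub> s \<in> D.filt S (k - 1)) \<Longrightarrow> g (torus_map B x) (LC *v y) = 0"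
    by (auto simp: log_support_def)
  have SN: "S \<subseteq> carrier N" using S Gr_closed by blast
  show "(x, y) \<in> log_support N S"
    unfolding log_support_def
  proof (intro CollectI case_prodI conjI allI impI x)
    fix k P f assume P: "has_symbol UNIV k P f" "\<forall>s\<in>S. P \<odot>\<^bsub>N\<^esub> s \<in> filt S (k - 1)"
    from homogeneous_decomposition[OF P(1), of A] obtain \<Lambda> PP ff where \<Lambda>: "finite \<Lambda>"
      "\<And>\<alpha>. has_symbol {u. A *v u = \<alpha>} k (PP \<alpha>) (ff \<alpha>)" "P = (\<Sum>\<alpha>\<in>\<Lambda>. PP \<alpha>)"
      "\<And>x y. x \<in> torus \<Longrightarrow> f x y = (\<Sum>\<alpha>\<in>\<Lambda>. ff \<alpha> x y)"
      by blast
    have PPc: "PP \<alpha> \<in> carrier torus_dops" for \<alpha> using \<Lambda>(2) by (rule has_symbol_carrier)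
    have "ff \<alpha> x y = 0" if \<alpha>: "\<alpha> \<in> \<Lambda>" for \<alpha>
    proof -
      \<comment> \<open>Since \<open>A R = 1\<close>, the monomial \<open>x^c\<close> has degree
        \<open>- \<alpha>\<close> and brings the component of degree \<open>\<alpha>\<close> to
        degree zero; it has order 0 and its symbol has no zeros on the torus.\<close>
      define c where "c = R *v (- \<alpha>)"
      have Ac: "A *v c = - \<alpha>" by (simp add: c_def matrix_vector_mul_assoc AR)
      define T where "T = (shift_op c (\<lambda>_. 1) :: 'n dop)"
      have T: "has_symbol {u. A *v u = - \<alpha>} 0 T (\<lambda>x y. 1 * tpow x c)"
        unfolding T_def by (rule has_symbol_shift_one) (simp add: Ac)
      have Tc: "T \<in> carrier torus_dops" using T by (rule has_symbol_carrier)
      have T0: "T \<in> torus_filt 0" using has_symbol_subset[OF T, of UNIV] by (auto simp: torus_filt_def)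
      have "\<exists>\<Lambda>s. finite \<Lambda>s \<and> (\<forall>Q. is_projector \<Lambda>s Q \<longrightarrow> Q \<odot>\<^bsub>N\<^esub> (T \<odot>\<^bsub>N\<^esub> (P \<odot>\<^bsub>N\<^esub> s)) \<in> D.filt S (k - 1))" if "s \<in> S" for s
        using filt_act[OF SN T0, of "P \<odot>\<^bsub>N\<^esub> s" "k - 1"] P(2) that by (intro project_filt[OF S(2)]) auto
      then obtain \<Lambda>s where \<Lambda>s: "\<And>s. s \<in> S \<Longrightarrow> finite (\<Lambda>s s)"
        "\<And>s Q. s \<in> S \<Longrightarrow> is_projector (\<Lambda>s s) Q \<Longrightarrow> Q \<odot>\<^bsub>N\<^esub> (T \<odot>\<^bsub>N\<^esub> (P \<odot>\<^bsub>N\<^esub> s)) \<in> D.filt S (k - 1)"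
        by metis
      \<comment> \<open>The degrees to be projected away: those demanded by
        \<open>project_filt\<close> for each generator, and those of the shifted components of
        \<open>P\<close>.\<close>
      define \<Lambda>' where "\<Lambda>' = (\<Union>s\<in>S. \<Lambda>s s) \<union> (\<lambda>\<alpha>'. - \<alpha> + \<alpha>') ` \<Lambda>"
      have "finite \<Lambda>'" using S(1) \<Lambda>s(1) \<Lambda>(1) by (simp add: \<Lambda>'_def)
      from projector[OF this, of 0] obtain Q where "is_projector \<Lambda>' Q"
        by (elim bexE) (rule that, simp only: is_projector_def)
      note Q = this
      have Qc: "Q \<in> carrier torus_dops" using Q by (simp add: is_projector_def)
      have iso: "Q \<odot>\<^bsub>N\<^esub> (T \<odot>\<^bsub>N\<^esub> (P \<odot>\<^bsub>N\<^esub> s)) = (T \<circ> PP \<alpha>) \<odot>\<^bsub>N\<^esub> s" if s: "s \<in> S" for s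
      proof -
        have s': "s \<in> Gr 0" "s \<in> carrier N" using s S SN by auto
        have TPP: "T \<odot>\<^bsub>N\<^esub> (PP \<alpha>' \<odot>\<^bsub>N\<^esub> s) \<in> Gr (- \<alpha> + \<alpha>')" for \<alpha>'
          using Gr_act[OF T Gr_act[OF \<Lambda>(2) s'(1)]] by simp
        have QT: "(Q \<circ> T) \<odot>\<^bsub>N\<^esub> n = Q \<odot>\<^bsub>N\<^esub> (T \<odot>\<^bsub>N\<^esub> n)" if "n \<in> carrier N" for n
          using that Qc Tc by (simp add: act_comp)
        have n: "PP \<alpha>' \<odot>\<^bsub>N\<^esub> s \<in> carrier N" for \<alpha>' using PPc s' by (intro smult_closed)
        have Pn: "P \<odot>\<^bsub>N\<^esub> s \<in> carrier N" using has_symbol_carrier[OF P(1)] s' by (intro smult_closed)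
        have "Q \<odot>\<^bsub>N\<^esub> (T \<odot>\<^bsub>N\<^esub> (P \<odot>\<^bsub>N\<^esub> s)) = (Q \<circ> T) \<odot>\<^bsub>N\<^esub> ((\<Sum>\<alpha>\<in>\<Lambda>. PP \<alpha>) \<odot>\<^bsub>N\<^esub> s)"
          using QT[OF Pn] by (simp add: \<Lambda>(3))
        also have "\<dots> = (if \<alpha> \<in> \<Lambda> then (Q \<circ> T) \<odot>\<^bsub>N\<^esub> (PP \<alpha> \<odot>\<^bsub>N\<^esub> s) else \<zero>\<^bsub>N\<^esub>)"
        proof (rule act_sum_isolate[OF \<Lambda>(1) _ s'(2) PPc])
          show "Q \<circ> T \<in> carrier torus_dops" using Qc Tc by (rule torus_dops_closed)
          fix \<alpha>' assume "\<alpha>' \<in> \<Lambda> - {\<alpha>}"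
          then have "- \<alpha> + \<alpha>' \<in> \<Lambda>' - {0}" by (auto simp: \<Lambda>'_def)
          then show "(Q \<circ> T) \<odot>\<^bsub>N\<^esub> (PP \<alpha>' \<odot>\<^bsub>N\<^esub> s) = \<zero>\<^bsub>N\<^esub>"
            using Q TPP[of \<alpha>'] unfolding QT[OF n] is_projector_def by blast
        qed
        also have "\<dots> = T \<odot>\<^bsub>N\<^esub> (PP \<alpha> \<odot>\<^bsub>N\<^esub> s)"
          using \<alpha> Q TPP[of \<alpha>] by (simp add: QT[OF n] is_projector_def)
        finally show ?thesis using Tc PPc s' by (simp add: act_comp)
      qed
      have "has_symbol {u. A *v u = 0} (0 + k) (T \<circ> PP \<alpha>) (\<lambda>x y. 1 * tpow x c * ff \<alpha> x y)"
        using T \<Lambda>(2) by (rule has_symbol_comp) (simp add: matrix_vector_mult_plus)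
      then have "has_symbol {u. A *v u = 0} k (T \<circ> PP \<alpha>) (\<lambda>x y. tpow x c * ff \<alpha> x y)" by simp
      from degree_zero_reduce[OF this] obtain Q' g where Q': "has_symbol UNIV k Q' g"
        "\<And>n. n \<in> Gr 0 \<Longrightarrow> (T \<circ> PP \<alpha>) \<odot>\<^bsub>N\<^esub> n = pull Q' \<odot>\<^bsub>N\<^esub> n"
        "\<And>x y. x \<in> torus \<Longrightarrow> AC *v y = 0 \<Longrightarrow> tpow x c * ff \<alpha> x y = g (torus_map B x) (LC *v y)" by blast
      have "Q' \<odot>\<^bsub>Dm\<^esub> s \<in> D.filt S (k - 1)" if s: "s \<in> S" for s
      proof -
        have "is_projector (\<Lambda>s s) Q" using Q s by (auto simp: is_projector_def \<Lambda>'_def)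
        from \<Lambda>s(2)[OF s this] have "(T \<circ> PP \<alpha>) \<odot>\<^bsub>N\<^esub> s \<in> D.filt S (k - 1)" unfolding iso[OF s] .
        then show ?thesis using Q'(2)[of s] s S has_symbol_carrier[OF Q'(1)] by (auto simp: Dm_act)
      qed
      then have "tpow x c * ff \<alpha> x y = 0" using supp[OF Q'(1)] Q'(3)[OF x y] by simp
      then show ?thesis using tpow_nonzero[OF x] by simp
    qed
    then show "f x y = 0" using \<Lambda>(4)[OF x] by simp
  qed
qed

end

section \<open>Polynomial functions and the linear independence of monomials\<close>

section \<open>Polynomial functions\<close>

declare op_apply [simp]

text \<open>Unlike \<open>tpow_add\<close> this covers points with vanishing coordinates, because
  nonnegative exponents reduce to ordinary powers.\<close>

lemma tpow_add_nonneg: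
  assumes "\<And>i. 0 \<le> u $ i" "\<And>i. 0 \<le> v $ i" shows "tpow x (u + v) = tpow x u * tpow x v"
  unfolding tpow_def prod.distrib[symmetric]
proof (rule prod.cong)
  fix i
  obtain a b where "u $ i = int a" "v $ i = int b" using assms[of i] nonneg_int_cases by metis
  then show "x $ i powi (u + v) $ i = x $ i powi u $ i * x $ i powi v $ i"
    by (simp add: power_add flip: of_nat_add)
qed simp

lemma leval_sum: "leval (\<Sum>i\<in>I. f i) x = (\<Sum>i\<in>I. leval (f i) x)"
  by (induction I rule: infinite_finite_induct) (auto simp: leval_add)

lemma leval_mult:
  assumes "f \<in> polynomials" "g \<in> polynomials" shows "leval (f * g) x = leval f x * leval g x"
proof -
  let ?l = "Poly_Mapping.lookup" and ?K = "Poly_Mapping.keys"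
  have nnf: "0 \<le> u $ i" if "u \<in> ?K f" for u i
    using assms(1) that by (simp add: polynomials_def)
  have nng: "0 \<le> u $ i" if "u \<in> ?K g" for u i
    using assms(2) that by (simp add: polynomials_def)
  have "f * g = (\<Sum>u\<in>?K f. Poly_Mapping.single u (?l f u)) * (\<Sum>v\<in>?K g. Poly_Mapping.single v (?l g v))"
    by (simp flip: poly_mapping_as_sum)
  also have "\<dots> = (\<Sum>u\<in>?K f. \<Sum>v\<in>?K g. Poly_Mapping.single (u + v) (?l f u * ?l g v))"
    by (simp add: sum_product mult_single)
  also have "leval \<dots> x = (\<Sum>u\<in>?K f. \<Sum>v\<in>?K g. (?l f u * tpow x u) * (?l g v * tpow x v))"
    unfolding leval_sum leval_single
    by (intro sum.cong refl) (simp add: tpow_add_nonneg nnf nng)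
  also have "\<dots> = leval f x * leval g x"
    by (simp add: leval_superset[OF finite_keys order_refl] sum_product)
  finally show ?thesis .
qed

lemma polyfuns_const: "(\<lambda>_. c) \<in> polyfuns"
proof -
  have "(\<lambda>_. c) = leval (Poly_Mapping.single 0 c)" by (simp add: fun_eq_iff leval_single)
  moreover have "Poly_Mapping.single 0 c \<in> polynomials" by (simp add: polynomials_def)
  ultimately show ?thesis unfolding polyfuns_def by (rule image_eqI)
qed

lemma polyfuns_coord: "(\<lambda>x. x $ i) \<in> polyfuns"
proof -
  have "(\<lambda>x. x $ i) = leval (Poly_Mapping.single (axis i 1) 1)" by (simp add: fun_eq_iff leval_single tpow_axis)
  moreover have "Poly_Mapping.single (axis i 1) 1 \<in> polynomials" by (simp add: polynomials_def axis_def)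
  ultimately show ?thesis unfolding polyfuns_def by (rule image_eqI)
qed

lemma polyfuns_add: "f \<in> polyfuns \<Longrightarrow> g \<in> polyfuns \<Longrightarrow> (\<lambda>x. f x + g x) \<in> polyfuns"
proof -
  assume "f \<in> polyfuns" "g \<in> polyfuns"
  then obtain a b where "f = leval a" "a \<in> polynomials" "g = leval b" "b \<in> polynomials" by (auto simp: polyfuns_def)
  then show ?thesis unfolding polyfuns_def by (intro image_eqI[of _ _ "a + b"]) (auto simp: leval_add polynomials_add)
qed

lemma polyfuns_mult: "f \<in> polyfuns \<Longrightarrow> g \<in> polyfuns \<Longrightarrow> (\<lambda>x. f x * g x) \<in> polyfuns"
proof -
  assume "f \<in> polyfuns" "g \<in> polyfuns"
  then obtain a b where "f = leval a" "a \<in> polynomials" "g = leval b" "b \<in> polynomials" by (auto simp: polyfuns_def)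
  then show ?thesis unfolding polyfuns_def by (intro image_eqI[of _ _ "a * b"]) (auto simp: leval_mult polynomials_mult)
qed

lemma polyfuns_diff: "f \<in> polyfuns \<Longrightarrow> g \<in> polyfuns \<Longrightarrow> (\<lambda>x. f x - g x) \<in> polyfuns"
  using polyfuns_add[OF _ polyfuns_mult[OF polyfuns_const[of "-1"]], of f g] by simp

lemma polyfuns_sum: "(\<And>i. i \<in> I \<Longrightarrow> f i \<in> polyfuns) \<Longrightarrow> (\<lambda>x. \<Sum>i\<in>I. f i x) \<in> polyfuns"
  by (induction I rule: infinite_finite_induct) (auto intro: polyfuns_const polyfuns_add)

lemma polyfuns_prod: "(\<And>i. i \<in> I \<Longrightarrow> f i \<in> polyfuns) \<Longrightarrow> (\<lambda>x. \<Prod>i\<in>I. f i x) \<in> polyfuns"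
  by (induction I rule: infinite_finite_induct) (auto intro: polyfuns_const polyfuns_mult)

lemma polyfuns_power: "f \<in> polyfuns \<Longrightarrow> (\<lambda>x. f x ^ n) \<in> polyfuns"
  by (induction n) (auto intro: polyfuns_const polyfuns_mult)

lemma polyfuns_ymon: "ymon v \<in> polyfuns"
  unfolding ymon_def[abs_def] by (intro polyfuns_prod polyfuns_power polyfuns_coord)

lemma polyfunsE:
  assumes "f \<in> polyfuns"
  obtains I c where "finite I" "f = (\<lambda>x. \<Sum>v\<in>I. c v * ymon v x)"
proof -
  obtain a where a: "f = leval a" "a \<in> polynomials" using assms by (auto simp: polyfuns_def)
  define r where "r u = (\<chi> i. nat (u $ i))" for u :: "int ^ 'a"
  have r: "ivec (r u) = u" if "u \<in> Poly_Mapping.keys a" for u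
    using a(2) that by (simp add: polynomials_def r_def ivec_def vec_eq_iff)
  have inj: "inj_on r (Poly_Mapping.keys a)" by (rule inj_on_inverseI[of _ ivec]) (rule r)
  have "f x = (\<Sum>v\<in>r ` Poly_Mapping.keys a. Poly_Mapping.lookup a (ivec v) * ymon v x)" for x
    unfolding a(1) leval_superset[OF finite_keys order_refl] sum.reindex[OF inj]
    by (intro sum.cong refl) (simp add: r tpow_ivec[symmetric] comp_def)
  then show ?thesis using that[of "r ` Poly_Mapping.keys a" "\<lambda>v. Poly_Mapping.lookup a (ivec v)"] by auto
qed

lemma polyfuns_induct [consumes 1, case_names const coord add]:
  assumes "f \<in> polyfuns" "\<And>c. Q (\<lambda>_. c)"
    "\<And>f i. f \<in> polyfuns \<Longrightarrow> Q f \<Longrightarrow> Q (\<lambda>x. x $ i * f x)"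
    "\<And>f g. f \<in> polyfuns \<Longrightarrow> g \<in> polyfuns \<Longrightarrow> Q f \<Longrightarrow> Q g \<Longrightarrow> Q (\<lambda>x. f x + g x)"
  shows "Q f"
proof -
  obtain I c where I: "finite I" "f = (\<lambda>x. \<Sum>v\<in>I. c v * ymon v x)" using assms(1) by (rule polyfunsE)
  have mon: "Q (\<lambda>x. a * ymon v x)" for a v
  proof (induction v rule: vec_nat_induct)
    case zero
    then show ?case using assms(2)[of a] by simp
  next
    case (step v i)
    have "(\<lambda>x. a * ymon (v + axis i 1) x) = (\<lambda>x. x $ i * (a * ymon v x))"
      by (simp add: ymon_Suc mult.left_commute)
    then show ?case using assms(3)[OF polyfuns_mult[OF polyfuns_const polyfuns_ymon] step, of i] by simp
  qed
  have "Q (\<lambda>x. \<Sum>v\<in>I. c v * ymon v x)"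
    using I(1)
  proof (induction I)
    case empty
    show ?case using assms(2)[of 0] by simp
  next
    case (insert v I)
    have "(\<lambda>x. \<Sum>v\<in>I. c v * ymon v x) \<in> polyfuns" "(\<lambda>x. c v * ymon v x) \<in> polyfuns"
      by (intro polyfuns_sum polyfuns_mult polyfuns_const polyfuns_ymon)+
    then show ?case using assms(4)[of "\<lambda>x. c v * ymon v x", OF _ _ mon insert.IH] insert.hyps by simp
  qed
  then show ?thesis using I by simp
qed

text \<open>The points whose coordinates are powers of distinct primes separate the monomials.\<close>

lemma ymon_independent:
  assumes "finite I" "\<And>x. x \<in> torus \<Longrightarrow> (\<Sum>v\<in>I. c v * ymon v x) = 0" "v \<in> (I :: (nat ^ ('n::finite)) set)"
  shows "c v = 0"
proof -
  obtain code :: "'n mon \<Rightarrow> nat" and p q where "monomial_code code p q" using monomial_code_exists by blast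
  then interpret monomial_code code p q .
  \<comment> \<open>Dividing by the code of the empty monomial removes the prime of the basis
    vector, so that \<open>C\<close> is multiplicative and \<open>ymon v (pt s)\<close> equals
    \<open>C v ^ s\<close>.\<close>
  define C where "C v = (of_nat (code (v, 0, 0)) / of_nat (code (0, 0, 0)) :: complex)" for v
  define pt where "pt s = ((\<chi> i. of_nat (p i) ^ s) :: complex ^ 'n)" for s :: nat
  have "p i \<noteq> 0" for i using p[of i] by simp
  then have pt: "pt s \<in> torus" for s by (simp add: torus_def pt_def)
  have mon: "ymon v (pt s) = C v ^ s" for v s
  proof (induction v rule: vec_nat_induct)
    case zero
    then show ?case using code_pos[of "(0, 0, 0)"] by (simp add: C_def)
  next
    case (step v i)
    then show ?case by (simp add: ymon_Suc code_x C_def pt_def power_mult_distrib flip: times_divide_eq_right)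
  qed
  have "\<forall>v\<in>I. c v = 0"
    using assms(1,2)
  proof (induction "card I" arbitrary: I)
    case 0
    then show ?case by simp
  next
    case (Suc n)
    then have ne: "I \<noteq> {}" by auto
    have "Max ((\<lambda>v. code (v, 0, 0)) ` I) \<in> (\<lambda>v. code (v, 0, 0)) ` I" using ne Suc.prems(1) by (intro Max_in) auto
    then obtain w where w: "w \<in> I" "code (w, 0, 0) = Max ((\<lambda>v. code (v, 0, 0)) ` I)" by auto
    have less: "code (v, 0, 0) < code (w, 0, 0)" if "v \<in> I - {w}" for v
    proof -
      have "code (v, 0, 0) \<le> code (w, 0, 0)" unfolding w(2) using that Suc.prems(1) by (intro Max_ge) auto
      moreover have "code (v, 0, 0) \<noteq> code (w, 0, 0)" using that inj_code by (auto dest: injD)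
      ultimately show ?thesis by simp
    qed
    \<comment> \<open>The largest base dominates: after division by \<open>C w ^ s\<close> all other
      terms tend to 0, which isolates \<open>c w\<close>.\<close>
    have "(\<lambda>s. \<Sum>v\<in>I. c v * (C v / C w) ^ s) \<longlonglongrightarrow> (\<Sum>v\<in>I. if v = w then c w else 0)"
    proof (rule tendsto_sum)
      fix v assume v: "v \<in> I"
      show "(\<lambda>s. c v * (C v / C w) ^ s) \<longlonglongrightarrow> (if v = w then c w else 0)"
      proof (cases "v = w")
        case True
        then show ?thesis using code_pos[of "(w, 0, 0)"] code_pos[of "(0, 0, 0)"] by (simp add: C_def)
      next
        case False
        then have "norm (C v / C w) < 1"
          using less[of v] v code_pos by (simp add: C_def norm_divide)
        then show ?thesis using False LIMSEQ_power_zero[of "C v / C w"] by (auto intro: tendsto_mult_right_zero)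
      qed
    qed
    moreover have "(\<Sum>v\<in>I. c v * (C v / C w) ^ s) = 0" for s
    proof -
      have "(\<Sum>v\<in>I. c v * (C v / C w) ^ s) = (\<Sum>v\<in>I. c v * ymon v (pt s)) / C w ^ s"
        by (simp add: mon power_divide sum_divide_distrib)
      then show ?thesis using Suc.prems(2)[OF pt] by simp
    qed
    ultimately have "(\<lambda>s :: nat. 0 :: complex) \<longlonglongrightarrow> (\<Sum>v\<in>I. if v = w then c w else 0)" by simp
    then have cw: "c w = 0" using w(1) Suc.prems(1) by (simp add: LIMSEQ_const_iff)
    have "\<forall>v\<in>I - {w}. c v = 0"
    proof (rule Suc.hyps(1))
      show "n = card (I - {w})" using Suc.hyps(2) w(1) by simp
      show "finite (I - {w})" using Suc.prems(1) by simp
      show "(\<Sum>v\<in>I - {w}. c v * ymon v x) = 0" if "x \<in> torus" for x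
        using Suc.prems(2)[OF that] sum.remove[OF Suc.prems(1) w(1), of "\<lambda>v. c v * ymon v x"] cw by simp
    qed
    then show ?case using cw by auto
  qed
  then show ?thesis using assms(3) by blast
qed

section \<open>Maximal ideals are points, by a counting argument over
  \<open>\<complex>\<close>\<close>

subsection \<open>The weak Nullstellensatz\<close>

definition poly_ideal :: "(complex ^ ('n::finite) \<Rightarrow> complex) set \<Rightarrow> bool" where
  "poly_ideal J \<longleftrightarrow> J \<subseteq> polyfuns \<and> (\<lambda>_. 0) \<in> J \<and> (\<forall>f\<in>J. \<forall>g\<in>J. (\<lambda>x. f x + g x) \<in> J) \<and>
    (\<forall>a\<in>polyfuns. \<forall>f\<in>J. (\<lambda>x. a x * f x) \<in> J)"

lemma poly_idealD:
  assumes "poly_ideal J"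
  shows "f \<in> J \<Longrightarrow> f \<in> polyfuns" "(\<lambda>_. 0) \<in> J" "f \<in> J \<Longrightarrow> g \<in> J \<Longrightarrow> (\<lambda>x. f x + g x) \<in> J"
    "a \<in> polyfuns \<Longrightarrow> f \<in> J \<Longrightarrow> (\<lambda>x. a x * f x) \<in> J" "f \<in> J \<Longrightarrow> g \<in> J \<Longrightarrow> (\<lambda>x. f x - g x) \<in> J"
proof -
  show 1: "f \<in> J \<Longrightarrow> f \<in> polyfuns" "(\<lambda>_. 0) \<in> J" "a \<in> polyfuns \<Longrightarrow> f \<in> J \<Longrightarrow> (\<lambda>x. a x * f x) \<in> J" for a f
    using assms by (auto simp: poly_ideal_def)
  show 2: "f \<in> J \<Longrightarrow> g \<in> J \<Longrightarrow> (\<lambda>x. f x + g x) \<in> J" for f g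
    using assms by (auto simp: poly_ideal_def)
  show "f \<in> J \<Longrightarrow> g \<in> J \<Longrightarrow> (\<lambda>x. f x - g x) \<in> J"
    using 2[of f "\<lambda>x. - 1 * g x"] 1(3)[OF polyfuns_const[of "- 1"], of g] by simp
qed

lemma poly_ideal_sum:
  assumes "poly_ideal J" "\<And>i. i \<in> I \<Longrightarrow> f i \<in> J" shows "(\<lambda>x. \<Sum>i\<in>I. f i x) \<in> J"
  using assms(2) by (induction I rule: infinite_finite_induct) (auto intro: poly_idealD[OF assms(1)])

inductive_set ideal_gen :: "(complex ^ ('n::finite) \<Rightarrow> complex) set \<Rightarrow> (complex ^ 'n \<Rightarrow> complex) set" for H where
  zero: "(\<lambda>_. 0) \<in> ideal_gen H"
| gen: "h \<in> H \<Longrightarrow> h \<in> ideal_gen H"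
| add: "f \<in> ideal_gen H \<Longrightarrow> g \<in> ideal_gen H \<Longrightarrow> (\<lambda>x. f x + g x) \<in> ideal_gen H"
| mult: "a \<in> polyfuns \<Longrightarrow> f \<in> ideal_gen H \<Longrightarrow> (\<lambda>x. a x * f x) \<in> ideal_gen H"

lemma poly_ideal_gen:
  assumes "H \<subseteq> polyfuns" shows "poly_ideal (ideal_gen H)"
proof -
  have "f \<in> polyfuns" if "f \<in> ideal_gen H" for f
    using that by induction (use assms in \<open>auto intro: polyfuns_const polyfuns_add polyfuns_mult\<close>)
  then show ?thesis by (auto simp: poly_ideal_def intro: ideal_gen.intros)
qed

lemma maximal_ideal_exists:
  assumes "poly_ideal I" "(\<lambda>_. 1) \<notin> I"
  obtains J where "poly_ideal J" "I \<subseteq> J" "(\<lambda>_. 1) \<notin> J"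
    "\<And>K. poly_ideal K \<Longrightarrow> J \<subseteq> K \<Longrightarrow> (\<lambda>_. 1) \<notin> K \<Longrightarrow> K = J"
proof -
  let ?A = "{J. poly_ideal J \<and> I \<subseteq> J \<and> (\<lambda>_. 1) \<notin> J}"
  have "\<exists>M\<in>?A. \<forall>Z\<in>?A. M \<subseteq> Z \<longrightarrow> Z = M"
  proof (rule subset_Zorn)
    fix C assume C: "subset.chain ?A C"
    show "\<exists>U\<in>?A. \<forall>Z\<in>C. Z \<subseteq> U"
    proof (cases "C = {}")
      case True
      then show ?thesis using assms by (intro bexI[of _ I]) auto
    next
      case False
      have CA: "Z \<in> ?A" if "Z \<in> C" for Z using C that by (auto simp: subset_chain_def)
      have lin: "Z \<subseteq> Y \<or> Y \<subseteq> Z" if "Z \<in> C" "Y \<in> C" for Z Y using C that by (auto simp: subset_chain_def)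
      have "poly_ideal (\<Union>C)"
        unfolding poly_ideal_def
      proof (intro conjI ballI)
        show "\<Union>C \<subseteq> polyfuns" using CA by (auto dest: poly_idealD(1))
        show "(\<lambda>_. 0) \<in> \<Union>C" using False CA poly_idealD(2) by blast
        show "(\<lambda>x. a x * f x) \<in> \<Union>C" if "a \<in> polyfuns" "f \<in> \<Union>C" for a f
          using that CA poly_idealD(4) by blast
        fix f g assume "f \<in> \<Union>C" "g \<in> \<Union>C"
        then obtain Z Y where ZY: "Z \<in> C" "Y \<in> C" "f \<in> Z" "g \<in> Y" by blast
        then have "\<exists>V\<in>C. f \<in> V \<and> g \<in> V" using lin[OF ZY(1,2)] by blast
        then show "(\<lambda>x. f x + g x) \<in> \<Union>C" using CA poly_idealD(3) by blast
      qed
      moreover have "I \<subseteq> \<Union>C" "(\<lambda>_. 1) \<notin> \<Union>C" using False CA by blast+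
      ultimately show ?thesis by (intro bexI[of _ "\<Union>C"]) auto
    qed
  qed
  then obtain M where "M \<in> ?A" "\<forall>Z\<in>?A. M \<subseteq> Z \<longrightarrow> Z = M" by blast
  then show ?thesis using that[of M] by blast
qed

interpretation fun_space: vector_space "\<lambda>(c::complex) (f :: 'a \<Rightarrow> complex) x. c * f x"
  by unfold_locales (auto simp: fun_eq_iff op_apply algebra_simps)

lemma finite_vdeg_le: "finite {v :: nat ^ ('n::finite). vdeg v \<le> d}"
proof -
  have "v $ i \<le> vdeg v" for v :: "nat ^ 'n" and i
    unfolding vdeg_def by (rule member_le_sum) auto
  then have "{v :: nat ^ 'n. vdeg v \<le> d} \<subseteq> (\<lambda>f. \<chi> i. f i) ` (UNIV \<rightarrow>\<^sub>E {..d})"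
  proof (intro subsetI)
    fix v :: "nat ^ 'n" assume *: "\<And>(v :: nat ^ 'n) i. v $ i \<le> vdeg v" and "v \<in> {v. vdeg v \<le> d}"
    then have "v $ i \<le> d" for i using order.trans[OF *[of v i]] by simp
    then show "v \<in> (\<lambda>f. \<chi> i. f i) ` (UNIV \<rightarrow>\<^sub>E {..d})"
      by (intro image_eqI[of _ _ "\<lambda>i. v $ i"]) (auto simp: PiE_UNIV_domain)
  qed
  moreover have "finite ((UNIV :: 'n set) \<rightarrow>\<^sub>E {..d})" by (intro finite_PiE) auto
  ultimately show ?thesis using finite_surj by blast
qed

text \<open>Otherwise every \<open>x\<^sub>i - a\<close> has an inverse \<open>q a\<close> modulo
  \<open>J\<close>. There are uncountably many \<open>a\<close>, but the polynomials are a countable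
  union of finite-dimensional spaces, so some of the \<open>q a\<close> are linearly dependent.
  Clearing denominators puts a nonzero polynomial in \<open>x\<^sub>i\<close> alone into
  \<open>J\<close>, and this splits into linear factors invertible modulo \<open>J\<close>.\<close>

lemma maximal_ideal_coordinate:
  assumes J: "poly_ideal J" "(\<lambda>_. 1) \<notin> J"
    and max: "\<And>K. poly_ideal K \<Longrightarrow> J \<subseteq> K \<Longrightarrow> (\<lambda>_. 1) \<notin> K \<Longrightarrow> K = J"
  shows "\<exists>a. (\<lambda>x :: complex ^ ('n::finite). x $ i - a) \<in> J"
proof (rule ccontr)
  assume no: "\<not> ?thesis"
  have pf: "(\<lambda>x :: complex ^ 'n. x $ i - a) \<in> polyfuns" for a
    by (intro polyfuns_diff polyfuns_coord polyfuns_const)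
  have "\<exists>q\<in>polyfuns. (\<lambda>x. q x * (x $ i - a) - 1) \<in> J" for a
  proof -
    \<comment> \<open>The ideal generated by \<open>J\<close> and \<open>x\<^sub>i - a\<close>; by
      maximality it contains 1, which is the invertibility of \<open>x\<^sub>i - a\<close> modulo
      \<open>J\<close>.\<close>
    define K where "K = {f. \<exists>j\<in>J. \<exists>q\<in>polyfuns. f = (\<lambda>x. j x + q x * (x $ i - a))}"
    have KI: "f \<in> K" if "j \<in> J" "q \<in> polyfuns" "\<And>x. f x = j x + q x * (x $ i - a)" for f j q
    proof -
      have "f = (\<lambda>x. j x + q x * (x $ i - a))" by (rule ext) (rule that(3))
      then show ?thesis unfolding K_def using that(1,2) by blast
    qed
    have K: "poly_ideal K"
      unfolding poly_ideal_def
    proof (intro conjI ballI)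
      show "K \<subseteq> polyfuns"
        using poly_idealD(1)[OF J(1)] pf by (auto simp: K_def intro!: polyfuns_add polyfuns_mult)
      show "(\<lambda>_. 0) \<in> K"
        by (rule KI[OF poly_idealD(2)[OF J(1)] polyfuns_const[of 0]]) simp
      show "(\<lambda>x. f x + g x) \<in> K" if f: "f \<in> K" and g: "g \<in> K" for f g
      proof -
        obtain j q where 1: "j \<in> J" "q \<in> polyfuns" "f = (\<lambda>x. j x + q x * (x $ i - a))" using f by (auto simp: K_def)
        obtain j' q' where 2: "j' \<in> J" "q' \<in> polyfuns" "g = (\<lambda>x. j' x + q' x * (x $ i - a))" using g by (auto simp: K_def)
        show ?thesis
          by (rule KI[OF poly_idealD(3)[OF J(1) 1(1) 2(1)] polyfuns_add[OF 1(2) 2(2)]]) (simp add: 1 2 algebra_simps)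
      qed
      show "(\<lambda>x. b x * f x) \<in> K" if b: "b \<in> polyfuns" and f: "f \<in> K" for b f
      proof -
        obtain j q where 1: "j \<in> J" "q \<in> polyfuns" "f = (\<lambda>x. j x + q x * (x $ i - a))" using f by (auto simp: K_def)
        show ?thesis
          by (rule KI[OF poly_idealD(4)[OF J(1) b 1(1)] polyfuns_mult[OF b 1(2)]]) (simp add: 1 algebra_simps)
      qed
    qed
    have "J \<subseteq> K"
    proof
      show "j \<in> K" if "j \<in> J" for j
        by (rule KI[OF that polyfuns_const[of 0]]) simp
    qed
    moreover have "(\<lambda>x. x $ i - a) \<in> K"
      by (rule KI[OF poly_idealD(2)[OF J(1)] polyfuns_const[of 1]]) simp
    ultimately have "(\<lambda>_. 1) \<in> K" using max[OF K] no by blast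
    then obtain j q where jq: "j \<in> J" "q \<in> polyfuns" "(\<lambda>_. 1) = (\<lambda>x. j x + q x * (x $ i - a))" by (auto simp: K_def)
    have "(\<lambda>x. q x * (x $ i - a) - 1) = (\<lambda>x. - 1 * j x)" using fun_cong[OF jq(3)] by (auto simp: fun_eq_iff algebra_simps)
    then have "(\<lambda>x. q x * (x $ i - a) - 1) \<in> J"
      using poly_idealD(4)[OF J(1) polyfuns_const[of "-1"] jq(1)] by simp
    then show ?thesis using jq(2) by (rule bexI)
  qed
  then obtain q where q: "\<And>a. q a \<in> polyfuns" "\<And>a. (\<lambda>x. q a x * (x $ i - a) - 1) \<in> J" by metis
  have cancel: "f \<in> J" if "f \<in> polyfuns" "(\<lambda>x. (x $ i - a) * f x) \<in> J" for f a
  proof -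
    have "(\<lambda>x. q a x * ((x $ i - a) * f x) - f x * (q a x * (x $ i - a) - 1)) \<in> J"
      by (rule poly_idealD(5)[OF J(1) poly_idealD(4)[OF J(1) q(1) that(2)] poly_idealD(4)[OF J(1) that(1) q(2)]])
    then show ?thesis by (simp add: algebra_simps)
  qed
  \<comment> \<open>A factor \<open>x\<^sub>i - r\<close> with \<open>r\<close> a root can be
    cancelled, so the degree drops until a nonzero constant would lie in \<open>J\<close>.\<close>
  have no_poly: "p = 0" if "(\<lambda>x. poly p (x $ i)) \<in> J" for p
    using that
  proof (induction "Polynomial.degree p" arbitrary: p rule: less_induct)
    case less
    have pp: "(\<lambda>x. poly r (x $ i)) \<in> polyfuns" for r
      unfolding poly_altdef by (intro polyfuns_sum polyfuns_mult polyfuns_const polyfuns_power polyfuns_coord)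
    show ?case
    proof (cases "Polynomial.degree p = 0")
      case True
      then obtain c where c: "p = [:c:]" by (rule degree_eq_zeroE)
      show ?thesis
      proof (rule ccontr)
        assume "p \<noteq> 0"
        then have "c \<noteq> 0" using c by simp
        then have "(\<lambda>x. inverse c * poly p (x $ i)) = (\<lambda>_. 1)" using c by simp
        then show False using poly_idealD(4)[OF J(1) polyfuns_const[of "inverse c"] less.prems] J(2) by simp
      qed
    next
      case False
      then have "\<not> constant (poly p)" by (simp add: constant_degree)
      then obtain r where "poly p r = 0" using fundamental_theorem_of_algebra by blast
      then obtain s where s: "p = [:- r, 1:] * s" by (auto simp: poly_eq_0_iff_dvd elim: dvdE)
      have "s \<noteq> 0" using s False by auto
      then have "Polynomial.degree s < Polynomial.degree p" unfolding s by (subst degree_mult_eq) auto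
      moreover have "(\<lambda>x. poly s (x $ i)) \<in> J"
      proof (rule cancel[OF pp])
        have "(\<lambda>x. (x $ i - r) * poly s (x $ i)) = (\<lambda>x. poly p (x $ i))" by (simp add: s left_diff_distrib)
        then show "(\<lambda>x. (x $ i - r) * poly s (x $ i)) \<in> J" using less.prems by simp
      qed
      ultimately have "s = 0" using less.hyps by blast
      then show ?thesis using s by simp
    qed
  qed
  define T where "T d = (ymon ` {v :: nat ^ 'n. vdeg v \<le> d})" for d
  have finT: "finite (T d)" for d unfolding T_def using finite_vdeg_le by blast
  have "\<exists>d. f \<in> fun_space.span (T d)" if f: "f \<in> polyfuns" for f
  proof -
    obtain I c where I: "finite I" "f = (\<lambda>x. \<Sum>v\<in>I. c v * ymon v x)" using f by (rule polyfunsE)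
    define d where "d = Max (insert 0 (vdeg ` I))"
    have d: "vdeg v \<le> d" if "v \<in> I" for v unfolding d_def using I(1) that by (intro Max_ge) auto
    have "f = (\<Sum>v\<in>I. (\<lambda>x. c v * ymon v x))" by (rule ext) (simp add: I(2) sum_apply)
    also have "\<dots> \<in> fun_space.span (T d)"
      using d by (intro fun_space.span_sum fun_space.span_scale fun_space.span_base) (auto simp: T_def)
    finally show ?thesis by blast
  qed
  then have "\<forall>a. \<exists>d. q a \<in> fun_space.span (T d)" using q(1) by blast
  then obtain dq where dq: "\<And>a. q a \<in> fun_space.span (T (dq a))" by (rule choice[THEN exE]) blast
  \<comment> \<open>Pigeonhole over the real numbers: uncountably many values \<open>a\<close>,
    countably many degree bounds \<open>d\<close>.\<close>
  have "\<exists>d. infinite {a. dq (of_real a) = d}"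
  proof (rule ccontr)
    assume "\<nexists>d. infinite {a. dq (of_real a) = d}"
    then have "countable (\<Union>d. {a :: real. dq (of_real a) = d})" by (intro countable_UN) (auto intro: countable_finite)
    moreover have "(\<Union>d. {a :: real. dq (of_real a) = d}) = UNIV" by blast
    ultimately show False using uncountable_UNIV_real by simp
  qed
  then obtain d where "infinite {a :: real. dq (of_real a) = d}" by blast
  then obtain A0 where A0: "A0 \<subseteq> {a :: real. dq (of_real a) = d}" "finite A0" "card A0 = Suc (card (T d))"
    using infinite_arbitrarily_large by blast
  define A where "A = (of_real ` A0 :: complex set)"
  have A: "finite A" "card A = Suc (card (T d))" "\<And>a. a \<in> A \<Longrightarrow> q a \<in> fun_space.span (T d)"
    using A0 dq by (auto simp: A_def card_image inj_on_def)
  \<comment> \<open>If \<open>q a = q b\<close> with \<open>a \<noteq> b\<close>, then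
    \<open>(b - a) q a\<close> lies in \<open>J\<close>, hence so does \<open>q a\<close>, and with
    it 1.\<close>
  have inj: "inj_on q A"
  proof (rule inj_onI, rule ccontr)
    fix a b assume ab: "q a = q b" "a \<noteq> b"
    have "(\<lambda>x. (q a x * (x $ i - a) - 1) - (q b x * (x $ i - b) - 1)) \<in> J"
      by (rule poly_idealD(5)[OF J(1) q(2) q(2)])
    then have "(\<lambda>x. (b - a) * q a x) \<in> J" using ab(1) by (simp add: algebra_simps)
    from poly_idealD(4)[OF J(1) polyfuns_const[of "inverse (b - a)"] this]
    have "q a \<in> J" using ab(2) by (simp add: mult.assoc[symmetric])
    from poly_idealD(5)[OF J(1) poly_idealD(4)[OF J(1) pf[of a] this] q(2)[of a]]
    have "(\<lambda>_. 1) \<in> J" by (simp add: algebra_simps)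
    then show False using J(2) by simp
  qed
  have "\<not> fun_space.independent (q ` A)"
  proof
    assume "fun_space.independent (q ` A)"
    then have "card (q ` A) \<le> card (T d)"
      using fun_space.independent_span_bound[OF finT, of "q ` A" d] A(3) by blast
    then show False using A(2) inj by (simp add: card_image)
  qed
  then obtain u where u: "(\<Sum>f\<in>q ` A. (\<lambda>x. u f * f x)) = 0" "\<exists>f\<in>q ` A. u f \<noteq> 0"
    using A(1) unfolding fun_space.dependent_finite[OF finite_imageI[OF A(1), of q]] by blast
  define c where "c a = u (q a)" for a
  have rel: "(\<Sum>a\<in>A. c a * q a x) = 0" for x
    using fun_cong[OF u(1), of x] by (simp add: sum_apply sum.reindex[OF inj] c_def)
  obtain a0 where a0: "a0 \<in> A" "c a0 \<noteq> 0" using u(2) by (auto simp: c_def)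
  \<comment> \<open>The numerator of the sum of \<open>c a / (t - a)\<close> over the common
    denominator; at \<open>a0\<close> only one summand survives.\<close>
  define p where "p = (\<Sum>a\<in>A. [:c a:] * (\<Prod>b\<in>A - {a}. [:- b, 1:]))"
  have "(\<lambda>x. \<Sum>a\<in>A. (c a * (\<Prod>b\<in>A - {a}. x $ i - b)) * (q a x * (x $ i - a) - 1)) \<in> J"
    using q(2)
    by (intro poly_ideal_sum[OF J(1)] poly_idealD(4)[OF J(1)] polyfuns_mult polyfuns_const polyfuns_prod pf)
  moreover have "(\<Sum>a\<in>A. (c a * (\<Prod>b\<in>A - {a}. x $ i - b)) * (q a x * (x $ i - a) - 1)) = - 1 * poly p (x $ i)" for x
  proof -
    have "(\<Sum>a\<in>A. (c a * (\<Prod>b\<in>A - {a}. x $ i - b)) * (q a x * (x $ i - a) - 1)) =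
      (\<Sum>a\<in>A. c a * q a x * (\<Prod>b\<in>A. x $ i - b) - c a * (\<Prod>b\<in>A - {a}. x $ i - b))"
      using A(1) by (intro sum.cong refl) (simp add: prod.remove algebra_simps)
    also have "\<dots> = (\<Sum>a\<in>A. c a * q a x) * (\<Prod>b\<in>A. x $ i - b) - (\<Sum>a\<in>A. c a * (\<Prod>b\<in>A - {a}. x $ i - b))"
      by (simp add: sum_subtractf sum_distrib_right)
    also have "(\<Sum>a\<in>A. c a * (\<Prod>b\<in>A - {a}. x $ i - b)) = poly p (x $ i)"
      by (simp add: p_def poly_sum poly_prod)
    finally show ?thesis by (simp add: rel)
  qed
  ultimately have "(\<lambda>x. - 1 * poly p (x $ i)) \<in> J" by simp
  from poly_idealD(4)[OF J(1) polyfuns_const[of "-1"] this] have "(\<lambda>x. poly p (x $ i)) \<in> J" by simp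
  then have "p = 0" by (rule no_poly)
  have "poly p a0 = (\<Sum>a\<in>A. if a = a0 then c a0 * (\<Prod>b\<in>A - {a0}. a0 - b) else 0)"
    unfolding p_def poly_sum
  proof (intro sum.cong refl)
    fix a assume "a \<in> A"
    show "poly ([:c a:] * (\<Prod>b\<in>A - {a}. [:- b, 1:])) a0 = (if a = a0 then c a0 * (\<Prod>b\<in>A - {a0}. a0 - b) else 0)"
      using A(1) a0(1) by (auto simp: poly_prod intro!: prod_zero bexI[of _ a0])
  qed
  also have "\<dots> \<noteq> 0" using A(1) a0 by auto
  finally show False using \<open>p = 0\<close> by simp
qed

text \<open>A maximal ideal above \<open>ideal_gen H\<close> contains all
  \<open>x\<^sub>i - a\<^sub>i\<close>, so modulo it every polynomial equals its value at the point
  \<open>a\<close>. Some \<open>h\<close> in \<open>H\<close> does not vanish there, which puts a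
  nonzero constant into the ideal.\<close>

theorem weak_nullstellensatz:
  assumes "H \<subseteq> polyfuns" "\<And>x :: complex ^ ('n::finite). \<exists>h\<in>H. h x \<noteq> 0"
  shows "(\<lambda>_. 1) \<in> ideal_gen H"
proof (rule ccontr)
  assume "(\<lambda>_. 1) \<notin> ideal_gen H"
  then obtain J where J: "poly_ideal J" "ideal_gen H \<subseteq> J" "(\<lambda>_. 1) \<notin> J"
    "\<And>K. poly_ideal K \<Longrightarrow> J \<subseteq> K \<Longrightarrow> (\<lambda>_. 1) \<notin> K \<Longrightarrow> K = J"
    using maximal_ideal_exists[OF poly_ideal_gen[OF assms(1)]] by metis
  have "\<exists>a. (\<lambda>x. x $ i - a) \<in> J" for i using maximal_ideal_coordinate[OF J(1,3,4)] .
  then obtain a where a: "\<And>i. (\<lambda>x. x $ i - a i) \<in> J" by metis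
  define pt where "pt = (\<chi> i. a i)"
  have red: "(\<lambda>x. f x - f pt) \<in> J" if "f \<in> polyfuns" for f
    using that
  proof (induction rule: polyfuns_induct)
    case (const c)
    then show ?case using poly_idealD(2)[OF J(1)] by simp
  next
    case (coord f i)
    have "(\<lambda>x. f x * (x $ i - a i) + a i * (f x - f pt)) \<in> J"
      using coord a by (intro poly_idealD(3)[OF J(1)] poly_idealD(4)[OF J(1)] polyfuns_const)
    then show ?case by (simp add: algebra_simps pt_def)
  next
    case (add f g)
    from poly_idealD(3)[OF J(1) add.IH] show ?case by (simp add: algebra_simps)
  qed
  obtain h where h: "h \<in> H" "h pt \<noteq> 0" using assms(2) by blast
  have hJ: "h \<in> J" and hp: "h \<in> polyfuns" using h(1) J(2) ideal_gen.gen assms(1) by blast+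
  from poly_idealD(5)[OF J(1) hJ red[OF hp]] have "(\<lambda>_. h pt) \<in> J" by simp
  from poly_idealD(4)[OF J(1) polyfuns_const[of "inverse (h pt)"] this] show False using h(2) J(3) by simp
qed

section \<open>Projections of families of cones\<close>

section \<open>Elimination\<close>

text \<open>At \<open>z\<^sub>0\<close> the matrix is diagonal with nonzero entries. Elimination
  without division keeps the entries polynomial and preserves this shape at
  \<open>z\<^sub>0\<close>; the product of the pivots is a polynomial whose nonvanishing forces a
  trivial kernel.\<close>

lemma kernel_trivial_open:
  fixes G :: "'i \<Rightarrow> 'i \<Rightarrow> complex ^ ('n::finite) \<Rightarrow> complex"
  assumes "finite I" "\<And>i j. i \<in> I \<Longrightarrow> j \<in> I \<Longrightarrow> G i j \<in> polyfuns"
    "\<And>i j. i \<in> I \<Longrightarrow> j \<in> I \<Longrightarrow> G i j z\<^sub>0 = 0 \<longleftrightarrow> i \<noteq> j"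
  shows "\<exists>g\<in>polyfuns. g z\<^sub>0 \<noteq> 0 \<and>
    (\<forall>z y. g z \<noteq> 0 \<longrightarrow> (\<forall>i\<in>I. (\<Sum>j\<in>I. G i j z * y j) = 0) \<longrightarrow> (\<forall>j\<in>I. y j = 0))"
  using assms
proof (induction I arbitrary: G)
  case empty
  show ?case by (intro bexI[of _ "\<lambda>_. 1"]) (auto intro: polyfuns_const)
next
  case (insert e I)
  note G = insert.prems(1) and G0 = insert.prems(2)
  define G' where "G' i j = (\<lambda>z. G e e z * G i j z - G i e z * G e j z)" for i j
  have "\<exists>g\<in>polyfuns. g z\<^sub>0 \<noteq> 0 \<and>
    (\<forall>z y. g z \<noteq> 0 \<longrightarrow> (\<forall>i\<in>I. (\<Sum>j\<in>I. G' i j z * y j) = 0) \<longrightarrow> (\<forall>j\<in>I. y j = 0))"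
  proof (rule insert.IH)
    show "G' i j \<in> polyfuns" if "i \<in> I" "j \<in> I" for i j
      unfolding G'_def using that by (intro polyfuns_diff polyfuns_mult G) auto
    show "G' i j z\<^sub>0 = 0 \<longleftrightarrow> i \<noteq> j" if "i \<in> I" "j \<in> I" for i j
    proof -
      have "i \<noteq> e" "j \<noteq> e" using that insert.hyps(2) by auto
      then have "G i e z\<^sub>0 = 0" "G e j z\<^sub>0 = 0" "G e e z\<^sub>0 \<noteq> 0" using G0 that by blast+
      then show ?thesis using G0[of i j] that by (simp add: G'_def)
    qed
  qed
  then obtain g where g: "g \<in> polyfuns" "g z\<^sub>0 \<noteq> 0"
    "\<And>z y. g z \<noteq> 0 \<Longrightarrow> \<forall>i\<in>I. (\<Sum>j\<in>I. G' i j z * y j) = 0 \<Longrightarrow> \<forall>j\<in>I. y j = 0" by blast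
  show ?case
  proof (intro bexI[of _ "\<lambda>z. G e e z * g z"] conjI allI impI)
    show "(\<lambda>z. G e e z * g z) \<in> polyfuns" using G g(1) by (intro polyfuns_mult) auto
    show "G e e z\<^sub>0 * g z\<^sub>0 \<noteq> 0" using G0[of e e] g(2) by simp
    fix z y assume z: "G e e z * g z \<noteq> 0" and y: "\<forall>i\<in>insert e I. (\<Sum>j\<in>insert e I. G i j z * y j) = 0"
    have eq: "G i e z * y e + (\<Sum>j\<in>I. G i j z * y j) = 0" if "i \<in> insert e I" for i
      using bspec[OF y that] insert.hyps by simp
    have "\<forall>i\<in>I. (\<Sum>j\<in>I. G' i j z * y j) = 0"
    proof
      fix i assume i: "i \<in> I"
      have "(\<Sum>j\<in>I. G' i j z * y j) = G e e z * (\<Sum>j\<in>I. G i j z * y j) - G i e z * (\<Sum>j\<in>I. G e j z * y j)"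
        unfolding G'_def sum_distrib_left sum_subtractf[symmetric] by (intro sum.cong refl) (simp add: algebra_simps)
      moreover have "(\<Sum>j\<in>I. G i j z * y j) = - (G i e z * y e)" "(\<Sum>j\<in>I. G e j z * y j) = - (G e e z * y e)"
        using eq[of i] eq[of e] i by (simp_all add: add_eq_0_iff)
      ultimately show "(\<Sum>j\<in>I. G' i j z * y j) = 0" by simp
    qed
    moreover have "g z \<noteq> 0" using z by simp
    ultimately have I: "\<forall>j\<in>I. y j = 0" using g(3) by blast
    then have "y e = 0" using eq[of e] z by simp
    with I have "y j = 0" if "j \<in> insert e I" for j using that by blast
    then show "\<forall>j\<in>insert e I. y j = 0" by blast
  qed
qed

inductive hom_form :: "nat \<Rightarrow> (complex ^ ('m::finite) \<Rightarrow> complex ^ ('n::finite) \<Rightarrow> complex) \<Rightarrow> bool" where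
  zero: "hom_form k (\<lambda>z \<zeta>. 0)"
| mono: "a \<in> polyfuns \<Longrightarrow> vdeg v = k \<Longrightarrow> hom_form k (\<lambda>z \<zeta>. a z * ymon v \<zeta>)"
| add: "hom_form k g \<Longrightarrow> hom_form k h \<Longrightarrow> hom_form k (\<lambda>z \<zeta>. g z \<zeta> + h z \<zeta>)"

lemma hom_form_ymon: "hom_form k h \<Longrightarrow> hom_form (vdeg u + k) (\<lambda>z \<zeta>. ymon u \<zeta> * h z \<zeta>)"
proof (induction rule: hom_form.induct)
  case (zero k)
  show ?case using hom_form.zero by simp
next
  case (mono a v k)
  have "(\<lambda>z \<zeta>. ymon u \<zeta> * (a z * ymon v \<zeta>)) = (\<lambda>z \<zeta>. a z * ymon (u + v) \<zeta>)"
    by (simp add: ymon_add fun_eq_iff)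
  then show ?case using hom_form.mono[OF mono(1), of "u + v"] mono(2) by (simp add: vdeg_add)
next
  case (add k g h)
  show ?case unfolding distrib_left by (rule hom_form.add[OF add.IH])
qed

lemma ymon_axis_power: "ymon (axis i k) \<zeta> = (\<zeta> $ i) ^ k"
proof -
  have "ymon (axis i k) \<zeta> = (\<Prod>j\<in>UNIV. if j = i then (\<zeta> $ i) ^ k else 1)"
    unfolding ymon_def by (rule prod.cong) (auto simp: axis_def)
  then show ?thesis by simp
qed

lemma hom_form_scale: "hom_form k h \<Longrightarrow> hom_form k (\<lambda>z \<zeta>. c * h z \<zeta>)"
proof (induction rule: hom_form.induct)
  case (zero k)
  show ?case using hom_form.zero by simp
next
  case (mono a v k)
  show ?case unfolding mult.assoc[symmetric]
    by (rule hom_form.mono[OF polyfuns_mult[OF polyfuns_const mono(1)] mono(2)])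
next
  case (add k g h)
  show ?case unfolding distrib_left by (rule hom_form.add[OF add.IH])
qed

lemma hom_form_sum: "(\<And>i. i \<in> I \<Longrightarrow> hom_form k (h i)) \<Longrightarrow> hom_form k (\<lambda>z \<zeta>. \<Sum>i\<in>I. h i z \<zeta>)"
  by (induction I rule: infinite_finite_induct) (auto intro: hom_form.intros)

lemma ymon_scale: "ymon v (s *s \<zeta>) = s ^ vdeg v * ymon v \<zeta>"
  by (simp add: ymon_def vdeg_def power_mult_distrib prod.distrib power_sum)

lemma hom_form_homogeneous: "hom_form k h \<Longrightarrow> h z (s *s \<zeta>) = s ^ k * h z \<zeta>"
  by (induction rule: hom_form.induct) (auto simp: ymon_scale algebra_simps)

lemma finite_vdeg_eq: "finite {v :: nat ^ ('n::finite). vdeg v = k}"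
  by (rule finite_subset[OF _ finite_vdeg_le[of k]]) auto

lemma hom_form_coeffs:
  "hom_form k h \<Longrightarrow> \<exists>a. (\<forall>v. a v \<in> polyfuns) \<and> (\<forall>z \<zeta>. h z \<zeta> = (\<Sum>v | vdeg v = k. a v z * ymon v \<zeta>))"
proof (induction rule: hom_form.induct)
  case (zero k)
  show ?case by (intro exI[of _ "\<lambda>_ _. 0"]) (auto intro: polyfuns_const)
next
  case (mono a v k)
  have "a z * ymon v \<zeta> = (\<Sum>w | vdeg w = k. (if w = v then a z else 0) * ymon w \<zeta>)" for z \<zeta>
    by (subst sum.remove[OF finite_vdeg_eq, of v]) (auto simp: mono)
  then show ?case
  proof (intro exI[of _ "\<lambda>w z. if w = v then a z else 0"] conjI allI)
    show "(\<lambda>z. if w = v then a z else 0) \<in> polyfuns" for w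
      using mono(1) by (cases "w = v") (simp_all add: polyfuns_const)
  qed
next
  case (add k g h)
  then obtain a b where ab: "\<And>v. a v \<in> polyfuns" "\<And>z \<zeta>. g z \<zeta> = (\<Sum>v | vdeg v = k. a v z * ymon v \<zeta>)"
    "\<And>v. b v \<in> polyfuns" "\<And>z \<zeta>. h z \<zeta> = (\<Sum>v | vdeg v = k. b v z * ymon v \<zeta>)" by blast
  show ?case
  proof (intro exI[of _ "\<lambda>v z. a v z + b v z"] conjI allI)
    show "(\<lambda>z. a v z + b v z) \<in> polyfuns" for v by (rule polyfuns_add[OF ab(1,3)])
    show "g z \<zeta> + h z \<zeta> = (\<Sum>v | vdeg v = k. (a v z + b v z) * ymon v \<zeta>)" for z \<zeta>
      by (simp add: ab sum.distrib distrib_right)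
  qed
qed

text \<open>The Nullstellensatz is applied on the affine charts \<open>\<zeta>\<^sub>i = 1\<close> and homogenised, so that the
  monomials of a large degree are, at \<open>z\<^sub>0\<close>, combinations of forms vanishing on the zero set of \<open>H\<close>. Then
  the same holds near \<open>z\<^sub>0\<close> by Gaussian elimination.\<close>

theorem elimination:
  fixes H :: "(complex ^ ('m::finite) \<Rightarrow> complex ^ ('n::finite) \<Rightarrow> complex) set"
  assumes hom: "\<And>h. h \<in> H \<Longrightarrow> \<exists>k. hom_form k h"
    and z\<^sub>0: "\<And>\<zeta>. \<forall>h\<in>H. h z\<^sub>0 \<zeta> = 0 \<Longrightarrow> \<zeta> = 0"
  shows "\<exists>g\<in>polyfuns. g z\<^sub>0 \<noteq> 0 \<and> (\<forall>z \<zeta>. g z \<noteq> 0 \<longrightarrow> (\<forall>h\<in>H. h z \<zeta> = 0) \<longrightarrow> \<zeta> = 0)"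
proof -
  define Z where "Z = {(z, \<zeta>). \<forall>h\<in>H. h z \<zeta> = 0}"
  \<comment> \<open>\<open>f\<close> on the chart \<open>\<zeta>\<^sub>i = 1\<close>, homogenised to
    degree \<open>N\<close>, agrees at \<open>z\<^sub>0\<close> with a form vanishing on
    \<open>Z\<close>. Demanding all large \<open>N\<close> lets sums be formed in a common
    degree.\<close>
  define Q where "Q i f \<longleftrightarrow> (\<exists>N\<^sub>0. \<forall>N\<ge>N\<^sub>0. \<exists>E. hom_form N E \<and> (\<forall>z \<zeta>. (z, \<zeta>) \<in> Z \<longrightarrow> E z \<zeta> = 0) \<and>
    (\<forall>\<zeta>. \<zeta> $ i \<noteq> 0 \<longrightarrow> E z\<^sub>0 \<zeta> = (\<zeta> $ i) ^ N * f (inverse (\<zeta> $ i) *s \<zeta>)))" for i f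
  have Q0: "Q i f" if "\<And>\<zeta> :: complex ^ 'n. \<zeta> $ i = 1 \<Longrightarrow> f \<zeta> = 0" for i f
    unfolding Q_def using that
    by (intro exI[of _ 0] allI impI exI[of _ "\<lambda>_ _. 0"]) (auto intro: hom_form.zero)
  have Q_scale: "Q i (\<lambda>\<zeta>. c * f \<zeta>)" if "Q i f" for i f c
  proof -
    obtain N\<^sub>0 where N0: "\<And>N. N \<ge> N\<^sub>0 \<Longrightarrow> \<exists>E. hom_form N E \<and> (\<forall>z \<zeta>. (z, \<zeta>) \<in> Z \<longrightarrow> E z \<zeta> = 0) \<and>
      (\<forall>\<zeta>. \<zeta> $ i \<noteq> 0 \<longrightarrow> E z\<^sub>0 \<zeta> = (\<zeta> $ i) ^ N * f (inverse (\<zeta> $ i) *s \<zeta>))"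
      using \<open>Q i f\<close> by (auto simp: Q_def)
    show ?thesis unfolding Q_def
    proof (intro exI[of _ N\<^sub>0] allI impI)
      fix N assume "N \<ge> N\<^sub>0"
      from N0[OF this] obtain E where "hom_form N E" "\<forall>z \<zeta>. (z, \<zeta>) \<in> Z \<longrightarrow> E z \<zeta> = 0"
        "\<forall>\<zeta>. \<zeta> $ i \<noteq> 0 \<longrightarrow> E z\<^sub>0 \<zeta> = (\<zeta> $ i) ^ N * f (inverse (\<zeta> $ i) *s \<zeta>)" by blast
      then show "\<exists>E. hom_form N E \<and> (\<forall>z \<zeta>. (z, \<zeta>) \<in> Z \<longrightarrow> E z \<zeta> = 0) \<and>
        (\<forall>\<zeta>. \<zeta> $ i \<noteq> 0 \<longrightarrow> E z\<^sub>0 \<zeta> = (\<zeta> $ i) ^ N * (c * f (inverse (\<zeta> $ i) *s \<zeta>)))"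
        by (intro exI[of _ "\<lambda>z \<zeta>. c * E z \<zeta>"]) (auto intro: hom_form_scale)
    qed
  qed
  have Q_add: "Q i (\<lambda>\<zeta>. f \<zeta> + g \<zeta>)" if "Q i f" "Q i g" for i f g
  proof -
    obtain N\<^sub>0 where N0: "\<And>N. N \<ge> N\<^sub>0 \<Longrightarrow> \<exists>E. hom_form N E \<and> (\<forall>z \<zeta>. (z, \<zeta>) \<in> Z \<longrightarrow> E z \<zeta> = 0) \<and>
      (\<forall>\<zeta>. \<zeta> $ i \<noteq> 0 \<longrightarrow> E z\<^sub>0 \<zeta> = (\<zeta> $ i) ^ N * f (inverse (\<zeta> $ i) *s \<zeta>))"
      using \<open>Q i f\<close> by (auto simp: Q_def)
    obtain N\<^sub>1 where N1: "\<And>N. N \<ge> N\<^sub>1 \<Longrightarrow> \<exists>E. hom_form N E \<and> (\<forall>z \<zeta>. (z, \<zeta>) \<in> Z \<longrightarrow> E z \<zeta> = 0) \<and>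
      (\<forall>\<zeta>. \<zeta> $ i \<noteq> 0 \<longrightarrow> E z\<^sub>0 \<zeta> = (\<zeta> $ i) ^ N * g (inverse (\<zeta> $ i) *s \<zeta>))"
      using \<open>Q i g\<close> by (auto simp: Q_def)
    show ?thesis unfolding Q_def
    proof (intro exI[of _ "max N\<^sub>0 N\<^sub>1"] allI impI)
      fix N assume N: "N \<ge> max N\<^sub>0 N\<^sub>1"
      from N0[of N] N obtain E where E: "hom_form N E" "\<forall>z \<zeta>. (z, \<zeta>) \<in> Z \<longrightarrow> E z \<zeta> = 0"
        "\<forall>\<zeta>. \<zeta> $ i \<noteq> 0 \<longrightarrow> E z\<^sub>0 \<zeta> = (\<zeta> $ i) ^ N * f (inverse (\<zeta> $ i) *s \<zeta>)" by auto
      from N1[of N] N obtain F where "hom_form N F" "\<forall>z \<zeta>. (z, \<zeta>) \<in> Z \<longrightarrow> F z \<zeta> = 0"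
        "\<forall>\<zeta>. \<zeta> $ i \<noteq> 0 \<longrightarrow> F z\<^sub>0 \<zeta> = (\<zeta> $ i) ^ N * g (inverse (\<zeta> $ i) *s \<zeta>)" by auto
      with E show "\<exists>E. hom_form N E \<and> (\<forall>z \<zeta>. (z, \<zeta>) \<in> Z \<longrightarrow> E z \<zeta> = 0) \<and>
        (\<forall>\<zeta>. \<zeta> $ i \<noteq> 0 \<longrightarrow> E z\<^sub>0 \<zeta> = (\<zeta> $ i) ^ N * (f (inverse (\<zeta> $ i) *s \<zeta>) + g (inverse (\<zeta> $ i) *s \<zeta>)))"
        by (intro exI[of _ "\<lambda>z \<zeta>. E z \<zeta> + F z \<zeta>"]) (auto intro: hom_form.add simp: distrib_left)
    qed
  qed
  have Q_coord: "Q i (\<lambda>\<zeta>. \<zeta> $ j * f \<zeta>)" if "Q i f" for i j f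
  proof -
    obtain N\<^sub>0 where N0: "\<And>N. N \<ge> N\<^sub>0 \<Longrightarrow> \<exists>E. hom_form N E \<and> (\<forall>z \<zeta>. (z, \<zeta>) \<in> Z \<longrightarrow> E z \<zeta> = 0) \<and>
      (\<forall>\<zeta>. \<zeta> $ i \<noteq> 0 \<longrightarrow> E z\<^sub>0 \<zeta> = (\<zeta> $ i) ^ N * f (inverse (\<zeta> $ i) *s \<zeta>))"
      using \<open>Q i f\<close> by (auto simp: Q_def)
    show ?thesis unfolding Q_def
    proof (intro exI[of _ "Suc N\<^sub>0"] allI impI)
      fix N assume "N \<ge> Suc N\<^sub>0"
      then obtain K where K: "N = Suc K" "K \<ge> N\<^sub>0" by (cases N) auto
      from N0[OF K(2)] obtain E where E: "hom_form K E" "\<forall>z \<zeta>. (z, \<zeta>) \<in> Z \<longrightarrow> E z \<zeta> = 0"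
        "\<forall>\<zeta>. \<zeta> $ i \<noteq> 0 \<longrightarrow> E z\<^sub>0 \<zeta> = (\<zeta> $ i) ^ K * f (inverse (\<zeta> $ i) *s \<zeta>)" by blast
      have "hom_form N (\<lambda>z \<zeta>. \<zeta> $ j * E z \<zeta>)"
        using hom_form_ymon[OF E(1), of "axis j 1"] by (simp add: K(1) vdeg_axis Suc_eq_plus1_left del: add_Suc)
      then show "\<exists>E. hom_form N E \<and> (\<forall>z \<zeta>. (z, \<zeta>) \<in> Z \<longrightarrow> E z \<zeta> = 0) \<and> (\<forall>\<zeta>. \<zeta> $ i \<noteq> 0 \<longrightarrow>
        E z\<^sub>0 \<zeta> = (\<zeta> $ i) ^ N * ((inverse (\<zeta> $ i) *s \<zeta>) $ j * f (inverse (\<zeta> $ i) *s \<zeta>)))"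
        using E(2,3) by (intro exI[of _ "\<lambda>z \<zeta>. \<zeta> $ j * E z \<zeta>"]) (auto simp: K field_simps)
    qed
  qed
  have Q_mult: "Q i (\<lambda>\<zeta>. a \<zeta> * f \<zeta>)" if a: "a \<in> polyfuns" and f: "Q i f" for i a f
    using a
  proof (induction rule: polyfuns_induct)
    case (const c)
    show ?case by (rule Q_scale[OF f])
  next
    case (coord g j)
    show ?case using Q_coord[OF coord.IH, of j] by (simp add: mult.assoc)
  next
    case (add g h)
    show ?case using Q_add[OF add.IH] by (simp add: distrib_right)
  qed
  have polyf: "h z\<^sub>0 \<in> polyfuns" if "h \<in> H" for h
  proof -
    have "(\<lambda>\<zeta>. h' z\<^sub>0 \<zeta>) \<in> polyfuns" if "hom_form k h'" for h' :: "complex ^ 'm \<Rightarrow> complex ^ 'n \<Rightarrow> complex" and k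
      using that by induction (auto intro: polyfuns_const polyfuns_mult polyfuns_add polyfuns_ymon)
    then show ?thesis using hom[OF that] by auto
  qed
  have Q1: "Q i (\<lambda>_. 1)" for i
  proof -
    \<comment> \<open>A common zero would satisfy \<open>\<zeta> = 0\<close> by the hypothesis at
      \<open>z\<^sub>0\<close>, and \<open>\<zeta>\<^sub>i = 1\<close> by the added
      equation.\<close>
    let ?H = "insert (\<lambda>\<zeta>. \<zeta> $ i - 1) ((\<lambda>h. h z\<^sub>0) ` H)"
    have "(\<lambda>_. 1) \<in> ideal_gen ?H"
    proof (rule weak_nullstellensatz)
      have "(\<lambda>\<zeta>. \<zeta> $ i - 1) \<in> polyfuns" by (intro polyfuns_diff polyfuns_coord polyfuns_const)
      then show "?H \<subseteq> polyfuns" using polyf by auto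
      show "\<exists>h\<in>?H. h \<zeta> \<noteq> 0" for \<zeta>
        using z\<^sub>0[of \<zeta>] by (cases "\<zeta> = 0") auto
    qed
    moreover have "Q i f" if "f \<in> ideal_gen ?H" for f
      using that
    proof induction
      case zero
      show ?case by (rule Q0) simp
    next
      case (gen h)
      show ?case
      proof (cases "h \<in> (\<lambda>h. h z\<^sub>0) ` H")
        case False
        then have "h = (\<lambda>\<zeta>. \<zeta> $ i - 1)" using gen by blast
        then show ?thesis by (intro Q0) simp
      next
        case True
        then obtain h' k where h': "h' \<in> H" "h = h' z\<^sub>0" "hom_form k h'" using hom by blast
        show ?thesis unfolding Q_def
        proof (intro exI[of _ k] allI impI)
          fix N assume "N \<ge> k"
          then obtain r where N: "N = r + k" by (metis add.commute le_Suc_ex)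
          let ?u = "axis i r :: nat ^ 'n"
          note u = vdeg_axis[of i r] ymon_axis_power[of i r]
          show "\<exists>E. hom_form N E \<and> (\<forall>z \<zeta>. (z, \<zeta>) \<in> Z \<longrightarrow> E z \<zeta> = 0) \<and>
            (\<forall>\<zeta>. \<zeta> $ i \<noteq> 0 \<longrightarrow> E z\<^sub>0 \<zeta> = (\<zeta> $ i) ^ N * h (inverse (\<zeta> $ i) *s \<zeta>))"
          proof (intro exI[of _ "\<lambda>z \<zeta>. ymon ?u \<zeta> * h' z \<zeta>"] conjI allI impI)
            show "hom_form N (\<lambda>z \<zeta>. ymon ?u \<zeta> * h' z \<zeta>)"
              using hom_form_ymon[OF h'(3), of ?u] by (simp add: u N)
            show "ymon ?u \<zeta> * h' z \<zeta> = 0" if "(z, \<zeta>) \<in> Z" for z \<zeta> using that h'(1) by (simp add: Z_def)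
            show "ymon ?u \<zeta> * h' z\<^sub>0 \<zeta> = (\<zeta> $ i) ^ N * h (inverse (\<zeta> $ i) *s \<zeta>)" if "\<zeta> $ i \<noteq> 0" for \<zeta>
              using that by (simp add: u N h'(2) hom_form_homogeneous[OF h'(3)] power_add power_inverse)
          qed
        qed
      qed
    next
      case (add f g)
      then show ?case by (intro Q_add)
    next
      case (mult a f)
      then show ?case by (intro Q_mult)
    qed
    ultimately show ?thesis by blast
  qed
  then have "\<forall>i. \<exists>N\<^sub>0. \<forall>N\<ge>N\<^sub>0. \<exists>E. hom_form N E \<and> (\<forall>z \<zeta>. (z, \<zeta>) \<in> Z \<longrightarrow> E z \<zeta> = 0) \<and>
    (\<forall>\<zeta>. \<zeta> $ i \<noteq> 0 \<longrightarrow> E z\<^sub>0 \<zeta> = (\<zeta> $ i) ^ N)" by (simp add: Q_def)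
  then obtain N\<^sub>0 where N0: "\<And>i N. N \<ge> N\<^sub>0 i \<Longrightarrow> \<exists>E. hom_form N E \<and> (\<forall>z \<zeta>. (z, \<zeta>) \<in> Z \<longrightarrow> E z \<zeta> = 0) \<and>
    (\<forall>\<zeta>. \<zeta> $ i \<noteq> 0 \<longrightarrow> E z\<^sub>0 \<zeta> = (\<zeta> $ i) ^ N)" by (rule choice[THEN exE]) blast
  define N where "N = Suc (\<Sum>i\<in>UNIV. N\<^sub>0 i)"
  have "N\<^sub>0 i \<le> N" for i unfolding N_def by (rule le_SucI, rule member_le_sum) auto
  then have "\<forall>i. \<exists>E. hom_form N E \<and> (\<forall>z \<zeta>. (z, \<zeta>) \<in> Z \<longrightarrow> E z \<zeta> = 0) \<and> (\<forall>\<zeta>. \<zeta> $ i \<noteq> 0 \<longrightarrow> E z\<^sub>0 \<zeta> = (\<zeta> $ i) ^ N)"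
    using N0 by blast
  then obtain E where E: "\<And>i. hom_form N (E i)" "\<And>i z \<zeta>. (z, \<zeta>) \<in> Z \<Longrightarrow> E i z \<zeta> = 0"
    "\<And>i \<zeta>. \<zeta> $ i \<noteq> 0 \<Longrightarrow> E i z\<^sub>0 \<zeta> = (\<zeta> $ i) ^ N" by (rule choice[THEN exE]) blast
  \<comment> \<open>By the pigeonhole principle a monomial of this degree contains some
    \<open>\<zeta>\<^sub>i\<close> to the power \<open>N\<close> at least.\<close>
  define D where "D = CARD('n) * N"
  have "\<exists>F a. (\<forall>z \<zeta>. (z, \<zeta>) \<in> Z \<longrightarrow> F z \<zeta> = 0) \<and> (\<forall>\<zeta>\<in>torus. F z\<^sub>0 \<zeta> = ymon \<mu> \<zeta>) \<and> (\<forall>v. a v \<in> polyfuns) \<and>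
    (\<forall>z \<zeta>. F z \<zeta> = (\<Sum>v | vdeg v = D. a v z * ymon v \<zeta>))" if \<mu>: "vdeg \<mu> = D" for \<mu> :: "nat ^ 'n"
  proof -
    obtain i where i: "\<mu> $ i \<ge> N"
    proof (rule ccontr)
      assume "\<not> thesis"
      then have "\<mu> $ i < N" for i using that not_le by blast
      then have "vdeg \<mu> < (\<Sum>i\<in>(UNIV :: 'n set). N)" unfolding vdeg_def by (intro sum_strict_mono) auto
      then show False using \<mu> by (simp add: D_def)
    qed
    define u where "u = (\<chi> j. if j = i then \<mu> $ i - N else \<mu> $ j)"
    have \<mu>u: "\<mu> = axis i N + u" using i by (simp add: u_def vec_eq_iff axis_def)
    note ax = vdeg_axis[of i N] ymon_axis_power[of i N]
    have "vdeg u + N = D" using \<mu> by (simp add: \<mu>u vdeg_add ax)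
    then have "hom_form D (\<lambda>z \<zeta>. ymon u \<zeta> * E i z \<zeta>)" using hom_form_ymon[OF E(1)[of i], of u] by simp
    from hom_form_coeffs[OF this] obtain a where a: "\<And>v. a v \<in> polyfuns"
      "\<And>z \<zeta>. ymon u \<zeta> * E i z \<zeta> = (\<Sum>v | vdeg v = D. a v z * ymon v \<zeta>)" by blast
    have "\<forall>z \<zeta>. (z, \<zeta>) \<in> Z \<longrightarrow> ymon u \<zeta> * E i z \<zeta> = 0" using E(2) by auto
    moreover have "\<forall>\<zeta>\<in>torus. ymon u \<zeta> * E i z\<^sub>0 \<zeta> = ymon \<mu> \<zeta>"
      using E(3) by (simp add: \<mu>u ymon_add ax torus_def)
    ultimately show ?thesis
      using a by (intro exI[of _ "\<lambda>z \<zeta>. ymon u \<zeta> * E i z \<zeta>"] exI[of _ a] conjI allI) blast+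
  qed
  then have "\<forall>\<mu>. \<exists>F a. vdeg \<mu> = D \<longrightarrow> (\<forall>z \<zeta>. (z, \<zeta>) \<in> Z \<longrightarrow> F z \<zeta> = 0) \<and> (\<forall>\<zeta>\<in>torus. F z\<^sub>0 \<zeta> = ymon \<mu> \<zeta>) \<and>
    (\<forall>v. a v \<in> polyfuns) \<and> (\<forall>z \<zeta>. F z \<zeta> = (\<Sum>v | vdeg v = D. a v z * ymon v \<zeta>))" by blast
  from choice[OF this] obtain F where "\<forall>\<mu>. \<exists>a. vdeg \<mu> = D \<longrightarrow> (\<forall>z \<zeta>. (z, \<zeta>) \<in> Z \<longrightarrow> F \<mu> z \<zeta> = 0) \<and>
    (\<forall>\<zeta>\<in>torus. F \<mu> z\<^sub>0 \<zeta> = ymon \<mu> \<zeta>) \<and> (\<forall>v. a v \<in> polyfuns) \<and>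
    (\<forall>z \<zeta>. F \<mu> z \<zeta> = (\<Sum>v | vdeg v = D. a v z * ymon v \<zeta>))" by blast
  from choice[OF this] obtain a where F: "\<And>\<mu> z \<zeta>. vdeg \<mu> = D \<Longrightarrow> (z, \<zeta>) \<in> Z \<Longrightarrow> F \<mu> z \<zeta> = 0"
    "\<And>\<mu> \<zeta>. vdeg \<mu> = D \<Longrightarrow> \<zeta> \<in> torus \<Longrightarrow> F \<mu> z\<^sub>0 \<zeta> = ymon \<mu> \<zeta>" "\<And>\<mu> v. vdeg \<mu> = D \<Longrightarrow> a \<mu> v \<in> polyfuns"
    "\<And>\<mu> z \<zeta>. vdeg \<mu> = D \<Longrightarrow> F \<mu> z \<zeta> = (\<Sum>v | vdeg v = D. a \<mu> v z * ymon v \<zeta>)" by blast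
  let ?I = "{v :: nat ^ 'n. vdeg v = D}"
  \<comment> \<open>The values of \<open>E i z\<^sub>0\<close> are known only where
    \<open>\<zeta>\<^sub>i\<close> is nonzero, so the coefficients are compared on the
    torus.\<close>
  have a0: "a \<mu> v z\<^sub>0 = (if v = \<mu> then 1 else 0)" if "vdeg \<mu> = D" "vdeg v = D" for \<mu> v
  proof -
    have "a \<mu> v z\<^sub>0 - (if v = \<mu> then 1 else 0) = 0"
    proof (rule ymon_independent[of ?I "\<lambda>v. a \<mu> v z\<^sub>0 - (if v = \<mu> then 1 else 0)"])
      show "finite ?I" by (rule finite_vdeg_eq)
      show "v \<in> ?I" using that by simp
      show "(\<Sum>v | vdeg v = D. (a \<mu> v z\<^sub>0 - (if v = \<mu> then 1 else 0)) * ymon v \<zeta>) = 0" if \<zeta>: "\<zeta> \<in> torus" for \<zeta>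
      proof -
        have "(\<Sum>v | vdeg v = D. (if v = \<mu> then 1 else 0) * ymon v \<zeta>) = ymon \<mu> \<zeta>"
          by (subst sum.remove[OF finite_vdeg_eq, of \<mu>]) (auto simp: \<open>vdeg \<mu> = D\<close>)
        then show ?thesis
          using F(2,4)[OF \<open>vdeg \<mu> = D\<close>] \<zeta> by (simp add: left_diff_distrib sum_subtractf)
      qed
    qed
    then show ?thesis by simp
  qed
  have "\<exists>g\<in>polyfuns. g z\<^sub>0 \<noteq> 0 \<and> (\<forall>z y. g z \<noteq> 0 \<longrightarrow> (\<forall>i\<in>?I. (\<Sum>j\<in>?I. a i j z * y j) = 0) \<longrightarrow> (\<forall>j\<in>?I. y j = 0))"
    by (rule kernel_trivial_open) (auto simp: finite_vdeg_eq F(3) a0)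
  then obtain g where g: "g \<in> polyfuns" "g z\<^sub>0 \<noteq> 0"
    "\<And>z y. g z \<noteq> 0 \<Longrightarrow> \<forall>i\<in>?I. (\<Sum>j\<in>?I. a i j z * y j) = 0 \<Longrightarrow> \<forall>j\<in>?I. y j = 0" by blast
  have "\<zeta> = 0" if "g z \<noteq> 0" "\<forall>h\<in>H. h z \<zeta> = 0" for z \<zeta>
  proof -
    have "(z, \<zeta>) \<in> Z" using that(2) by (simp add: Z_def)
    \<comment> \<open>The unknowns of the linear system are specialised to the monomials of degree
      \<open>D\<close> at \<open>\<zeta>\<close>; among them are the pure powers of the
      coordinates.\<close>
    then have "\<forall>i\<in>?I. (\<Sum>j\<in>?I. a i j z * ymon j \<zeta>) = 0" using F(1,4) by simp
    then have *: "\<forall>j\<in>?I. ymon j \<zeta> = 0" by (rule g(3)[OF that(1), of "\<lambda>v. ymon v \<zeta>"])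
    have "\<zeta> $ i = 0" for i
    proof -
      let ?v = "axis i D :: nat ^ 'n"
      have "ymon ?v \<zeta> = 0" using * vdeg_axis by blast
      then show ?thesis by (simp add: ymon_axis_power)
    qed
    then show ?thesis by (simp add: vec_eq_iff)
  qed
  then show ?thesis using g(1,2) by blast
qed

section \<open>Principal open sets, fractions, and quotients that admit a section\<close>

section \<open>The Zariski topology\<close>

lemma openin_zariski: "openin zariski U \<longleftrightarrow> (\<forall>p\<in>U. \<exists>f\<in>polyfuns. f p \<noteq> 0 \<and> {q. f q \<noteq> 0} \<subseteq> U)"
proof
  assume "openin zariski U"
  then have "generate_topology_on ((\<lambda>f. {p. f p \<noteq> 0}) ` polyfuns) U"
    by (simp add: zariski_def openin_topology_generated_by_iff)
  then show "\<forall>p\<in>U. \<exists>f\<in>polyfuns. f p \<noteq> 0 \<and> {q. f q \<noteq> 0} \<subseteq> U"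
  proof induction
    case (Int a b)
    show ?case
    proof
      fix p assume p: "p \<in> a \<inter> b"
      obtain f where f: "f \<in> polyfuns" "f p \<noteq> 0" "{q. f q \<noteq> 0} \<subseteq> a" using Int p by blast
      obtain g where g: "g \<in> polyfuns" "g p \<noteq> 0" "{q. g q \<noteq> 0} \<subseteq> b" using Int p by blast
      show "\<exists>f\<in>polyfuns. f p \<noteq> 0 \<and> {q. f q \<noteq> 0} \<subseteq> a \<inter> b"
        by (rule bexI[of _ "\<lambda>q. f q * g q"]) (use f g in \<open>auto intro: polyfuns_mult\<close>)
    qed
  next
    case (UN K)
    show ?case
    proof
      fix p assume "p \<in> \<Union>K"
      then obtain k where k: "k \<in> K" "p \<in> k" by blast
      from UN.IH[OF k(1)] k(2) obtain f where "f \<in> polyfuns" "f p \<noteq> 0" "{q. f q \<noteq> 0} \<subseteq> k" by blast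
      then show "\<exists>f\<in>polyfuns. f p \<noteq> 0 \<and> {q. f q \<noteq> 0} \<subseteq> \<Union>K" using k(1) by blast
    qed
  qed auto
next
  assume *: "\<forall>p\<in>U. \<exists>f\<in>polyfuns. f p \<noteq> 0 \<and> {q. f q \<noteq> 0} \<subseteq> U"
  have "openin zariski {q. f q \<noteq> 0}" if "f \<in> polyfuns" for f :: "complex ^ 'a \<Rightarrow> complex"
    unfolding zariski_def using that by (intro topology_generated_by_Basis) auto
  then show "openin zariski U" using * by (subst openin_subopen) blast
qed

lemma topspace_zariski [simp]: "topspace zariski = UNIV"
proof -
  have "openin zariski UNIV" unfolding openin_zariski by (intro ballI bexI[of _ "\<lambda>_. 1"]) (auto intro: polyfuns_const)
  then show ?thesis using openin_subset by blast
qed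

lemma closedin_zariski_zeros:
  assumes "F \<subseteq> polyfuns" shows "closedin zariski {p. \<forall>f\<in>F. f p = 0}"
  unfolding closedin_def using assms by (auto simp: openin_zariski)

lemma openin_sub_zariski:
  "openin (subtopology zariski V) S \<longleftrightarrow> S \<subseteq> V \<and> (\<forall>p\<in>S. \<exists>f\<in>polyfuns. f p \<noteq> 0 \<and> {q\<in>V. f q \<noteq> 0} \<subseteq> S)"
proof
  assume "openin (subtopology zariski V) S"
  then obtain U where "openin zariski U" "S = U \<inter> V" by (auto simp: openin_subtopology)
  then show "S \<subseteq> V \<and> (\<forall>p\<in>S. \<exists>f\<in>polyfuns. f p \<noteq> 0 \<and> {q\<in>V. f q \<noteq> 0} \<subseteq> S)"
    unfolding openin_zariski by blast
next
  assume S: "S \<subseteq> V \<and> (\<forall>p\<in>S. \<exists>f\<in>polyfuns. f p \<noteq> 0 \<and> {q\<in>V. f q \<noteq> 0} \<subseteq> S)"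
  define U where "U = \<Union>{{q. f q \<noteq> 0} | f. f \<in> polyfuns \<and> {q\<in>V. f q \<noteq> 0} \<subseteq> S}"
  have "openin zariski U" unfolding openin_zariski U_def by blast
  moreover have "S = U \<inter> V"
  proof
    show "S \<subseteq> U \<inter> V" using S unfolding U_def by blast
    show "U \<inter> V \<subseteq> S" unfolding U_def by blast
  qed
  ultimately show "openin (subtopology zariski V) S" by (auto simp: openin_subtopology)
qed

lemma openin_torus: "openin zariski torus"
  unfolding openin_zariski
proof
  fix p :: "complex ^ 'a" assume "p \<in> torus"
  then show "\<exists>f\<in>polyfuns. f p \<noteq> 0 \<and> {q. f q \<noteq> 0} \<subseteq> torus"
    by (intro bexI[of _ "\<lambda>p. \<Prod>i\<in>UNIV. p $ i"] polyfuns_prod polyfuns_coord) (auto simp: torus_def)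
qed

lemma openin_cot_torus: "openin zariski cot_torus"
  unfolding openin_zariski
proof
  fix p :: "complex ^ ('a + 'a)" assume "p \<in> cot_torus"
  then show "\<exists>f\<in>polyfuns. f p \<noteq> 0 \<and> {q. f q \<noteq> 0} \<subseteq> cot_torus"
    by (intro bexI[of _ "\<lambda>p. \<Prod>i\<in>UNIV. p $ Inl i"] polyfuns_prod polyfuns_coord)
      (auto simp: cot_torus_def torus_def cot_base_def)
qed

text \<open>One fraction on all of \<open>V\<close>, stronger than the local condition in
  \<open>regular_fun\<close>; on the torus, monomial and linear maps are of this kind.\<close>

definition rational_on :: "(complex ^ ('k::finite)) set \<Rightarrow> (complex ^ 'k \<Rightarrow> complex) \<Rightarrow> bool" where
  "rational_on V f \<longleftrightarrow> (\<exists>g\<in>polyfuns. \<exists>h\<in>polyfuns. \<forall>p\<in>V. h p \<noteq> 0 \<and> f p = g p / h p)"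

lemma rational_onI: "g \<in> polyfuns \<Longrightarrow> h \<in> polyfuns \<Longrightarrow> (\<And>p. p \<in> V \<Longrightarrow> h p \<noteq> 0 \<and> f p = g p / h p) \<Longrightarrow> rational_on V f"
  by (auto simp: rational_on_def)

lemma rational_on_polyfun: "f \<in> polyfuns \<Longrightarrow> rational_on V f"
  by (rule rational_onI[of f "\<lambda>_. 1"]) (auto intro: polyfuns_const)

lemma rational_on_subset: "rational_on V f \<Longrightarrow> V' \<subseteq> V \<Longrightarrow> rational_on V' f"
  by (auto simp: rational_on_def)

lemma rational_on_add: "rational_on V f \<Longrightarrow> rational_on V f' \<Longrightarrow> rational_on V (\<lambda>p. f p + f' p)"
  unfolding rational_on_def[of V f] rational_on_def[of V f']
proof (elim bexE)
  fix g h g' h' assume *: "g \<in> polyfuns" "h \<in> polyfuns" "g' \<in> polyfuns" "h' \<in> polyfuns"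
    "\<forall>p\<in>V. h p \<noteq> 0 \<and> f p = g p / h p" "\<forall>p\<in>V. h' p \<noteq> 0 \<and> f' p = g' p / h' p"
  show "rational_on V (\<lambda>p. f p + f' p)"
    by (rule rational_onI[of "\<lambda>p. g p * h' p + g' p * h p" "\<lambda>p. h p * h' p"])
      (use * in \<open>auto intro!: polyfuns_add polyfuns_mult simp: add_frac_eq\<close>)
qed

lemma rational_on_mult: "rational_on V f \<Longrightarrow> rational_on V f' \<Longrightarrow> rational_on V (\<lambda>p. f p * f' p)"
  unfolding rational_on_def[of V f] rational_on_def[of V f']
proof (elim bexE)
  fix g h g' h' assume *: "g \<in> polyfuns" "h \<in> polyfuns" "g' \<in> polyfuns" "h' \<in> polyfuns"
    "\<forall>p\<in>V. h p \<noteq> 0 \<and> f p = g p / h p" "\<forall>p\<in>V. h' p \<noteq> 0 \<and> f' p = g' p / h' p"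
  show "rational_on V (\<lambda>p. f p * f' p)"
    by (rule rational_onI[of "\<lambda>p. g p * g' p" "\<lambda>p. h p * h' p"])
      (use * in \<open>auto intro!: polyfuns_mult\<close>)
qed

lemma rational_on_inverse:
  assumes "rational_on V f" "\<And>p. p \<in> V \<Longrightarrow> f p \<noteq> 0" shows "rational_on V (\<lambda>p. inverse (f p))"
proof -
  obtain g h where *: "g \<in> polyfuns" "h \<in> polyfuns" "\<And>p. p \<in> V \<Longrightarrow> h p \<noteq> 0" "\<And>p. p \<in> V \<Longrightarrow> f p = g p / h p"
    using assms(1) by (auto simp: rational_on_def)
  show ?thesis
    by (rule rational_onI[of h g]) (use * assms(2) in \<open>auto simp: *(4)\<close>)
qed

lemma rational_on_divide:
  "rational_on V f \<Longrightarrow> rational_on V g \<Longrightarrow> (\<And>p. p \<in> V \<Longrightarrow> g p \<noteq> 0) \<Longrightarrow> rational_on V (\<lambda>p. f p / g p)"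
  unfolding divide_inverse by (intro rational_on_mult rational_on_inverse)

lemma rational_on_prod: "(\<And>i. i \<in> I \<Longrightarrow> rational_on V (f i)) \<Longrightarrow> rational_on V (\<lambda>p. \<Prod>i\<in>I. f i p)"
  by (induction I rule: infinite_finite_induct) (auto intro: rational_on_polyfun polyfuns_const rational_on_mult)

lemma rational_on_powi:
  assumes "rational_on V f" "\<And>p. p \<in> V \<Longrightarrow> f p \<noteq> 0" shows "rational_on V (\<lambda>p. f p powi k)"
proof -
  have pow: "rational_on V (\<lambda>p. g p ^ n)" if "rational_on V g" for g n
    using that by (induction n) (auto intro: rational_on_polyfun polyfuns_const rational_on_mult)
  show ?thesis unfolding power_int_def
    by (cases "k \<ge> 0") (use pow[OF assms(1)] pow[OF rational_on_inverse[OF assms]] in auto)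
qed

lemma rational_on_comp:
  assumes "f \<in> polyfuns" "\<And>i. rational_on V (\<lambda>p. \<phi> p $ i)" shows "rational_on V (\<lambda>p. f (\<phi> p))"
  using assms(1)
proof (induction rule: polyfuns_induct)
  case (const c)
  show ?case by (intro rational_on_polyfun polyfuns_const)
next
  case (coord f i)
  then show ?case by (intro rational_on_mult assms(2))
next
  case (add f g)
  then show ?case by (intro rational_on_add)
qed

lemma rational_continuous:
  assumes "\<And>i. rational_on V (\<lambda>p. \<phi> p $ i)" "\<And>p. p \<in> V \<Longrightarrow> \<phi> p \<in> W"
  shows "continuous_map (subtopology zariski V) (subtopology zariski W) \<phi>"
  unfolding continuous_map_def
proof (intro conjI allI impI)
  show "\<phi> \<in> topspace (subtopology zariski V) \<rightarrow> topspace (subtopology zariski W)" using assms(2) by simp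
  fix U assume "openin (subtopology zariski W) U"
  then have U: "U \<subseteq> W" "\<And>p. p \<in> U \<Longrightarrow> \<exists>f\<in>polyfuns. f p \<noteq> 0 \<and> {q\<in>W. f q \<noteq> 0} \<subseteq> U"
    unfolding openin_sub_zariski by auto
  show "openin (subtopology zariski V) {p \<in> topspace (subtopology zariski V). \<phi> p \<in> U}"
    unfolding openin_sub_zariski
  proof (intro conjI ballI)
    fix p assume "p \<in> {p \<in> topspace (subtopology zariski V). \<phi> p \<in> U}"
    then have p: "p \<in> V" "\<phi> p \<in> U" by auto
    obtain f where f: "f \<in> polyfuns" "f (\<phi> p) \<noteq> 0" "{q\<in>W. f q \<noteq> 0} \<subseteq> U" using U(2)[OF p(2)] by blast
    obtain g h where gh: "g \<in> polyfuns" "h \<in> polyfuns" "\<forall>p\<in>V. h p \<noteq> 0 \<and> f (\<phi> p) = g p / h p"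
      using rational_on_comp[OF f(1) assms(1)] unfolding rational_on_def by blast
    then have g0: "g q \<noteq> 0 \<longleftrightarrow> f (\<phi> q) \<noteq> 0" if "q \<in> V" for q using that by simp
    show "\<exists>g\<in>polyfuns. g p \<noteq> 0 \<and> {q\<in>V. g q \<noteq> 0} \<subseteq> {p \<in> topspace (subtopology zariski V). \<phi> p \<in> U}"
    proof (intro bexI[of _ g] conjI gh)
      show "g p \<noteq> 0" using g0[OF p(1)] f(2) by blast
      show "{q\<in>V. g q \<noteq> 0} \<subseteq> {p \<in> topspace (subtopology zariski V). \<phi> p \<in> U}"
        using g0 f(3) assms(2) by auto
    qed
  qed auto
qed

lemma rational_morphism:
  assumes \<phi>: "\<And>i. rational_on V (\<lambda>p. \<phi> p $ i)" "\<And>p. p \<in> V \<Longrightarrow> \<phi> p \<in> W"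
  shows "variety_morphism V W \<phi>"
  unfolding variety_morphism_def
proof (intro conjI allI impI)
  show cont: "continuous_map (subtopology zariski V) (subtopology zariski W) \<phi>"
    using assms by (rule rational_continuous)
  fix U f assume "openin (subtopology zariski W) U \<and> regular_fun W U f"
  then have U: "openin (subtopology zariski W) U" and f: "regular_fun W U f" by auto
  show "regular_fun V {p\<in>V. \<phi> p \<in> U} (f \<circ> \<phi>)"
    unfolding regular_fun_def
  proof
    fix p assume "p \<in> {p\<in>V. \<phi> p \<in> U}"
    then have p: "p \<in> V" "\<phi> p \<in> U" by auto
    obtain W' g h where W': "openin (subtopology zariski W) W'" "\<phi> p \<in> W'" "W' \<subseteq> U" and
      gh: "g \<in> polyfuns" "h \<in> polyfuns" "\<forall>q\<in>W'. h q \<noteq> 0 \<and> f q = g q / h q"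
      using bspec[OF f[unfolded regular_fun_def] p(2)] by (elim exE conjE bexE)
    let ?O = "{p\<in>V. \<phi> p \<in> W'}"
    have "openin (subtopology zariski V) ?O"
      using cont W'(1) by (auto simp: continuous_map_def)
    have "rational_on ?O (\<lambda>p. g (\<phi> p) / h (\<phi> p))"
    proof (rule rational_on_divide)
      show "rational_on ?O (\<lambda>p. g (\<phi> p))" "rational_on ?O (\<lambda>p. h (\<phi> p))"
        by (rule rational_on_comp[OF gh(1)], rule rational_on_subset[OF \<phi>(1)], blast)
          (rule rational_on_comp[OF gh(2)], rule rational_on_subset[OF \<phi>(1)], blast)
    qed (use gh(3) in blast)
    then obtain g' h' where gh': "g' \<in> polyfuns" "h' \<in> polyfuns"
      "\<forall>q\<in>?O. h' q \<noteq> 0 \<and> g (\<phi> q) / h (\<phi> q) = g' q / h' q"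
      unfolding rational_on_def by blast
    have "\<forall>q\<in>?O. h' q \<noteq> 0 \<and> (f \<circ> \<phi>) q = g' q / h' q" using gh(3) gh'(3) by simp
    then have "\<exists>g\<in>polyfuns. \<exists>h\<in>polyfuns. \<forall>q\<in>?O. h q \<noteq> 0 \<and> (f \<circ> \<phi>) q = g q / h q"
      using gh'(1,2) by blast
    moreover have "p \<in> ?O" "?O \<subseteq> {p\<in>V. \<phi> p \<in> U}" using p W' by auto
    ultimately show "\<exists>O'. openin (subtopology zariski V) O' \<and> p \<in> O' \<and> O' \<subseteq> {p\<in>V. \<phi> p \<in> U} \<and>
      (\<exists>g\<in>polyfuns. \<exists>h\<in>polyfuns. \<forall>q\<in>O'. h q \<noteq> 0 \<and> (f \<circ> \<phi>) q = g q / h q)"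
      using \<open>openin (subtopology zariski V) ?O\<close> by blast
  qed
qed

text \<open>The section does the work: it exhibits \<open>\<phi>\<close> as a retraction and hence a
  quotient map, and an invariant \<open>f\<close> descends to \<open>f \<circ> \<sigma>\<close>
  because \<open>\<sigma> (\<phi> p)\<close> lies in the orbit of \<open>p\<close>.\<close>

lemma geometric_quotient_with_section:
  assumes qa: "quasi_affine V" "quasi_affine W" and stable: "\<And>t p. t \<in> T \<Longrightarrow> p \<in> V \<Longrightarrow> act t p \<in> V"
    and \<phi>: "\<And>i. rational_on V (\<lambda>p. \<phi> p $ i)" "\<And>p. p \<in> V \<Longrightarrow> \<phi> p \<in> W"
    and \<sigma>: "\<And>i. rational_on W (\<lambda>p. \<sigma> p $ i)" "\<And>q. q \<in> W \<Longrightarrow> \<sigma> q \<in> V" "\<And>q. q \<in> W \<Longrightarrow> \<phi> (\<sigma> q) = q"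
    and fib: "\<And>p q. p \<in> V \<Longrightarrow> q \<in> V \<Longrightarrow> \<phi> p = \<phi> q \<longleftrightarrow> (\<exists>t\<in>T. q = act t p)"
  shows "geometric_quotient_map T act V W \<phi>"
  unfolding geometric_quotient_map_def
proof (intro conjI ballI allI impI)
  show "variety_morphism V W \<phi>" by (rule rational_morphism[OF \<phi>])
  have "retraction_maps (subtopology zariski V) (subtopology zariski W) \<phi> \<sigma>"
    unfolding retraction_maps_def using rational_continuous[OF \<phi>] rational_continuous[OF \<sigma>(1,2)] \<sigma>(3) by simp
  then show "quotient_map (subtopology zariski V) (subtopology zariski W) \<phi>" by (intro retraction_imp_quotient_map) (auto simp: retraction_map_def)
  fix U f assume *: "openin (subtopology zariski W) U \<and> regular_fun V {p\<in>V. \<phi> p \<in> U} f \<and>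
        (\<forall>t\<in>T. \<forall>p\<in>V. \<phi> p \<in> U \<longrightarrow> f (act t p) = f p)"
  have UW: "U \<subseteq> W" using * by (simp add: openin_sub_zariski)
  have "openin (subtopology zariski V) {p\<in>V. \<phi> p \<in> U}"
    using rational_continuous[OF \<phi>] * by (auto simp: continuous_map_def)
  then have "regular_fun W {q\<in>W. \<sigma> q \<in> {p\<in>V. \<phi> p \<in> U}} (f \<circ> \<sigma>)"
    using rational_morphism[OF \<sigma>(1,2)] * unfolding variety_morphism_def by blast
  moreover have "{q\<in>W. \<sigma> q \<in> {p\<in>V. \<phi> p \<in> U}} = U" using \<sigma>(2,3) UW by auto
  ultimately have reg: "regular_fun W U (f \<circ> \<sigma>)" by simp
  have "f p = (f \<circ> \<sigma>) (\<phi> p)" if p: "p \<in> V" "\<phi> p \<in> U" for p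
  proof -
    have "\<sigma> (\<phi> p) \<in> V" "\<phi> p = \<phi> (\<sigma> (\<phi> p))" using \<phi>(2) \<sigma>(2,3) p(1) by auto
    then obtain t where "t \<in> T" "\<sigma> (\<phi> p) = act t p" using fib[OF p(1)] by blast
    then show ?thesis using * p by simp
  qed
  with reg show "\<exists>g. regular_fun W U g \<and> (\<forall>p\<in>V. \<phi> p \<in> U \<longrightarrow> f p = g (\<phi> p))" by blast
qed (use qa stable fib in auto)

section \<open>Torus orbits as fibres, on \<open>X\<close> and on its cotangent bundle\<close>

section \<open>The quotient maps\<close>

lemma rational_on_tpow:
  assumes "\<And>i. rational_on V (\<lambda>p. \<phi> p $ i)" "\<And>p. p \<in> V \<Longrightarrow> \<phi> p \<in> torus"
  shows "rational_on V (\<lambda>p. tpow (\<phi> p) u)"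
  unfolding tpow_def by (intro rational_on_prod rational_on_powi assms) (use assms(2) in \<open>auto simp: torus_def\<close>)

lemma torus_map_mult: "torus_map B (x * y) = torus_map B x * torus_map B y"
  by (simp add: torus_map_def tpow_def vec_eq_iff power_int_mult_distrib prod.distrib)

lemma torus_map_add: "x \<in> torus \<Longrightarrow> torus_map (B + B') x = torus_map B x * torus_map B' x"
  by (simp add: torus_map_def tpow_def vec_eq_iff torus_def column_def power_int_add prod.distrib)

lemma torus_map_1 [simp]: "torus_map B 1 = 1"
  by (simp add: torus_map_def tpow_def vec_eq_iff)

lemma torus_map_0 [simp]: "torus_map 0 x = 1"
  by (simp add: torus_map_def tpow_def vec_eq_iff column_def)

lemma torus_act_eq: "torus_act A t x = torus_map A t * x"
  by (simp add: torus_act_def torus_map_def vec_eq_iff)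

lemma torus_mult: "x \<in> torus \<Longrightarrow> y \<in> torus \<Longrightarrow> x * y \<in> torus"
  by (simp add: torus_def)

text \<open>The covector at \<open>x\<close> with logarithmic coordinates \<open>x\<^sub>i \<xi>\<^sub>i = y\<^sub>i\<close>.\<close>

definition log_covector :: "complex ^ ('n::finite) \<Rightarrow> complex ^ 'n \<Rightarrow> complex ^ ('n + 'n)" where
  "log_covector x y = (\<chi> k. case k of Inl i \<Rightarrow> x $ i | Inr i \<Rightarrow> y $ i / x $ i)"

lemma cot_base_log_covector [simp]: "cot_base (log_covector x y) = x"
  by (simp add: cot_base_def log_covector_def vec_eq_iff)

lemma log_fibre_log_covector [simp]: "x \<in> torus \<Longrightarrow> log_fibre (log_covector x y) = y"
  by (simp add: log_fibre_def cot_fibre_def log_covector_def vec_eq_iff torus_def cot_base_def)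

lemma log_covector_cases: "p \<in> cot_torus \<Longrightarrow> log_covector (cot_base p) (log_fibre p) = p"
  unfolding vec_eq_iff
proof
  fix k assume "p \<in> cot_torus"
  then show "log_covector (cot_base p) (log_fibre p) $ k = p $ k"
    by (cases k) (auto simp: log_covector_def cot_base_def log_fibre_def cot_fibre_def cot_torus_def torus_def)
qed

lemma cot_torus_act_log_covector:
  assumes "t \<in> torus" "x \<in> torus"
  shows "cot_torus_act A t (log_covector x y) = log_covector (torus_act A t x) y"
  unfolding vec_eq_iff
proof
  fix k
  have "tpow t (- column i A) = inverse (tpow t (column i A))" for i
    using tpow_minus assms(1) by blast
  then show "cot_torus_act A t (log_covector x y) $ k = log_covector (torus_act A t x) y $ k"
    by (cases k) (simp_all add: cot_torus_act_def log_covector_def torus_act_def divide_inverse)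
qed

lemma rational_on_cot_base: "rational_on V (\<lambda>p. cot_base p $ i)"
  by (simp add: cot_base_def rational_on_polyfun polyfuns_coord)

lemma rational_on_linear_log_fibre: "rational_on V (\<lambda>p. (D *v log_fibre p) $ j)"
  unfolding matrix_vector_mult_def log_fibre_def cot_base_def cot_fibre_def
  by (simp, intro rational_on_polyfun polyfuns_sum polyfuns_mult polyfuns_const polyfuns_coord)

lemma rational_on_log_covector:
  assumes "\<And>i. rational_on V (\<lambda>p. f p $ i)" "\<And>i. rational_on V (\<lambda>p. g p $ i)" "\<And>p. p \<in> V \<Longrightarrow> f p \<in> torus"
  shows "rational_on V (\<lambda>p. log_covector (f p) (g p) $ k)"
proof (cases k)
  case (Inl i)
  then show ?thesis using assms(1) by (simp add: log_covector_def)
next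
  case (Inr i)
  then show ?thesis using assms(3) by (auto simp: log_covector_def torus_def intro!: rational_on_divide assms(1,2))
qed

lemma rational_preimage:
  assumes "openin zariski U" "\<And>i. rational_on U (\<lambda>p. \<phi> p $ i)" "closedin zariski C"
  obtains C' where "closedin zariski C'" "{p\<in>U. \<phi> p \<in> C} = C' \<inter> U"
proof -
  have "continuous_map (subtopology zariski U) zariski \<phi>"
    using rational_continuous[of U \<phi> UNIV] assms(2) by simp
  then have "closedin (subtopology zariski U) {p\<in>topspace (subtopology zariski U). \<phi> p \<in> C}"
    using assms(3) by (rule closedin_continuous_map_preimage)
  then show ?thesis using that by (auto simp: closedin_subtopology)
qed

context split_torus
begin

text \<open>The quotient \<open>u = x' / x\<close> satisfies \<open>u^B = 1\<close>. From
  \<open>R A + B L = 1\<close> it follows that \<open>u = (u^R)^A\<close>, so \<open>t = u^R\<close>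
  moves \<open>x\<close> to \<open>x'\<close>.\<close>

lemma torus_map_fibres:
  assumes "x \<in> torus" "x' \<in> torus"
  shows "torus_map B x = torus_map B x' \<longleftrightarrow> (\<exists>t\<in>torus. x' = torus_act A t x)"
proof
  assume eq: "torus_map B x = torus_map B x'"
  define u where "u = (\<chi> i. x' $ i / x $ i)"
  have u: "u \<in> torus" "x' = u * x" using assms by (auto simp: u_def torus_def vec_eq_iff)
  have "torus_map B u * torus_map B x = 1 * torus_map B x" using eq by (simp add: u(2) torus_map_mult)
  then have "torus_map B u = 1" using torus_map_torus[OF assms(1), of B] by (auto simp: vec_eq_iff torus_def)
  then have BL: "torus_map (B ** L) u = 1" using torus_map_comp[OF u(1), of L B] by simp
  have "u = torus_map (R ** A + B ** L) u" by (simp add: RABL torus_map_one)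
  also have "\<dots> = torus_map A (torus_map R u)" by (simp add: torus_map_add u(1) BL torus_map_comp)
  finally show "\<exists>t\<in>torus. x' = torus_act A t x"
    using torus_map_torus[OF u(1), of R] u(2) by (metis torus_act_eq)
next
  assume "\<exists>t\<in>torus. x' = torus_act A t x"
  then obtain t where "t \<in> torus" "x' = torus_act A t x" by blast
  then show "torus_map B x = torus_map B x'"
    using torus_map_comp[of t B A] by (simp add: torus_act_eq torus_map_mult AB)
qed

lemma torus_map_section: "z \<in> torus \<Longrightarrow> torus_map B (torus_map L z) = z"
  by (simp add: torus_map_comp LB torus_map_one)

lemma torus_act_torus: "t \<in> torus \<Longrightarrow> x \<in> torus \<Longrightarrow> torus_act A t x \<in> torus"
  by (simp add: torus_act_eq torus_mult torus_map_torus)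

text \<open>The section is \<open>z \<mapsto> z^L\<close>, by \<open>L B = 1\<close>; the preimage
  of \<open>C\<close> is relatively closed in the open torus because monomial maps are continuous
  there.\<close>

lemma base_quotient:
  assumes "closedin zariski C"
  shows "is_geometric_quotient torus (torus_act A) {x\<in>torus. torus_map B x \<in> C} (C \<inter> torus)"
  unfolding is_geometric_quotient_def
proof (intro exI geometric_quotient_with_section)
  let ?V = "{x\<in>torus. torus_map B x \<in> C}"
  have rat: "rational_on U (\<lambda>p. torus_map D p $ i)" if "U \<subseteq> torus" for U D i
    unfolding torus_map_def using that
    by (simp, intro rational_on_tpow rational_on_polyfun polyfuns_coord) auto
  obtain C' where "closedin zariski C'" "?V = C' \<inter> torus"
    by (rule rational_preimage[OF openin_torus rat[OF order_refl] assms])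
  then show "quasi_affine ?V" unfolding quasi_affine_def using openin_torus by blast
  show "quasi_affine (C \<inter> torus)" unfolding quasi_affine_def using openin_torus assms by blast
  show "rational_on ?V (\<lambda>p. torus_map B p $ i)" "rational_on (C \<inter> torus) (\<lambda>p. torus_map L p $ j)" for i j
    by (rule rat, auto)+
  show "torus_act A t p \<in> ?V" if "t \<in> torus" "p \<in> ?V" for t p
    using torus_map_fibres[of p "torus_act A t p"] that torus_act_torus by auto
  show "torus_map B p = torus_map B q \<longleftrightarrow> (\<exists>t\<in>torus. q = torus_act A t p)" if "p \<in> ?V" "q \<in> ?V" for p q
    using that by (intro torus_map_fibres) auto
qed (auto simp: torus_map_torus torus_map_section)

definition cot_map :: "complex ^ ('n + 'n) \<Rightarrow> complex ^ ('m + 'm)" where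
  "cot_map p = log_covector (torus_map B (cot_base p)) (LC *v log_fibre p)"

definition cot_section :: "complex ^ ('m + 'm) \<Rightarrow> complex ^ ('n + 'n)" where
  "cot_section q = log_covector (torus_map L (cot_base q)) (BC *v log_fibre q)"

lemma AC_BC: "AC *v (BC *v w) = 0"
  by (simp add: matrix_vector_mul_assoc map_matrix_of_int_mult[symmetric] AB map_matrix_of_int_zero)

lemma LC_BC: "LC *v (BC *v w) = w"
  by (simp add: matrix_vector_mul_assoc map_matrix_of_int_mult[symmetric] LB map_matrix_of_int_one)

text \<open>In logarithmic coordinates the action moves \<open>x\<close> and fixes \<open>y\<close>,
  so orbits are detected on the base. On \<open>A y = 0\<close> the map \<open>L\<close> is
  injective with inverse \<open>B\<close>, which also provides the section.\<close>

lemma cot_quotient: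
  assumes "closedin zariski C"
  shows "is_geometric_quotient torus (cot_torus_act A)
    {p\<in>cot_torus. AC *v log_fibre p = 0 \<and> cot_map p \<in> C} (C \<inter> cot_torus)"
  unfolding is_geometric_quotient_def
proof (intro exI geometric_quotient_with_section)
  let ?V = "{p\<in>cot_torus. AC *v log_fibre p = 0 \<and> cot_map p \<in> C}"
  have base: "rational_on U (\<lambda>p. torus_map D (cot_base p) $ i)" if "U \<subseteq> cot_torus" for U D i
    unfolding torus_map_def using that
    by (simp, intro rational_on_tpow rational_on_cot_base) (auto simp: cot_torus_def)
  have rat: "rational_on U (\<lambda>p. log_covector (torus_map D (cot_base p)) (D' *v log_fibre p) $ i)"
    if "U \<subseteq> cot_torus" for U D D' i
    by (intro rational_on_log_covector base[OF that] rational_on_linear_log_fibre torus_map_torus)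
      (use that in \<open>auto simp: cot_torus_def\<close>)
  have "rational_on cot_torus (\<lambda>p. cot_map p $ i)" for i
    unfolding cot_map_def by (rule rat) simp
  from rational_preimage[OF openin_cot_torus this assms]
  obtain C' where C': "closedin zariski C'" "{p\<in>cot_torus. cot_map p \<in> C} = C' \<inter> cot_torus" .
  let ?E = "range (\<lambda>i p. (AC *v log_fibre p) $ i)"
  have "?E \<subseteq> polyfuns"
    unfolding matrix_vector_mult_def log_fibre_def cot_base_def cot_fibre_def
    by (simp add: image_subset_iff, intro allI polyfuns_sum polyfuns_mult polyfuns_const polyfuns_coord)
  then have "closedin zariski (C' \<inter> {p. \<forall>f\<in>?E. f p = 0})"
    using C'(1) closedin_zariski_zeros by blast
  moreover have "?V = (C' \<inter> {p. \<forall>f\<in>?E. f p = 0}) \<inter> cot_torus"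
    using C'(2) by (auto simp: vec_eq_iff)
  ultimately show "quasi_affine ?V" unfolding quasi_affine_def using openin_cot_torus by blast
  show "quasi_affine (C \<inter> cot_torus)" unfolding quasi_affine_def using openin_cot_torus assms by blast
  show "rational_on ?V (\<lambda>p. cot_map p $ i)" "rational_on (C \<inter> cot_torus) (\<lambda>p. cot_section p $ j)" for i j
    unfolding cot_map_def cot_section_def by (rule rat, auto)+
  show cm: "cot_map p \<in> C \<inter> cot_torus" if "p \<in> ?V" for p
    using that by (simp add: cot_map_def cot_torus_def torus_map_torus)
  show sec: "cot_map (cot_section q) = q" if "q \<in> C \<inter> cot_torus" for q
    using that log_covector_cases[of q]
    by (simp add: cot_map_def cot_section_def cot_torus_def torus_map_torus torus_map_section AC_BC LC_BC)
  show "cot_section q \<in> ?V" if "q \<in> C \<inter> cot_torus" for q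
    using that sec[OF that] by (simp add: cot_section_def cot_torus_def torus_map_torus AC_BC LC_BC)
  have act: "cot_torus_act A t p = log_covector (torus_act A t (cot_base p)) (log_fibre p)"
    if "t \<in> torus" "p \<in> cot_torus" for t p
    using cot_torus_act_log_covector[OF that(1), of "cot_base p" A "log_fibre p"] that(2)
    by (simp add: log_covector_cases cot_torus_def)
  show "cot_torus_act A t p \<in> ?V" if "t \<in> torus" "p \<in> ?V" for t p
  proof -
    have p: "p \<in> cot_torus" "cot_base p \<in> torus" using that(2) by (auto simp: cot_torus_def)
    have "torus_map B (cot_base p) = torus_map B (torus_act A t (cot_base p))"
      using torus_map_fibres torus_act_torus p(2) that(1) by blast
    then show ?thesis
      using that torus_act_torus[OF that(1) p(2)] by (simp add: act p cot_map_def) (simp add: cot_torus_def)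
  qed
  show "cot_map p = cot_map q \<longleftrightarrow> (\<exists>t\<in>torus. q = cot_torus_act A t p)" if "p \<in> ?V" "q \<in> ?V" for p q
  proof -
    have t: "cot_base p \<in> torus" "cot_base q \<in> torus" "p \<in> cot_torus" "q \<in> cot_torus"
      "AC *v log_fibre p = 0" "AC *v log_fibre q = 0"
      using that by (auto simp: cot_torus_def)
    have "log_covector x y = log_covector x' y' \<longleftrightarrow> x = x' \<and> y = y'"
      if "x \<in> torus" "x' \<in> torus" for x x' y y' :: "complex ^ ('k::finite)"
      using that by (metis cot_base_log_covector log_fibre_log_covector)
    note inj = this
    have "cot_map p = cot_map q \<longleftrightarrow> torus_map B (cot_base p) = torus_map B (cot_base q) \<and> LC *v log_fibre p = LC *v log_fibre q"
      unfolding cot_map_def by (rule inj) (auto simp: t torus_map_torus)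
    also have "\<dots> \<longleftrightarrow> (\<exists>t\<in>torus. cot_base q = torus_act A t (cot_base p)) \<and> log_fibre q = log_fibre p"
      using torus_map_fibres[OF t(1,2)] kernel_AC[OF t(5)] kernel_AC[OF t(6)] by metis
    also have "\<dots> \<longleftrightarrow> (\<exists>t\<in>torus. q = cot_torus_act A t p)"
    proof -
      have "q = cot_torus_act A s p \<longleftrightarrow> cot_base q = torus_act A s (cot_base p) \<and> log_fibre q = log_fibre p"
        if "s \<in> torus" for s
        using inj[of "cot_base q" "torus_act A s (cot_base p)" "log_fibre q" "log_fibre p"] t
          torus_act_torus[OF that t(1)] by (simp add: act that log_covector_cases)
      then show ?thesis by blast
    qed
    finally show ?thesis .
  qed
qed

end

declare op_apply [simp del]

section \<open>Weights and degree-zero generators after restriction to the torus\<close>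

section \<open>The grading induced on the torus\<close>

locale T_irreducible = split_torus A L R B + tensor_setup M
  for A :: "int ^ ('n::finite) ^ ('d::finite)" and L :: "int ^ 'n ^ ('m::finite)"
    and R :: "int ^ 'd ^ 'n" and B :: "int ^ 'm ^ 'n" and M :: "('n dop, 'v) module" +
  fixes \<beta> :: "complex ^ 'd" and G :: "int ^ 'd \<Rightarrow> 'v set"
  assumes irred: "(M, G) \<in> T_irred A \<beta>"
begin

abbreviation "Gr \<equiv> torus_grading A M G"

lemma G_subgroup: "subgroup (G \<alpha>) (add_monoid M)"
  using irred by (simp add: T_irred_def graded_module_def)

lemma G_closed: "u \<in> G \<alpha> \<Longrightarrow> u \<in> carrier M"
  using subgroup.mem_carrier[OF G_subgroup] by simp

lemma G_decomposition:
  assumes "u \<in> carrier M"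
  obtains g where "\<And>\<alpha>. g \<alpha> \<in> G \<alpha>" "finite {\<alpha>. g \<alpha> \<noteq> \<zero>\<^bsub>M\<^esub>}" "u = finsum M g {\<alpha>. g \<alpha> \<noteq> \<zero>\<^bsub>M\<^esub>}"
proof -
  have "\<exists>!g. (\<forall>\<alpha>. g \<alpha> \<in> G \<alpha>) \<and> finite {\<alpha>. g \<alpha> \<noteq> \<zero>\<^bsub>M\<^esub>} \<and> u = finsum M g {\<alpha>. g \<alpha> \<noteq> \<zero>\<^bsub>M\<^esub>}"
    using irred assms unfolding T_irred_def graded_module_def by blast
  then show ?thesis using that by blast
qed

lemma finitely_generated_M: "finitely_generated weyl M"
  using irred by (simp add: T_irred_def)

text \<open>The generators of the annihilator ideal are themselves annihilators, which is the weight
  condition; the zero element, about which irreducibility says nothing, is treated apart.\<close>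

lemma G_weight:
  assumes u: "u \<in> G \<alpha>"
  shows "euler A i \<odot>\<^bsub>M\<^esub> u = cst (\<beta> $ i + of_int (\<alpha> $ i)) \<odot>\<^bsub>M\<^esub> u"
proof (cases "u = \<zero>\<^bsub>M\<^esub>")
  case True
  then show ?thesis using W.act_zero_right[OF euler_weyl] W.act_zero_right[OF cst_weyl] by simp
next
  case False
  let ?E = "\<lambda>i f. euler A i f - lconst (\<beta> $ i) * f - lconst (of_int (\<alpha> $ i)) * f"
  have "{P \<in> carrier (euler_ring A). P \<odot>\<^bsub>M\<^esub> u = \<zero>\<^bsub>M\<^esub>} = Idl\<^bsub>euler_ring A\<^esub> (range ?E)"
    using irred u False unfolding T_irred_def by blast
  moreover have "?E i \<in> Idl\<^bsub>euler_ring A\<^esub> (range ?E)" by (auto simp: genideal_def)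
  ultimately have "?E i \<odot>\<^bsub>M\<^esub> u = \<zero>\<^bsub>M\<^esub>" by blast
  moreover have "?E i = euler A i - cst (\<beta> $ i + of_int (\<alpha> $ i))"
    unfolding cst_add by (rule ext) (simp add: op_apply cst_def lmult_lconst[symmetric] lmult_def)
  ultimately have "euler A i \<odot>\<^bsub>M\<^esub> u \<ominus>\<^bsub>M\<^esub> cst (\<beta> $ i + of_int (\<alpha> $ i)) \<odot>\<^bsub>M\<^esub> u = \<zero>\<^bsub>M\<^esub>"
    by (simp only: W.act_diff[OF euler_weyl cst_weyl G_closed[OF u]])
  then show ?thesis
    using W.smult_closed[OF euler_weyl G_closed[OF u]] W.smult_closed[OF cst_weyl G_closed[OF u]]
    by (rule W.minus_eq_zeroD)
qed

lemma degree_torus: "P \<in> dop_degree A \<gamma> \<Longrightarrow> P \<in> carrier torus_dops"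
  by (auto simp: dop_degree_iff intro: has_symbol_carrier)

lemma Gr_eq: "Gr \<alpha> = generate (add_monoid N) {tens P u | P u \<gamma>. P \<in> dop_degree A \<gamma> \<and> u \<in> G (\<alpha> - \<gamma>)}"
  by (simp add: torus_grading_def tens_def)

lemma Gr_gen: "P \<in> dop_degree A \<gamma> \<Longrightarrow> u \<in> G (\<alpha> - \<gamma>) \<Longrightarrow> tens P u \<in> Gr \<alpha>"
  unfolding Gr_eq by (rule generate.incl) blast

lemma Gr_subgroup: "subgroup (Gr \<alpha>) (add_monoid N)"
  unfolding Gr_eq
  by (rule X.M.add.generate_is_subgroup) (auto intro!: tens_closed degree_torus G_closed)

lemma Gr_closed: "n \<in> Gr \<alpha> \<Longrightarrow> n \<in> carrier N"
  using subgroup.mem_carrier[OF Gr_subgroup] by simp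

lemma Gr_induct [consumes 1, case_names zero tens add]:
  assumes "n \<in> Gr \<alpha>" "Q \<zero>\<^bsub>N\<^esub>"
    and tens: "\<And>P u \<gamma>. P \<in> dop_degree A \<gamma> \<Longrightarrow> u \<in> G (\<alpha> - \<gamma>) \<Longrightarrow> Q (tens P u)"
    and add: "\<And>a b. a \<in> Gr \<alpha> \<Longrightarrow> b \<in> Gr \<alpha> \<Longrightarrow> Q a \<Longrightarrow> Q b \<Longrightarrow> Q (a \<oplus>\<^bsub>N\<^esub> b)"
  shows "Q n"
  using assms(1) unfolding Gr_eq
proof (induction rule: generate.induct)
  case one
  then show ?case using assms(2) by simp
next
  case (incl h)
  then show ?case using tens by blast
next
  case (inv h)
  then obtain P u \<gamma> where h: "h = tens P u" and P: "P \<in> dop_degree A \<gamma>" and u: "u \<in> G (\<alpha> - \<gamma>)" by blast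
  have c: "P \<in> carrier torus_dops" "u \<in> carrier M" using P u degree_torus G_closed by blast+
  have "- P \<in> dop_degree A \<gamma>" using P has_symbol_uminus unfolding dop_degree_iff by blast
  moreover have "tens (- P) u = inv\<^bsub>add_monoid N\<^esub> h"
  proof -
    have "(- id) \<odot>\<^bsub>N\<^esub> tens P u = tens (- id \<circ> P) u"
      using torus_dops_closed(2,5) by (intro act_tens c) auto
    also have "- id \<circ> P = - P" by (simp add: fun_eq_iff op_apply)
    finally show ?thesis
      using X.act_uminus[OF torus_dops_closed(2) tens_closed[OF c]] X.act_id[OF tens_closed[OF c]]
      by (simp only: h a_inv_def)
  qed
  ultimately show ?case using tens u by metis
next
  case (eng a b)
  then show ?case using add[of a b, unfolded Gr_eq] by simp
qed

text \<open>Degrees add: moving \<open>E\<^sub>i\<close> past \<open>P\<close> contributes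
  \<open>\<gamma>\<^sub>i\<close>, and on \<open>u\<close> it contributes
  \<open>\<beta>\<^sub>i + \<alpha>\<^sub>i - \<gamma>\<^sub>i\<close>.\<close>

lemma Gr_weight:
  assumes "n \<in> Gr \<alpha>"
  shows "euler A i \<odot>\<^bsub>N\<^esub> n = cst (\<beta> $ i + of_int (\<alpha> $ i)) \<odot>\<^bsub>N\<^esub> n"
  using assms
proof (induction rule: Gr_induct)
  case zero
  show ?case using X.act_zero_right[OF euler_torus] X.act_zero_right[OF cst_torus] by simp
next
  case (tens P u \<gamma>)
  have c: "P \<in> carrier torus_dops" "u \<in> carrier M" using tens degree_torus G_closed by blast+
  let ?c = "\<beta> $ i + of_int ((\<alpha> - \<gamma>) $ i)" and ?g = "of_int (\<gamma> $ i)"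
  have "euler A i \<circ> P = (P \<circ> euler A i) + (cst ?g \<circ> P)"
    using tens(1) euler_comm unfolding dop_degree_iff by blast
  then have "euler A i \<odot>\<^bsub>N\<^esub> tens P u = tens (P \<circ> euler A i) u \<oplus>\<^bsub>N\<^esub> tens (cst ?g \<circ> P) u"
    using c by (simp add: act_tens euler_torus cst_torus torus_dops_closed tens_add_left)
  also have "tens (P \<circ> euler A i) u = tens P (cst ?c \<odot>\<^bsub>M\<^esub> u)"
    using c by (simp add: tens_comp euler_weyl G_weight[OF tens(2)])
  also have "\<dots> = tens (cst ?c \<circ> P) u"
    using tens_comp[OF c(1) cst_weyl c(2)] cst_commute[OF c(1)] by metis
  also have "\<dots> \<oplus>\<^bsub>N\<^esub> tens (cst ?g \<circ> P) u = (cst ?c + cst ?g) \<odot>\<^bsub>N\<^esub> tens P u"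
    using c by (simp add: act_tens cst_torus torus_dops_closed X.act_add tens_closed comp_plus_left flip: tens_add_left)
  also have "cst ?c + cst ?g = cst (\<beta> $ i + of_int (\<alpha> $ i))" by (simp flip: cst_add)
  finally show ?case .
next
  case (add a b)
  show ?case
    unfolding X.smult_r_distr[OF euler_torus Gr_closed[OF add(1)] Gr_closed[OF add(2)]]
      X.smult_r_distr[OF cst_torus Gr_closed[OF add(1)] Gr_closed[OF add(2)]] add.IH ..
qed

lemma Gr_act:
  assumes P: "has_symbol {u. A *v u = \<gamma>} k P f" and "n \<in> Gr \<alpha>"
  shows "P \<odot>\<^bsub>N\<^esub> n \<in> Gr (\<gamma> + \<alpha>)"
  using assms(2)
proof (induction rule: Gr_induct)
  case zero
  show ?case using X.act_zero_right[OF has_symbol_carrier[OF P]] subgroup.one_closed[OF Gr_subgroup] by simp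
next
  case (tens Q u \<delta>)
  obtain l g where Q: "has_symbol {u. A *v u = \<delta>} l Q g" using tens(1) unfolding dop_degree_iff by blast
  have "has_symbol {u. A *v u = \<gamma> + \<delta>} (k + l) (P \<circ> Q) (\<lambda>x y. f x y * g x y)"
    by (rule has_symbol_comp[OF P Q]) (simp add: matrix_vector_mult_plus)
  then have "P \<circ> Q \<in> dop_degree A (\<gamma> + \<delta>)" unfolding dop_degree_iff by blast
  moreover have "u \<in> G (\<gamma> + \<alpha> - (\<gamma> + \<delta>))" using tens(2) by simp
  ultimately have "tens (P \<circ> Q) u \<in> Gr (\<gamma> + \<alpha>)" by (rule Gr_gen)
  then show ?case
    using act_tens[OF has_symbol_carrier[OF P] has_symbol_carrier[OF Q] G_closed[OF tens(2)]] by simp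
next
  case (add a b)
  then show ?case
    using X.smult_r_distr[OF has_symbol_carrier[OF P] Gr_closed Gr_closed] subgroup.m_closed[OF Gr_subgroup] by simp
qed

sublocale weighted_module A L R B N \<beta> Gr
  by (intro weighted_module.intro weighted_module_axioms.intro split_torus_axioms X.torus_module_axioms
      Gr_subgroup Gr_weight Gr_act)

text \<open>A homogeneous generator of degree \<open>\<alpha>\<close> becomes a generator of degree \<open>0\<close> after multiplication by
  \<open>x\<^bsup>-R\<alpha>\<^esup>\<close>.\<close>

theorem degree_zero_generators:
  obtains S where "finite S" "S \<subseteq> Gr 0" "\<And>n. n \<in> carrier N \<Longrightarrow> \<exists>a. n \<in> X.filt S a"
proof -
  obtain T where T: "finite T" "T \<subseteq> carrier M"
    "generate (add_monoid M) {P \<odot>\<^bsub>M\<^esub> s | P s. P \<in> carrier weyl \<and> s \<in> T} = carrier M"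
    using finitely_generated_M unfolding finitely_generated_def by blast
  have "\<forall>s\<in>T. \<exists>g. (\<forall>\<alpha>. g \<alpha> \<in> G \<alpha>) \<and> finite {\<alpha>. g \<alpha> \<noteq> \<zero>\<^bsub>M\<^esub>} \<and> s = finsum M g {\<alpha>. g \<alpha> \<noteq> \<zero>\<^bsub>M\<^esub>}"
  proof
    fix s assume "s \<in> T"
    then have "s \<in> carrier M" using T(2) by blast
    then show "\<exists>g. (\<forall>\<alpha>. g \<alpha> \<in> G \<alpha>) \<and> finite {\<alpha>. g \<alpha> \<noteq> \<zero>\<^bsub>M\<^esub>} \<and> s = finsum M g {\<alpha>. g \<alpha> \<noteq> \<zero>\<^bsub>M\<^esub>}"
      by (rule G_decomposition) blast
  qed
  from bchoice[OF this] obtain g where "\<forall>s\<in>T. (\<forall>\<alpha>. g s \<alpha> \<in> G \<alpha>) \<and> finite {\<alpha>. g s \<alpha> \<noteq> \<zero>\<^bsub>M\<^esub>} \<and>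
      s = finsum M (g s) {\<alpha>. g s \<alpha> \<noteq> \<zero>\<^bsub>M\<^esub>}" ..
  then have g: "\<And>s \<alpha>. s \<in> T \<Longrightarrow> g s \<alpha> \<in> G \<alpha>" "\<And>s. s \<in> T \<Longrightarrow> finite {\<alpha>. g s \<alpha> \<noteq> \<zero>\<^bsub>M\<^esub>}"
    "\<And>s. s \<in> T \<Longrightarrow> s = finsum M (g s) {\<alpha>. g s \<alpha> \<noteq> \<zero>\<^bsub>M\<^esub>}" by blast+
  let ?A = "\<lambda>s. {\<alpha>. g s \<alpha> \<noteq> \<zero>\<^bsub>M\<^esub>}"
  define x where "x u = shift_op u (\<lambda>_. 1)" for u :: "int ^ 'n"
  have xc: "x u \<in> carrier torus_dops" for u unfolding x_def by (rule shift_one_torus)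
  have xf: "x u \<in> torus_filt 0" for u
    unfolding x_def torus_filt_def using has_symbol_shift_one[of u UNIV] by blast
  define e where "e s \<alpha> = x (- (R *v \<alpha>)) \<odot>\<^bsub>N\<^esub> tens id (g s \<alpha>)" for s \<alpha>
  define S where "S = (\<Union>s\<in>T. e s ` ?A s)"
  have gc: "g s \<alpha> \<in> carrier M" if "s \<in> T" for s \<alpha> using g(1)[OF that] by (rule G_closed)
  have tc: "tens id u \<in> carrier N" if "u \<in> carrier M" for u using torus_dops_closed(2) that by (rule tens_closed)
  have finS: "finite S" unfolding S_def using T(1) g(2) by auto
  have e0: "e s \<alpha> \<in> Gr 0" if "s \<in> T" for s \<alpha>
  proof -
    have "A *v (R *v \<alpha>) = \<alpha>" by (simp add: matrix_vector_mul_assoc AR)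
    then have "A *v (- (R *v \<alpha>)) = - \<alpha>" using matrix_vector_mult_diff[of A 0 "R *v \<alpha>"] by simp
    then have "has_symbol {u. A *v u = - \<alpha>} 0 (x (- (R *v \<alpha>))) (\<lambda>y z. 1 * tpow y (- (R *v \<alpha>)))"
      unfolding x_def by (intro has_symbol_shift_one) simp
    moreover have "tens id (g s \<alpha>) \<in> Gr \<alpha>"
      using has_symbol_id[of "{u. A *v u = 0}"] g(1)[OF that, of \<alpha>] by (intro Gr_gen[of _ 0]) (auto simp: dop_degree_iff)
    ultimately have "e s \<alpha> \<in> Gr (- \<alpha> + \<alpha>)" unfolding e_def by (rule Gr_act)
    then show ?thesis by simp
  qed
  have S0: "S \<subseteq> Gr 0" unfolding S_def using e0 by blast
  have SN: "S \<subseteq> carrier N" using S0 Gr_closed by blast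
  \<comment> \<open>The submodule exhausted by the filtration of \<open>S\<close>. It is shown to
    contain the homogeneous components of the generators of \<open>M\<close>, hence the image of
    \<open>M\<close>, hence all fractions.\<close>
  define E where "E = {n. \<exists>a. n \<in> X.filt S a}"
  have E_act: "P \<odot>\<^bsub>N\<^esub> n \<in> E" if P: "P \<in> carrier torus_dops" and n: "n \<in> E" for P n
  proof -
    obtain a where a: "n \<in> X.filt S a" using n by (auto simp: E_def)
    obtain k where "P \<in> torus_filt k" using P by (auto simp: carrier_torus_dops torus_filt_def)
    from X.filt_act[OF SN this a] show ?thesis by (auto simp: E_def)
  qed
  have E_two: "\<exists>c. a \<in> X.filt S c \<and> b \<in> X.filt S c" if ab: "a \<in> E" "b \<in> E" for a b
  proof -
    obtain k l where "a \<in> X.filt S k" "b \<in> X.filt S l" using ab by (auto simp: E_def)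
    then have "a \<in> X.filt S (max k l)" "b \<in> X.filt S (max k l)" using X.filt_mono[OF SN] by auto
    then show ?thesis by blast
  qed
  have E_diff: "a \<ominus>\<^bsub>N\<^esub> b \<in> E" if "a \<in> E" "b \<in> E" for a b
    using E_two[OF that] X.span_minus[OF torus_filt_closed(1) SN] by (auto simp: E_def)
  have E_add: "a \<oplus>\<^bsub>N\<^esub> b \<in> E" if "a \<in> E" "b \<in> E" for a b
    using E_two[OF that] X.span_add unfolding E_def by blast
  have E_zero: "\<zero>\<^bsub>N\<^esub> \<in> E" using X.span_zero by (auto simp: E_def)
  have E_hom: "tens id (g s \<alpha>) \<in> E" if s: "s \<in> T" and \<alpha>: "\<alpha> \<in> ?A s" for s \<alpha>
  proof -
    have "e s \<alpha> \<in> E" using X.filt_gen[OF SN, of "e s \<alpha>"] s \<alpha> by (auto simp: E_def S_def)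
    then have "x (R *v \<alpha>) \<odot>\<^bsub>N\<^esub> e s \<alpha> \<in> E" by (rule E_act[OF xc])
    \<comment> \<open>The monomial that moved the component into degree 0 is invertible, so the
      component itself is recovered.\<close>
    moreover have "x (R *v \<alpha>) \<odot>\<^bsub>N\<^esub> e s \<alpha> = tens id (g s \<alpha>)"
      unfolding e_def X.act_comp[OF xc xc tc[OF gc[OF s]], symmetric]
      by (simp add: x_def shift_op_comp shift_op_one X.act_id tc gc s)
    ultimately show ?thesis by simp
  qed
  have E_T: "tens id s \<in> E" if s: "s \<in> T" for s
  proof -
    have "tens id (finsum M (g s) C) \<in> E" if "finite C" "C \<subseteq> ?A s" for C
      using that
    proof (induction C)
      case empty
      show ?case
        by (simp only: W.M.finsum_empty dop_localization.\<iota>_zero[OF localization] E_zero)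
    next
      case (insert \<alpha> C)
      have "finsum M (g s) (insert \<alpha> C) = g s \<alpha> \<oplus>\<^bsub>M\<^esub> finsum M (g s) C"
        using insert.hyps gc[OF s] by (intro W.M.finsum_insert) auto
      moreover have "tens id (g s \<alpha> \<oplus>\<^bsub>M\<^esub> finsum M (g s) C) = tens id (g s \<alpha>) \<oplus>\<^bsub>N\<^esub> tens id (finsum M (g s) C)"
        using gc[OF s] by (intro tens_add_right torus_dops_closed(2) W.M.finsum_closed) auto
      moreover have "tens id (g s \<alpha>) \<oplus>\<^bsub>N\<^esub> tens id (finsum M (g s) C) \<in> E"
      proof (rule E_add)
        show "tens id (finsum M (g s) C) \<in> E" by (rule insert.IH) (use insert.prems in auto)
      qed (rule E_hom[OF s], use insert.prems in auto)
      ultimately show ?case by (simp only:)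
    qed
    from this[OF g(2)[OF s] order_refl] show ?thesis using g(3)[OF s] by simp
  qed
  have E_M: "tens id m \<in> E" if "m \<in> carrier M" for m
  proof -
    have "m \<in> generate (add_monoid M) {P \<odot>\<^bsub>M\<^esub> s | P s. P \<in> carrier weyl \<and> s \<in> T}" using that T(3) by simp
    then have "m \<in> span_of M (carrier weyl) T" by (simp add: span_of_def)
    then show ?thesis
    proof (induction rule: W.span_induct)
      case zero
      show ?case by (simp only: dop_localization.\<iota>_zero[OF localization] E_zero)
    next
      case (gen P s)
      have "tens id (P \<odot>\<^bsub>M\<^esub> s) = P \<odot>\<^bsub>N\<^esub> tens id s"
        using gen T(2) by (intro dop_localization.\<iota>_act[OF localization]) auto
      then show ?case using E_act[OF weyl_subset[OF gen(1)] E_T[OF gen(2)]] by (simp only:)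
    next
      case (add a b)
      have "a \<in> carrier M" "b \<in> carrier M" using add.hyps W.span_closed[OF order_refl T(2)] by blast+
      then show ?case using tens_add_right[OF torus_dops_closed(2)] E_add[OF add.IH] by (simp only:)
    qed (use T(2) W.R_uminus in auto)
  qed
  have "n \<in> E" if "n \<in> carrier N" for n
    using that
  proof (induction rule: N_induct)
    case zero
    show ?case by (rule E_zero)
  next
    case (tens P u)
    then show ?case using E_act[OF tens(1) E_M[OF tens(2)]] act_tens[OF tens(1) torus_dops_closed(2) tens(2)] by (simp only: comp_id)
  next
    case (diff a b)
    then show ?case by (intro E_diff)
  qed
  then show ?thesis using that[OF finS S0] by (auto simp: E_def)
qed

end

section \<open>Supports as zero sets of symbols, and their images in the base\<close>

section \<open>Closedness\<close>

lemma polyfuns_comp: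
  assumes "f \<in> polyfuns" "\<And>i. (\<lambda>p. \<phi> p $ i) \<in> polyfuns" shows "(\<lambda>p. f (\<phi> p)) \<in> polyfuns"
  using assms(1)
proof (induction rule: polyfuns_induct)
  case (const c)
  show ?case by (rule polyfuns_const)
next
  case (coord f i)
  show ?case by (rule polyfuns_mult[OF assms(2) coord.IH])
next
  case (add f g)
  show ?case by (rule polyfuns_add[OF add.IH])
qed

lemma polyfuns_leval: "f \<in> polynomials \<Longrightarrow> leval f \<in> polyfuns"
  by (simp add: polyfuns_def)

lemma order_filt_polynomials: "c \<in> order_filt k \<Longrightarrow> Poly_Mapping.lookup c v \<in> polynomials"
  by (simp add: order_filt_def poly_coeffs_def)

lemma symb_eq:
  "symb k c p = (\<Sum>v \<in> {v \<in> Poly_Mapping.keys c. int (vdeg v) = k}.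
     leval (Poly_Mapping.lookup c v) (cot_base p) * ymon v (cot_fibre p))"
  by (simp add: symb_def ymon_def)

lemma polyfuns_symb:
  assumes "c \<in> order_filt k" shows "symb k c \<in> polyfuns"
  unfolding symb_eq[abs_def]
proof (intro polyfuns_sum polyfuns_mult)
  fix v
  show "(\<lambda>p. leval (Poly_Mapping.lookup c v) (cot_base p)) \<in> polyfuns"
    by (rule polyfuns_comp[OF polyfuns_leval[OF order_filt_polynomials[OF assms]]])
      (simp add: cot_base_def polyfuns_coord)
  show "(\<lambda>p. ymon v (cot_fibre p)) \<in> polyfuns"
    by (rule polyfuns_comp[OF polyfuns_ymon]) (simp add: cot_fibre_def polyfuns_coord)
qed

lemma gr_support_zeros:
  obtains K where "\<And>k c. (k, c) \<in> K \<Longrightarrow> c \<in> order_filt k" "gr_support M S = {p. \<forall>(k, c)\<in>K. symb k c p = 0}"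
proof
  let ?K = "{(k, c). c \<in> order_filt k \<and> (\<forall>l. \<forall>u \<in> gen_filt M S l. dop c \<odot>\<^bsub>M\<^esub> u \<in> gen_filt M S (l + k - 1))}"
  show "(k, c) \<in> ?K \<Longrightarrow> c \<in> order_filt k" for k c by simp
  show "gr_support M S = {p. \<forall>(k, c)\<in>?K. symb k c p = 0}" unfolding gr_support_def by auto
qed

lemma closedin_gr_support: "closedin zariski (gr_support M S)"
proof -
  obtain K where K: "\<And>k c. (k, c) \<in> K \<Longrightarrow> c \<in> order_filt k" "gr_support M S = {p. \<forall>(k, c)\<in>K. symb k c p = 0}"
    by (rule gr_support_zeros[of M S]) blast
  have "(\<lambda>(k, c). symb k c) ` K \<subseteq> polyfuns" using K(1) polyfuns_symb by auto
  from closedin_zariski_zeros[OF this] show ?thesis by (simp add: K(2) case_prod_beta)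
qed

definition covector :: "complex ^ ('n::finite) \<Rightarrow> complex ^ 'n \<Rightarrow> complex ^ ('n + 'n)" where
  "covector z \<zeta> = (\<chi> k. case k of Inl i \<Rightarrow> z $ i | Inr i \<Rightarrow> \<zeta> $ i)"

lemma covector_simps [simp]: "cot_base (covector z \<zeta>) = z" "cot_fibre (covector z \<zeta>) = \<zeta>"
  by (simp_all add: covector_def cot_base_def cot_fibre_def vec_eq_iff)

lemma covector_cases [simp]: "covector (cot_base p) (cot_fibre p) = p"
proof -
  have "covector (cot_base p) (cot_fibre p) $ k = p $ k" for k
    by (cases k) (simp_all add: covector_def cot_base_def cot_fibre_def)
  then show ?thesis by (simp add: vec_eq_iff)
qed

text \<open>In a negative order no terms remain and the zero form serves, which is why the degree is
  only asserted to exist.\<close>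

lemma hom_form_symb:
  assumes "c \<in> order_filt k" shows "\<exists>j. hom_form j (\<lambda>z \<zeta>. symb k c (covector z \<zeta>))"
proof (cases "k < 0")
  case True
  then have "{v \<in> Poly_Mapping.keys c. int (vdeg v) = k} = {}" by auto
  then have "(\<lambda>z \<zeta>. symb k c (covector z \<zeta>)) = (\<lambda>z \<zeta>. 0)" by (simp only: symb_def sum.empty)
  then show ?thesis using hom_form.zero by metis
next
  case False
  have "hom_form (nat k) (\<lambda>z \<zeta>. symb k c (covector z \<zeta>))"
    unfolding symb_eq covector_simps
    by (intro hom_form_sum hom_form.mono polyfuns_leval order_filt_polynomials[OF assms]) auto
  then show ?thesis by blast
qed

text \<open>The complement consists of the \<open>z\<close> over which the homogeneous equations
  have only the zero solution, an open condition by \<open>elimination\<close>.\<close>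

lemma closedin_projection: "closedin zariski {z. \<exists>\<zeta>. \<zeta> \<noteq> 0 \<and> covector z \<zeta> \<in> gr_support M S}"
proof -
  obtain K where K: "\<And>k c. (k, c) \<in> K \<Longrightarrow> c \<in> order_filt k" "gr_support M S = {p. \<forall>(k, c)\<in>K. symb k c p = 0}"
    by (rule gr_support_zeros[of M S]) blast
  let ?H = "(\<lambda>(k, c) z \<zeta>. symb k c (covector z \<zeta>)) ` K"
  have mem: "covector z \<zeta> \<in> gr_support M S \<longleftrightarrow> (\<forall>h\<in>?H. h z \<zeta> = 0)" for z \<zeta> by (auto simp: K(2))
  have "openin zariski {z. \<forall>\<zeta>. (\<forall>h\<in>?H. h z \<zeta> = 0) \<longrightarrow> \<zeta> = 0}"
    unfolding openin_zariski
  proof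
    fix z\<^sub>0 assume z0: "z\<^sub>0 \<in> {z. \<forall>\<zeta>. (\<forall>h\<in>?H. h z \<zeta> = 0) \<longrightarrow> \<zeta> = 0}"
    have "\<exists>g\<in>polyfuns. g z\<^sub>0 \<noteq> 0 \<and> (\<forall>z \<zeta>. g z \<noteq> 0 \<longrightarrow> (\<forall>h\<in>?H. h z \<zeta> = 0) \<longrightarrow> \<zeta> = 0)"
    proof (rule elimination)
      show "\<exists>k. hom_form k h" if h: "h \<in> ?H" for h
      proof -
        obtain k c where "(k, c) \<in> K" "h = (\<lambda>z \<zeta>. symb k c (covector z \<zeta>))" using h by auto
        then show ?thesis using hom_form_symb[OF K(1)] by blast
      qed
      show "\<zeta> = 0" if "\<forall>h\<in>?H. h z\<^sub>0 \<zeta> = 0" for \<zeta> using z0 that by blast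
    qed
    then obtain g where "g \<in> polyfuns" "g z\<^sub>0 \<noteq> 0" "\<And>z \<zeta>. g z \<noteq> 0 \<Longrightarrow> \<forall>h\<in>?H. h z \<zeta> = 0 \<Longrightarrow> \<zeta> = 0" by blast
    then show "\<exists>f\<in>polyfuns. f z\<^sub>0 \<noteq> 0 \<and> {q. f q \<noteq> 0} \<subseteq> {z. \<forall>\<zeta>. (\<forall>h\<in>?H. h z \<zeta> = 0) \<longrightarrow> \<zeta> = 0}"
      by blast
  qed
  moreover have "{z. \<exists>\<zeta>. \<zeta> \<noteq> 0 \<and> covector z \<zeta> \<in> gr_support M S} = - {z. \<forall>\<zeta>. (\<forall>h\<in>?H. h z \<zeta> = 0) \<longrightarrow> \<zeta> = 0}"
    unfolding mem by blast
  ultimately show ?thesis by (simp add: closedin_def Compl_eq_Diff_UNIV[symmetric])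
qed

section \<open>Comparison of \<open>M\<close> over \<open>X\<close> with its image over
  \<open>Z\<close>\<close>

section \<open>The characteristic variety and the singular locus of the functor\<close>

lemma direct_image_simps [simp]:
  "carrier (direct_image D) = carrier D" "\<zero>\<^bsub>direct_image D\<^esub> = \<zero>\<^bsub>D\<^esub>" "x \<oplus>\<^bsub>direct_image D\<^esub> y = x \<oplus>\<^bsub>D\<^esub> y"
  "P \<in> carrier weyl \<Longrightarrow> P \<odot>\<^bsub>direct_image D\<^esub> u = P \<odot>\<^bsub>D\<^esub> u"
  by (simp_all add: direct_image_def)

text \<open>On a module over the operators on the torus the coordinates already act invertibly, so
  restricting scalars and localizing again returns the module itself.\<close>

lemma direct_image_localization:
  assumes "left_module torus_dops D" shows "dop_localization (direct_image D) D id"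
proof -
  interpret X: filtered_dop_module torus_dops D torus_filt by (rule filtered_dop_moduleI_torus[OF assms])
  have "left_module weyl (direct_image D)"
  proof (intro left_module.intro left_module_axioms.intro ring_weyl abelian_groupI)
    fix x assume "x \<in> carrier (direct_image D)"
    then show "\<exists>y\<in>carrier (direct_image D). y \<oplus>\<^bsub>direct_image D\<^esub> x = \<zero>\<^bsub>direct_image D\<^esub>"
      by (intro bexI[of _ "\<ominus>\<^bsub>D\<^esub> x"]) (auto simp: X.M.l_neg)
  qed (auto simp: weyl_closed weyl_subset X.smult_closed X.act_add X.act_comp X.act_id X.smult_r_distr X.M.a_ac)
  then interpret W: filtered_dop_module weyl "direct_image D" weyl_filt by (rule filtered_dop_moduleI_weyl)
  show ?thesis
  proof (intro dop_localization.intro dop_localization_axioms.intro W.filtered_dop_module_axioms X.filtered_dop_module_axioms)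
    show "eventually (\<lambda>k. xpow k \<odot>\<^bsub>direct_image D\<^esub> m = \<zero>\<^bsub>direct_image D\<^esub>) sequentially"
      if "id m = \<zero>\<^bsub>D\<^esub>" for m
      using that by (simp add: xpow_weyl X.act_zero_right xpow_torus)
    show "eventually (\<lambda>k. xpow k \<odot>\<^bsub>D\<^esub> n \<in> id ` carrier (direct_image D)) sequentially" if "n \<in> carrier D" for n
      using that by (simp add: X.smult_closed xpow_torus)
  qed (auto simp: weyl_subset)
qed

lemma log_fibre_eq_0: "p \<in> cot_torus \<Longrightarrow> log_fibre p = 0 \<longleftrightarrow> cot_fibre p = 0"
  by (auto simp: log_fibre_def cot_torus_def torus_def vec_eq_iff)

locale T_irreducible_functor = T_irreducible A L R B M \<beta> G
  for A :: "int ^ ('n::finite) ^ ('d::finite)" and L :: "int ^ 'n ^ ('m::finite)"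
    and R :: "int ^ 'd ^ 'n" and B :: "int ^ 'm ^ 'n" and M :: "('n dop, 'v) module"
    and \<beta> :: "complex ^ 'd" and G :: "int ^ 'd \<Rightarrow> 'v set" +
  fixes Atil :: "int ^ 'n ^ ('d + 'm)"
  assumes eta: "eta_matrix Atil B = map_matrix of_int L"
begin

sublocale weighted_delta A L R B N \<beta> Gr Atil
  by (intro weighted_delta.intro weighted_delta_axioms.intro weighted_module_axioms eta)

abbreviation "MZ \<equiv> Pi_functor A Atil B M G"

lemma Pi_localization: "dop_localization MZ Dm id"
  unfolding Pi_functor_def by (rule direct_image_localization[OF Dm_module])

text \<open>Generators of degree zero serve on both sides. On \<open>Z\<close> the comparison of an
  arbitrary finite set with \<open>S\<close> is not redone: points are lifted to \<open>X\<close> by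
  the section, compared there, and sent back.\<close>

theorem char_varieties:
  obtains S where
    "char_variety M \<inter> cot_torus = {p\<in>cot_torus. AC *v log_fibre p = 0 \<and> cot_map p \<in> gr_support MZ S}"
    "char_variety MZ \<inter> cot_torus = gr_support MZ S \<inter> cot_torus"
proof -
  obtain S where S: "finite S" "S \<subseteq> Gr 0" "\<And>n. n \<in> carrier N \<Longrightarrow> \<exists>a. n \<in> X.filt S a"
    by (rule degree_zero_generators) blast
  have SN: "S \<subseteq> carrier N" using S(2) Gr_closed by blast
  have mono: "log_support N T \<subseteq> log_support N S" if "finite T" "T \<subseteq> carrier N" for T
    using that S(1,3) SN by (intro X.log_support_mono) auto
  have Pi_support: "q \<in> gr_support MZ S \<longleftrightarrow> (cot_base q, log_fibre q) \<in> log_support Dm S" if "q \<in> cot_torus" for q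
    using dop_localization.gr_support_iff[OF Pi_localization S(1) _ that] S(2)
    by (simp add: Pi_functor_def Dm_simps)
  have char_M: "p \<in> char_variety M \<longleftrightarrow> (cot_base p, log_fibre p) \<in> log_support N S" if "p \<in> cot_torus" for p
    using dop_localization.char_variety_iff[OF localization that] mono S(1) SN by blast
  have cot: "cot_map p \<in> cot_torus" if "p \<in> cot_torus" for p
    using that by (simp add: cot_map_def cot_torus_def torus_map_torus)
  have "char_variety M \<inter> cot_torus = {p\<in>cot_torus. AC *v log_fibre p = 0 \<and> cot_map p \<in> gr_support MZ S}"
  proof -
    have "p \<in> char_variety M \<longleftrightarrow> AC *v log_fibre p = 0 \<and> cot_map p \<in> gr_support MZ S" if p: "p \<in> cot_torus" for p
    proof -
      have "cot_base p \<in> torus" using p by (simp add: cot_torus_def)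
      then show ?thesis
        unfolding char_M[OF p] log_support_weighted[OF S(1,2)] Pi_support[OF cot[OF p]]
        by (simp add: cot_map_def torus_map_torus)
    qed
    then show ?thesis by blast
  qed
  moreover have "char_variety MZ \<inter> cot_torus = gr_support MZ S \<inter> cot_torus"
  proof -
    have "q \<in> char_variety MZ \<longleftrightarrow> q \<in> gr_support MZ S" if q: "q \<in> cot_torus" for q
    proof -
      have sub: "(z, w) \<in> log_support Dm S" if T: "finite T" "T \<subseteq> Gr 0" and zw: "(z, w) \<in> log_support Dm T" for T z w
      proof -
        have z: "z \<in> torus" using zw by (simp add: log_support_def)
        \<comment> \<open>The lift is admissible because \<open>A B = 0\<close>, and it lies over
          \<open>(z, w)\<close> because \<open>L B = 1\<close>.\<close>
        have "(torus_map L z, BC *v w) \<in> log_support N T"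
          unfolding log_support_weighted[OF T] using z zw
          by (simp add: torus_map_torus torus_map_section AC_BC LC_BC)
        then have "(torus_map L z, BC *v w) \<in> log_support N S" using mono[OF T(1)] T(2) Gr_closed by blast
        then show ?thesis
          unfolding log_support_weighted[OF S(1,2)] using z by (simp add: torus_map_section LC_BC)
      qed
      have "q \<in> char_variety MZ \<longleftrightarrow> (\<exists>T. finite T \<and> T \<subseteq> Gr 0 \<and> (cot_base q, log_fibre q) \<in> log_support Dm T)"
        using dop_localization.char_variety_iff[OF Pi_localization q] by (simp only: Dm_simps)
      also have "\<dots> \<longleftrightarrow> (cot_base q, log_fibre q) \<in> log_support Dm S" using sub S(1,2) by blast
      finally show ?thesis unfolding Pi_support[OF q] .
    qed
    then show ?thesis by blast
  qed
  ultimately show ?thesis by (rule that)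
qed

text \<open>For the singular loci the additional point is that nonzero covectors correspond:
  \<open>L\<close> is injective on \<open>A y = 0\<close> with inverse \<open>B\<close>, and over
  the torus \<open>\<xi> = 0\<close> is the same as \<open>y = 0\<close>.\<close>

theorem geometric_quotients:
  "is_geometric_quotient torus (cot_torus_act A) (char_variety M \<inter> cot_torus) (char_variety MZ \<inter> cot_torus)"
  "is_geometric_quotient torus (torus_act A) (singular_locus M \<inter> torus) (singular_locus MZ \<inter> torus)"
proof -
  obtain S where
    M: "char_variety M \<inter> cot_torus = {p\<in>cot_torus. AC *v log_fibre p = 0 \<and> cot_map p \<in> gr_support MZ S}" and
    P: "char_variety MZ \<inter> cot_torus = gr_support MZ S \<inter> cot_torus"
    using char_varieties .
  show "is_geometric_quotient torus (cot_torus_act A) (char_variety M \<inter> cot_torus) (char_variety MZ \<inter> cot_torus)"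
    unfolding M P by (rule cot_quotient[OF closedin_gr_support])
  let ?C = "{z. \<exists>\<zeta>. \<zeta> \<noteq> 0 \<and> covector z \<zeta> \<in> gr_support MZ S}"
  have SP: "singular_locus MZ \<inter> torus = ?C \<inter> torus"
  proof (intro equalityI subsetI)
    fix z assume "z \<in> singular_locus MZ \<inter> torus"
    then obtain q where q: "q \<in> char_variety MZ" "cot_fibre q \<noteq> 0" "z = cot_base q" "z \<in> torus"
      by (auto simp: singular_locus_def)
    then have "q \<in> gr_support MZ S" using P by (auto simp: cot_torus_def)
    then have "covector z (cot_fibre q) \<in> gr_support MZ S" using q(3) by simp
    then show "z \<in> ?C \<inter> torus" using q by blast
  next
    fix z assume "z \<in> ?C \<inter> torus"
    then obtain \<zeta> where z: "\<zeta> \<noteq> 0" "covector z \<zeta> \<in> gr_support MZ S" "z \<in> torus" by blast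
    then have "covector z \<zeta> \<in> cot_torus" by (simp add: cot_torus_def)
    then have "covector z \<zeta> \<in> char_variety MZ" using z(2) P by blast
    then have "covector z \<zeta> \<in> char_variety MZ - {p. cot_fibre p = 0}" using z(1) by simp
    then have "cot_base (covector z \<zeta>) \<in> singular_locus MZ" unfolding singular_locus_def by blast
    then show "z \<in> singular_locus MZ \<inter> torus" using z(3) by simp
  qed
  have SM: "singular_locus M \<inter> torus = {x\<in>torus. torus_map B x \<in> ?C}"
  proof (intro equalityI subsetI)
    fix x assume "x \<in> singular_locus M \<inter> torus"
    then obtain p where p: "p \<in> char_variety M" "cot_fibre p \<noteq> 0" "x = cot_base p" "x \<in> torus"
      by (auto simp: singular_locus_def)
    then have pt: "p \<in> cot_torus" by (simp add: cot_torus_def)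
    then have *: "AC *v log_fibre p = 0" "cot_map p \<in> gr_support MZ S" using p(1) M by blast+
    have z: "torus_map B x \<in> torus" using p(4) by (rule torus_map_torus)
    have b: "cot_base (cot_map p) = torus_map B x" "log_fibre (cot_map p) = LC *v log_fibre p"
      using z by (simp_all add: cot_map_def p(3))
    have "log_fibre p \<noteq> 0" using p(2) pt by (simp add: log_fibre_eq_0)
    then have "LC *v log_fibre p \<noteq> 0" using kernel_AC[OF *(1)] by auto
    then have "cot_fibre (cot_map p) \<noteq> 0"
      using log_fibre_eq_0[of "cot_map p"] b z by (simp add: cot_torus_def)
    moreover have "covector (torus_map B x) (cot_fibre (cot_map p)) \<in> gr_support MZ S"
      using *(2) b(1) covector_cases[of "cot_map p"] by simp
    ultimately show "x \<in> {x\<in>torus. torus_map B x \<in> ?C}" using p(4) by blast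
  next
    fix x assume "x \<in> {x\<in>torus. torus_map B x \<in> ?C}"
    then obtain \<zeta> where x: "x \<in> torus" "\<zeta> \<noteq> 0" "covector (torus_map B x) \<zeta> \<in> gr_support MZ S" by blast
    let ?q = "covector (torus_map B x) \<zeta>"
    have q: "?q \<in> cot_torus" using torus_map_torus[OF x(1)] by (simp add: cot_torus_def)
    \<comment> \<open>A preimage of \<open>?q\<close> over the given \<open>x\<close>, not over the
      section: only the logarithmic covector is lifted, by \<open>B\<close>.\<close>
    define p where "p = log_covector x (BC *v log_fibre ?q)"
    have p: "cot_base p = x" "log_fibre p = BC *v log_fibre ?q" "p \<in> cot_torus"
      using x(1) by (simp_all add: p_def cot_torus_def)
    have "cot_map p = ?q"
      using log_covector_cases[OF q] by (simp add: cot_map_def p(1,2) LC_BC)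
    then have "p \<in> char_variety M" using M p(2,3) x(3) AC_BC by auto
    moreover have "log_fibre ?q \<noteq> 0" using log_fibre_eq_0[OF q] x(2) by simp
    then have "log_fibre p \<noteq> 0" using p(2) LC_BC[of "log_fibre ?q"] by auto
    then have "cot_fibre p \<noteq> 0" using log_fibre_eq_0[OF p(3)] by simp
    ultimately have "p \<in> char_variety M - {p. cot_fibre p = 0}" by simp
    then have "cot_base p \<in> singular_locus M" unfolding singular_locus_def by blast
    then show "x \<in> singular_locus M \<inter> torus" using p(1) x(1) by simp
  qed
  show "is_geometric_quotient torus (torus_act A) (singular_locus M \<inter> torus) (singular_locus MZ \<inter> torus)"
    unfolding SP SM by (rule base_quotient[OF closedin_projection])
qed

end

theorem proposition5p18:
  fixes A :: "int ^ 'n ^ 'd"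
    and Atil :: "int ^ 'n ^ (('d :: finite) + ('m :: finite))"
    and B :: "int ^ 'm ^ 'n"
    and \<beta> :: "complex ^ 'd"
    and M :: "(('n :: finite) dop, 'v) module"
    and G :: "int ^ 'd \<Rightarrow> 'v set"
  assumes dims: "CARD('n) = CARD('d) + CARD('m)"
    and rank_A: "rank (map_matrix real_of_int A) = CARD('d)"
    and span_A: "columns_span A"
    and pointed_A: "pointed A"
    and Atil_inv: "invertible Atil"
    and Atil_top: "\<And>i. Atil $ Inl i = A $ i"
    and gale: "gale_dual A B"
    and B_span: "spans_integer_kernel A B"
    and M_irred: "(M, G) \<in> T_irred A \<beta>"
  shows "is_geometric_quotient torus (cot_torus_act A)
           (char_variety M \<inter> cot_torus)
           (char_variety (Pi_functor A Atil B M G) \<inter> cot_torus)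
       \<and> is_geometric_quotient torus (torus_act A)
           (singular_locus M \<inter> torus)
           (singular_locus (Pi_functor A Atil B M G) \<inter> torus)"
proof -
  obtain L R where L: "split_torus A L R B" "eta_matrix Atil B = map_matrix of_int L"
    using split_torus_exists[OF Atil_inv Atil_top B_span] .
  have "left_module weyl M" using M_irred by (simp add: T_irred_def graded_module_def)
  then have "tensor_setup M" by (intro tensor_setup.intro filtered_dop_moduleI_weyl)
  then interpret T_irreducible_functor A L R B M \<beta> G Atil
    using L M_irred
    by (intro T_irreducible_functor.intro T_irreducible.intro T_irreducible_axioms.intro T_irreducible_functor_axioms.intro)
  show ?thesis using geometric_quotients by blast
qed

end
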